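(* The forgetful strict 2-functors $\mathbf{CNM}_{\mho}\to\mathbf{CDC}_{\mho}$, $\mathbf{NTyp}\to\mathbf{Typ}$, and $\mathbf{NDTop}\to\mathbf{DTop}$ (each sending a natural model to its underlying display category) are 2-equivalences.
   Context: **2-equivalence.** A 2-equivalence is an equivalence of 2-categories in the weak sense (biequivalence): essentially surjective on objects (up to equivalence), and on hom-categories essentially surjective on objects (up to isomorphism) and bijective on 2-morphisms. **Display categories.** A display category $\mathbf{C}$ is a category (also denoted $\mathbf{C}$) with a class $\mathcal{D}_{\mathbf{C}}$ of morphisms, called displays, such that every display $p:E\to B$ has, along every $f:A\to B$, a pullback $f^*p:f^*E\to A$ that is a display, and $\mathcal{D}_{\mathbf{C}}$ is closed under composition with isomorphisms. A choice of such pullbacks is fixed. $\mathcal{D}_{\mathbf{C}}$ also denotes the $\mathbf{C}$-indexed category (pseudofunctor $\mathbf{C}^{\mathrm{op}}\to\mathbf{Cat}$) whose value at $A$ is the full subcategory of $\mathbf{C}/A$ on displays, with reindexing by the chosen pullbacks. A display functor is a functor taking displays to displays and pullbacks of displays to pullbacks of displays. "Cartesian" means having (for functors: preserving) finite limits. A display category $\mathbf{C}$ is Cartesian (resp. Cartesian closed) if its underlying category is; each $\mathcal{D}_{\mathbf{C}}(A)$ is, and the inclusion $\mathcal{D}_{\mathbf{C}}(A)\hookrightarrow\mathbf{C}/A$ preserves this structure; and each pullback functor $\mathcal{D}_{\mathbf{C}}(f)$ preserves this structure. A display functor is Cartesian if its underlying functor is. **Universes, typoses, toposes.** The externalization of a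 category $\mathbf{E}$ internal to $\mathbf{C}$ is the strict $\mathbf{C}$-indexed category $\Gamma\mapsto(\mathbf{C}(\Gamma,\mathbf{E}_1)\rightrightarrows\mathbf{C}(\Gamma,\mathbf{E}_0))$. A universe for a small display category $\mathbf{C}$ is an internal discrete opfibration $p:\mho_\bullet\to\mho$ in $\mathbf{C}$ whose object part $p_0$ is a display and such that the $\mathbf{C}$-indexed functor from (the externalization of) $\mho$ to $\mathcal{D}_{\mathbf{C}}$ sending $A:\Gamma\to\mho_0$ to the pullback of $p_0$ along $A$ is a $\mathbf{C}$-indexed equivalence (each component is an equivalence of categories). A small typos is a small, Cartesian display category that is Cartesian closed (that is, writing $\mathbf{C}$ for the display category: its underlying category is Cartesian closed; each category $\mathcal{D}_{\mathbf{C}}(A)$ is Cartesian closed, and the inclusion $\mathcal{D}_{\mathbf{C}}(A)\hookrightarrow\mathbf{C}/A$ preserves Cartesian closed structure; and each pullback functor $\mathcal{D}_{\mathbf{C}}(f)$ preserves Cartesian closed structure), whose displays are closed under composition, and that admits a universe. A small display topos is a small typos whose underlying category admits a subobject classifier $\top:1\to\Omega$ with $\top:1\to\Omega$ and $!:\Omega\to1$ displays. $\mathbf{CDC}_\mho$ is the strict 2-category of small, Cartesian display categories that admit a universe, Cartesian display functors, and natural transformations; $\mathbf{Typ}$ and $\mathbf{DTop}$ are its full sub-2-categories on the small typoses and small display toposes. **Natural models.** A small pre-natural model $\mathbf{C}$ is a small display category $\mathbf{C}$ with small strict $\mathbf{C}$-indexed categories $\mathbf{Tp}_{\mathbf{C}},\mathbf{Tm}_{\mathbf{C}}:\mathbf{C}^{\mathrm{op}}\to\mathbf{Cat}$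 (strict functors) and a strictly natural $p_{\mathbf{C}}:\mathbf{Tm}_{\mathbf{C}}\to\mathbf{Tp}_{\mathbf{C}}$, each component of which is a discrete opfibration, that is representable: for all $\Gamma\in\mathbf{C}$ and $A\in\mathbf{Tp}_{\mathbf{C}}(\Gamma)$, the presheaf $\Delta\mapsto\{(u:\Delta\to\Gamma,\ t\in\mathbf{Tm}_{\mathbf{C}}(\Delta)) : p_{\mathbf{C}}(t)=A[u]\}$ over $\Gamma$ is represented by a (chosen) display $p_A:\Gamma.A\to\Gamma$, with universal element $v_A\in\mathbf{Tm}_{\mathbf{C}}(\Gamma.A)$. Here $A[u]$ denotes $\mathbf{Tp}_{\mathbf{C}}(u)(A)$, and similarly for morphisms and terms. The $\mathbf{C}$-indexed functor $\mathrm{comp}_{\mathbf{C}}:\mathbf{Tp}_{\mathbf{C}}\to\mathcal{D}_{\mathbf{C}}$ sends $A$ to $p_A$ and $f:A\to B$ to the map $\Gamma.f:\Gamma.A\to\Gamma.B$ over $\Gamma$ with $v_B[\Gamma.f]$ equal to the codomain of the unique lift of $f[p_A]$ with domain $v_A$. A small natural model is a small pre-natural model for which $\mathrm{comp}_{\mathbf{C}}$ is a $\mathbf{C}$-indexed equivalence. It is Cartesian if its underlying display category is. A type classifier for it is a category in $\mathbf{C}$ whose externalization is isomorphic to $\mathbf{Tp}_{\mathbf{C}}$ via strict $\mathbf{C}$-indexed functors. **Morphisms.** A morphism $F:\mathbf{C}\to\mathbf{D}$ of small natural models is a display functor $F$ with strictly natural $\mathbf{Tp}_F:\mathbf{Tp}_{\mathbf{C}}\to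 F^*\mathbf{Tp}_{\mathbf{D}}$ and $\mathbf{Tm}_F:\mathbf{Tm}_{\mathbf{C}}\to F^*\mathbf{Tm}_{\mathbf{D}}$ commuting with $p_{\mathbf{C}},F^*p_{\mathbf{D}}$ (one writes $FA,Ft$ for their values), such that for each $A\in\mathbf{Tp}_{\mathbf{C}}(\Gamma)$ the canonical map $(\tau_F)_A:F(\Gamma.A)\to F\Gamma.FA$ over $F\Gamma$ (with $v_{FA}[(\tau_F)_A]=Fv_A$) is an isomorphism; it is Cartesian if its underlying display functor is. A 2-morphism $\alpha:F\Rightarrow G$ is a natural transformation $\alpha$ with $\mathbf{C}$-indexed natural transformations $\mathbf{Tp}_\alpha:\mathbf{Tp}_F\Rightarrow\alpha^*\mathbf{Tp}_{\mathbf{D}}\circ\mathbf{Tp}_G$ and $\mathbf{Tm}_\alpha:\mathbf{Tm}_F\Rightarrow\alpha^*\mathbf{Tm}_{\mathbf{D}}\circ\mathbf{Tm}_G$, with components $\alpha_A:FA\to(GA)[\alpha_\Gamma]$ and $\alpha_t:Ft\to(Gt)[\alpha_\Gamma]$, such that $p_{\mathbf{D}}(\alpha_t)=\alpha_{p_{\mathbf{C}}(t)}$. $\mathbf{CNM}_\mho$ is the strict 2-category of Cartesian small natural models that admit a type classifier, Cartesian morphisms, and 2-morphisms. A small natural typos (resp. small natural display topos) is an object of $\mathbf{CNM}_\mho$ whose underlying display category is a small typos (resp. small display topos); $\mathbf{NTyp}$ and $\mathbf{NDTop}$ are the corresponding full sub-2-categories of $\mathbf{CNM}_\mho$. *)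

theory Defs
  imports Main "HOL-Library.FuncSet"
begin

section \<open>Categories, functors, natural transformations\<close>

text \<open>
  Categories have explicit carriers; the value of an operation outside its carrier is irrelevant.
  \<open>Cmp C g f\<close> is the composite of first \<open>f\<close>, then \<open>g\<close>.
\<close>

record ('o, 'a) cat =
  Ob :: "'o set"
  Ar :: "'a set"
  Dom :: "'a \<Rightarrow> 'o"
  Cod :: "'a \<Rightarrow> 'o"
  Idn :: "'o \<Rightarrow> 'a"
  Cmp :: "'a \<Rightarrow> 'a \<Rightarrow> 'a"

definition hom :: "('o, 'a, 'z) cat_scheme \<Rightarrow> 'o \<Rightarrow> 'o \<Rightarrow> 'a set" where
  "hom C a b = {f \<in> Ar C. Dom C f = a \<and> Cod C f = b}"

definition category :: "('o, 'a, 'z) cat_scheme \<Rightarrow> bool" where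
  "category C \<longleftrightarrow>
     (\<forall>f\<in>Ar C. Dom C f \<in> Ob C \<and> Cod C f \<in> Ob C) \<and>
     (\<forall>a\<in>Ob C. Idn C a \<in> hom C a a) \<and>
     (\<forall>f\<in>Ar C. \<forall>g\<in>Ar C. Cod C f = Dom C g \<longrightarrow> Cmp C g f \<in> hom C (Dom C f) (Cod C g)) \<and>
     (\<forall>f\<in>Ar C. Cmp C f (Idn C (Dom C f)) = f \<and> Cmp C (Idn C (Cod C f)) f = f) \<and>
     (\<forall>f\<in>Ar C. \<forall>g\<in>Ar C. \<forall>h\<in>Ar C. Cod C f = Dom C g \<and> Cod C g = Dom C h \<longrightarrow>
        Cmp C h (Cmp C g f) = Cmp C (Cmp C h g) f)"

definition is_iso :: "('o, 'a, 'z) cat_scheme \<Rightarrow> 'a \<Rightarrow> bool" where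
  "is_iso C f \<longleftrightarrow> f \<in> Ar C \<and>
     (\<exists>g\<in>hom C (Cod C f) (Dom C f).
        Cmp C g f = Idn C (Dom C f) \<and> Cmp C f g = Idn C (Cod C f))"

definition is_mono :: "('o, 'a, 'z) cat_scheme \<Rightarrow> 'a \<Rightarrow> bool" where
  "is_mono C m \<longleftrightarrow> m \<in> Ar C \<and>
     (\<forall>a. \<forall>f\<in>hom C a (Dom C m). \<forall>g\<in>hom C a (Dom C m). Cmp C m f = Cmp C m g \<longrightarrow> f = g)"

record ('o, 'a, 'p, 'b) fct =
  Fo :: "'o \<Rightarrow> 'p"
  Fa :: "'a \<Rightarrow> 'b"

definition is_functor ::
  "('o, 'a, 'x) cat_scheme \<Rightarrow> ('p, 'b, 'y) cat_scheme \<Rightarrow> ('o, 'a, 'p, 'b, 'z) fct_scheme \<Rightarrow> bool" where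
  "is_functor C D F \<longleftrightarrow>
     (\<forall>a\<in>Ob C. Fo F a \<in> Ob D) \<and>
     (\<forall>f\<in>Ar C. Fa F f \<in> hom D (Fo F (Dom C f)) (Fo F (Cod C f))) \<and>
     (\<forall>a\<in>Ob C. Fa F (Idn C a) = Idn D (Fo F a)) \<and>
     (\<forall>f\<in>Ar C. \<forall>g\<in>Ar C. Cod C f = Dom C g \<longrightarrow> Fa F (Cmp C g f) = Cmp D (Fa F g) (Fa F f))"

definition fct_extensional :: "('o, 'a, 'x) cat_scheme \<Rightarrow> ('o, 'a, 'p, 'b, 'z) fct_scheme \<Rightarrow> bool" where
  "fct_extensional C F \<longleftrightarrow> Fo F \<in> extensional (Ob C) \<and> Fa F \<in> extensional (Ar C)"

definition id_fct :: "('o, 'a, 'x) cat_scheme \<Rightarrow> ('o, 'a, 'o, 'a) fct" where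
  "id_fct C = \<lparr>Fo = (\<lambda>a\<in>Ob C. a), Fa = (\<lambda>f\<in>Ar C. f)\<rparr>"

definition cmp_fct :: "('o, 'a, 'x) cat_scheme \<Rightarrow> ('p, 'b, 'q, 'c, 'y) fct_scheme \<Rightarrow>
    ('o, 'a, 'p, 'b, 'z) fct_scheme \<Rightarrow> ('o, 'a, 'q, 'c) fct" where
  "cmp_fct C G F = \<lparr>Fo = compose (Ob C) (Fo G) (Fo F), Fa = compose (Ar C) (Fa G) (Fa F)\<rparr>"

definition is_nat :: "('o, 'a, 'x) cat_scheme \<Rightarrow> ('p, 'b, 'y) cat_scheme \<Rightarrow>
    ('o, 'a, 'p, 'b, 'z) fct_scheme \<Rightarrow> ('o, 'a, 'p, 'b, 'w) fct_scheme \<Rightarrow> ('o \<Rightarrow> 'b) \<Rightarrow> bool" where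
  "is_nat C D F G \<alpha> \<longleftrightarrow>
     (\<forall>a\<in>Ob C. \<alpha> a \<in> hom D (Fo F a) (Fo G a)) \<and>
     (\<forall>f\<in>Ar C. Cmp D (\<alpha> (Cod C f)) (Fa F f) = Cmp D (Fa G f) (\<alpha> (Dom C f)))"

definition is_nat_iso :: "('o, 'a, 'x) cat_scheme \<Rightarrow> ('p, 'b, 'y) cat_scheme \<Rightarrow>
    ('o, 'a, 'p, 'b, 'z) fct_scheme \<Rightarrow> ('o, 'a, 'p, 'b, 'w) fct_scheme \<Rightarrow> ('o \<Rightarrow> 'b) \<Rightarrow> bool" where
  "is_nat_iso C D F G \<alpha> \<longleftrightarrow> is_nat C D F G \<alpha> \<and> (\<forall>a\<in>Ob C. is_iso D (\<alpha> a))"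

definition is_equivalence ::
  "('o, 'a, 'x) cat_scheme \<Rightarrow> ('p, 'b, 'y) cat_scheme \<Rightarrow> ('o, 'a, 'p, 'b, 'z) fct_scheme \<Rightarrow> bool" where
  "is_equivalence C D F \<longleftrightarrow> is_functor C D F \<and>
     (\<exists>(G :: ('p, 'b, 'o, 'a) fct) \<eta> \<epsilon>. is_functor D C G \<and>
        is_nat_iso C C (id_fct C) (cmp_fct C G F) \<eta> \<and>
        is_nat_iso D D (cmp_fct D F G) (id_fct D) \<epsilon>)"

definition is_discrete_opfibration ::
  "('o, 'a, 'x) cat_scheme \<Rightarrow> ('p, 'b, 'y) cat_scheme \<Rightarrow> ('o, 'a, 'p, 'b, 'z) fct_scheme \<Rightarrow> bool" where
  "is_discrete_opfibration C D F \<longleftrightarrow> is_functor C D F \<and>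
     (\<forall>t\<in>Ob C. \<forall>f\<in>Ar D. Dom D f = Fo F t \<longrightarrow> (\<exists>!g. g \<in> Ar C \<and> Dom C g = t \<and> Fa F g = f))"

definition full_sub :: "('o, 'a) cat \<Rightarrow> 'o set \<Rightarrow> ('o, 'a) cat" where
  "full_sub C S = C\<lparr>Ob := Ob C \<inter> S, Ar := {f \<in> Ar C. Dom C f \<in> S \<and> Cod C f \<in> S}\<rparr>"

text \<open>An arrow \<open>p \<rightarrow> q\<close> of a slice is a triple \<open>(p, h, q)\<close> with \<open>q \<circ> h = p\<close>.\<close>

definition slice :: "('o, 'a, 'x) cat_scheme \<Rightarrow> 'o \<Rightarrow> ('a, 'a \<times> 'a \<times> 'a) cat" where
  "slice C A = \<lparr>
     Ob = {p \<in> Ar C. Cod C p = A},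
     Ar = {(p, h, q). p \<in> Ar C \<and> q \<in> Ar C \<and> Cod C p = A \<and> Cod C q = A \<and>
             h \<in> hom C (Dom C p) (Dom C q) \<and> Cmp C q h = p},
     Dom = (\<lambda>(p, h, q). p),
     Cod = (\<lambda>(p, h, q). q),
     Idn = (\<lambda>p. (p, Idn C (Dom C p), p)),
     Cmp = (\<lambda>(q', k, r) (p, h, q). (p, Cmp C k h, r))\<rparr>"


section \<open>Limits and exponentials\<close>

definition is_cone :: "('j, 'k, 'x) cat_scheme \<Rightarrow> ('o, 'a, 'y) cat_scheme \<Rightarrow>
    ('j, 'k, 'o, 'a, 'z) fct_scheme \<Rightarrow> 'o \<Rightarrow> ('j \<Rightarrow> 'a) \<Rightarrow> bool" where
  "is_cone J C D x l \<longleftrightarrow> x \<in> Ob C \<and>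
     (\<forall>j\<in>Ob J. l j \<in> hom C x (Fo D j)) \<and>
     (\<forall>k\<in>Ar J. Cmp C (Fa D k) (l (Dom J k)) = l (Cod J k))"

definition is_limit :: "('j, 'k, 'x) cat_scheme \<Rightarrow> ('o, 'a, 'y) cat_scheme \<Rightarrow>
    ('j, 'k, 'o, 'a, 'z) fct_scheme \<Rightarrow> 'o \<Rightarrow> ('j \<Rightarrow> 'a) \<Rightarrow> bool" where
  "is_limit J C D x l \<longleftrightarrow> is_cone J C D x l \<and>
     (\<forall>y m. is_cone J C D y m \<longrightarrow> (\<exists>!h. h \<in> hom C y x \<and> (\<forall>j\<in>Ob J. Cmp C (l j) h = m j)))"

text \<open>
  Every finite category is isomorphic to one whose objects and arrows are natural numbers,
  so these suffice as shapes of finite diagrams.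
\<close>

definition finite_category :: "(nat, nat) cat \<Rightarrow> bool" where
  "finite_category J \<longleftrightarrow> category J \<and> finite (Ob J) \<and> finite (Ar J)"

definition has_finite_limits :: "('o, 'a, 'y) cat_scheme \<Rightarrow> bool" where
  "has_finite_limits C \<longleftrightarrow>
     (\<forall>J (D :: (nat, nat, 'o, 'a) fct). finite_category J \<and> is_functor J C D \<longrightarrow>
        (\<exists>x l. is_limit J C D x l))"

definition preserves_finite_limits ::
  "('o, 'a, 'x) cat_scheme \<Rightarrow> ('p, 'b, 'y) cat_scheme \<Rightarrow> ('o, 'a, 'p, 'b, 'z) fct_scheme \<Rightarrow> bool" where
  "preserves_finite_limits C D F \<longleftrightarrow>
     (\<forall>J (X :: (nat, nat, 'o, 'a) fct) x l.
        finite_category J \<and> is_functor J C X \<and> is_limit J C X x l \<longrightarrow>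
        is_limit J D (cmp_fct J F X) (Fo F x) (\<lambda>j. Fa F (l j)))"

definition is_terminal :: "('o, 'a, 'x) cat_scheme \<Rightarrow> 'o \<Rightarrow> bool" where
  "is_terminal C t \<longleftrightarrow> t \<in> Ob C \<and> (\<forall>a\<in>Ob C. \<exists>!f. f \<in> hom C a t)"

text \<open>
  \<open>is_pullback C f g p q\<close>: the square \<open>f \<circ> p = g \<circ> q\<close> is a pullback; \<open>p\<close> is a pullback of \<open>g\<close> along \<open>f\<close>.
\<close>

definition is_pullback :: "('o, 'a, 'x) cat_scheme \<Rightarrow> 'a \<Rightarrow> 'a \<Rightarrow> 'a \<Rightarrow> 'a \<Rightarrow> bool" where
  "is_pullback C f g p q \<longleftrightarrow>
     f \<in> Ar C \<and> g \<in> Ar C \<and> p \<in> Ar C \<and> q \<in> Ar C \<and> Cod C f = Cod C g \<and>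
     Dom C p = Dom C q \<and> Cod C p = Dom C f \<and> Cod C q = Dom C g \<and> Cmp C f p = Cmp C g q \<and>
     (\<forall>z. \<forall>a\<in>hom C z (Dom C f). \<forall>b\<in>hom C z (Dom C g). Cmp C f a = Cmp C g b \<longrightarrow>
        (\<exists>!h. h \<in> hom C z (Dom C p) \<and> Cmp C p h = a \<and> Cmp C q h = b))"

definition is_product :: "('o, 'a, 'x) cat_scheme \<Rightarrow> 'o \<Rightarrow> 'o \<Rightarrow> 'o \<Rightarrow> 'a \<Rightarrow> 'a \<Rightarrow> bool" where
  "is_product C a b p \<pi> \<rho> \<longleftrightarrow>
     a \<in> Ob C \<and> b \<in> Ob C \<and> p \<in> Ob C \<and> \<pi> \<in> hom C p a \<and> \<rho> \<in> hom C p b \<and>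
     (\<forall>z. \<forall>f\<in>hom C z a. \<forall>g\<in>hom C z b. \<exists>!h. h \<in> hom C z p \<and> Cmp C \<pi> h = f \<and> Cmp C \<rho> h = g)"

text \<open>
  \<open>e\<close>, with the product \<open>p\<close> of \<open>e\<close> and \<open>x\<close> and the evaluation \<open>ev : p \<rightarrow> y\<close>, is an exponential of
  \<open>y\<close> by \<open>x\<close>.  The arrow \<open>k\<close> below is the product of \<open>g\<close> and the identity of \<open>x\<close>.
\<close>

definition is_exponential ::
  "('o, 'a, 'z) cat_scheme \<Rightarrow> 'o \<Rightarrow> 'o \<Rightarrow> 'o \<Rightarrow> 'o \<Rightarrow> 'a \<Rightarrow> 'a \<Rightarrow> 'a \<Rightarrow> bool" where
  "is_exponential C x y e p \<pi> \<rho> ev \<longleftrightarrow>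
     is_product C e x p \<pi> \<rho> \<and> ev \<in> hom C p y \<and>
     (\<forall>z q \<pi>' \<rho>' f. is_product C z x q \<pi>' \<rho>' \<and> f \<in> hom C q y \<longrightarrow>
        (\<exists>!g. g \<in> hom C z e \<and>
           (\<exists>k\<in>hom C q p. Cmp C \<pi> k = Cmp C g \<pi>' \<and> Cmp C \<rho> k = \<rho>' \<and> Cmp C ev k = f)))"

definition cartesian_closed :: "('o, 'a, 'z) cat_scheme \<Rightarrow> bool" where
  "cartesian_closed C \<longleftrightarrow> has_finite_limits C \<and>
     (\<forall>x\<in>Ob C. \<forall>y\<in>Ob C. \<exists>e p \<pi> \<rho> ev. is_exponential C x y e p \<pi> \<rho> ev)"

definition preserves_cartesian_closed ::
  "('o, 'a, 'x) cat_scheme \<Rightarrow> ('p, 'b, 'y) cat_scheme \<Rightarrow> ('o, 'a, 'p, 'b, 'z) fct_scheme \<Rightarrow> bool" where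
  "preserves_cartesian_closed C D F \<longleftrightarrow> preserves_finite_limits C D F \<and>
     (\<forall>x y e p \<pi> \<rho> ev. is_exponential C x y e p \<pi> \<rho> ev \<longrightarrow>
        is_exponential D (Fo F x) (Fo F y) (Fo F e) (Fo F p) (Fa F \<pi>) (Fa F \<rho>) (Fa F ev))"

definition is_subobject_classifier ::
  "('o, 'a, 'z) cat_scheme \<Rightarrow> 'o \<Rightarrow> 'o \<Rightarrow> 'a \<Rightarrow> bool" where
  "is_subobject_classifier C one \<Omega> tr \<longleftrightarrow>
     is_terminal C one \<and> \<Omega> \<in> Ob C \<and> tr \<in> hom C one \<Omega> \<and>
     (\<forall>m. is_mono C m \<longrightarrow>
        (\<exists>!\<chi>. \<chi> \<in> hom C (Cod C m) \<Omega> \<and> (\<exists>b\<in>hom C (Dom C m) one. is_pullback C \<chi> tr m b)))"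


section \<open>Display categories\<close>

text \<open>
  For a display \<open>p : E \<rightarrow> B\<close> and \<open>f : A \<rightarrow> B\<close>, the chosen pullback consists of
  \<open>Pbk C f p : f\<^sup>*E \<rightarrow> A\<close> and \<open>Pbt C f p : f\<^sup>*E \<rightarrow> E\<close>.
\<close>

record 'u dcat = "('u, 'u) cat" +
  Disp :: "'u set"
  Pbk :: "'u \<Rightarrow> 'u \<Rightarrow> 'u"
  Pbt :: "'u \<Rightarrow> 'u \<Rightarrow> 'u"

definition display_category :: "('u, 'z) dcat_scheme \<Rightarrow> bool" where
  "display_category C \<longleftrightarrow> category C \<and> Disp C \<subseteq> Ar C \<and>
     (\<forall>p\<in>Disp C. \<forall>f\<in>Ar C. Cod C f = Cod C p \<longrightarrow>
        Pbk C f p \<in> Disp C \<and> is_pullback C f p (Pbk C f p) (Pbt C f p)) \<and>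
     (\<forall>p\<in>Disp C. \<forall>i. is_iso C i \<and> Cod C i = Dom C p \<longrightarrow> Cmp C p i \<in> Disp C) \<and>
     (\<forall>p\<in>Disp C. \<forall>i. is_iso C i \<and> Dom C i = Cod C p \<longrightarrow> Cmp C i p \<in> Disp C)"

text \<open>
  The fibre at \<open>A\<close> and the reindexing functor along \<open>f\<close> of the indexed category of displays.
\<close>

definition disp_fib :: "('u, 'z) dcat_scheme \<Rightarrow> 'u \<Rightarrow> ('u, 'u \<times> 'u \<times> 'u) cat" where
  "disp_fib C A = full_sub (slice C A) (Disp C)"

definition disp_reindex ::
  "('u, 'z) dcat_scheme \<Rightarrow> 'u \<Rightarrow> ('u, 'u \<times> 'u \<times> 'u, 'u, 'u \<times> 'u \<times> 'u) fct" where
  "disp_reindex C f = \<lparr>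
     Fo = Pbk C f,
     Fa = (\<lambda>(p, h, q). (Pbk C f p,
            THE k. k \<in> hom C (Dom C (Pbk C f p)) (Dom C (Pbk C f q)) \<and>
                   Cmp C (Pbk C f q) k = Pbk C f p \<and>
                   Cmp C (Pbt C f q) k = Cmp C h (Pbt C f p),
            Pbk C f q))\<rparr>"

definition disp_incl :: "('u, 'z) dcat_scheme \<Rightarrow> 'u \<Rightarrow> ('u, 'u \<times> 'u \<times> 'u, 'u, 'u \<times> 'u \<times> 'u) fct" where
  "disp_incl C A = id_fct (disp_fib C A)"

definition cartesian_dcat :: "('u, 'z) dcat_scheme \<Rightarrow> bool" where
  "cartesian_dcat C \<longleftrightarrow> has_finite_limits C \<and>
     (\<forall>A\<in>Ob C. has_finite_limits (disp_fib C A) \<and>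
        preserves_finite_limits (disp_fib C A) (slice C A) (disp_incl C A)) \<and>
     (\<forall>f\<in>Ar C. preserves_finite_limits (disp_fib C (Cod C f)) (disp_fib C (Dom C f)) (disp_reindex C f))"

definition cartesian_closed_dcat :: "('u, 'z) dcat_scheme \<Rightarrow> bool" where
  "cartesian_closed_dcat C \<longleftrightarrow> cartesian_closed C \<and>
     (\<forall>A\<in>Ob C. cartesian_closed (disp_fib C A) \<and>
        preserves_cartesian_closed (disp_fib C A) (slice C A) (disp_incl C A)) \<and>
     (\<forall>f\<in>Ar C. preserves_cartesian_closed (disp_fib C (Cod C f)) (disp_fib C (Dom C f)) (disp_reindex C f))"

definition display_functor :: "('u, 'x) dcat_scheme \<Rightarrow> ('u, 'y) dcat_scheme \<Rightarrow>
    ('u, 'u, 'u, 'u, 'z) fct_scheme \<Rightarrow> bool" where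
  "display_functor C D F \<longleftrightarrow> is_functor C D F \<and>
     (\<forall>p\<in>Disp C. Fa F p \<in> Disp D) \<and>
     (\<forall>f p q t. p \<in> Disp C \<and> is_pullback C f p q t \<longrightarrow>
        is_pullback D (Fa F f) (Fa F p) (Fa F q) (Fa F t))"

text \<open>
  Size: the objects and arrows of small (indexed) categories form subsets of one type \<open>'u\<close>, and
  \<open>small\<close> says which of these subsets are small.  It is a parameter; the elements of a Grothendieck
  universe \<open>'u\<close> (viewed as subsets of \<open>'u\<close>) and all subsets of \<open>'u\<close> are two instances.
\<close>

definition small_cat :: "('u set \<Rightarrow> bool) \<Rightarrow> ('u, 'u, 'z) cat_scheme \<Rightarrow> bool" where
  "small_cat small C \<longleftrightarrow> small (Ob C) \<and> small (Ar C)"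


section \<open>Strict indexed categories, internal categories, universes\<close>

record ('o, 'a, 'x, 'y) icat =
  Fib :: "'o \<Rightarrow> ('x, 'y) cat"
  Re :: "'a \<Rightarrow> ('x, 'y, 'x, 'y) fct"

definition strict_indexed_category ::
  "('o, 'a, 'z) cat_scheme \<Rightarrow> ('o, 'a, 'x, 'y) icat \<Rightarrow> bool" where
  "strict_indexed_category C X \<longleftrightarrow>
     (\<forall>\<Gamma>\<in>Ob C. category (Fib X \<Gamma>)) \<and>
     (\<forall>u\<in>Ar C. is_functor (Fib X (Cod C u)) (Fib X (Dom C u)) (Re X u)) \<and>
     (\<forall>\<Gamma>\<in>Ob C.
        (\<forall>A\<in>Ob (Fib X \<Gamma>). Fo (Re X (Idn C \<Gamma>)) A = A) \<and>
        (\<forall>f\<in>Ar (Fib X \<Gamma>). Fa (Re X (Idn C \<Gamma>)) f = f)) \<and>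
     (\<forall>u\<in>Ar C. \<forall>v\<in>Ar C. Cod C u = Dom C v \<longrightarrow>
        (\<forall>A\<in>Ob (Fib X (Cod C v)). Fo (Re X (Cmp C v u)) A = Fo (Re X u) (Fo (Re X v) A)) \<and>
        (\<forall>f\<in>Ar (Fib X (Cod C v)). Fa (Re X (Cmp C v u)) f = Fa (Re X u) (Fa (Re X v) f)))"

text \<open>
  A strictly natural \<open>\<Phi> : X \<rightarrow> F\<^sup>*Y\<close>, for \<open>F : C \<rightarrow> D\<close>, a \<open>C\<close>-indexed \<open>X\<close> and a \<open>D\<close>-indexed \<open>Y\<close>.
\<close>

definition strict_indexed_functor ::
  "('o, 'a, 'r) cat_scheme \<Rightarrow> ('o, 'a, 'p, 'b, 's) fct_scheme \<Rightarrow> ('o, 'a, 'x, 'y) icat \<Rightarrow>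
   ('p, 'b, 'x', 'y') icat \<Rightarrow> ('o \<Rightarrow> ('x, 'y, 'x', 'y') fct) \<Rightarrow> bool" where
  "strict_indexed_functor C F X Y \<Phi> \<longleftrightarrow>
     (\<forall>\<Gamma>\<in>Ob C. is_functor (Fib X \<Gamma>) (Fib Y (Fo F \<Gamma>)) (\<Phi> \<Gamma>)) \<and>
     (\<forall>u\<in>Ar C.
        (\<forall>A\<in>Ob (Fib X (Cod C u)).
           Fo (\<Phi> (Dom C u)) (Fo (Re X u) A) = Fo (Re Y (Fa F u)) (Fo (\<Phi> (Cod C u)) A)) \<and>
        (\<forall>f\<in>Ar (Fib X (Cod C u)).
           Fa (\<Phi> (Dom C u)) (Fa (Re X u) f) = Fa (Re Y (Fa F u)) (Fa (\<Phi> (Cod C u)) f)))"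

definition strict_indexed_iso ::
  "('o, 'a, 'z) cat_scheme \<Rightarrow> ('o, 'a, 'x, 'y) icat \<Rightarrow> ('o, 'a, 'x', 'y') icat \<Rightarrow> bool" where
  "strict_indexed_iso C X Y \<longleftrightarrow>
     (\<exists>\<Phi> \<Psi>. strict_indexed_functor C (id_fct C) X Y \<Phi> \<and> strict_indexed_functor C (id_fct C) Y X \<Psi> \<and>
        (\<forall>\<Gamma>\<in>Ob C.
           (\<forall>A\<in>Ob (Fib X \<Gamma>). Fo (\<Psi> \<Gamma>) (Fo (\<Phi> \<Gamma>) A) = A) \<and>
           (\<forall>f\<in>Ar (Fib X \<Gamma>). Fa (\<Psi> \<Gamma>) (Fa (\<Phi> \<Gamma>) f) = f) \<and>
           (\<forall>B\<in>Ob (Fib Y \<Gamma>). Fo (\<Phi> \<Gamma>) (Fo (\<Psi> \<Gamma>) B) = B) \<and>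
           (\<forall>g\<in>Ar (Fib Y \<Gamma>). Fa (\<Phi> \<Gamma>) (Fa (\<Psi> \<Gamma>) g) = g)))"

text \<open>
  An indexed natural transformation \<open>a : \<Phi> \<Rightarrow> \<alpha>\<^sup>*Y \<circ> \<Psi>\<close>, for \<open>\<alpha> : F \<Rightarrow> G : C \<rightarrow> D\<close>,
  \<open>\<Phi> : X \<rightarrow> F\<^sup>*Y\<close> and \<open>\<Psi> : X \<rightarrow> G\<^sup>*Y\<close>.
\<close>

definition indexed_nat ::
  "('o, 'a, 'r) cat_scheme \<Rightarrow> ('o, 'a, 'p, 'b, 's) fct_scheme \<Rightarrow> ('o \<Rightarrow> 'b) \<Rightarrow>
   ('o, 'a, 'x, 'y) icat \<Rightarrow> ('p, 'b, 'x', 'y') icat \<Rightarrow>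
   ('o \<Rightarrow> ('x, 'y, 'x', 'y') fct) \<Rightarrow> ('o \<Rightarrow> ('x, 'y, 'x', 'y') fct) \<Rightarrow> ('o \<Rightarrow> 'x \<Rightarrow> 'y') \<Rightarrow> bool" where
  "indexed_nat C F \<alpha> X Y \<Phi> \<Psi> a \<longleftrightarrow>
     (\<forall>\<Gamma>\<in>Ob C. is_nat (Fib X \<Gamma>) (Fib Y (Fo F \<Gamma>)) (\<Phi> \<Gamma>)
        (cmp_fct (Fib X \<Gamma>) (Re Y (\<alpha> \<Gamma>)) (\<Psi> \<Gamma>)) (a \<Gamma>)) \<and>
     (\<forall>u\<in>Ar C. \<forall>A\<in>Ob (Fib X (Cod C u)).
        a (Dom C u) (Fo (Re X u) A) = Fa (Re Y (Fa F u)) (a (Cod C u) A))"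

text \<open>
  \<open>I0\<close> and \<open>I1\<close> are the objects of objects and of arrows, with domain \<open>Idm\<close>, codomain \<open>Icd\<close> and
  identities \<open>Iid\<close>; \<open>Ip\<close> is the object of composable pairs, with projections \<open>Ip1\<close> to the arrow
  applied first and \<open>Ip2\<close> to the arrow applied second; \<open>Imul\<close> is composition.
\<close>

record 'u internal =
  I0 :: 'u
  I1 :: 'u
  Idm :: 'u
  Icd :: 'u
  Iid :: 'u
  Ip :: 'u
  Ip1 :: 'u
  Ip2 :: 'u
  Imul :: 'u

text \<open>Composition of generalised elements \<open>f, g : \<Gamma> \<rightarrow> I1 E\<close> with \<open>Icd E \<circ> f = Idm E \<circ> g\<close>.\<close>

definition icmp :: "('u, 'u, 'z) cat_scheme \<Rightarrow> 'u internal \<Rightarrow> 'u \<Rightarrow> 'u \<Rightarrow> 'u" where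
  "icmp C E g f = Cmp C (Imul E)
     (THE h. h \<in> hom C (Dom C f) (Ip E) \<and> Cmp C (Ip1 E) h = f \<and> Cmp C (Ip2 E) h = g)"

text \<open>The unit and associativity laws are imposed on generalised elements.\<close>

definition internal_category :: "('u, 'u, 'z) cat_scheme \<Rightarrow> 'u internal \<Rightarrow> bool" where
  "internal_category C E \<longleftrightarrow>
     I0 E \<in> Ob C \<and> I1 E \<in> Ob C \<and> Ip E \<in> Ob C \<and>
     Idm E \<in> hom C (I1 E) (I0 E) \<and> Icd E \<in> hom C (I1 E) (I0 E) \<and> Iid E \<in> hom C (I0 E) (I1 E) \<and>
     Ip1 E \<in> hom C (Ip E) (I1 E) \<and> Ip2 E \<in> hom C (Ip E) (I1 E) \<and> Imul E \<in> hom C (Ip E) (I1 E) \<and>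
     is_pullback C (Icd E) (Idm E) (Ip1 E) (Ip2 E) \<and>
     Cmp C (Idm E) (Iid E) = Idn C (I0 E) \<and> Cmp C (Icd E) (Iid E) = Idn C (I0 E) \<and>
     Cmp C (Idm E) (Imul E) = Cmp C (Idm E) (Ip1 E) \<and> Cmp C (Icd E) (Imul E) = Cmp C (Icd E) (Ip2 E) \<and>
     (\<forall>\<Gamma>. \<forall>f\<in>hom C \<Gamma> (I1 E).
        icmp C E f (Cmp C (Iid E) (Cmp C (Idm E) f)) = f \<and>
        icmp C E (Cmp C (Iid E) (Cmp C (Icd E) f)) f = f) \<and>
     (\<forall>\<Gamma>. \<forall>f\<in>hom C \<Gamma> (I1 E). \<forall>g\<in>hom C \<Gamma> (I1 E). \<forall>h\<in>hom C \<Gamma> (I1 E).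
        Cmp C (Icd E) f = Cmp C (Idm E) g \<and> Cmp C (Icd E) g = Cmp C (Idm E) h \<longrightarrow>
        icmp C E h (icmp C E g f) = icmp C E (icmp C E h g) f)"

definition internal_functor ::
  "('u, 'u, 'z) cat_scheme \<Rightarrow> 'u internal \<Rightarrow> 'u internal \<Rightarrow> 'u \<Rightarrow> 'u \<Rightarrow> bool" where
  "internal_functor C T E p0 p1 \<longleftrightarrow>
     p0 \<in> hom C (I0 T) (I0 E) \<and> p1 \<in> hom C (I1 T) (I1 E) \<and>
     Cmp C (Idm E) p1 = Cmp C p0 (Idm T) \<and> Cmp C (Icd E) p1 = Cmp C p0 (Icd T) \<and>
     Cmp C p1 (Iid T) = Cmp C (Iid E) p0 \<and>
     Cmp C p1 (Imul T) = icmp C E (Cmp C p1 (Ip2 T)) (Cmp C p1 (Ip1 T))"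

definition internal_discrete_opfibration ::
  "('u, 'u, 'z) cat_scheme \<Rightarrow> 'u internal \<Rightarrow> 'u internal \<Rightarrow> 'u \<Rightarrow> 'u \<Rightarrow> bool" where
  "internal_discrete_opfibration C T E p0 p1 \<longleftrightarrow>
     internal_category C T \<and> internal_category C E \<and> internal_functor C T E p0 p1 \<and>
     is_pullback C (Idm E) p0 p1 (Idm T)"

definition externalization :: "('u, 'u, 'z) cat_scheme \<Rightarrow> 'u internal \<Rightarrow> ('u, 'u, 'u, 'u) icat" where
  "externalization C E = \<lparr>
     Fib = (\<lambda>\<Gamma>. \<lparr>Ob = hom C \<Gamma> (I0 E), Ar = hom C \<Gamma> (I1 E),
                 Dom = Cmp C (Idm E), Cod = Cmp C (Icd E), Idn = Cmp C (Iid E), Cmp = icmp C E\<rparr>),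
     Re = (\<lambda>u. \<lparr>Fo = (\<lambda>A. Cmp C A u), Fa = (\<lambda>f. Cmp C f u)\<rparr>)\<rparr>"

text \<open>
  The component at \<open>\<Gamma>\<close> of the indexed functor from \<open>E\<close> to displays, for a discrete opfibration
  \<open>p : T \<rightarrow> E\<close>.  An arrow \<open>f : A \<rightarrow> B\<close> is sent to the map \<open>A\<^sup>*p0 \<rightarrow> B\<^sup>*p0\<close> over \<open>\<Gamma>\<close> induced by the
  codomain of the lift \<open>g\<close> of \<open>f\<close> (restricted to \<open>A\<^sup>*p0\<close>) with domain the generic element of \<open>A\<^sup>*p0\<close>.
  Neither this nor \<open>comprehension\<close> below records the (canonical) comparison isomorphisms of a
  pseudonatural transformation, since being an indexed equivalence is a condition on components.
\<close>

definition universe_functor ::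
  "('u, 'z) dcat_scheme \<Rightarrow> 'u internal \<Rightarrow> 'u internal \<Rightarrow> 'u \<Rightarrow> 'u \<Rightarrow>
   ('u, 'u, 'u, 'u \<times> 'u \<times> 'u) fct" where
  "universe_functor C T E p0 p1 = \<lparr>
     Fo = (\<lambda>A. Pbk C A p0),
     Fa = (\<lambda>f. let A = Cmp C (Idm E) f; B = Cmp C (Icd E) f; q = Pbk C A p0;
                   g = (THE g. g \<in> hom C (Dom C q) (I1 T) \<and>
                          Cmp C (Idm T) g = Pbt C A p0 \<and> Cmp C p1 g = Cmp C f q)
               in (q,
                   THE h. h \<in> hom C (Dom C q) (Dom C (Pbk C B p0)) \<and>
                     Cmp C (Pbk C B p0) h = q \<and> Cmp C (Pbt C B p0) h = Cmp C (Icd T) g,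
                   Pbk C B p0))\<rparr>"

definition is_universe ::
  "('u, 'z) dcat_scheme \<Rightarrow> 'u internal \<Rightarrow> 'u internal \<Rightarrow> 'u \<Rightarrow> 'u \<Rightarrow> bool" where
  "is_universe C T E p0 p1 \<longleftrightarrow> internal_discrete_opfibration C T E p0 p1 \<and> p0 \<in> Disp C \<and>
     (\<forall>\<Gamma>\<in>Ob C. is_equivalence (Fib (externalization C E) \<Gamma>) (disp_fib C \<Gamma>)
        (universe_functor C T E p0 p1))"

definition admits_universe :: "('u, 'z) dcat_scheme \<Rightarrow> bool" where
  "admits_universe C \<longleftrightarrow> (\<exists>T E p0 p1. is_universe C T E p0 p1)"

definition small_typos :: "('u set \<Rightarrow> bool) \<Rightarrow> ('u, 'z) dcat_scheme \<Rightarrow> bool" where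
  "small_typos small C \<longleftrightarrow> display_category C \<and> small_cat small C \<and>
     cartesian_dcat C \<and> cartesian_closed_dcat C \<and>
     (\<forall>p\<in>Disp C. \<forall>q\<in>Disp C. Cod C p = Dom C q \<longrightarrow> Cmp C q p \<in> Disp C) \<and>
     admits_universe C"

definition small_display_topos :: "('u set \<Rightarrow> bool) \<Rightarrow> ('u, 'z) dcat_scheme \<Rightarrow> bool" where
  "small_display_topos small C \<longleftrightarrow> small_typos small C \<and>
     (\<exists>one \<Omega> tr. is_subobject_classifier C one \<Omega> tr \<and> tr \<in> Disp C \<and>
        (\<exists>b\<in>hom C \<Omega> one. b \<in> Disp C))"


section \<open>Natural models\<close>

text \<open>
  \<open>Pr N \<Gamma>\<close> is the component of \<open>p : Tm \<rightarrow> Tp\<close>; \<open>Prj N \<Gamma> A\<close> is the display \<open>p\<^sub>A : \<Gamma>.A \<rightarrow> \<Gamma>\<close>, so that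
  \<open>\<Gamma>.A\<close> is its domain, and \<open>Var N \<Gamma> A\<close> is the universal element \<open>v\<^sub>A\<close>.
\<close>

record 'u natmod = "'u dcat" +
  Tp :: "('u, 'u, 'u, 'u) icat"
  Tm :: "('u, 'u, 'u, 'u) icat"
  Pr :: "'u \<Rightarrow> ('u, 'u, 'u, 'u) fct"
  Prj :: "'u \<Rightarrow> 'u \<Rightarrow> 'u"
  Var :: "'u \<Rightarrow> 'u \<Rightarrow> 'u"

abbreviation underlying :: "('u, 'z) natmod_scheme \<Rightarrow> 'u dcat" where
  "underlying N \<equiv> dcat.truncate N"

definition represents :: "('u, 'z) natmod_scheme \<Rightarrow> 'u \<Rightarrow> 'u \<Rightarrow> 'u \<Rightarrow> 'u \<Rightarrow> bool" where
  "represents N \<Gamma> A p v \<longleftrightarrow>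
     p \<in> Ar N \<and> Cod N p = \<Gamma> \<and> v \<in> Ob (Fib (Tm N) (Dom N p)) \<and>
     Fo (Pr N (Dom N p)) v = Fo (Re (Tp N) p) A \<and>
     (\<forall>\<Delta>. \<forall>u\<in>hom N \<Delta> \<Gamma>. \<forall>t\<in>Ob (Fib (Tm N) \<Delta>). Fo (Pr N \<Delta>) t = Fo (Re (Tp N) u) A \<longrightarrow>
        (\<exists>!w. w \<in> hom N \<Delta> (Dom N p) \<and> Cmp N p w = u \<and> Fo (Re (Tm N) w) v = t))"

definition pre_natural_model :: "('u set \<Rightarrow> bool) \<Rightarrow> ('u, 'z) natmod_scheme \<Rightarrow> bool" where
  "pre_natural_model small N \<longleftrightarrow> display_category N \<and> small_cat small N \<and>
     strict_indexed_category N (Tp N) \<and> strict_indexed_category N (Tm N) \<and>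
     (\<forall>\<Gamma>\<in>Ob N. small_cat small (Fib (Tp N) \<Gamma>) \<and> small_cat small (Fib (Tm N) \<Gamma>)) \<and>
     strict_indexed_functor N (id_fct N) (Tm N) (Tp N) (Pr N) \<and>
     (\<forall>\<Gamma>\<in>Ob N. is_discrete_opfibration (Fib (Tm N) \<Gamma>) (Fib (Tp N) \<Gamma>) (Pr N \<Gamma>)) \<and>
     (\<forall>\<Gamma>\<in>Ob N. \<forall>A\<in>Ob (Fib (Tp N) \<Gamma>).
        Prj N \<Gamma> A \<in> Disp N \<and> represents N \<Gamma> A (Prj N \<Gamma> A) (Var N \<Gamma> A))"

text \<open>
  The map \<open>\<Delta> \<rightarrow> \<Gamma>.A\<close> over \<open>\<Gamma>\<close> classifying \<open>u : \<Delta> \<rightarrow> \<Gamma>\<close> and a term \<open>t\<close> of type \<open>A[u]\<close>.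
\<close>

definition ext_pair :: "('u, 'z) natmod_scheme \<Rightarrow> 'u \<Rightarrow> 'u \<Rightarrow> 'u \<Rightarrow> 'u \<Rightarrow> 'u" where
  "ext_pair N \<Gamma> A u t = (THE w. w \<in> hom N (Dom N u) (Dom N (Prj N \<Gamma> A)) \<and>
     Cmp N (Prj N \<Gamma> A) w = u \<and> Fo (Re (Tm N) w) (Var N \<Gamma> A) = t)"

definition comprehension :: "('u, 'z) natmod_scheme \<Rightarrow> 'u \<Rightarrow> ('u, 'u, 'u, 'u \<times> 'u \<times> 'u) fct" where
  "comprehension N \<Gamma> = \<lparr>
     Fo = Prj N \<Gamma>,
     Fa = (\<lambda>f. let A = Dom (Fib (Tp N) \<Gamma>) f; B = Cod (Fib (Tp N) \<Gamma>) f; p = Prj N \<Gamma> A; T = Fib (Tm N) (Dom N p);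
                   g = (THE g. g \<in> Ar T \<and> Dom T g = Var N \<Gamma> A \<and> Fa (Pr N (Dom N p)) g = Fa (Re (Tp N) p) f)
               in (p, ext_pair N \<Gamma> B p (Cod T g), Prj N \<Gamma> B))\<rparr>"

definition natural_model :: "('u set \<Rightarrow> bool) \<Rightarrow> ('u, 'z) natmod_scheme \<Rightarrow> bool" where
  "natural_model small N \<longleftrightarrow> pre_natural_model small N \<and>
     (\<forall>\<Gamma>\<in>Ob N. is_equivalence (Fib (Tp N) \<Gamma>) (disp_fib N \<Gamma>) (comprehension N \<Gamma>))"

definition admits_type_classifier :: "('u, 'z) natmod_scheme \<Rightarrow> bool" where
  "admits_type_classifier N \<longleftrightarrow>
     (\<exists>E. internal_category N E \<and> strict_indexed_iso N (externalization N E) (Tp N))"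


section \<open>Strict 2-categories and 2-equivalences\<close>

text \<open>\<open>vcmp K \<beta> \<alpha>\<close> and \<open>hcmp K \<beta> \<alpha>\<close> apply \<open>\<alpha>\<close> first.\<close>

record ('o, 'm, 'c) twocat =
  Obj :: "'o set"
  Mor :: "'m set"
  Cel :: "'c set"
  src1 :: "'m \<Rightarrow> 'o"
  tgt1 :: "'m \<Rightarrow> 'o"
  src2 :: "'c \<Rightarrow> 'm"
  tgt2 :: "'c \<Rightarrow> 'm"
  id1 :: "'o \<Rightarrow> 'm"
  cmp1 :: "'m \<Rightarrow> 'm \<Rightarrow> 'm"
  id2 :: "'m \<Rightarrow> 'c"
  vcmp :: "'c \<Rightarrow> 'c \<Rightarrow> 'c"
  hcmp :: "'c \<Rightarrow> 'c \<Rightarrow> 'c"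

text \<open>
  A strict 2-category amounts to a category of objects and 1-cells, the sum of all hom-categories,
  and a category of objects and 2-cells under horizontal composition, compatible with each other.
\<close>

definition cat1 :: "('o, 'm, 'c) twocat \<Rightarrow> ('o, 'm) cat" where
  "cat1 K = \<lparr>Ob = Obj K, Ar = Mor K, Dom = src1 K, Cod = tgt1 K, Idn = id1 K, Cmp = cmp1 K\<rparr>"

definition vcat :: "('o, 'm, 'c) twocat \<Rightarrow> ('m, 'c) cat" where
  "vcat K = \<lparr>Ob = Mor K, Ar = Cel K, Dom = src2 K, Cod = tgt2 K, Idn = id2 K, Cmp = vcmp K\<rparr>"

definition hcat :: "('o, 'm, 'c) twocat \<Rightarrow> ('o, 'c) cat" where
  "hcat K = \<lparr>Ob = Obj K, Ar = Cel K, Dom = (\<lambda>\<alpha>. src1 K (src2 K \<alpha>)), Cod = (\<lambda>\<alpha>. tgt1 K (src2 K \<alpha>)),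
             Idn = (\<lambda>a. id2 K (id1 K a)), Cmp = hcmp K\<rparr>"

definition strict_2_category :: "('o, 'm, 'c) twocat \<Rightarrow> bool" where
  "strict_2_category K \<longleftrightarrow> category (cat1 K) \<and> category (vcat K) \<and> category (hcat K) \<and>
     (\<forall>\<alpha>\<in>Cel K. src1 K (src2 K \<alpha>) = src1 K (tgt2 K \<alpha>) \<and> tgt1 K (src2 K \<alpha>) = tgt1 K (tgt2 K \<alpha>)) \<and>
     (\<forall>\<alpha>\<in>Cel K. \<forall>\<beta>\<in>Cel K. tgt1 K (src2 K \<alpha>) = src1 K (src2 K \<beta>) \<longrightarrow>
        src2 K (hcmp K \<beta> \<alpha>) = cmp1 K (src2 K \<beta>) (src2 K \<alpha>) \<and>
        tgt2 K (hcmp K \<beta> \<alpha>) = cmp1 K (tgt2 K \<beta>) (tgt2 K \<alpha>)) \<and>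
     (\<forall>f\<in>Mor K. \<forall>g\<in>Mor K. tgt1 K f = src1 K g \<longrightarrow>
        id2 K (cmp1 K g f) = hcmp K (id2 K g) (id2 K f)) \<and>
     (\<forall>\<alpha>\<in>Cel K. \<forall>\<alpha>'\<in>Cel K. \<forall>\<beta>\<in>Cel K. \<forall>\<beta>'\<in>Cel K.
        tgt2 K \<alpha> = src2 K \<alpha>' \<and> tgt2 K \<beta> = src2 K \<beta>' \<and> tgt1 K (src2 K \<alpha>) = src1 K (src2 K \<beta>) \<longrightarrow>
        hcmp K (vcmp K \<beta>' \<beta>) (vcmp K \<alpha>' \<alpha>) = vcmp K (hcmp K \<beta>' \<alpha>') (hcmp K \<beta> \<alpha>))"

record ('o, 'm, 'c, 'o', 'm', 'c') fct2 =
  on0 :: "'o \<Rightarrow> 'o'"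
  on1 :: "'m \<Rightarrow> 'm'"
  on2 :: "'c \<Rightarrow> 'c'"

definition strict_2_functor ::
  "('o, 'm, 'c) twocat \<Rightarrow> ('o', 'm', 'c') twocat \<Rightarrow> ('o, 'm, 'c, 'o', 'm', 'c') fct2 \<Rightarrow> bool" where
  "strict_2_functor K L U \<longleftrightarrow>
     is_functor (cat1 K) (cat1 L) \<lparr>Fo = on0 U, Fa = on1 U\<rparr> \<and>
     is_functor (vcat K) (vcat L) \<lparr>Fo = on1 U, Fa = on2 U\<rparr> \<and>
     is_functor (hcat K) (hcat L) \<lparr>Fo = on0 U, Fa = on2 U\<rparr>"

definition iso_1cells :: "('o, 'm, 'c) twocat \<Rightarrow> 'm \<Rightarrow> 'm \<Rightarrow> bool" where
  "iso_1cells K f g \<longleftrightarrow> (\<exists>\<alpha>\<in>hom (vcat K) f g. is_iso (vcat K) \<alpha>)"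

definition equivalent_objects :: "('o, 'm, 'c) twocat \<Rightarrow> 'o \<Rightarrow> 'o \<Rightarrow> bool" where
  "equivalent_objects K a b \<longleftrightarrow>
     (\<exists>f\<in>hom (cat1 K) a b. \<exists>g\<in>hom (cat1 K) b a.
        iso_1cells K (cmp1 K g f) (id1 K a) \<and> iso_1cells K (cmp1 K f g) (id1 K b))"

definition is_2_equivalence ::
  "('o, 'm, 'c) twocat \<Rightarrow> ('o', 'm', 'c') twocat \<Rightarrow> ('o, 'm, 'c, 'o', 'm', 'c') fct2 \<Rightarrow> bool" where
  "is_2_equivalence K L U \<longleftrightarrow>
     strict_2_category K \<and> strict_2_category L \<and> strict_2_functor K L U \<and>
     (\<forall>b\<in>Obj L. \<exists>a\<in>Obj K. equivalent_objects L (on0 U a) b) \<and>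
     (\<forall>a\<in>Obj K. \<forall>b\<in>Obj K. \<forall>g\<in>hom (cat1 L) (on0 U a) (on0 U b).
        \<exists>f\<in>hom (cat1 K) a b. iso_1cells L (on1 U f) g) \<and>
     (\<forall>a\<in>Obj K. \<forall>b\<in>Obj K. \<forall>f\<in>hom (cat1 K) a b. \<forall>g\<in>hom (cat1 K) a b.
        bij_betw (on2 U) (hom (vcat K) f g) (hom (vcat L) (on1 U f) (on1 U g)))"

definition full_sub2 :: "('o, 'm, 'c) twocat \<Rightarrow> 'o set \<Rightarrow> ('o, 'm, 'c) twocat" where
  "full_sub2 K S = K\<lparr>
     Obj := Obj K \<inter> S,
     Mor := {f \<in> Mor K. src1 K f \<in> S \<and> tgt1 K f \<in> S},
     Cel := {\<alpha> \<in> Cel K. src1 K (src2 K \<alpha>) \<in> S \<and> tgt1 K (src2 K \<alpha>) \<in> S}\<rparr>"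


section \<open>The 2-category of Cartesian display categories that admit a universe\<close>

text \<open>
  1-cells and 2-cells store their boundaries.  All their components are extensional, i.e. constantly
  \<open>undefined\<close> off the relevant carriers, so that equality of cells is equality on carriers.
\<close>

record 'u dfun = "('u, 'u, 'u, 'u) fct" +
  dsrc :: "'u dcat"
  dtgt :: "'u dcat"

record 'u dnat =
  dnsrc :: "'u dfun"
  dntgt :: "'u dfun"
  dncomp :: "'u \<Rightarrow> 'u"

definition cdc_object :: "('u set \<Rightarrow> bool) \<Rightarrow> 'u dcat \<Rightarrow> bool" where
  "cdc_object small C \<longleftrightarrow>
     display_category C \<and> small_cat small C \<and> cartesian_dcat C \<and> admits_universe C"

definition cdc_mor :: "('u set \<Rightarrow> bool) \<Rightarrow> 'u dfun \<Rightarrow> bool" where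
  "cdc_mor small F \<longleftrightarrow> cdc_object small (dsrc F) \<and> cdc_object small (dtgt F) \<and>
     display_functor (dsrc F) (dtgt F) F \<and> preserves_finite_limits (dsrc F) (dtgt F) F \<and>
     fct_extensional (dsrc F) F"

definition cdc_cell :: "('u set \<Rightarrow> bool) \<Rightarrow> 'u dnat \<Rightarrow> bool" where
  "cdc_cell small \<alpha> \<longleftrightarrow> cdc_mor small (dnsrc \<alpha>) \<and> cdc_mor small (dntgt \<alpha>) \<and>
     dsrc (dnsrc \<alpha>) = dsrc (dntgt \<alpha>) \<and> dtgt (dnsrc \<alpha>) = dtgt (dntgt \<alpha>) \<and>
     is_nat (dsrc (dnsrc \<alpha>)) (dtgt (dnsrc \<alpha>)) (dnsrc \<alpha>) (dntgt \<alpha>) (dncomp \<alpha>) \<and>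
     dncomp \<alpha> \<in> extensional (Ob (dsrc (dnsrc \<alpha>)))"

definition cdc_id1 :: "'u dcat \<Rightarrow> 'u dfun" where
  "cdc_id1 C = fct.extend (id_fct C) (dfun.fields C C)"

definition cdc_cmp1 :: "'u dfun \<Rightarrow> 'u dfun \<Rightarrow> 'u dfun" where
  "cdc_cmp1 G F = fct.extend (cmp_fct (dsrc F) G F) (dfun.fields (dsrc F) (dtgt G))"

definition cdc_id2 :: "'u dfun \<Rightarrow> 'u dnat" where
  "cdc_id2 F = \<lparr>dnsrc = F, dntgt = F, dncomp = (\<lambda>\<Gamma>\<in>Ob (dsrc F). Idn (dtgt F) (Fo F \<Gamma>))\<rparr>"

definition cdc_vcmp :: "'u dnat \<Rightarrow> 'u dnat \<Rightarrow> 'u dnat" where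
  "cdc_vcmp \<beta> \<alpha> = \<lparr>dnsrc = dnsrc \<alpha>, dntgt = dntgt \<beta>,
     dncomp = (\<lambda>\<Gamma>\<in>Ob (dsrc (dnsrc \<alpha>)). Cmp (dtgt (dnsrc \<alpha>)) (dncomp \<beta> \<Gamma>) (dncomp \<alpha> \<Gamma>))\<rparr>"

definition cdc_hcmp :: "'u dnat \<Rightarrow> 'u dnat \<Rightarrow> 'u dnat" where
  "cdc_hcmp \<beta> \<alpha> = \<lparr>dnsrc = cdc_cmp1 (dnsrc \<beta>) (dnsrc \<alpha>), dntgt = cdc_cmp1 (dntgt \<beta>) (dntgt \<alpha>),
     dncomp = (\<lambda>\<Gamma>\<in>Ob (dsrc (dnsrc \<alpha>)).
        Cmp (dtgt (dnsrc \<beta>)) (dncomp \<beta> (Fo (dntgt \<alpha>) \<Gamma>)) (Fa (dnsrc \<beta>) (dncomp \<alpha> \<Gamma>)))\<rparr>"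

definition CDC :: "('u set \<Rightarrow> bool) \<Rightarrow> ('u dcat, 'u dfun, 'u dnat) twocat" where
  "CDC small = \<lparr>
     Obj = {C. cdc_object small C}, Mor = {F. cdc_mor small F}, Cel = {\<alpha>. cdc_cell small \<alpha>},
     src1 = dsrc, tgt1 = dtgt, src2 = dnsrc, tgt2 = dntgt,
     id1 = cdc_id1, cmp1 = cdc_cmp1, id2 = cdc_id2, vcmp = cdc_vcmp, hcmp = cdc_hcmp\<rparr>"

definition Typ :: "('u set \<Rightarrow> bool) \<Rightarrow> ('u dcat, 'u dfun, 'u dnat) twocat" where
  "Typ small = full_sub2 (CDC small) {C. small_typos small C}"

definition DTop :: "('u set \<Rightarrow> bool) \<Rightarrow> ('u dcat, 'u dfun, 'u dnat) twocat" where
  "DTop small = full_sub2 (CDC small) {C. small_display_topos small C}"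


section \<open>The 2-category of Cartesian natural models that admit a type classifier\<close>

record 'u nmor = "('u, 'u, 'u, 'u) fct" +
  nsrc :: "'u natmod"
  ntgt :: "'u natmod"
  nTp :: "'u \<Rightarrow> ('u, 'u, 'u, 'u) fct"
  nTm :: "'u \<Rightarrow> ('u, 'u, 'u, 'u) fct"

record 'u ncell =
  ncsrc :: "'u nmor"
  nctgt :: "'u nmor"
  nccomp :: "'u \<Rightarrow> 'u"
  ncTp :: "'u \<Rightarrow> 'u \<Rightarrow> 'u"
  ncTm :: "'u \<Rightarrow> 'u \<Rightarrow> 'u"

definition cnm_object :: "('u set \<Rightarrow> bool) \<Rightarrow> 'u natmod \<Rightarrow> bool" where
  "cnm_object small N \<longleftrightarrow>
     natural_model small N \<and> cartesian_dcat (underlying N) \<and> admits_type_classifier N"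

definition tau :: "'u nmor \<Rightarrow> 'u \<Rightarrow> 'u \<Rightarrow> 'u" where
  "tau F \<Gamma> A = ext_pair (ntgt F) (Fo F \<Gamma>) (Fo (nTp F \<Gamma>) A)
     (Fa F (Prj (nsrc F) \<Gamma> A))
     (Fo (nTm F (Dom (nsrc F) (Prj (nsrc F) \<Gamma> A))) (Var (nsrc F) \<Gamma> A))"

definition natural_model_morphism :: "'u nmor \<Rightarrow> bool" where
  "natural_model_morphism F \<longleftrightarrow>
     display_functor (nsrc F) (ntgt F) F \<and>
     strict_indexed_functor (nsrc F) F (Tp (nsrc F)) (Tp (ntgt F)) (nTp F) \<and>
     strict_indexed_functor (nsrc F) F (Tm (nsrc F)) (Tm (ntgt F)) (nTm F) \<and>
     (\<forall>\<Gamma>\<in>Ob (nsrc F).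
        (\<forall>t\<in>Ob (Fib (Tm (nsrc F)) \<Gamma>).
           Fo (Pr (ntgt F) (Fo F \<Gamma>)) (Fo (nTm F \<Gamma>) t) = Fo (nTp F \<Gamma>) (Fo (Pr (nsrc F) \<Gamma>) t)) \<and>
        (\<forall>f\<in>Ar (Fib (Tm (nsrc F)) \<Gamma>).
           Fa (Pr (ntgt F) (Fo F \<Gamma>)) (Fa (nTm F \<Gamma>) f) = Fa (nTp F \<Gamma>) (Fa (Pr (nsrc F) \<Gamma>) f))) \<and>
     (\<forall>\<Gamma>\<in>Ob (nsrc F). \<forall>A\<in>Ob (Fib (Tp (nsrc F)) \<Gamma>). is_iso (ntgt F) (tau F \<Gamma> A))"

definition nmor_extensional :: "'u nmor \<Rightarrow> bool" where
  "nmor_extensional F \<longleftrightarrow> fct_extensional (nsrc F) F \<and>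
     nTp F \<in> extensional (Ob (nsrc F)) \<and> nTm F \<in> extensional (Ob (nsrc F)) \<and>
     (\<forall>\<Gamma>\<in>Ob (nsrc F). fct_extensional (Fib (Tp (nsrc F)) \<Gamma>) (nTp F \<Gamma>) \<and>
        fct_extensional (Fib (Tm (nsrc F)) \<Gamma>) (nTm F \<Gamma>))"

definition cnm_mor :: "('u set \<Rightarrow> bool) \<Rightarrow> 'u nmor \<Rightarrow> bool" where
  "cnm_mor small F \<longleftrightarrow> cnm_object small (nsrc F) \<and> cnm_object small (ntgt F) \<and>
     natural_model_morphism F \<and> preserves_finite_limits (nsrc F) (ntgt F) F \<and> nmor_extensional F"

definition natural_model_2_morphism :: "'u ncell \<Rightarrow> bool" where
  "natural_model_2_morphism \<alpha> \<longleftrightarrow> (let F = ncsrc \<alpha>; G = nctgt \<alpha>; C = nsrc F; D = ntgt F in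
     nsrc G = C \<and> ntgt G = D \<and>
     is_nat C D F G (nccomp \<alpha>) \<and>
     indexed_nat C F (nccomp \<alpha>) (Tp C) (Tp D) (nTp F) (nTp G) (ncTp \<alpha>) \<and>
     indexed_nat C F (nccomp \<alpha>) (Tm C) (Tm D) (nTm F) (nTm G) (ncTm \<alpha>) \<and>
     (\<forall>\<Gamma>\<in>Ob C. \<forall>t\<in>Ob (Fib (Tm C) \<Gamma>).
        Fa (Pr D (Fo F \<Gamma>)) (ncTm \<alpha> \<Gamma> t) = ncTp \<alpha> \<Gamma> (Fo (Pr C \<Gamma>) t)))"

definition ncell_extensional :: "'u ncell \<Rightarrow> bool" where
  "ncell_extensional \<alpha> \<longleftrightarrow> (let C = nsrc (ncsrc \<alpha>) in
     nccomp \<alpha> \<in> extensional (Ob C) \<and> ncTp \<alpha> \<in> extensional (Ob C) \<and> ncTm \<alpha> \<in> extensional (Ob C) \<and>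
     (\<forall>\<Gamma>\<in>Ob C. ncTp \<alpha> \<Gamma> \<in> extensional (Ob (Fib (Tp C) \<Gamma>)) \<and>
               ncTm \<alpha> \<Gamma> \<in> extensional (Ob (Fib (Tm C) \<Gamma>))))"

definition cnm_cell :: "('u set \<Rightarrow> bool) \<Rightarrow> 'u ncell \<Rightarrow> bool" where
  "cnm_cell small \<alpha> \<longleftrightarrow> cnm_mor small (ncsrc \<alpha>) \<and> cnm_mor small (nctgt \<alpha>) \<and>
     natural_model_2_morphism \<alpha> \<and> ncell_extensional \<alpha>"

definition cnm_id1 :: "'u natmod \<Rightarrow> 'u nmor" where
  "cnm_id1 N = fct.extend (id_fct N) (nmor.fields N N
     (\<lambda>\<Gamma>\<in>Ob N. id_fct (Fib (Tp N) \<Gamma>)) (\<lambda>\<Gamma>\<in>Ob N. id_fct (Fib (Tm N) \<Gamma>)))"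

definition cnm_cmp1 :: "'u nmor \<Rightarrow> 'u nmor \<Rightarrow> 'u nmor" where
  "cnm_cmp1 G F = fct.extend (cmp_fct (nsrc F) G F) (nmor.fields (nsrc F) (ntgt G)
     (\<lambda>\<Gamma>\<in>Ob (nsrc F). cmp_fct (Fib (Tp (nsrc F)) \<Gamma>) (nTp G (Fo F \<Gamma>)) (nTp F \<Gamma>))
     (\<lambda>\<Gamma>\<in>Ob (nsrc F). cmp_fct (Fib (Tm (nsrc F)) \<Gamma>) (nTm G (Fo F \<Gamma>)) (nTm F \<Gamma>)))"

definition cnm_id2 :: "'u nmor \<Rightarrow> 'u ncell" where
  "cnm_id2 F = (let C = nsrc F; D = ntgt F in \<lparr>
     ncsrc = F, nctgt = F,
     nccomp = (\<lambda>\<Gamma>\<in>Ob C. Idn D (Fo F \<Gamma>)),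
     ncTp = (\<lambda>\<Gamma>\<in>Ob C. \<lambda>A\<in>Ob (Fib (Tp C) \<Gamma>). Idn (Fib (Tp D) (Fo F \<Gamma>)) (Fo (nTp F \<Gamma>) A)),
     ncTm = (\<lambda>\<Gamma>\<in>Ob C. \<lambda>t\<in>Ob (Fib (Tm C) \<Gamma>). Idn (Fib (Tm D) (Fo F \<Gamma>)) (Fo (nTm F \<Gamma>) t))\<rparr>)"

text \<open>\<open>(\<beta>\<alpha>)\<^sub>A = \<beta>\<^sub>A[\<alpha>\<^sub>\<Gamma>] \<circ> \<alpha>\<^sub>A\<close>, and likewise for terms.\<close>

definition cnm_vcmp :: "'u ncell \<Rightarrow> 'u ncell \<Rightarrow> 'u ncell" where
  "cnm_vcmp \<beta> \<alpha> = (let F = ncsrc \<alpha>; C = nsrc F; D = ntgt F in \<lparr>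
     ncsrc = F, nctgt = nctgt \<beta>,
     nccomp = (\<lambda>\<Gamma>\<in>Ob C. Cmp D (nccomp \<beta> \<Gamma>) (nccomp \<alpha> \<Gamma>)),
     ncTp = (\<lambda>\<Gamma>\<in>Ob C. \<lambda>A\<in>Ob (Fib (Tp C) \<Gamma>).
        Cmp (Fib (Tp D) (Fo F \<Gamma>)) (Fa (Re (Tp D) (nccomp \<alpha> \<Gamma>)) (ncTp \<beta> \<Gamma> A)) (ncTp \<alpha> \<Gamma> A)),
     ncTm = (\<lambda>\<Gamma>\<in>Ob C. \<lambda>t\<in>Ob (Fib (Tm C) \<Gamma>).
        Cmp (Fib (Tm D) (Fo F \<Gamma>)) (Fa (Re (Tm D) (nccomp \<alpha> \<Gamma>)) (ncTm \<beta> \<Gamma> t)) (ncTm \<alpha> \<Gamma> t))\<rparr>)"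

text \<open>
  For \<open>\<alpha> : F \<Rightarrow> F'\<close> and \<open>\<beta> : G \<Rightarrow> G'\<close>, the horizontal composite has components
  \<open>\<beta>\<^bsub>F'\<Gamma>\<^esub> \<circ> G\<alpha>\<^sub>\<Gamma>\<close> and \<open>\<beta>\<^bsub>F'A\<^esub>[G\<alpha>\<^sub>\<Gamma>] \<circ> G\<alpha>\<^sub>A\<close>, and likewise for terms.
\<close>

definition cnm_hcmp :: "'u ncell \<Rightarrow> 'u ncell \<Rightarrow> 'u ncell" where
  "cnm_hcmp \<beta> \<alpha> = (let F = ncsrc \<alpha>; F' = nctgt \<alpha>; G = ncsrc \<beta>; C = nsrc F; E = ntgt G in \<lparr>
     ncsrc = cnm_cmp1 G F, nctgt = cnm_cmp1 (nctgt \<beta>) F',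
     nccomp = (\<lambda>\<Gamma>\<in>Ob C. Cmp E (nccomp \<beta> (Fo F' \<Gamma>)) (Fa G (nccomp \<alpha> \<Gamma>))),
     ncTp = (\<lambda>\<Gamma>\<in>Ob C. \<lambda>A\<in>Ob (Fib (Tp C) \<Gamma>).
        Cmp (Fib (Tp E) (Fo G (Fo F \<Gamma>)))
          (Fa (Re (Tp E) (Fa G (nccomp \<alpha> \<Gamma>))) (ncTp \<beta> (Fo F' \<Gamma>) (Fo (nTp F' \<Gamma>) A)))
          (Fa (nTp G (Fo F \<Gamma>)) (ncTp \<alpha> \<Gamma> A))),
     ncTm = (\<lambda>\<Gamma>\<in>Ob C. \<lambda>t\<in>Ob (Fib (Tm C) \<Gamma>).
        Cmp (Fib (Tm E) (Fo G (Fo F \<Gamma>)))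
          (Fa (Re (Tm E) (Fa G (nccomp \<alpha> \<Gamma>))) (ncTm \<beta> (Fo F' \<Gamma>) (Fo (nTm F' \<Gamma>) t)))
          (Fa (nTm G (Fo F \<Gamma>)) (ncTm \<alpha> \<Gamma> t)))\<rparr>)"

definition CNM :: "('u set \<Rightarrow> bool) \<Rightarrow> ('u natmod, 'u nmor, 'u ncell) twocat" where
  "CNM small = \<lparr>
     Obj = {N. cnm_object small N}, Mor = {F. cnm_mor small F}, Cel = {\<alpha>. cnm_cell small \<alpha>},
     src1 = nsrc, tgt1 = ntgt, src2 = ncsrc, tgt2 = nctgt,
     id1 = cnm_id1, cmp1 = cnm_cmp1, id2 = cnm_id2, vcmp = cnm_vcmp, hcmp = cnm_hcmp\<rparr>"

definition NTyp :: "('u set \<Rightarrow> bool) \<Rightarrow> ('u natmod, 'u nmor, 'u ncell) twocat" where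
  "NTyp small = full_sub2 (CNM small) {N. small_typos small (underlying N)}"

definition NDTop :: "('u set \<Rightarrow> bool) \<Rightarrow> ('u natmod, 'u nmor, 'u ncell) twocat" where
  "NDTop small = full_sub2 (CNM small) {N. small_display_topos small (underlying N)}"

definition forget1 :: "'u nmor \<Rightarrow> 'u dfun" where
  "forget1 F = fct.extend (fct.truncate F) (dfun.fields (underlying (nsrc F)) (underlying (ntgt F)))"

definition forget2 :: "'u ncell \<Rightarrow> 'u dnat" where
  "forget2 \<alpha> = \<lparr>dnsrc = forget1 (ncsrc \<alpha>), dntgt = forget1 (nctgt \<alpha>), dncomp = nccomp \<alpha>\<rparr>"

definition forgetful ::
  "('u natmod, 'u nmor, 'u ncell, 'u dcat, 'u dfun, 'u dnat) fct2" where
  "forgetful = \<lparr>on0 = dcat.truncate, on1 = forget1, on2 = forget2\<rparr>"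

end

theory Submission
  imports Defs
begin

text \<open>
  The three 2-functors are, on the nose, surjective on objects and on 1-cells, and bijective on 2-cells.

  A universe yields a natural model whose types and terms are generalised elements.  Conversely, if \<open>E\<close>
  classifies the types of a natural model, then the comprehension of the generic type represents its
  terms, so that by Yoneda the terms come from an internal category over \<open>E\<close>, and the functor to displays
  given by this universe is isomorphic to the comprehension.

  A display functor \<open>F\<close> between natural models lifts to a morphism: choose a type \<open>B\<close> whose comprehension
  is isomorphic to the image under \<open>F\<close> of the comprehension of the generic type \<open>A\<close>, and send \<open>A[u]\<close> to
  \<open>B[F u]\<close>, which is strictly natural.  Since comprehension is fully faithful, this determines the action
  on arrows of types, and the type components of a 2-morphism are determined by the underlying natural
  transformation.  Everything on terms is then forced, because terms correspond to sections of displays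
  and arrows of terms are lifts of arrows of types.
\<close>


section \<open>Categories and functors\<close>

text \<open>Morphisms of natural models commute strictly with substitution, whereas a display
  functor respects chosen pullbacks only up to isomorphism. The type classifier bridges this gap: a
  single type is chosen, over the classifying object, and substitution spreads the choice to all
  contexts. A separate choice for every type would be natural only up to isomorphism. For the
  existence of a universe, the natural model built from the reconstructed internal categories has to
  be compared with the given one. A morphism that is the identity on contexts connects them; its
  comparison maps \<open>tau\<close> form a natural isomorphism between the two comprehensions, and
  the equivalence with displays is transferred along it. Most equations are proved by testing maps
  into a context extension, either against its projection and its generic term or, when it is a
  pullback, against the two projections. Equations between arrows of types are moved there by
  faithfulness of comprehension, and equations between terms by passing to sections.\<close>

lemma mem_hom [simp]: "f \<in> hom C a b \<longleftrightarrow> f \<in> Ar C \<and> Dom C f = a \<and> Cod C f = b"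
  by (auto simp: hom_def)

lemma Dom_ob [simp]: "category C \<Longrightarrow> f \<in> Ar C \<Longrightarrow> Dom C f \<in> Ob C"
  and Cod_ob [simp]: "category C \<Longrightarrow> f \<in> Ar C \<Longrightarrow> Cod C f \<in> Ob C"
  unfolding category_def by blast+

lemma Idn_ar [simp]: "category C \<Longrightarrow> a \<in> Ob C \<Longrightarrow> Idn C a \<in> Ar C"
  and Dom_Idn [simp]: "category C \<Longrightarrow> a \<in> Ob C \<Longrightarrow> Dom C (Idn C a) = a"
  and Cod_Idn [simp]: "category C \<Longrightarrow> a \<in> Ob C \<Longrightarrow> Cod C (Idn C a) = a"
  unfolding category_def hom_def by blast+

lemma
  assumes "category C" "f \<in> Ar C" "g \<in> Ar C" "Cod C f = Dom C g"
  shows Cmp_ar [simp]: "Cmp C g f \<in> Ar C"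
    and Dom_Cmp [simp]: "Dom C (Cmp C g f) = Dom C f"
    and Cod_Cmp [simp]: "Cod C (Cmp C g f) = Cod C g"
  using assms unfolding category_def hom_def by blast+

lemma Cmp_Idn [simp]: "category C \<Longrightarrow> f \<in> Ar C \<Longrightarrow> Dom C f = a \<Longrightarrow> Cmp C f (Idn C a) = f"
  and Idn_Cmp [simp]: "category C \<Longrightarrow> f \<in> Ar C \<Longrightarrow> Cod C f = a \<Longrightarrow> Cmp C (Idn C a) f = f"
  unfolding category_def by blast+

lemma Cmp_assoc [simp]:
  assumes "category C" "f \<in> Ar C" "g \<in> Ar C" "h \<in> Ar C" "Cod C f = Dom C g" "Cod C g = Dom C h"
  shows "Cmp C (Cmp C h g) f = Cmp C h (Cmp C g f)"
  using assms unfolding category_def by metis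

text \<open>A composite equation in the form needed to rewrite inside a right-nested composite.\<close>

lemma Cmp_reassoc:
  assumes "Cmp C g f = k" "category C" "f \<in> Ar C" "g \<in> Ar C" "Cod C f = Dom C g"
    "x \<in> Ar C" "Cod C x = Dom C f"
  shows "Cmp C g (Cmp C f x) = Cmp C k x"
  using assms Cmp_assoc by metis

lemma categoryI:
  assumes "\<And>f. f \<in> Ar C \<Longrightarrow> Dom C f \<in> Ob C" "\<And>f. f \<in> Ar C \<Longrightarrow> Cod C f \<in> Ob C"
    "\<And>a. a \<in> Ob C \<Longrightarrow> Idn C a \<in> Ar C \<and> Dom C (Idn C a) = a \<and> Cod C (Idn C a) = a"
    "\<And>f g. f \<in> Ar C \<Longrightarrow> g \<in> Ar C \<Longrightarrow> Cod C f = Dom C g \<Longrightarrow>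
       Cmp C g f \<in> Ar C \<and> Dom C (Cmp C g f) = Dom C f \<and> Cod C (Cmp C g f) = Cod C g"
    "\<And>f. f \<in> Ar C \<Longrightarrow> Cmp C f (Idn C (Dom C f)) = f"
    "\<And>f. f \<in> Ar C \<Longrightarrow> Cmp C (Idn C (Cod C f)) f = f"
    "\<And>f g h. f \<in> Ar C \<Longrightarrow> g \<in> Ar C \<Longrightarrow> h \<in> Ar C \<Longrightarrow> Cod C f = Dom C g \<Longrightarrow> Cod C g = Dom C h \<Longrightarrow>
       Cmp C h (Cmp C g f) = Cmp C (Cmp C h g) f"
  shows "category C"
  using assms unfolding category_def by simp

lemma functor_Fo [simp]: "is_functor C D F \<Longrightarrow> a \<in> Ob C \<Longrightarrow> Fo F a \<in> Ob D"
  and functor_Fa [simp]: "is_functor C D F \<Longrightarrow> f \<in> Ar C \<Longrightarrow> Fa F f \<in> Ar D"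
  and functor_Dom: "is_functor C D F \<Longrightarrow> f \<in> Ar C \<Longrightarrow> Dom D (Fa F f) = Fo F (Dom C f)"
  and functor_Cod: "is_functor C D F \<Longrightarrow> f \<in> Ar C \<Longrightarrow> Cod D (Fa F f) = Fo F (Cod C f)"
  and functor_Idn: "is_functor C D F \<Longrightarrow> a \<in> Ob C \<Longrightarrow> Fa F (Idn C a) = Idn D (Fo F a)"
  and functor_Cmp: "is_functor C D F \<Longrightarrow> f \<in> Ar C \<Longrightarrow> g \<in> Ar C \<Longrightarrow> Cod C f = Dom C g \<Longrightarrow>
        Fa F (Cmp C g f) = Cmp D (Fa F g) (Fa F f)"
  by (auto simp: is_functor_def)

lemma is_functorI:
  assumes "\<And>a. a \<in> Ob C \<Longrightarrow> Fo F a \<in> Ob D"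
    "\<And>f. f \<in> Ar C \<Longrightarrow> Fa F f \<in> Ar D \<and> Dom D (Fa F f) = Fo F (Dom C f) \<and> Cod D (Fa F f) = Fo F (Cod C f)"
    "\<And>a. a \<in> Ob C \<Longrightarrow> Fa F (Idn C a) = Idn D (Fo F a)"
    "\<And>f g. f \<in> Ar C \<Longrightarrow> g \<in> Ar C \<Longrightarrow> Cod C f = Dom C g \<Longrightarrow> Fa F (Cmp C g f) = Cmp D (Fa F g) (Fa F f)"
  shows "is_functor C D F"
  using assms unfolding is_functor_def by auto

lemma id_fct_simps [simp]:
  "a \<in> Ob C \<Longrightarrow> Fo (id_fct C) a = a" "f \<in> Ar C \<Longrightarrow> Fa (id_fct C) f = f"
  by (auto simp: id_fct_def)

lemma cmp_fct_simps [simp]: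
  "a \<in> Ob C \<Longrightarrow> Fo (cmp_fct C G F) a = Fo G (Fo F a)"
  "f \<in> Ar C \<Longrightarrow> Fa (cmp_fct C G F) f = Fa G (Fa F f)"
  by (auto simp: cmp_fct_def compose_def)

lemma id_fct_functor: "category C \<Longrightarrow> is_functor C C (id_fct C)"
  by (rule is_functorI) auto

lemma cmp_fct_functor:
  "category C \<Longrightarrow> is_functor C D F \<Longrightarrow> is_functor D E G \<Longrightarrow> is_functor C E (cmp_fct C G F)"
  by (rule is_functorI) (auto simp: functor_Dom functor_Cod functor_Idn functor_Cmp)

text \<open>Taking the equation as a premise lets a named law be transported along \<open>F\<close>
  by \<open>OF\<close>.\<close>

lemma functor_triangle:
  assumes "is_functor C D F" "Cmp C g f = k" "f \<in> Ar C" "g \<in> Ar C" "Cod C f = Dom C g"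
  shows "Cmp D (Fa F g) (Fa F f) = Fa F k"
  using assms functor_Cmp by metis

lemma functor_square:
  assumes "is_functor C D F" "Cmp C g f = Cmp C k h" "f \<in> Ar C" "g \<in> Ar C" "Cod C f = Dom C g"
    "h \<in> Ar C" "k \<in> Ar C" "Cod C h = Dom C k"
  shows "Cmp D (Fa F g) (Fa F f) = Cmp D (Fa F k) (Fa F h)"
  using assms functor_Cmp by metis

definition inv_ar :: "('o, 'a, 'z) cat_scheme \<Rightarrow> 'a \<Rightarrow> 'a" where
  "inv_ar C f = (SOME g. g \<in> hom C (Cod C f) (Dom C f) \<and>
     Cmp C g f = Idn C (Dom C f) \<and> Cmp C f g = Idn C (Cod C f))"

lemma
  assumes "is_iso C f"
  shows iso_ar [simp]: "f \<in> Ar C"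
    and inv_ar [simp]: "inv_ar C f \<in> Ar C" "Dom C (inv_ar C f) = Cod C f" "Cod C (inv_ar C f) = Dom C f"
    and inv_left: "Cmp C (inv_ar C f) f = Idn C (Dom C f)"
    and inv_right: "Cmp C f (inv_ar C f) = Idn C (Cod C f)"
proof -
  have "\<exists>g. g \<in> hom C (Cod C f) (Dom C f) \<and>
     Cmp C g f = Idn C (Dom C f) \<and> Cmp C f g = Idn C (Cod C f)"
    using assms unfolding is_iso_def by blast
  from someI_ex[OF this]
  show "inv_ar C f \<in> Ar C" "Dom C (inv_ar C f) = Cod C f" "Cod C (inv_ar C f) = Dom C f"
    "Cmp C (inv_ar C f) f = Idn C (Dom C f)" "Cmp C f (inv_ar C f) = Idn C (Cod C f)"
    by (auto simp: inv_ar_def)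
  show "f \<in> Ar C" using assms by (simp add: is_iso_def)
qed

lemma
  assumes "category C" "is_iso C f" "x \<in> Ar C"
  shows inv_left_Cmp: "Cod C x = Dom C f \<Longrightarrow> Cmp C (inv_ar C f) (Cmp C f x) = x"
    and inv_right_Cmp: "Cod C x = Cod C f \<Longrightarrow> Cmp C f (Cmp C (inv_ar C f) x) = x"
  using assms Cmp_reassoc[OF inv_left, of C f x] Cmp_reassoc[OF inv_right, of C f x] by auto

lemma is_isoI:
  "f \<in> Ar C \<Longrightarrow> g \<in> Ar C \<Longrightarrow> Dom C g = Cod C f \<Longrightarrow> Cod C g = Dom C f \<Longrightarrow>
     Cmp C g f = Idn C (Dom C f) \<Longrightarrow> Cmp C f g = Idn C (Cod C f) \<Longrightarrow> is_iso C f"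
  unfolding is_iso_def by auto

lemma iso_inv [simp]: "is_iso C f \<Longrightarrow> is_iso C (inv_ar C f)"
  by (rule is_isoI[where g = f]) (auto simp: inv_left inv_right)

lemma iso_Idn [simp]: "category C \<Longrightarrow> a \<in> Ob C \<Longrightarrow> is_iso C (Idn C a)"
  by (rule is_isoI[where g = "Idn C a"]) auto

lemma iso_Cmp:
  assumes "category C" "is_iso C f" "is_iso C g" "Cod C f = Dom C g"
  shows "is_iso C (Cmp C g f)"
  by (rule is_isoI[where g = "Cmp C (inv_ar C f) (inv_ar C g)"])
     (use assms in \<open>auto simp: inv_left_Cmp inv_right_Cmp inv_left inv_right\<close>)

lemma functor_iso:
  assumes "category C" "is_functor C D F" "is_iso C f"
  shows "is_iso D (Fa F f)"
proof (rule is_isoI[where g = "Fa F (inv_ar C f)"])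
  show "Cmp D (Fa F (inv_ar C f)) (Fa F f) = Idn D (Dom D (Fa F f))"
    using functor_triangle[OF assms(2) inv_left[OF assms(3)]] assms
    by (simp add: functor_Dom functor_Idn)
  show "Cmp D (Fa F f) (Fa F (inv_ar C f)) = Idn D (Cod D (Fa F f))"
    using functor_triangle[OF assms(2) inv_right[OF assms(3)]] assms
    by (simp add: functor_Cod functor_Idn)
qed (use assms in \<open>auto simp: functor_Dom functor_Cod\<close>)

lemma iso_cancel_left:
  assumes "category C" "is_iso C i" "f \<in> Ar C" "g \<in> Ar C" "Cod C f = Dom C i" "Cod C g = Dom C i"
    "Cmp C i f = Cmp C i g"
  shows "f = g"
  using assms inv_left_Cmp by metis

lemma iso_cancel_right:
  assumes "category C" "is_iso C i" "f \<in> Ar C" "g \<in> Ar C" "Dom C f = Cod C i" "Dom C g = Cod C i"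
    "Cmp C f i = Cmp C g i"
  shows "f = g"
proof -
  have "x = Cmp C (Cmp C x i) (inv_ar C i)" if "x \<in> Ar C" "Dom C x = Cod C i" for x
    using assms(1,2) that by (simp add: inv_right)
  then show ?thesis using assms by metis
qed


section \<open>Equivalences\<close>

definition fully_faithful ::
  "('o, 'a, 'x) cat_scheme \<Rightarrow> ('p, 'b, 'y) cat_scheme \<Rightarrow> ('o, 'a, 'p, 'b, 'z) fct_scheme \<Rightarrow> bool" where
  "fully_faithful C D F \<longleftrightarrow> (\<forall>a\<in>Ob C. \<forall>b\<in>Ob C. \<forall>g\<in>hom D (Fo F a) (Fo F b).
     \<exists>!f. f \<in> hom C a b \<and> Fa F f = g)"

definition essentially_surjective ::
  "('o, 'a, 'x) cat_scheme \<Rightarrow> ('p, 'b, 'y) cat_scheme \<Rightarrow> ('o, 'a, 'p, 'b, 'z) fct_scheme \<Rightarrow> bool" where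
  "essentially_surjective C D F \<longleftrightarrow> (\<forall>b\<in>Ob D. \<exists>a\<in>Ob C. \<exists>i\<in>hom D (Fo F a) b. is_iso D i)"

definition faithful ::
  "('o, 'a, 'x) cat_scheme \<Rightarrow> ('p, 'b, 'y) cat_scheme \<Rightarrow> ('o, 'a, 'p, 'b, 'z) fct_scheme \<Rightarrow> bool" where
  "faithful C D F \<longleftrightarrow> (\<forall>f\<in>Ar C. \<forall>g\<in>Ar C.
     Dom C f = Dom C g \<and> Cod C f = Cod C g \<and> Fa F f = Fa F g \<longrightarrow> f = g)"

lemma fully_faithful_faithful:
  assumes "category C" "is_functor C D F" "fully_faithful C D F"
  shows "faithful C D F"
  unfolding faithful_def
proof (intro ballI impI)
  fix f g assume f: "f \<in> Ar C" and g: "g \<in> Ar C"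
    and e: "Dom C f = Dom C g \<and> Cod C f = Cod C g \<and> Fa F f = Fa F g"
  have "\<exists>!k. k \<in> hom C (Dom C f) (Cod C f) \<and> Fa F k = Fa F f"
    using assms(3)[unfolded fully_faithful_def, rule_format, of "Dom C f" "Cod C f" "Fa F f"] assms(1,2) f
    by (simp add: functor_Dom functor_Cod)
  then show "f = g" using f g e by (metis mem_hom)
qed

lemma fully_faithful_full:
  assumes "fully_faithful C D F" "a \<in> Ob C" "b \<in> Ob C" "g \<in> hom D (Fo F a) (Fo F b)"
  obtains f where "f \<in> Ar C" "Dom C f = a" "Cod C f = b" "Fa F f = g"
  using assms unfolding fully_faithful_def by (metis mem_hom)

lemma fully_faithfulI:
  assumes "faithful C D F"
    "\<And>a b g. a \<in> Ob C \<Longrightarrow> b \<in> Ob C \<Longrightarrow> g \<in> Ar D \<Longrightarrow> Dom D g = Fo F a \<Longrightarrow> Cod D g = Fo F b \<Longrightarrow>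
       \<exists>f. f \<in> Ar C \<and> Dom C f = a \<and> Cod C f = b \<and> Fa F f = g"
  shows "fully_faithful C D F"
  unfolding fully_faithful_def
proof (intro ballI ex_ex1I)
  fix a b g assume "a \<in> Ob C" "b \<in> Ob C" "g \<in> hom D (Fo F a) (Fo F b)"
  then show "\<exists>f. f \<in> hom C a b \<and> Fa F f = g" using assms(2)[of a b g] by auto
next
  fix a b g f k
  assume "f \<in> hom C a b \<and> Fa F f = g" "k \<in> hom C a b \<and> Fa F k = g"
  then show "f = k" using assms(1) unfolding faithful_def by auto
qed

text \<open>Naturality equates \<open>\<eta> \<circ> f\<close> with
  \<open>G (F f) \<circ> \<eta>\<close>, so \<open>F f\<close> determines \<open>f\<close> once the
  isomorphism \<open>\<eta>\<close> at the codomain is cancelled.\<close>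

lemma faithful_of_nat_iso:
  assumes "category C" "is_functor C D F" "is_functor D C G"
    "\<And>a. a \<in> Ob C \<Longrightarrow> is_iso C (\<eta> a) \<and> Dom C (\<eta> a) = a"
    "\<And>f. f \<in> Ar C \<Longrightarrow> Cmp C (\<eta> (Cod C f)) f = Cmp C (Fa G (Fa F f)) (\<eta> (Dom C f))"
  shows "faithful C D F"
  unfolding faithful_def
proof (intro ballI impI)
  fix f g assume f: "f \<in> Ar C" and g: "g \<in> Ar C"
    and e: "Dom C f = Dom C g \<and> Cod C f = Cod C g \<and> Fa F f = Fa F g"
  show "f = g"
    by (rule iso_cancel_left[of C "\<eta> (Cod C f)"])
       (use assms(1-4) assms(5)[OF f] assms(5)[OF g] f g e in auto)
qed

lemma is_equivalenceD:
  fixes C :: "('o, 'a, 'x) cat_scheme" and D :: "('p, 'b, 'y) cat_scheme"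
    and F :: "('o, 'a, 'p, 'b, 'z) fct_scheme"
  assumes C: "category C" and D: "category D" and eq: "is_equivalence C D F"
  shows "is_functor C D F" "fully_faithful C D F" "essentially_surjective C D F"
proof -
  from eq obtain G :: "('p, 'b, 'o, 'a) fct" and \<eta> \<epsilon> where F: "is_functor C D F" and G: "is_functor D C G"
    and n: "is_nat_iso C C (id_fct C) (cmp_fct C G F) \<eta>"
    and e: "is_nat_iso D D (cmp_fct D F G) (id_fct D) \<epsilon>"
    unfolding is_equivalence_def by blast
  show "is_functor C D F" by fact
  have \<eta>: "is_iso C (\<eta> a)" "\<eta> a \<in> Ar C" "Dom C (\<eta> a) = a" "Cod C (\<eta> a) = Fo G (Fo F a)" if "a \<in> Ob C" for a
    using n that by (auto simp: is_nat_iso_def is_nat_def)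
  have \<eta>n: "Cmp C (\<eta> (Cod C f)) f = Cmp C (Fa G (Fa F f)) (\<eta> (Dom C f))" if "f \<in> Ar C" for f
    using n that by (auto simp: is_nat_iso_def is_nat_def)
  have \<epsilon>: "is_iso D (\<epsilon> a)" "\<epsilon> a \<in> Ar D" "Cod D (\<epsilon> a) = a" "Dom D (\<epsilon> a) = Fo F (Fo G a)" if "a \<in> Ob D" for a
    using e that by (auto simp: is_nat_iso_def is_nat_def)
  have \<epsilon>n: "Cmp D (\<epsilon> (Cod D f)) (Fa F (Fa G f)) = Cmp D f (\<epsilon> (Dom D f))" if "f \<in> Ar D" for f
    using e that by (auto simp: is_nat_iso_def is_nat_def)
  have ff: "faithful C D F" by (rule faithful_of_nat_iso[OF C F G]) (use \<eta> \<eta>n in auto)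
  \<comment> \<open>The counit gives this in the same way, with cancellation on the right. Fullness
    of \<open>F\<close> depends on it.\<close>
  have fg: "faithful D C G"
    unfolding faithful_def
  proof (intro ballI impI)
    fix f g assume f: "f \<in> Ar D" and g: "g \<in> Ar D"
      and e: "Dom D f = Dom D g \<and> Cod D f = Cod D g \<and> Fa G f = Fa G g"
    show "f = g"
      by (rule iso_cancel_right[of D "\<epsilon> (Dom D f)"]) (use D f g e \<epsilon> \<epsilon>n[of f] \<epsilon>n[of g] in auto)
  qed
  show "fully_faithful C D F"
  proof (rule fully_faithfulI[OF ff])
    fix a b g assume ab: "a \<in> Ob C" "b \<in> Ob C"
      and g: "g \<in> Ar D" "Dom D g = Fo F a" "Cod D g = Fo F b"
    \<comment> \<open>The only possible preimage of \<open>g\<close>, read off from naturality of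
      \<open>\<eta>\<close>. It satisfies \<open>G (F f) = G g\<close>, and faithfulness of
      \<open>G\<close> then removes \<open>G\<close>.\<close>
    define f where "f = Cmp C (inv_ar C (\<eta> b)) (Cmp C (Fa G g) (\<eta> a))"
    have f: "f \<in> Ar C" "Dom C f = a" "Cod C f = b"
      using ab g C G \<eta> by (auto simp: f_def functor_Dom functor_Cod)
    have "Cmp C (Fa G (Fa F f)) (\<eta> a) = Cmp C (Fa G g) (\<eta> a)"
      using \<eta>n[OF f(1)] f ab g C G \<eta> by (simp add: f_def functor_Dom functor_Cod inv_right_Cmp)
    then have "Fa G (Fa F f) = Fa G g"
      using iso_cancel_right[of C "\<eta> a"] C \<eta> ab g f F G by (simp add: functor_Dom functor_Cod)
    then have "Fa F f = g"
      using fg f F g by (auto simp: faithful_def functor_Dom functor_Cod)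
    then show "\<exists>f. f \<in> Ar C \<and> Dom C f = a \<and> Cod C f = b \<and> Fa F f = g" using f by auto
  qed
  show "essentially_surjective C D F"
    unfolding essentially_surjective_def using \<epsilon> G by (metis functor_Fo mem_hom)
qed

lemma is_equivalenceI:
  fixes C :: "('o, 'a, 'x) cat_scheme" and D :: "('p, 'b, 'y) cat_scheme"
    and F :: "('o, 'a, 'p, 'b, 'z) fct_scheme"
  assumes C: "category C" and D: "category D" and F: "is_functor C D F"
    and ff: "fully_faithful C D F" and es: "essentially_surjective C D F"
  shows "is_equivalence C D F"
proof -
  \<comment> \<open>Object and isomorphism are packed into a pair so that one choice function
    selects both; the isomorphisms \<open>i\<close> become the counit.\<close>
  have "\<forall>b\<in>Ob D. \<exists>p. fst p \<in> Ob C \<and> is_iso D (snd p) \<and> Dom D (snd p) = Fo F (fst p) \<and> Cod D (snd p) = b"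
    using es unfolding essentially_surjective_def by fastforce
  then obtain P where P: "\<And>b. b \<in> Ob D \<Longrightarrow> fst (P b) \<in> Ob C \<and> is_iso D (snd (P b)) \<and>
      Dom D (snd (P b)) = Fo F (fst (P b)) \<and> Cod D (snd (P b)) = b"
    by metis
  define G0 where "G0 b = fst (P b)" for b
  define i where "i b = snd (P b)" for b
  have G0: "G0 b \<in> Ob C" and i: "is_iso D (i b)" "i b \<in> Ar D" "Dom D (i b) = Fo F (G0 b)" "Cod D (i b) = b"
    if "b \<in> Ob D" for b
    using P[OF that] by (auto simp: G0_def i_def)
  have fa: "faithful C D F" by (rule fully_faithful_faithful[OF C F ff])
  define i' where "i' b = inv_ar D (i b)" for b
  have i': "is_iso D (i' b)" "i' b \<in> Ar D" "Dom D (i' b) = b" "Cod D (i' b) = Fo F (G0 b)" if "b \<in> Ob D" for b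
    using i[OF that] by (auto simp: i'_def)
  have li: "Cmp D (i' b) (Cmp D (i b) x) = x" if "b \<in> Ob D" "x \<in> Ar D" "Cod D x = Fo F (G0 b)" for b x
    using i[OF that(1)] that D by (simp add: i'_def inv_left_Cmp)
  have ri: "Cmp D (i b) (Cmp D (i' b) x) = x" if "b \<in> Ob D" "x \<in> Ar D" "Cod D x = b" for b x
    using i[OF that(1)] that D by (simp add: i'_def inv_right_Cmp)
  have "\<exists>f. f \<in> Ar C \<and> Dom C f = G0 (Dom D g) \<and> Cod C f = G0 (Cod D g) \<and>
      Fa F f = Cmp D (i' (Cod D g)) (Cmp D g (i (Dom D g)))" if "g \<in> Ar D" for g
    by (rule fully_faithful_full[OF ff, of "G0 (Dom D g)" "G0 (Cod D g)"
          "Cmp D (i' (Cod D g)) (Cmp D g (i (Dom D g)))"])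
       (use that D G0 i i' in auto)
  then obtain G1 where G1: "\<And>g. g \<in> Ar D \<Longrightarrow> G1 g \<in> Ar C \<and> Dom C (G1 g) = G0 (Dom D g) \<and>
      Cod C (G1 g) = G0 (Cod D g) \<and> Fa F (G1 g) = Cmp D (i' (Cod D g)) (Cmp D g (i (Dom D g)))"
    by metis
  \<comment> \<open>The unit at \<open>a\<close> is the preimage of the inverse of the counit at
    \<open>F a\<close>. One triangle identity thus holds by construction, and the laws of
    \<open>\<eta>\<close> can be checked after applying \<open>F\<close>.\<close>
  have "\<exists>f. f \<in> Ar C \<and> Dom C f = a \<and> Cod C f = G0 (Fo F a) \<and> Fa F f = i' (Fo F a)" if "a \<in> Ob C" for a
    by (rule fully_faithful_full[OF ff, of a "G0 (Fo F a)" "i' (Fo F a)"]) (use that F G0 i' in auto)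
  then obtain \<eta> where \<eta>: "\<And>a. a \<in> Ob C \<Longrightarrow> \<eta> a \<in> Ar C \<and> Dom C (\<eta> a) = a \<and>
      Cod C (\<eta> a) = G0 (Fo F a) \<and> Fa F (\<eta> a) = i' (Fo F a)"
    by metis
  define G :: "('p, 'b, 'o, 'a) fct" where "G = \<lparr>Fo = G0, Fa = G1\<rparr>"
  have G: "is_functor D C G"
  proof (rule is_functorI)
    fix a assume a: "a \<in> Ob D"
    have "Fa F (G1 (Idn D a)) = Fa F (Idn C (G0 a))"
      using G1[of "Idn D a"] a D C F G0 i[OF a] i'[OF a] by (simp add: functor_Idn i'_def inv_left)
    moreover have "G1 (Idn D a) \<in> Ar C \<and> Dom C (G1 (Idn D a)) = G0 a \<and> Cod C (G1 (Idn D a)) = G0 a"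
      using G1[of "Idn D a"] a D by simp
    ultimately show "Fa G (Idn D a) = Idn C (Fo G a)"
      using fa C G0[OF a] by (auto simp: G_def faithful_def)
  next
    fix f g assume fg: "f \<in> Ar D" "g \<in> Ar D" "Cod D f = Dom D g"
    have gf: "Cmp D g f \<in> Ar D" "Dom D (Cmp D g f) = Dom D f" "Cod D (Cmp D g f) = Cod D g"
      using fg D by auto
    have "Fa F (Cmp C (G1 g) (G1 f)) = Cmp D (Fa F (G1 g)) (Fa F (G1 f))"
      using G1[OF fg(1)] G1[OF fg(2)] fg F by (simp add: functor_Cmp)
    also have "\<dots> = Fa F (G1 (Cmp D g f))"
      using G1[OF fg(1)] G1[OF fg(2)] G1[OF gf(1)] fg gf D i i'
      by (simp add: ri)
    finally show "Fa G (Cmp D g f) = Cmp C (Fa G g) (Fa G f)"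
      using fa C G1[OF fg(1)] G1[OF fg(2)] G1[OF gf(1)] fg gf by (simp add: G_def faithful_def)
  qed (use G0 G1 in \<open>auto simp: G_def\<close>)
  have iso_\<eta>: "is_iso C (\<eta> a)" if a: "a \<in> Ob C" for a
  proof -
    have Fa': "Fo F a \<in> Ob D" using a F by simp
    obtain g where g: "g \<in> Ar C" "Dom C g = G0 (Fo F a)" "Cod C g = a" "Fa F g = i (Fo F a)"
      by (rule fully_faithful_full[OF ff, of "G0 (Fo F a)" a "i (Fo F a)"]) (use a F G0 i in auto)
    show ?thesis
    proof (rule is_isoI[where g = g])
      have "Fa F (Cmp C g (\<eta> a)) = Fa F (Idn C a)"
        using a F g \<eta>[OF a] i[OF Fa'] by (simp add: functor_Cmp functor_Idn i'_def inv_right)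
      then show "Cmp C g (\<eta> a) = Idn C (Dom C (\<eta> a))"
        using fa C a g \<eta>[OF a] by (simp add: faithful_def)
      have "Fa F (Cmp C (\<eta> a) g) = Fa F (Idn C (G0 (Fo F a)))"
        using a F g \<eta>[OF a] i[OF Fa'] G0[OF Fa'] by (simp add: functor_Cmp functor_Idn i'_def inv_left)
      then show "Cmp C (\<eta> a) g = Idn C (Cod C (\<eta> a))"
        using fa C a g \<eta>[OF a] G0[OF Fa'] by (simp add: faithful_def)
    qed (use a g \<eta> in auto)
  qed
  have "is_nat_iso C C (id_fct C) (cmp_fct C G F) \<eta>"
    unfolding is_nat_iso_def is_nat_def
  proof (intro conjI ballI)
    fix f assume f: "f \<in> Ar C"
    have Ff: "Fa F f \<in> Ar D" "Dom D (Fa F f) = Fo F (Dom C f)" "Cod D (Fa F f) = Fo F (Cod C f)"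
      using F f by (auto simp: functor_Dom functor_Cod)
    have "Fa F (Cmp C (\<eta> (Cod C f)) f) = Fa F (Cmp C (G1 (Fa F f)) (\<eta> (Dom C f)))"
      using f C D F Ff \<eta>[of "Dom C f"] \<eta>[of "Cod C f"] G1[OF Ff(1)] i i'
      by (simp add: functor_Cmp i'_def inv_right)
    then show "Cmp C (\<eta> (Cod C f)) (Fa (id_fct C) f) = Cmp C (Fa (cmp_fct C G F) f) (\<eta> (Dom C f))"
      using fa f C Ff \<eta>[of "Dom C f"] \<eta>[of "Cod C f"] G1[OF Ff(1)]
      by (simp add: faithful_def G_def)
  qed (use \<eta> iso_\<eta> in \<open>auto simp: G_def\<close>)
  moreover have "is_nat_iso D D (cmp_fct D F G) (id_fct D) i"
    unfolding is_nat_iso_def is_nat_def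
    using i G1 D by (auto simp: G_def ri i' )
  ultimately show ?thesis unfolding is_equivalence_def using F G by blast
qed

text \<open>\<open>G\<close> is isomorphic, through \<open>\<theta>\<close>, to \<open>F\<close>
  precomposed with the isomorphism of categories \<open>\<Phi>\<close>. This is what compares the
  comprehension of a model built from a universe with the comprehension of the given model.\<close>

lemma equivalence_transfer:
  assumes X: "category X" and Y: "category Y" and D: "category D"
    and F: "is_equivalence Y D F" and G: "is_functor X D G"
    and \<Phi>: "is_functor X Y \<Phi>" and \<Psi>: "is_functor Y X \<Psi>"
    and inv: "\<And>a. a \<in> Ob X \<Longrightarrow> Fo \<Psi> (Fo \<Phi> a) = a" "\<And>f. f \<in> Ar X \<Longrightarrow> Fa \<Psi> (Fa \<Phi> f) = f"
      "\<And>b. b \<in> Ob Y \<Longrightarrow> Fo \<Phi> (Fo \<Psi> b) = b" "\<And>g. g \<in> Ar Y \<Longrightarrow> Fa \<Phi> (Fa \<Psi> g) = g"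
    and \<theta>: "\<And>a. a \<in> Ob X \<Longrightarrow> is_iso D (\<theta> a) \<and> Dom D (\<theta> a) = Fo G a \<and> Cod D (\<theta> a) = Fo F (Fo \<Phi> a)"
    and \<theta>n: "\<And>f. f \<in> Ar X \<Longrightarrow> Cmp D (\<theta> (Cod X f)) (Fa G f) = Cmp D (Fa F (Fa \<Phi> f)) (\<theta> (Dom X f))"
  shows "is_equivalence X D G"
proof (rule is_equivalenceI[OF X D G])
  note FD = is_equivalenceD[OF Y D F]
  have \<theta>a: "\<theta> a \<in> Ar D" if "a \<in> Ob X" for a using \<theta>[OF that] by simp
  have fa: "faithful Y D F" using fully_faithful_faithful FD Y by blast
  \<comment> \<open>Naturality of \<open>\<theta>\<close> solved for \<open>F (\<Phi> f)\<close>; it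
    reduces faithfulness of \<open>G\<close> to that of \<open>F\<close>.\<close>
  have key: "Fa F (Fa \<Phi> f) = Cmp D (\<theta> (Cod X f)) (Cmp D (Fa G f) (inv_ar D (\<theta> (Dom X f))))" if f: "f \<in> Ar X" for f
  proof (rule iso_cancel_right[of D "\<theta> (Dom X f)"])
    show "Cmp D (Fa F (Fa \<Phi> f)) (\<theta> (Dom X f)) =
      Cmp D (Cmp D (\<theta> (Cod X f)) (Cmp D (Fa G f) (inv_ar D (\<theta> (Dom X f))))) (\<theta> (Dom X f))"
      using f \<theta>n[OF f] \<theta>[of "Dom X f"] \<theta>[of "Cod X f"] \<theta>a X D G by (simp add: functor_Dom functor_Cod inv_left)
  qed (use f \<theta>[of "Dom X f"] \<theta>[of "Cod X f"] \<theta>a X D G \<Phi> FD in \<open>auto simp: functor_Dom functor_Cod\<close>)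
  have faG: "faithful X D G"
    unfolding faithful_def
  proof (intro ballI impI)
    fix f g assume f: "f \<in> Ar X" and g: "g \<in> Ar X"
      and e: "Dom X f = Dom X g \<and> Cod X f = Cod X g \<and> Fa G f = Fa G g"
    then have "Fa F (Fa \<Phi> f) = Fa F (Fa \<Phi> g)" by (simp add: key)
    then have "Fa \<Phi> f = Fa \<Phi> g" using fa \<Phi> e f g by (auto simp: faithful_def functor_Dom functor_Cod)
    then show "f = g" using inv f g by metis
  qed
  show "fully_faithful X D G"
  proof (rule fully_faithfulI[OF faG])
    fix a b g assume ab: "a \<in> Ob X" "b \<in> Ob X" and g: "g \<in> Ar D" "Dom D g = Fo G a" "Cod D g = Fo G b"
    obtain h where h: "h \<in> Ar Y" "Dom Y h = Fo \<Phi> a" "Cod Y h = Fo \<Phi> b"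
      "Fa F h = Cmp D (\<theta> b) (Cmp D g (inv_ar D (\<theta> a)))"
      by (rule fully_faithful_full[OF FD(2), of "Fo \<Phi> a" "Fo \<Phi> b" "Cmp D (\<theta> b) (Cmp D g (inv_ar D (\<theta> a)))"])
         (use ab g \<theta>[of a] \<theta>[of b] \<Phi> D \<theta>a in auto)
    define f where "f = Fa \<Psi> h"
    have f: "f \<in> Ar X" "Dom X f = a" "Cod X f = b" "Fa \<Phi> f = h"
      using h \<Psi> inv ab by (auto simp: f_def functor_Dom functor_Cod)
    have "Cmp D (\<theta> b) (Fa G f) = Cmp D (\<theta> b) g"
      using \<theta>n[OF f(1)] f h \<theta>[of a] \<theta>[of b] \<theta>a ab D g by (simp add: inv_left)
    then have "Fa G f = g"
      using iso_cancel_left[of D "\<theta> b"] \<theta>[of b] \<theta>a ab D g G f by (simp add: functor_Dom functor_Cod)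
    then show "\<exists>f. f \<in> Ar X \<and> Dom X f = a \<and> Cod X f = b \<and> Fa G f = g" using f by blast
  qed
  show "essentially_surjective X D G"
    unfolding essentially_surjective_def
  proof
    fix b assume "b \<in> Ob D"
    then obtain y i where y: "y \<in> Ob Y" and i: "i \<in> hom D (Fo F y) b" "is_iso D i"
      using FD(3) unfolding essentially_surjective_def by blast
    let ?a = "Fo \<Psi> y"
    have a: "?a \<in> Ob X" "Fo \<Phi> ?a = y" using y \<Psi> inv by auto
    have "is_iso D (Cmp D i (\<theta> ?a))" using \<theta>[OF a(1)] a i D by (intro iso_Cmp) auto
    moreover have "Cmp D i (\<theta> ?a) \<in> hom D (Fo G ?a) b" using \<theta>[OF a(1)] \<theta>a[OF a(1)] a i D by auto
    ultimately show "\<exists>a\<in>Ob X. \<exists>i\<in>hom D (Fo G a) b. is_iso D i" using a by blast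
  qed
qed


section \<open>Pullbacks and fibres of displays\<close>

lemma
  assumes "is_pullback C f g p q"
  shows pullback_ar: "f \<in> Ar C" "g \<in> Ar C" "p \<in> Ar C" "q \<in> Ar C"
    and pullback_bd: "Cod C f = Cod C g" "Dom C p = Dom C q" "Cod C p = Dom C f" "Cod C q = Dom C g"
    and pullback_comm: "Cmp C f p = Cmp C g q"
  using assms unfolding is_pullback_def by blast+

lemma pullback_ex1:
  assumes "is_pullback C f g p q" "a \<in> Ar C" "b \<in> Ar C" "Dom C a = Dom C b"
    "Cod C a = Dom C f" "Cod C b = Dom C g" "Cmp C f a = Cmp C g b"
  shows "\<exists>!h. h \<in> hom C (Dom C a) (Dom C p) \<and> Cmp C p h = a \<and> Cmp C q h = b"
proof -
  have "a \<in> hom C (Dom C a) (Dom C f)" "b \<in> hom C (Dom C a) (Dom C g)" using assms by auto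
  then show ?thesis using assms(1,7) unfolding is_pullback_def by blast
qed

lemma pullback_ex:
  assumes "is_pullback C f g p q" "a \<in> Ar C" "b \<in> Ar C" "Dom C a = Dom C b"
    "Cod C a = Dom C f" "Cod C b = Dom C g" "Cmp C f a = Cmp C g b"
  obtains h where "h \<in> Ar C" "Dom C h = Dom C a" "Cod C h = Dom C p" "Cmp C p h = a" "Cmp C q h = b"
  using pullback_ex1[OF assms] by auto

lemma pullback_eq:
  assumes "category C" "is_pullback C f g p q" "h \<in> Ar C" "k \<in> Ar C" "Cod C h = Dom C p" "Cod C k = Dom C p"
    "Dom C h = Dom C k" "Cmp C p h = Cmp C p k" "Cmp C q h = Cmp C q k"
  shows "h = k"
proof -
  note pb = pullback_ar[OF assms(2)] pullback_bd[OF assms(2)]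
  have "Cmp C f (Cmp C p h) = Cmp C g (Cmp C q h)"
    using Cmp_reassoc[OF pullback_comm[OF assms(2)], of h] pb assms by simp
  then have "\<exists>!x. x \<in> hom C (Dom C (Cmp C p h)) (Dom C p) \<and> Cmp C p x = Cmp C p h \<and> Cmp C q x = Cmp C q h"
    using pb assms by (intro pullback_ex1[OF assms(2)]) auto
  moreover have "Dom C (Cmp C p h) = Dom C h" using pb assms by simp
  ultimately show ?thesis using assms by (metis mem_hom)
qed

lemma is_pullbackI:
  assumes "f \<in> Ar C" "g \<in> Ar C" "p \<in> Ar C" "q \<in> Ar C" "Cod C f = Cod C g" "Dom C p = Dom C q"
    "Cod C p = Dom C f" "Cod C q = Dom C g" "Cmp C f p = Cmp C g q"
    "\<And>a b. a \<in> Ar C \<Longrightarrow> b \<in> Ar C \<Longrightarrow> Dom C a = Dom C b \<Longrightarrow> Cod C a = Dom C f \<Longrightarrow> Cod C b = Dom C g \<Longrightarrow>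
      Cmp C f a = Cmp C g b \<Longrightarrow>
      \<exists>h. h \<in> Ar C \<and> Dom C h = Dom C a \<and> Cod C h = Dom C p \<and> Cmp C p h = a \<and> Cmp C q h = b"
    "\<And>h k. h \<in> Ar C \<Longrightarrow> k \<in> Ar C \<Longrightarrow> Dom C h = Dom C k \<Longrightarrow> Cod C h = Dom C p \<Longrightarrow> Cod C k = Dom C p \<Longrightarrow>
      Cmp C p h = Cmp C p k \<Longrightarrow> Cmp C q h = Cmp C q k \<Longrightarrow> h = k"
  shows "is_pullback C f g p q"
  unfolding is_pullback_def
proof (intro conjI allI ballI impI ex_ex1I)
  fix z a b assume "a \<in> hom C z (Dom C f)" "b \<in> hom C z (Dom C g)" "Cmp C f a = Cmp C g b"
  then show "\<exists>h. h \<in> hom C z (Dom C p) \<and> Cmp C p h = a \<and> Cmp C q h = b"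
    using assms(10)[of a b] by auto
next
  fix z a b h k
  assume "h \<in> hom C z (Dom C p) \<and> Cmp C p h = a \<and> Cmp C q h = b"
    "k \<in> hom C z (Dom C p) \<and> Cmp C p k = a \<and> Cmp C q k = b"
  then show "h = k" using assms(11)[of h k] by auto
qed (use assms in auto)

text \<open>The universal property of the second square gives an arrow in the opposite direction,
  and both composites agree with identities on the projections.\<close>

lemma pullback_comparison_iso:
  assumes C: "category C" and pb: "is_pullback C f g p q" "is_pullback C f g p' q'"
    and h: "h \<in> Ar C" "Dom C h = Dom C p'" "Cod C h = Dom C p" "Cmp C p h = p'" "Cmp C q h = q'"
  shows "is_iso C h"
proof -
  note p = pullback_ar[OF pb(1)] pullback_bd[OF pb(1)] pullback_comm[OF pb(1)]
  note p' = pullback_ar[OF pb(2)] pullback_bd[OF pb(2)]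
  obtain k where k: "k \<in> Ar C" "Dom C k = Dom C p" "Cod C k = Dom C p'" "Cmp C p' k = p" "Cmp C q' k = q"
    by (rule pullback_ex[OF pb(2), of p q]) (use p in auto)
  show ?thesis
  proof (rule is_isoI[where g = k])
    show "Cmp C k h = Idn C (Dom C h)"
      by (rule pullback_eq[OF C pb(2)])
         (use C p p' h k in \<open>auto simp: Cmp_reassoc[OF k(4)] Cmp_reassoc[OF k(5)]\<close>)
    show "Cmp C h k = Idn C (Cod C h)"
      by (rule pullback_eq[OF C pb(1)])
         (use C p p' h k in \<open>auto simp: Cmp_reassoc[OF h(4)] Cmp_reassoc[OF h(5)]\<close>)
  qed (use h k in auto)
qed

lemma display_category_category [simp]: "display_category C \<Longrightarrow> category C"
  by (simp add: display_category_def)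

lemma Disp_ar [simp]: "display_category C \<Longrightarrow> p \<in> Disp C \<Longrightarrow> p \<in> Ar C"
  by (auto simp: display_category_def)

lemma display_pullback:
  assumes "display_category C" "p \<in> Disp C" "f \<in> Ar C" "Cod C f = Cod C p"
  shows "Pbk C f p \<in> Disp C" "is_pullback C f p (Pbk C f p) (Pbt C f p)"
  using assms unfolding display_category_def by auto

lemma disp_fib_simps [simp]:
  "p \<in> Ob (disp_fib C A) \<longleftrightarrow> p \<in> Ar C \<and> p \<in> Disp C \<and> Cod C p = A"
  "(p, h, q) \<in> Ar (disp_fib C A) \<longleftrightarrow> p \<in> Ar C \<and> q \<in> Ar C \<and> p \<in> Disp C \<and> q \<in> Disp C \<and> Cod C p = A \<and> Cod C q = A \<and>
     h \<in> hom C (Dom C p) (Dom C q) \<and> Cmp C q h = p"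
  "Dom (disp_fib C A) (p, h, q) = p" "Cod (disp_fib C A) (p, h, q) = q"
  "Idn (disp_fib C A) p = (p, Idn C (Dom C p), p)"
  "Cmp (disp_fib C A) (q', k, r) (p, h, q) = (p, Cmp C k h, r)"
  by (auto simp: disp_fib_def full_sub_def slice_def)

lemma disp_fib_category [simp]:
  assumes C [simp]: "display_category C"
  shows "category (disp_fib C A)"
proof (rule categoryI)
  fix f g assume f: "f \<in> Ar (disp_fib C A)" and g: "g \<in> Ar (disp_fib C A)"
    and e: "Cod (disp_fib C A) f = Dom (disp_fib C A) g"
  obtain p h q where f': "f = (p, h, q)" by (cases f)
  obtain q' k r where g': "g = (q', k, r)" by (cases g)
  show "Cmp (disp_fib C A) g f \<in> Ar (disp_fib C A) \<and>
      Dom (disp_fib C A) (Cmp (disp_fib C A) g f) = Dom (disp_fib C A) f \<and>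
      Cod (disp_fib C A) (Cmp (disp_fib C A) g f) = Cod (disp_fib C A) g"
    using f g e Cmp_reassoc[of C r k q h] unfolding f' g' by simp
next
  fix f g h assume "f \<in> Ar (disp_fib C A)" "g \<in> Ar (disp_fib C A)" "h \<in> Ar (disp_fib C A)"
    "Cod (disp_fib C A) f = Dom (disp_fib C A) g" "Cod (disp_fib C A) g = Dom (disp_fib C A) h"
  then show "Cmp (disp_fib C A) h (Cmp (disp_fib C A) g f) = Cmp (disp_fib C A) (Cmp (disp_fib C A) h g) f"
    by (cases f; cases g; cases h) simp
next
  fix a assume "a \<in> Ob (disp_fib C A)"
  then show "Idn (disp_fib C A) a \<in> Ar (disp_fib C A) \<and>
      Dom (disp_fib C A) (Idn (disp_fib C A) a) = a \<and> Cod (disp_fib C A) (Idn (disp_fib C A) a) = a"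
    by simp
next
  fix f assume "f \<in> Ar (disp_fib C A)"
  then show "Dom (disp_fib C A) f \<in> Ob (disp_fib C A)" "Cod (disp_fib C A) f \<in> Ob (disp_fib C A)"
    "Cmp (disp_fib C A) f (Idn (disp_fib C A) (Dom (disp_fib C A) f)) = f"
    "Cmp (disp_fib C A) (Idn (disp_fib C A) (Cod (disp_fib C A) f)) f = f"
    by (cases f; simp)+
qed

text \<open>The inverse of \<open>h\<close> lies over the base automatically: cancelling
  \<open>h\<close> in \<open>q \<circ> h = p\<close> shows that \<open>p\<close> after the inverse
  is \<open>q\<close>.\<close>

lemma disp_fib_iso:
  assumes "display_category C"
  shows "is_iso (disp_fib C A) (p, h, q) \<longleftrightarrow> (p, h, q) \<in> Ar (disp_fib C A) \<and> is_iso C h"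
proof
  assume i: "is_iso (disp_fib C A) (p, h, q)"
  then obtain k where "k \<in> Ar (disp_fib C A)" "Dom (disp_fib C A) k = q" "Cod (disp_fib C A) k = p"
    "Cmp (disp_fib C A) k (p, h, q) = (p, Idn C (Dom C p), p)"
    "Cmp (disp_fib C A) (p, h, q) k = (q, Idn C (Dom C q), q)"
    unfolding is_iso_def by auto
  moreover obtain l where "k = (q, l, p)" using calculation by (cases k) auto
  ultimately show "(p, h, q) \<in> Ar (disp_fib C A) \<and> is_iso C h"
    using iso_ar[OF i] by (auto intro!: is_isoI[where g = l])
next
  assume a: "(p, h, q) \<in> Ar (disp_fib C A) \<and> is_iso C h"
  show "is_iso (disp_fib C A) (p, h, q)"
  proof (rule is_isoI[where g = "(q, inv_ar C h, p)"])
    have "Cmp C p (inv_ar C h) = q"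
      using a assms Cmp_assoc[of C "inv_ar C h" h q] by (auto simp: inv_right)
    then show "(q, inv_ar C h, p) \<in> Ar (disp_fib C A)" using a by auto
  qed (use a in \<open>auto simp: inv_left inv_right\<close>)
qed


section \<open>Pre-natural models\<close>

text \<open>Size plays no role below, so the parameter is eliminated.\<close>

definition prenat :: "'u natmod \<Rightarrow> bool" where
  "prenat N \<longleftrightarrow> pre_natural_model (\<lambda>_. True) N"

lemma pre_natural_model_prenat: "pre_natural_model small N \<Longrightarrow> prenat N"
  by (auto simp: prenat_def pre_natural_model_def small_cat_def)

text \<open>
  \<open>tsb\<close> and \<open>tsa\<close> substitute in types and in arrows of types, \<open>msb\<close> and \<open>msa\<close> in terms and in arrows
  of terms.
\<close>

abbreviation ty where "ty N \<Gamma> \<equiv> Fib (Tp N) \<Gamma>"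
abbreviation tm where "tm N \<Gamma> \<equiv> Fib (Tm N) \<Gamma>"
abbreviation tsb where "tsb N u A \<equiv> Fo (Re (Tp N) u) A"
abbreviation tsa where "tsa N u f \<equiv> Fa (Re (Tp N) u) f"
abbreviation msb where "msb N u t \<equiv> Fo (Re (Tm N) u) t"
abbreviation msa where "msa N u g \<equiv> Fa (Re (Tm N) u) g"
abbreviation tyof where "tyof N \<Gamma> t \<equiv> Fo (Pr N \<Gamma>) t"
abbreviation tyofa where "tyofa N \<Gamma> g \<equiv> Fa (Pr N \<Gamma>) g"
abbreviation ext where "ext N \<Gamma> A \<equiv> Dom N (Prj N \<Gamma> A)"

lemma strict_indexed_categoryD:
  assumes "strict_indexed_category C X"
  shows "\<Gamma> \<in> Ob C \<Longrightarrow> category (Fib X \<Gamma>)"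
    "u \<in> Ar C \<Longrightarrow> is_functor (Fib X (Cod C u)) (Fib X (Dom C u)) (Re X u)"
    "\<Gamma> \<in> Ob C \<Longrightarrow> A \<in> Ob (Fib X \<Gamma>) \<Longrightarrow> Fo (Re X (Idn C \<Gamma>)) A = A"
    "\<Gamma> \<in> Ob C \<Longrightarrow> f \<in> Ar (Fib X \<Gamma>) \<Longrightarrow> Fa (Re X (Idn C \<Gamma>)) f = f"
    "u \<in> Ar C \<Longrightarrow> v \<in> Ar C \<Longrightarrow> Cod C u = Dom C v \<Longrightarrow> A \<in> Ob (Fib X (Cod C v)) \<Longrightarrow>
       Fo (Re X (Cmp C v u)) A = Fo (Re X u) (Fo (Re X v) A)"
    "u \<in> Ar C \<Longrightarrow> v \<in> Ar C \<Longrightarrow> Cod C u = Dom C v \<Longrightarrow> f \<in> Ar (Fib X (Cod C v)) \<Longrightarrow>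
       Fa (Re X (Cmp C v u)) f = Fa (Re X u) (Fa (Re X v) f)"
  using assms unfolding strict_indexed_category_def by blast+

lemma prenatD:
  assumes "prenat N"
  shows prenat_display [simp]: "display_category N"
    and prenat_Tp: "strict_indexed_category N (Tp N)"
    and prenat_Tm: "strict_indexed_category N (Tm N)"
    and prenat_Pr: "strict_indexed_functor N (id_fct N) (Tm N) (Tp N) (Pr N)"
    and prenat_opfib: "\<Gamma> \<in> Ob N \<Longrightarrow> is_discrete_opfibration (tm N \<Gamma>) (ty N \<Gamma>) (Pr N \<Gamma>)"
    and prenat_represents: "\<Gamma> \<in> Ob N \<Longrightarrow> A \<in> Ob (ty N \<Gamma>) \<Longrightarrow>
      Prj N \<Gamma> A \<in> Disp N \<and> represents N \<Gamma> A (Prj N \<Gamma> A) (Var N \<Gamma> A)"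
  using assms unfolding prenat_def pre_natural_model_def by blast+

lemma
  assumes "prenat N"
  shows prenat_category [simp]: "category N"
    and prenat_ty [simp]: "\<Gamma> \<in> Ob N \<Longrightarrow> category (ty N \<Gamma>)"
    and prenat_tm [simp]: "\<Gamma> \<in> Ob N \<Longrightarrow> category (tm N \<Gamma>)"
  using assms strict_indexed_categoryD(1)[OF prenat_Tp] strict_indexed_categoryD(1)[OF prenat_Tm] by auto

lemma
  assumes "prenat N" "u \<in> Ar N" "Dom N u = \<Delta>"
  shows tsb_ob [simp]: "A \<in> Ob (ty N (Cod N u)) \<Longrightarrow> tsb N u A \<in> Ob (ty N \<Delta>)"
    and tsa_ar [simp]: "f \<in> Ar (ty N (Cod N u)) \<Longrightarrow> tsa N u f \<in> Ar (ty N \<Delta>)"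
    and Dom_tsa [simp]: "f \<in> Ar (ty N (Cod N u)) \<Longrightarrow> Dom (ty N \<Delta>) (tsa N u f) = tsb N u (Dom (ty N (Cod N u)) f)"
    and Cod_tsa [simp]: "f \<in> Ar (ty N (Cod N u)) \<Longrightarrow> Cod (ty N \<Delta>) (tsa N u f) = tsb N u (Cod (ty N (Cod N u)) f)"
    and tsa_Idn [simp]: "A \<in> Ob (ty N (Cod N u)) \<Longrightarrow> Cod N u = \<Gamma> \<Longrightarrow> tsa N u (Idn (ty N \<Gamma>) A) = Idn (ty N \<Delta>) (tsb N u A)"
    and tsa_Cmp [simp]: "f \<in> Ar (ty N (Cod N u)) \<Longrightarrow> g \<in> Ar (ty N (Cod N u)) \<Longrightarrow>
      Cod (ty N (Cod N u)) f = Dom (ty N (Cod N u)) g \<Longrightarrow> Cod N u = \<Gamma> \<Longrightarrow>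
      tsa N u (Cmp (ty N \<Gamma>) g f) = Cmp (ty N \<Delta>) (tsa N u g) (tsa N u f)"
    and msb_ob [simp]: "t \<in> Ob (tm N (Cod N u)) \<Longrightarrow> msb N u t \<in> Ob (tm N \<Delta>)"
    and msa_ar [simp]: "g \<in> Ar (tm N (Cod N u)) \<Longrightarrow> msa N u g \<in> Ar (tm N \<Delta>)"
    and Dom_msa [simp]: "g \<in> Ar (tm N (Cod N u)) \<Longrightarrow> Dom (tm N \<Delta>) (msa N u g) = msb N u (Dom (tm N (Cod N u)) g)"
    and Cod_msa [simp]: "g \<in> Ar (tm N (Cod N u)) \<Longrightarrow> Cod (tm N \<Delta>) (msa N u g) = msb N u (Cod (tm N (Cod N u)) g)"
  using strict_indexed_categoryD(2)[OF prenat_Tp[OF assms(1)] assms(2)]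
    strict_indexed_categoryD(2)[OF prenat_Tm[OF assms(1)] assms(2)] assms(3)
  by (auto simp: functor_Dom functor_Cod functor_Idn functor_Cmp)

lemma
  assumes "prenat N" "\<Gamma> \<in> Ob N"
  shows tsb_Idn [simp]: "A \<in> Ob (ty N \<Gamma>) \<Longrightarrow> tsb N (Idn N \<Gamma>) A = A"
    and tsa_Idn_left [simp]: "f \<in> Ar (ty N \<Gamma>) \<Longrightarrow> tsa N (Idn N \<Gamma>) f = f"
    and msb_Idn [simp]: "t \<in> Ob (tm N \<Gamma>) \<Longrightarrow> msb N (Idn N \<Gamma>) t = t"
  using assms strict_indexed_categoryD(3,4)[OF prenat_Tp[OF assms(1)] assms(2)]
    strict_indexed_categoryD(3)[OF prenat_Tm[OF assms(1)] assms(2)] by auto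

lemma
  assumes "prenat N" "u \<in> Ar N" "v \<in> Ar N" "Cod N u = Dom N v"
  shows tsb_Cmp: "A \<in> Ob (ty N (Cod N v)) \<Longrightarrow> tsb N (Cmp N v u) A = tsb N u (tsb N v A)"
    and tsa_Cmp_left: "f \<in> Ar (ty N (Cod N v)) \<Longrightarrow> tsa N (Cmp N v u) f = tsa N u (tsa N v f)"
    and msb_Cmp: "t \<in> Ob (tm N (Cod N v)) \<Longrightarrow> msb N (Cmp N v u) t = msb N u (msb N v t)"
  using strict_indexed_categoryD(5,6)[OF prenat_Tp[OF assms(1)] assms(2-4)]
    strict_indexed_categoryD(5)[OF prenat_Tm[OF assms(1)] assms(2-4)] by auto

lemma Pr_functor: "prenat N \<Longrightarrow> \<Gamma> \<in> Ob N \<Longrightarrow> is_functor (tm N \<Gamma>) (ty N \<Gamma>) (Pr N \<Gamma>)"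
  using prenat_opfib[of N \<Gamma>] by (simp add: is_discrete_opfibration_def)

lemma
  assumes "prenat N" "\<Gamma> \<in> Ob N"
  shows tyof_ob [simp]: "t \<in> Ob (tm N \<Gamma>) \<Longrightarrow> tyof N \<Gamma> t \<in> Ob (ty N \<Gamma>)"
    and tyofa_ar [simp]: "g \<in> Ar (tm N \<Gamma>) \<Longrightarrow> tyofa N \<Gamma> g \<in> Ar (ty N \<Gamma>)"
    and Dom_tyofa [simp]: "g \<in> Ar (tm N \<Gamma>) \<Longrightarrow> Dom (ty N \<Gamma>) (tyofa N \<Gamma> g) = tyof N \<Gamma> (Dom (tm N \<Gamma>) g)"
    and Cod_tyofa [simp]: "g \<in> Ar (tm N \<Gamma>) \<Longrightarrow> Cod (ty N \<Gamma>) (tyofa N \<Gamma> g) = tyof N \<Gamma> (Cod (tm N \<Gamma>) g)"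
  using Pr_functor[OF assms] by (auto simp: functor_Dom functor_Cod)

lemma
  assumes "prenat N" "u \<in> Ar N" "Dom N u = \<Delta>"
  shows tyof_msb [simp]: "t \<in> Ob (tm N (Cod N u)) \<Longrightarrow> tyof N \<Delta> (msb N u t) = tsb N u (tyof N (Cod N u) t)"
    and tyofa_msa [simp]: "g \<in> Ar (tm N (Cod N u)) \<Longrightarrow> tyofa N \<Delta> (msa N u g) = tsa N u (tyofa N (Cod N u) g)"
  using prenat_Pr[OF assms(1)] assms unfolding strict_indexed_functor_def by auto

subsection \<open>Transport of terms along arrows of types\<close>

definition lift :: "'u natmod \<Rightarrow> 'u \<Rightarrow> 'u \<Rightarrow> 'u \<Rightarrow> 'u" where
  "lift N \<Gamma> t f = (THE g. g \<in> Ar (tm N \<Gamma>) \<and> Dom (tm N \<Gamma>) g = t \<and> tyofa N \<Gamma> g = f)"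

definition push :: "'u natmod \<Rightarrow> 'u \<Rightarrow> 'u \<Rightarrow> 'u \<Rightarrow> 'u" where
  "push N \<Gamma> t f = Cod (tm N \<Gamma>) (lift N \<Gamma> t f)"

lemma
  assumes N: "prenat N" "\<Gamma> \<in> Ob N" and t: "t \<in> Ob (tm N \<Gamma>)"
    and f: "f \<in> Ar (ty N \<Gamma>)" "Dom (ty N \<Gamma>) f = tyof N \<Gamma> t"
  shows lift_ar [simp]: "lift N \<Gamma> t f \<in> Ar (tm N \<Gamma>)"
    and Dom_lift [simp]: "Dom (tm N \<Gamma>) (lift N \<Gamma> t f) = t"
    and tyofa_lift [simp]: "tyofa N \<Gamma> (lift N \<Gamma> t f) = f"
    and push_ob [simp]: "push N \<Gamma> t f \<in> Ob (tm N \<Gamma>)"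
    and tyof_push [simp]: "tyof N \<Gamma> (push N \<Gamma> t f) = Cod (ty N \<Gamma>) f"
proof -
  have ex: "\<exists>!g. g \<in> Ar (tm N \<Gamma>) \<and> Dom (tm N \<Gamma>) g = t \<and> tyofa N \<Gamma> g = f"
    using prenat_opfib[OF N] t f unfolding is_discrete_opfibration_def by blast
  note l = theI'[OF ex, folded lift_def]
  then show "lift N \<Gamma> t f \<in> Ar (tm N \<Gamma>)" "Dom (tm N \<Gamma>) (lift N \<Gamma> t f) = t" "tyofa N \<Gamma> (lift N \<Gamma> t f) = f" by auto
  then show "push N \<Gamma> t f \<in> Ob (tm N \<Gamma>)" "tyof N \<Gamma> (push N \<Gamma> t f) = Cod (ty N \<Gamma>) f"
    using N Cod_tyofa[OF N, of "lift N \<Gamma> t f"] unfolding push_def by auto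
qed

lemma lift_unique:
  assumes N: "prenat N" "\<Gamma> \<in> Ob N" and g: "g \<in> Ar (tm N \<Gamma>)"
  shows "lift N \<Gamma> (Dom (tm N \<Gamma>) g) (tyofa N \<Gamma> g) = g"
proof -
  have "\<exists>!h. h \<in> Ar (tm N \<Gamma>) \<and> Dom (tm N \<Gamma>) h = Dom (tm N \<Gamma>) g \<and> tyofa N \<Gamma> h = tyofa N \<Gamma> g"
    using prenat_opfib[OF N] g N unfolding is_discrete_opfibration_def by auto
  then show ?thesis unfolding lift_def by (rule the1_equality) (use g in auto)
qed

text \<open>In a discrete opfibration both sides are the lift of the same arrow from the same
  source. Equations between arrows of terms are in this way reduced to equations between arrows of
  types.\<close>

lemma arrow_of_terms_eq:
  assumes "prenat N" "\<Gamma> \<in> Ob N" "g \<in> Ar (tm N \<Gamma>)" "h \<in> Ar (tm N \<Gamma>)"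
    "Dom (tm N \<Gamma>) g = Dom (tm N \<Gamma>) h" "tyofa N \<Gamma> g = tyofa N \<Gamma> h"
  shows "g = h"
  using assms lift_unique by metis

lemma push_tyofa:
  "prenat N \<Longrightarrow> \<Gamma> \<in> Ob N \<Longrightarrow> g \<in> Ar (tm N \<Gamma>) \<Longrightarrow> push N \<Gamma> (Dom (tm N \<Gamma>) g) (tyofa N \<Gamma> g) = Cod (tm N \<Gamma>) g"
  by (simp add: push_def lift_unique)

lemma push_Idn [simp]:
  assumes "prenat N" "\<Gamma> \<in> Ob N" "t \<in> Ob (tm N \<Gamma>)" "tyof N \<Gamma> t = A"
  shows "push N \<Gamma> t (Idn (ty N \<Gamma>) A) = t"
proof -
  have "tyofa N \<Gamma> (Idn (tm N \<Gamma>) t) = Idn (ty N \<Gamma>) A"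
    using functor_Idn[OF Pr_functor[OF assms(1,2)] assms(3)] assms(4) by simp
  then show ?thesis using push_tyofa[OF assms(1,2), of "Idn (tm N \<Gamma>) t"] assms by simp
qed

text \<open>The composite of the two lifts is a lift of the composite.\<close>

lemma push_Cmp:
  assumes "prenat N" "\<Gamma> \<in> Ob N" "t \<in> Ob (tm N \<Gamma>)" "f \<in> Ar (ty N \<Gamma>)" "Dom (ty N \<Gamma>) f = tyof N \<Gamma> t"
    "g \<in> Ar (ty N \<Gamma>)" "Dom (ty N \<Gamma>) g = Cod (ty N \<Gamma>) f"
  shows "push N \<Gamma> t (Cmp (ty N \<Gamma>) g f) = push N \<Gamma> (push N \<Gamma> t f) g"
proof -
  let ?h = "Cmp (tm N \<Gamma>) (lift N \<Gamma> (push N \<Gamma> t f) g) (lift N \<Gamma> t f)"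
  have c: "Cod (tm N \<Gamma>) (lift N \<Gamma> t f) = Dom (tm N \<Gamma>) (lift N \<Gamma> (push N \<Gamma> t f) g)"
    using assms by (simp add: push_def[symmetric])
  have "tyofa N \<Gamma> ?h = Cmp (ty N \<Gamma>) g f"
    using functor_Cmp[OF Pr_functor[OF assms(1,2)] _ _ c] assms by simp
  moreover have "Dom (tm N \<Gamma>) ?h = t" "Cod (tm N \<Gamma>) ?h = push N \<Gamma> (push N \<Gamma> t f) g"
    using Dom_Cmp[OF _ _ _ c] Cod_Cmp[OF _ _ _ c] assms by (auto simp: push_def[of N \<Gamma> "push N \<Gamma> t f"])
  moreover have "?h \<in> Ar (tm N \<Gamma>)" using Cmp_ar[OF _ _ _ c] assms by simp
  ultimately show ?thesis using push_tyofa[OF assms(1,2), of ?h] by simp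
qed

text \<open>Substitution commutes with \<open>Pr\<close>, so it carries a lift to a lift.\<close>

lemma msb_push:
  assumes "prenat N" "u \<in> Ar N" "t \<in> Ob (tm N (Cod N u))" "f \<in> Ar (ty N (Cod N u))"
    "Dom (ty N (Cod N u)) f = tyof N (Cod N u) t"
  shows "msb N u (push N (Cod N u) t f) = push N (Dom N u) (msb N u t) (tsa N u f)"
proof -
  let ?l = "lift N (Cod N u) t f"
  have "push N (Dom N u) (Dom (tm N (Dom N u)) (msa N u ?l)) (tyofa N (Dom N u) (msa N u ?l)) = Cod (tm N (Dom N u)) (msa N u ?l)"
    by (rule push_tyofa) (use assms in auto)
  then show ?thesis using assms by (simp add: push_def)
qed

subsection \<open>Context extension\<close>

lemma
  assumes N: "prenat N" "\<Gamma> \<in> Ob N" "A \<in> Ob (ty N \<Gamma>)"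
  shows Prj_Disp [simp]: "Prj N \<Gamma> A \<in> Disp N"
    and Prj_ar [simp]: "Prj N \<Gamma> A \<in> Ar N"
    and Cod_Prj [simp]: "Cod N (Prj N \<Gamma> A) = \<Gamma>"
    and Var_ob [simp]: "Var N \<Gamma> A \<in> Ob (tm N (ext N \<Gamma> A))"
    and tyof_Var [simp]: "tyof N (ext N \<Gamma> A) (Var N \<Gamma> A) = tsb N (Prj N \<Gamma> A) A"
  using prenat_represents[OF N] by (auto simp: represents_def)

lemma
  assumes N: "prenat N" "\<Gamma> \<in> Ob N" "A \<in> Ob (ty N \<Gamma>)"
    and u: "u \<in> Ar N" "Cod N u = \<Gamma>" and t: "t \<in> Ob (tm N (Dom N u))" "tyof N (Dom N u) t = tsb N u A"
  shows ext_pair_ar [simp]: "ext_pair N \<Gamma> A u t \<in> Ar N"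
    and Dom_ext_pair [simp]: "Dom N (ext_pair N \<Gamma> A u t) = Dom N u"
    and Cod_ext_pair [simp]: "Cod N (ext_pair N \<Gamma> A u t) = ext N \<Gamma> A"
    and Prj_ext_pair [simp]: "Cmp N (Prj N \<Gamma> A) (ext_pair N \<Gamma> A u t) = u"
    and Var_ext_pair [simp]: "msb N (ext_pair N \<Gamma> A u t) (Var N \<Gamma> A) = t"
proof -
  have "\<exists>!w. w \<in> hom N (Dom N u) (ext N \<Gamma> A) \<and> Cmp N (Prj N \<Gamma> A) w = u \<and> msb N w (Var N \<Gamma> A) = t"
    using prenat_represents[OF N] u t unfolding represents_def by (simp add: hom_def)
  from theI'[OF this, folded ext_pair_def]
  show "ext_pair N \<Gamma> A u t \<in> Ar N" "Dom N (ext_pair N \<Gamma> A u t) = Dom N u"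
    "Cod N (ext_pair N \<Gamma> A u t) = ext N \<Gamma> A" "Cmp N (Prj N \<Gamma> A) (ext_pair N \<Gamma> A u t) = u"
    "msb N (ext_pair N \<Gamma> A u t) (Var N \<Gamma> A) = t"
    by auto
qed

text \<open>This is the uniqueness half of representability: an arrow into \<open>\<Gamma>.A\<close>
  is a pair of an arrow to \<open>\<Gamma>\<close> and a term. Equations between maps into a context
  extension are proved with it.\<close>

lemma ext_eq:
  assumes N: "prenat N" "\<Gamma> \<in> Ob N" "A \<in> Ob (ty N \<Gamma>)"
    and w: "w \<in> Ar N" "Cod N w = ext N \<Gamma> A" and w': "w' \<in> Ar N" "Cod N w' = ext N \<Gamma> A"
    and e: "Dom N w = Dom N w'" "Cmp N (Prj N \<Gamma> A) w = Cmp N (Prj N \<Gamma> A) w'"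
      "msb N w (Var N \<Gamma> A) = msb N w' (Var N \<Gamma> A)"
  shows "w = w'"
proof -
  let ?u = "Cmp N (Prj N \<Gamma> A) w" and ?t = "msb N w (Var N \<Gamma> A)"
  have "tyof N (Dom N w) ?t = tsb N ?u A" using N w by (simp add: tsb_Cmp)
  moreover have "?u \<in> hom N (Dom N w) \<Gamma>" "?t \<in> Ob (tm N (Dom N w))" using N w by auto
  ultimately have "\<exists>!x. x \<in> hom N (Dom N w) (ext N \<Gamma> A) \<and> Cmp N (Prj N \<Gamma> A) x = ?u \<and> msb N x (Var N \<Gamma> A) = ?t"
    using prenat_represents[OF N] unfolding represents_def by blast
  then show ?thesis using w w' e by (metis mem_hom)
qed

text \<open>The canonical map \<open>\<Delta>.A[u] \<rightarrow> \<Gamma>.A\<close> over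
  \<open>u : \<Delta> \<rightarrow> \<Gamma>\<close>, characterised by restricting the universal
  element of its target to that of its source.\<close>

definition q_ext :: "'u natmod \<Rightarrow> 'u \<Rightarrow> 'u \<Rightarrow> 'u \<Rightarrow> 'u" where
  "q_ext N \<Gamma> A u = ext_pair N \<Gamma> A (Cmp N u (Prj N (Dom N u) (tsb N u A))) (Var N (Dom N u) (tsb N u A))"

lemma
  assumes N: "prenat N" "\<Gamma> \<in> Ob N" "A \<in> Ob (ty N \<Gamma>)" and u: "u \<in> Ar N" "Cod N u = \<Gamma>"
  shows q_ext_ar [simp]: "q_ext N \<Gamma> A u \<in> Ar N"
    and Dom_q_ext [simp]: "Dom N (q_ext N \<Gamma> A u) = ext N (Dom N u) (tsb N u A)"
    and Cod_q_ext [simp]: "Cod N (q_ext N \<Gamma> A u) = ext N \<Gamma> A"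
    and Prj_q_ext: "Cmp N (Prj N \<Gamma> A) (q_ext N \<Gamma> A u) = Cmp N u (Prj N (Dom N u) (tsb N u A))"
    and Var_q_ext: "msb N (q_ext N \<Gamma> A u) (Var N \<Gamma> A) = Var N (Dom N u) (tsb N u A)"
  using assms by (auto simp: q_ext_def tsb_Cmp)

text \<open>Maps into either extension are pairs with a term, and
  \<open>A[u][a] = A[u \<circ> a]\<close> holds strictly, so the same term serves for both.\<close>

lemma q_ext_pullback:
  assumes N: "prenat N" "\<Gamma> \<in> Ob N" "A \<in> Ob (ty N \<Gamma>)" and u: "u \<in> Ar N" "Cod N u = \<Gamma>"
  shows "is_pullback N u (Prj N \<Gamma> A) (Prj N (Dom N u) (tsb N u A)) (q_ext N \<Gamma> A u)"
proof (rule is_pullbackI)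
  let ?A = "tsb N u A" and ?q = "q_ext N \<Gamma> A u"
  fix a b assume a: "a \<in> Ar N" and b: "b \<in> Ar N" and ab: "Dom N a = Dom N b" "Cod N a = Dom N u"
    "Cod N b = Dom N (Prj N \<Gamma> A)" "Cmp N u a = Cmp N (Prj N \<Gamma> A) b"
  let ?t = "msb N b (Var N \<Gamma> A)" and ?w = "ext_pair N (Dom N u) ?A a (msb N b (Var N \<Gamma> A))"
  have "tsb N b (tsb N (Prj N \<Gamma> A) A) = tsb N a (tsb N u A)"
    using tsb_Cmp[OF N(1) a u(1), of A] tsb_Cmp[OF N(1) b, of "Prj N \<Gamma> A" A] N u ab by simp
  then have w: "?w \<in> Ar N" "Dom N ?w = Dom N a" "Cod N ?w = ext N (Dom N u) ?A"
    "Cmp N (Prj N (Dom N u) ?A) ?w = a" "msb N ?w (Var N (Dom N u) ?A) = ?t"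
    using N u a b ab by auto
  have "Cmp N ?q ?w = b"
  proof (rule ext_eq[OF N])
    show "Cmp N (Prj N \<Gamma> A) (Cmp N ?q ?w) = Cmp N (Prj N \<Gamma> A) b"
      using Cmp_reassoc[OF Prj_q_ext[OF N u], of ?w] N u w ab by simp
    show "msb N (Cmp N ?q ?w) (Var N \<Gamma> A) = msb N b (Var N \<Gamma> A)"
      using N u w by (simp add: msb_Cmp Var_q_ext)
  qed (use N u w a b ab in auto)
  then show "\<exists>h. h \<in> Ar N \<and> Dom N h = Dom N a \<and> Cod N h = ext N (Dom N u) ?A \<and>
      Cmp N (Prj N (Dom N u) ?A) h = a \<and> Cmp N ?q h = b"
    using w by blast
next
  let ?A = "tsb N u A" and ?q = "q_ext N \<Gamma> A u"
  fix h k assume h: "h \<in> Ar N" "k \<in> Ar N" "Dom N h = Dom N k" "Cod N h = ext N (Dom N u) ?A" "Cod N k = ext N (Dom N u) ?A"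
    "Cmp N (Prj N (Dom N u) ?A) h = Cmp N (Prj N (Dom N u) ?A) k" "Cmp N ?q h = Cmp N ?q k"
  have *: "msb N (Cmp N ?q x) (Var N \<Gamma> A) = msb N x (Var N (Dom N u) ?A)"
    if "x \<in> Ar N" "Cod N x = ext N (Dom N u) ?A" for x
    using N u that by (simp add: msb_Cmp Var_q_ext)
  have D: "Dom N u \<in> Ob N" "?A \<in> Ob (ty N (Dom N u))" using N u by auto
  show "h = k"
    by (rule ext_eq[OF N(1) D h(1,4,2,5,3,6)]) (metis * h)
qed (use assms in \<open>auto simp: Prj_q_ext\<close>)

text \<open>These pullback squares paste on the nose, which the chosen pullbacks of displays need
  not do. Compatibility with substitution of the comparisons \<open>ltau\<close> and of the type
  components \<open>trans_ty\<close> rests on it.\<close>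

lemma q_ext_Cmp:
  assumes N: "prenat N" and v: "v \<in> Ar N" and w: "w \<in> Ar N" and vw: "Cod N w = Dom N v" and B: "B \<in> Ob (ty N (Cod N v))"
  shows "Cmp N (q_ext N (Cod N v) B v) (q_ext N (Dom N v) (tsb N v B) w) = q_ext N (Cod N v) B (Cmp N v w)"
proof (rule ext_eq[OF N _ B])
  let ?q = "q_ext N (Dom N v) (tsb N v B) w" and ?r = "q_ext N (Cod N v) B (Cmp N v w)"
  have G: "Cod N v \<in> Ob N" "Dom N v \<in> Ob N" "tsb N v B \<in> Ob (ty N (Dom N v))" using N v B by auto
  have wv: "Cmp N v w \<in> Ar N" "Cod N (Cmp N v w) = Cod N v" "Dom N (Cmp N v w) = Dom N w"
    "tsb N (Cmp N v w) B = tsb N w (tsb N v B)"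
    using N v w vw B by (auto simp: tsb_Cmp)
  note r = q_ext_ar[OF N G(1) B wv(1,2)] Dom_q_ext[OF N G(1) B wv(1,2)] Cod_q_ext[OF N G(1) B wv(1,2)]
    Prj_q_ext[OF N G(1) B wv(1,2)] Var_q_ext[OF N G(1) B wv(1,2)]
  note q = q_ext_ar[OF N G(2,3) w vw] Dom_q_ext[OF N G(2,3) w vw] Cod_q_ext[OF N G(2,3) w vw]
    Prj_q_ext[OF N G(2,3) w vw] Var_q_ext[OF N G(2,3) w vw]
  note p = q_ext_ar[OF N G(1) B v refl] Dom_q_ext[OF N G(1) B v refl] Cod_q_ext[OF N G(1) B v refl]
  have P: "Prj N (Dom N v) (tsb N v B) \<in> Ar N" "Cod N (Prj N (Dom N v) (tsb N v B)) = Dom N v"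
    "Prj N (Dom N w) (tsb N w (tsb N v B)) \<in> Ar N" "Cod N (Prj N (Dom N w) (tsb N w (tsb N v B))) = Dom N w"
    using N v w vw B G by auto
  have "Cmp N (Prj N (Cod N v) B) (Cmp N (q_ext N (Cod N v) B v) ?q) = Cmp N (Cmp N v (Prj N (Dom N v) (tsb N v B))) ?q"
    by (rule Cmp_reassoc[OF Prj_q_ext]) (use N G B v p q in auto)
  also have "\<dots> = Cmp N v (Cmp N (Prj N (Dom N v) (tsb N v B)) ?q)"
    using N v P q by simp
  also have "\<dots> = Cmp N (Cmp N v w) (Prj N (Dom N w) (tsb N w (tsb N v B)))"
    using N v w vw P q by simp
  finally show "Cmp N (Prj N (Cod N v) B) (Cmp N (q_ext N (Cod N v) B v) ?q) = Cmp N (Prj N (Cod N v) B) ?r"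
    using r(4) wv by simp
  show "msb N (Cmp N (q_ext N (Cod N v) B v) ?q) (Var N (Cod N v) B) = msb N ?r (Var N (Cod N v) B)"
    using r(5) wv q p N G B v by (simp add: msb_Cmp Var_q_ext)
qed (use N v w vw B in \<open>auto simp: tsb_Cmp\<close>)

text \<open>The arrow \<open>\<Gamma>.f\<close> alone, the middle entry of the triple that
  \<open>comprehension\<close> produces, so that computations take place in the base category and
  not in the slice.\<close>

definition comp_ar :: "'u natmod \<Rightarrow> 'u \<Rightarrow> 'u \<Rightarrow> 'u" where
  "comp_ar N \<Gamma> f = (let A = Dom (ty N \<Gamma>) f in
     ext_pair N \<Gamma> (Cod (ty N \<Gamma>) f) (Prj N \<Gamma> A) (push N (ext N \<Gamma> A) (Var N \<Gamma> A) (tsa N (Prj N \<Gamma> A) f)))"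

lemma
  assumes N: "prenat N" "\<Gamma> \<in> Ob N" and f: "f \<in> Ar (ty N \<Gamma>)"
  shows comp_ar_ar [simp]: "comp_ar N \<Gamma> f \<in> Ar N"
    and Dom_comp_ar [simp]: "Dom N (comp_ar N \<Gamma> f) = ext N \<Gamma> (Dom (ty N \<Gamma>) f)"
    and Cod_comp_ar [simp]: "Cod N (comp_ar N \<Gamma> f) = ext N \<Gamma> (Cod (ty N \<Gamma>) f)"
    and Prj_comp_ar: "Cmp N (Prj N \<Gamma> (Cod (ty N \<Gamma>) f)) (comp_ar N \<Gamma> f) = Prj N \<Gamma> (Dom (ty N \<Gamma>) f)"
    and Var_comp_ar: "msb N (comp_ar N \<Gamma> f) (Var N \<Gamma> (Cod (ty N \<Gamma>) f)) =
      push N (ext N \<Gamma> (Dom (ty N \<Gamma>) f)) (Var N \<Gamma> (Dom (ty N \<Gamma>) f)) (tsa N (Prj N \<Gamma> (Dom (ty N \<Gamma>) f)) f)"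
  using assms by (auto simp: comp_ar_def Let_def)

lemma comprehension_simps [simp]:
  "Fo (comprehension N \<Gamma>) A = Prj N \<Gamma> A"
  "Fa (comprehension N \<Gamma>) f =
     (Prj N \<Gamma> (Dom (ty N \<Gamma>) f), comp_ar N \<Gamma> f, Prj N \<Gamma> (Cod (ty N \<Gamma>) f))"
  by (auto simp: comprehension_def Let_def comp_ar_def push_def lift_def)

text \<open>On generalised elements \<open>\<Gamma>.f\<close> acts by transport along the
  substituted \<open>f\<close>. This form, with an arbitrary \<open>w\<close>, is what
  \<open>ext_eq\<close> asks for when \<open>\<Gamma>.f\<close> is precomposed with another
  map.\<close>

lemma Var_comp_ar_Cmp:
  assumes N: "prenat N" "\<Gamma> \<in> Ob N" and f: "f \<in> Ar (ty N \<Gamma>)"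
    and w: "w \<in> Ar N" "Cod N w = ext N \<Gamma> (Dom (ty N \<Gamma>) f)"
  shows "msb N (Cmp N (comp_ar N \<Gamma> f) w) (Var N \<Gamma> (Cod (ty N \<Gamma>) f)) =
    push N (Dom N w) (msb N w (Var N \<Gamma> (Dom (ty N \<Gamma>) f))) (tsa N (Cmp N (Prj N \<Gamma> (Dom (ty N \<Gamma>) f)) w) f)"
proof -
  let ?A = "Dom (ty N \<Gamma>) f"
  have "msb N w (push N (ext N \<Gamma> ?A) (Var N \<Gamma> ?A) (tsa N (Prj N \<Gamma> ?A) f)) =
      push N (Dom N w) (msb N w (Var N \<Gamma> ?A)) (tsa N w (tsa N (Prj N \<Gamma> ?A) f))"
    using msb_push[OF N(1) w(1), of "Var N \<Gamma> ?A" "tsa N (Prj N \<Gamma> ?A) f"] N f w by simp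
  then show ?thesis using N f w by (simp add: msb_Cmp Var_comp_ar tsa_Cmp_left)
qed

lemma comp_ar_Idn:
  assumes N: "prenat N" "\<Gamma> \<in> Ob N" "A \<in> Ob (ty N \<Gamma>)"
  shows "comp_ar N \<Gamma> (Idn (ty N \<Gamma>) A) = Idn N (ext N \<Gamma> A)"
  by (rule ext_eq[OF N])
     (use Prj_comp_ar[of N \<Gamma> "Idn (ty N \<Gamma>) A"] Var_comp_ar[of N \<Gamma> "Idn (ty N \<Gamma>) A"] N in auto)

lemma comp_ar_Cmp:
  assumes N: "prenat N" "\<Gamma> \<in> Ob N" and f: "f \<in> Ar (ty N \<Gamma>)" and g: "g \<in> Ar (ty N \<Gamma>)"
    and fg: "Cod (ty N \<Gamma>) f = Dom (ty N \<Gamma>) g"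
  shows "comp_ar N \<Gamma> (Cmp (ty N \<Gamma>) g f) = Cmp N (comp_ar N \<Gamma> g) (comp_ar N \<Gamma> f)"
proof (rule ext_eq[OF N(1,2), of "Cod (ty N \<Gamma>) g"])
  have gf: "Cmp (ty N \<Gamma>) g f \<in> Ar (ty N \<Gamma>)" "Dom (ty N \<Gamma>) (Cmp (ty N \<Gamma>) g f) = Dom (ty N \<Gamma>) f"
    "Cod (ty N \<Gamma>) (Cmp (ty N \<Gamma>) g f) = Cod (ty N \<Gamma>) g"
    using N f g fg by auto
  show "Cmp N (Prj N \<Gamma> (Cod (ty N \<Gamma>) g)) (comp_ar N \<Gamma> (Cmp (ty N \<Gamma>) g f)) =
    Cmp N (Prj N \<Gamma> (Cod (ty N \<Gamma>) g)) (Cmp N (comp_ar N \<Gamma> g) (comp_ar N \<Gamma> f))"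
    using Prj_comp_ar[OF N gf(1)] Prj_comp_ar[OF N f] Cmp_reassoc[OF Prj_comp_ar[OF N g], of "comp_ar N \<Gamma> f"] gf N f g fg
    by simp
  show "msb N (comp_ar N \<Gamma> (Cmp (ty N \<Gamma>) g f)) (Var N \<Gamma> (Cod (ty N \<Gamma>) g)) =
    msb N (Cmp N (comp_ar N \<Gamma> g) (comp_ar N \<Gamma> f)) (Var N \<Gamma> (Cod (ty N \<Gamma>) g))"
    using Var_comp_ar[OF N gf(1)] Var_comp_ar[OF N f] Var_comp_ar_Cmp[OF N g, of "comp_ar N \<Gamma> f"]
      Prj_comp_ar[OF N f] gf N f g fg
    by (simp add: push_Cmp)
qed (use N f g fg in auto)

lemma comprehension_functor:
  assumes N: "prenat N" "\<Gamma> \<in> Ob N"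
  shows "is_functor (ty N \<Gamma>) (disp_fib N \<Gamma>) (comprehension N \<Gamma>)"
  by (rule is_functorI) (use N in \<open>auto simp: Prj_comp_ar comp_ar_Idn comp_ar_Cmp\<close>)

text \<open>Naturality of \<open>q_ext\<close> in the type: the square that makes comprehension
  compatible with reindexing.\<close>

lemma q_ext_comp_ar:
  assumes N: "prenat N" "\<Gamma> \<in> Ob N" and f: "f \<in> Ar (ty N \<Gamma>)" and u: "u \<in> Ar N" "Cod N u = \<Gamma>"
  shows "Cmp N (q_ext N \<Gamma> (Cod (ty N \<Gamma>) f) u) (comp_ar N (Dom N u) (tsa N u f)) =
    Cmp N (comp_ar N \<Gamma> f) (q_ext N \<Gamma> (Dom (ty N \<Gamma>) f) u)"
proof (rule ext_eq[OF N(1,2), of "Cod (ty N \<Gamma>) f"])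
  let ?A = "Dom (ty N \<Gamma>) f" and ?B = "Cod (ty N \<Gamma>) f"
  have uf: "tsa N u f \<in> Ar (ty N (Dom N u))" "Dom (ty N (Dom N u)) (tsa N u f) = tsb N u ?A"
    "Cod (ty N (Dom N u)) (tsa N u f) = tsb N u ?B" using N f u by auto
  note c = comp_ar_ar[OF N(1) _ uf(1)] Dom_comp_ar[OF N(1) _ uf(1)] Cod_comp_ar[OF N(1) _ uf(1)] Prj_comp_ar[OF N(1) _ uf(1)]
    Var_comp_ar[OF N(1) _ uf(1)]
  show "Cmp N (Prj N \<Gamma> ?B) (Cmp N (q_ext N \<Gamma> ?B u) (comp_ar N (Dom N u) (tsa N u f))) =
    Cmp N (Prj N \<Gamma> ?B) (Cmp N (comp_ar N \<Gamma> f) (q_ext N \<Gamma> ?A u))"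
    using Cmp_reassoc[OF Prj_q_ext[OF N _ u, of ?B], of "comp_ar N (Dom N u) (tsa N u f)"]
      Cmp_reassoc[OF Prj_comp_ar[OF N f], of "q_ext N \<Gamma> ?A u"] N f u c uf
    by (simp add: Prj_q_ext)
  show "msb N (Cmp N (q_ext N \<Gamma> ?B u) (comp_ar N (Dom N u) (tsa N u f))) (Var N \<Gamma> ?B) =
    msb N (Cmp N (comp_ar N \<Gamma> f) (q_ext N \<Gamma> ?A u)) (Var N \<Gamma> ?B)"
    using N f u c uf by (simp add: Var_comp_ar_Cmp msb_Cmp[of N _ "q_ext N \<Gamma> ?B u"] Var_q_ext Prj_q_ext tsa_Cmp_left)
qed (use N f u in auto)

text \<open>The section of \<open>p_A\<close> named by a term of type \<open>A\<close>. Since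
  \<open>Var_sect\<close> recovers the term, terms can be moved along functors between categories of
  contexts in the guise of sections.\<close>

definition sect :: "'u natmod \<Rightarrow> 'u \<Rightarrow> 'u \<Rightarrow> 'u" where
  "sect N \<Gamma> t = ext_pair N \<Gamma> (tyof N \<Gamma> t) (Idn N \<Gamma>) t"

lemma
  assumes N: "prenat N" "\<Gamma> \<in> Ob N" and t: "t \<in> Ob (tm N \<Gamma>)"
  shows sect_ar [simp]: "sect N \<Gamma> t \<in> Ar N"
    and Dom_sect [simp]: "Dom N (sect N \<Gamma> t) = \<Gamma>"
    and Cod_sect [simp]: "Cod N (sect N \<Gamma> t) = ext N \<Gamma> (tyof N \<Gamma> t)"
    and Prj_sect: "Cmp N (Prj N \<Gamma> (tyof N \<Gamma> t)) (sect N \<Gamma> t) = Idn N \<Gamma>"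
    and Var_sect: "msb N (sect N \<Gamma> t) (Var N \<Gamma> (tyof N \<Gamma> t)) = t"
  using assms by (auto simp: sect_def)

text \<open>Both sides are the pair of \<open>u\<close> and the term \<open>t[u]\<close>. The
  section of \<open>t[u]\<close> is thus the pullback of the section of \<open>t\<close>.\<close>

lemma sect_msb:
  assumes N: "prenat N" and u: "u \<in> Ar N" and t: "t \<in> Ob (tm N (Cod N u))"
  shows "Cmp N (q_ext N (Cod N u) (tyof N (Cod N u) t) u) (sect N (Dom N u) (msb N u t)) = Cmp N (sect N (Cod N u) t) u"
proof (rule ext_eq[OF N, of "Cod N u" "tyof N (Cod N u) t"])
  let ?\<Gamma> = "Cod N u" and ?\<Delta> = "Dom N u"
  let ?A = "tyof N ?\<Gamma> t" and ?t = "msb N u t"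
  note s = sect_ar[of N ?\<Delta> ?t] Dom_sect[of N ?\<Delta> ?t] Cod_sect[of N ?\<Delta> ?t] Prj_sect[of N ?\<Delta> ?t] Var_sect[of N ?\<Delta> ?t]
  show "Cmp N (Prj N ?\<Gamma> ?A) (Cmp N (q_ext N ?\<Gamma> ?A u) (sect N ?\<Delta> ?t)) = Cmp N (Prj N ?\<Gamma> ?A) (Cmp N (sect N ?\<Gamma> t) u)"
    using Cmp_reassoc[OF Prj_q_ext[of N ?\<Gamma> ?A u], of "sect N ?\<Delta> ?t"] Cmp_reassoc[OF Prj_sect[of N ?\<Gamma> t], of u] N u t s
    by simp
  show "msb N (Cmp N (q_ext N ?\<Gamma> ?A u) (sect N ?\<Delta> ?t)) (Var N ?\<Gamma> ?A) = msb N (Cmp N (sect N ?\<Gamma> t) u) (Var N ?\<Gamma> ?A)"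
    using N u t s by (simp add: msb_Cmp Var_q_ext Var_sect)
qed (use N u t in auto)

text \<open>The generic-term components agree by the action of \<open>\<Gamma>.f\<close> on
  generalised elements. Transport of terms thereby becomes composition of sections.\<close>

lemma sect_push:
  assumes N: "prenat N" "\<Gamma> \<in> Ob N" and t: "t \<in> Ob (tm N \<Gamma>)" and f: "f \<in> Ar (ty N \<Gamma>)" "Dom (ty N \<Gamma>) f = tyof N \<Gamma> t"
  shows "sect N \<Gamma> (push N \<Gamma> t f) = Cmp N (comp_ar N \<Gamma> f) (sect N \<Gamma> t)"
proof (rule ext_eq[OF N, of "Cod (ty N \<Gamma>) f"])
  let ?t = "push N \<Gamma> t f"
  have p: "?t \<in> Ob (tm N \<Gamma>)" "tyof N \<Gamma> ?t = Cod (ty N \<Gamma>) f" using assms by auto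
  note s = sect_ar[OF N p(1)] Dom_sect[OF N p(1)] Cod_sect[OF N p(1)] Prj_sect[OF N p(1)] Var_sect[OF N p(1)]
  show "Cmp N (Prj N \<Gamma> (Cod (ty N \<Gamma>) f)) (sect N \<Gamma> ?t) = Cmp N (Prj N \<Gamma> (Cod (ty N \<Gamma>) f)) (Cmp N (comp_ar N \<Gamma> f) (sect N \<Gamma> t))"
    using Cmp_reassoc[OF Prj_comp_ar[OF N f(1)], of "sect N \<Gamma> t"] N t f p s by (simp add: Prj_sect)
  show "msb N (sect N \<Gamma> ?t) (Var N \<Gamma> (Cod (ty N \<Gamma>) f)) = msb N (Cmp N (comp_ar N \<Gamma> f) (sect N \<Gamma> t)) (Var N \<Gamma> (Cod (ty N \<Gamma>) f))"
    using Var_comp_ar_Cmp[OF N f(1), of "sect N \<Gamma> t"] N t f p s by (simp add: Var_sect Prj_sect)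
qed (use assms in auto)

subsection \<open>Full faithfulness of comprehension\<close>

text \<open>The part of being a natural model that does not mention size.\<close>

definition natm :: "'u natmod \<Rightarrow> bool" where
  "natm N \<longleftrightarrow> prenat N \<and> (\<forall>\<Gamma>\<in>Ob N. is_equivalence (ty N \<Gamma>) (disp_fib N \<Gamma>) (comprehension N \<Gamma>))"

lemma natural_model_natm: "natural_model small N \<Longrightarrow> natm N"
  by (auto simp: natm_def natural_model_def pre_natural_model_prenat)

lemma natm_prenat [simp]: "natm N \<Longrightarrow> prenat N"
  by (simp add: natm_def)

lemma comprehension_equivalence:
  assumes "natm N" "\<Gamma> \<in> Ob N"
  shows "fully_faithful (ty N \<Gamma>) (disp_fib N \<Gamma>) (comprehension N \<Gamma>)"
    "essentially_surjective (ty N \<Gamma>) (disp_fib N \<Gamma>) (comprehension N \<Gamma>)"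
  using assms is_equivalenceD(2,3)[of "ty N \<Gamma>" "disp_fib N \<Gamma>" "comprehension N \<Gamma>"] by (auto simp: natm_def)

lemma comp_ar_faithful:
  assumes "natm N" "\<Gamma> \<in> Ob N" "f \<in> Ar (ty N \<Gamma>)" "g \<in> Ar (ty N \<Gamma>)"
    "Dom (ty N \<Gamma>) f = Dom (ty N \<Gamma>) g" "Cod (ty N \<Gamma>) f = Cod (ty N \<Gamma>) g" "comp_ar N \<Gamma> f = comp_ar N \<Gamma> g"
  shows "f = g"
  using fully_faithful_faithful[OF _ comprehension_functor comprehension_equivalence(1)[OF assms(1,2)]] assms
  by (simp add: faithful_def)

lemma comp_ar_full:
  assumes "natm N" "\<Gamma> \<in> Ob N" "A \<in> Ob (ty N \<Gamma>)" "B \<in> Ob (ty N \<Gamma>)"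
    "h \<in> Ar N" "Dom N h = ext N \<Gamma> A" "Cod N h = ext N \<Gamma> B" "Cmp N (Prj N \<Gamma> B) h = Prj N \<Gamma> A"
  shows "\<exists>f. f \<in> Ar (ty N \<Gamma>) \<and> Dom (ty N \<Gamma>) f = A \<and> Cod (ty N \<Gamma>) f = B \<and> comp_ar N \<Gamma> f = h"
  by (rule fully_faithful_full[OF comprehension_equivalence(1)[OF assms(1,2)], of A B "(Prj N \<Gamma> A, h, Prj N \<Gamma> B)"])
     (use assms in auto)

text \<open>Essential surjectivity unpacked from the slice, with the isomorphism inverted so that it
  starts at the domain of \<open>p\<close>. Applied to the image of a generic display under a
  functor, it produces the type from which a lift of that functor is built.\<close>

lemma comp_ess_surj:
  assumes N: "natm N" and p: "p \<in> Disp N"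
  obtains A i where "A \<in> Ob (ty N (Cod N p))" "is_iso N i" "Dom N i = Dom N p" "Cod N i = ext N (Cod N p) A"
    "Cmp N (Prj N (Cod N p) A) i = p"
proof -
  let ?\<Gamma> = "Cod N p"
  have G: "?\<Gamma> \<in> Ob N" and pf: "p \<in> Ob (disp_fib N ?\<Gamma>)" using N p by auto
  obtain A i where A: "A \<in> Ob (ty N ?\<Gamma>)" and i: "i \<in> hom (disp_fib N ?\<Gamma>) (Prj N ?\<Gamma> A) p" "is_iso (disp_fib N ?\<Gamma>) i"
    using bspec[OF comprehension_equivalence(2)[OF N G, unfolded essentially_surjective_def] pf] by auto
  obtain h where h: "i = (Prj N ?\<Gamma> A, h, p)" using i(1) by (cases i) auto
  have h': "h \<in> Ar N" "Dom N h = ext N ?\<Gamma> A" "Cod N h = Dom N p" "Cmp N p h = Prj N ?\<Gamma> A" "is_iso N h"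
    using i N unfolding h by (auto simp: disp_fib_iso)
  have "Cmp N (Prj N ?\<Gamma> A) (inv_ar N h) = p"
    using Cmp_assoc[of N "inv_ar N h" h p] h' N p by (simp add: inv_right)
  then show ?thesis using that[of A "inv_ar N h"] A h' by auto
qed


section \<open>Morphisms of natural models\<close>

text \<open>\<open>C\<close> and \<open>D\<close> are separate parameters tied to \<open>F\<close>
  by simp equations, so that parallel or composable morphisms can share them.\<close>

locale nat_mor =
  fixes F :: "'u nmor" and C D :: "'u natmod"
  assumes src [simp]: "nsrc F = C" and tgt [simp]: "ntgt F = D"
    and C [simp]: "prenat C" and D [simp]: "prenat D"
    and mor: "natural_model_morphism F"
begin

lemma display_functor: "display_functor C D F"
  and strict_Tp: "strict_indexed_functor C F (Tp C) (Tp D) (nTp F)"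
  and strict_Tm: "strict_indexed_functor C F (Tm C) (Tm D) (nTm F)"
  using mor by (auto simp: natural_model_morphism_def)

lemma is_functor: "is_functor C D F"
  using display_functor by (simp add: display_functor_def)

lemma Fo_ob [simp]: "\<Gamma> \<in> Ob C \<Longrightarrow> Fo F \<Gamma> \<in> Ob D"
  and Fa_ar [simp]: "u \<in> Ar C \<Longrightarrow> Fa F u \<in> Ar D"
  and Dom_Fa [simp]: "u \<in> Ar C \<Longrightarrow> Dom D (Fa F u) = Fo F (Dom C u)"
  and Cod_Fa [simp]: "u \<in> Ar C \<Longrightarrow> Cod D (Fa F u) = Fo F (Cod C u)"
  and Fa_Idn [simp]: "\<Gamma> \<in> Ob C \<Longrightarrow> Fa F (Idn C \<Gamma>) = Idn D (Fo F \<Gamma>)"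
  using is_functor by (auto simp: functor_Dom functor_Cod functor_Idn)

lemmas Fa_triangle = functor_triangle[OF is_functor] and Fa_square = functor_square[OF is_functor]

lemma nTp_functor: "\<Gamma> \<in> Ob C \<Longrightarrow> is_functor (ty C \<Gamma>) (ty D (Fo F \<Gamma>)) (nTp F \<Gamma>)"
  and nTm_functor: "\<Gamma> \<in> Ob C \<Longrightarrow> is_functor (tm C \<Gamma>) (tm D (Fo F \<Gamma>)) (nTm F \<Gamma>)"
  using strict_Tp strict_Tm by (auto simp: strict_indexed_functor_def)

lemma
  assumes "\<Gamma> \<in> Ob C"
  shows Fty_ob [simp]: "A \<in> Ob (ty C \<Gamma>) \<Longrightarrow> Fo (nTp F \<Gamma>) A \<in> Ob (ty D (Fo F \<Gamma>))"
    and Fty_ar [simp]: "f \<in> Ar (ty C \<Gamma>) \<Longrightarrow> Fa (nTp F \<Gamma>) f \<in> Ar (ty D (Fo F \<Gamma>))"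
    and Dom_Fty [simp]: "f \<in> Ar (ty C \<Gamma>) \<Longrightarrow> Dom (ty D (Fo F \<Gamma>)) (Fa (nTp F \<Gamma>) f) = Fo (nTp F \<Gamma>) (Dom (ty C \<Gamma>) f)"
    and Cod_Fty [simp]: "f \<in> Ar (ty C \<Gamma>) \<Longrightarrow> Cod (ty D (Fo F \<Gamma>)) (Fa (nTp F \<Gamma>) f) = Fo (nTp F \<Gamma>) (Cod (ty C \<Gamma>) f)"
    and Ftm_ob [simp]: "t \<in> Ob (tm C \<Gamma>) \<Longrightarrow> Fo (nTm F \<Gamma>) t \<in> Ob (tm D (Fo F \<Gamma>))"
    and Ftm_ar [simp]: "g \<in> Ar (tm C \<Gamma>) \<Longrightarrow> Fa (nTm F \<Gamma>) g \<in> Ar (tm D (Fo F \<Gamma>))"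
    and Dom_Ftm [simp]: "g \<in> Ar (tm C \<Gamma>) \<Longrightarrow> Dom (tm D (Fo F \<Gamma>)) (Fa (nTm F \<Gamma>) g) = Fo (nTm F \<Gamma>) (Dom (tm C \<Gamma>) g)"
    and Cod_Ftm [simp]: "g \<in> Ar (tm C \<Gamma>) \<Longrightarrow> Cod (tm D (Fo F \<Gamma>)) (Fa (nTm F \<Gamma>) g) = Fo (nTm F \<Gamma>) (Cod (tm C \<Gamma>) g)"
    and tyof_Ftm [simp]: "t \<in> Ob (tm C \<Gamma>) \<Longrightarrow> tyof D (Fo F \<Gamma>) (Fo (nTm F \<Gamma>) t) = Fo (nTp F \<Gamma>) (tyof C \<Gamma> t)"
    and tyofa_Ftm [simp]: "g \<in> Ar (tm C \<Gamma>) \<Longrightarrow> tyofa D (Fo F \<Gamma>) (Fa (nTm F \<Gamma>) g) = Fa (nTp F \<Gamma>) (tyofa C \<Gamma> g)"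
  using nTp_functor[OF assms] nTm_functor[OF assms] mor assms
  by (auto simp: functor_Dom functor_Cod natural_model_morphism_def)

lemma
  assumes "u \<in> Ar C" "Dom C u = \<Delta>"
  shows Fty_tsb [simp]: "A \<in> Ob (ty C (Cod C u)) \<Longrightarrow> Fo (nTp F \<Delta>) (tsb C u A) = tsb D (Fa F u) (Fo (nTp F (Cod C u)) A)"
    and Fty_tsa [simp]: "f \<in> Ar (ty C (Cod C u)) \<Longrightarrow> Fa (nTp F \<Delta>) (tsa C u f) = tsa D (Fa F u) (Fa (nTp F (Cod C u)) f)"
    and Ftm_msb [simp]: "t \<in> Ob (tm C (Cod C u)) \<Longrightarrow> Fo (nTm F \<Delta>) (msb C u t) = msb D (Fa F u) (Fo (nTm F (Cod C u)) t)"
    and Ftm_msa [simp]: "g \<in> Ar (tm C (Cod C u)) \<Longrightarrow> Fa (nTm F \<Delta>) (msa C u g) = msa D (Fa F u) (Fa (nTm F (Cod C u)) g)"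
  using strict_Tp strict_Tm assms by (auto simp: strict_indexed_functor_def)

lemma Ftm_push:
  assumes "\<Gamma> \<in> Ob C" "t \<in> Ob (tm C \<Gamma>)" "f \<in> Ar (ty C \<Gamma>)" "Dom (ty C \<Gamma>) f = tyof C \<Gamma> t"
  shows "Fo (nTm F \<Gamma>) (push C \<Gamma> t f) = push D (Fo F \<Gamma>) (Fo (nTm F \<Gamma>) t) (Fa (nTp F \<Gamma>) f)"
  using push_tyofa[OF D, of "Fo F \<Gamma>" "Fa (nTm F \<Gamma>) (lift C \<Gamma> t f)"] assms by (simp add: push_def)

lemma
  assumes "\<Gamma> \<in> Ob C" "A \<in> Ob (ty C \<Gamma>)"
  shows tau_iso [simp]: "is_iso D (tau F \<Gamma> A)"
    and Dom_tau [simp]: "Dom D (tau F \<Gamma> A) = Fo F (ext C \<Gamma> A)"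
    and Cod_tau [simp]: "Cod D (tau F \<Gamma> A) = ext D (Fo F \<Gamma>) (Fo (nTp F \<Gamma>) A)"
    and Prj_tau: "Cmp D (Prj D (Fo F \<Gamma>) (Fo (nTp F \<Gamma>) A)) (tau F \<Gamma> A) = Fa F (Prj C \<Gamma> A)"
    and Var_tau: "msb D (tau F \<Gamma> A) (Var D (Fo F \<Gamma>) (Fo (nTp F \<Gamma>) A)) = Fo (nTm F (ext C \<Gamma> A)) (Var C \<Gamma> A)"
  using mor assms by (auto simp: natural_model_morphism_def tau_def)

lemma tau_ar [simp]: "\<Gamma> \<in> Ob C \<Longrightarrow> A \<in> Ob (ty C \<Gamma>) \<Longrightarrow> tau F \<Gamma> A \<in> Ar D"
  by simp

lemma Prj_inv_tau:
  assumes "\<Gamma> \<in> Ob C" "A \<in> Ob (ty C \<Gamma>)"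
  shows "Cmp D (Fa F (Prj C \<Gamma> A)) (inv_ar D (tau F \<Gamma> A)) = Prj D (Fo F \<Gamma>) (Fo (nTp F \<Gamma>) A)"
  using Cmp_assoc[of D "inv_ar D (tau F \<Gamma> A)" "tau F \<Gamma> A" "Prj D (Fo F \<Gamma>) (Fo (nTp F \<Gamma>) A)"] assms
  by (simp add: Prj_tau inv_right)

text \<open>Both sides have the same projection, and the universal element pulls back along both to
  the image of the generic term of \<open>A[u]\<close>, because \<open>F\<close> commutes strictly
  with substitution of terms.\<close>

lemma tau_q_ext:
  assumes u: "u \<in> Ar C" "Cod C u = \<Gamma>" and A: "A \<in> Ob (ty C \<Gamma>)"
  shows "Cmp D (tau F \<Gamma> A) (Fa F (q_ext C \<Gamma> A u)) =
    Cmp D (q_ext D (Fo F \<Gamma>) (Fo (nTp F \<Gamma>) A) (Fa F u)) (tau F (Dom C u) (tsb C u A))"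
proof (rule ext_eq[of D "Fo F \<Gamma>" "Fo (nTp F \<Gamma>) A"])
  have G: "\<Gamma> \<in> Ob C" using u by auto
  let ?\<Delta> = "Dom C u" and ?FA = "Fo (nTp F \<Gamma>) A" and ?uA = "tsb C u A"
  note tau' = Prj_tau[of ?\<Delta> ?uA] Var_tau[of ?\<Delta> ?uA]
  have e1: "Cmp D (Fa F (Prj C \<Gamma> A)) (Fa F (q_ext C \<Gamma> A u)) = Cmp D (Fa F u) (Fa F (Prj C ?\<Delta> ?uA))"
    by (rule Fa_square[OF Prj_q_ext]) (use u A G in auto)
  show "Cmp D (Prj D (Fo F \<Gamma>) ?FA) (Cmp D (tau F \<Gamma> A) (Fa F (q_ext C \<Gamma> A u))) =
    Cmp D (Prj D (Fo F \<Gamma>) ?FA) (Cmp D (q_ext D (Fo F \<Gamma>) ?FA (Fa F u)) (tau F ?\<Delta> ?uA))"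
    using Cmp_reassoc[OF Prj_tau[of \<Gamma> A], of "Fa F (q_ext C \<Gamma> A u)"]
      Cmp_reassoc[OF Prj_q_ext[of D "Fo F \<Gamma>" ?FA "Fa F u"], of "tau F ?\<Delta> ?uA"] u A G e1 tau'
    by simp
  have "msb D (Cmp D (tau F \<Gamma> A) (Fa F (q_ext C \<Gamma> A u))) (Var D (Fo F \<Gamma>) ?FA) =
      Fo (nTm F (ext C ?\<Delta> ?uA)) (msb C (q_ext C \<Gamma> A u) (Var C \<Gamma> A))"
    using u A G by (simp add: msb_Cmp Var_tau)
  then show "msb D (Cmp D (tau F \<Gamma> A) (Fa F (q_ext C \<Gamma> A u))) (Var D (Fo F \<Gamma>) ?FA) =
    msb D (Cmp D (q_ext D (Fo F \<Gamma>) ?FA (Fa F u)) (tau F ?\<Delta> ?uA)) (Var D (Fo F \<Gamma>) ?FA)"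
    using u A G tau' by (simp add: msb_Cmp Var_q_ext del: Ftm_msb)
qed (use u A in auto)

text \<open>Naturality of the comparison in the type. On generic terms it says that
  \<open>F\<close>, being compatible with lifts, preserves \<open>push\<close>.\<close>

lemma tau_comp_ar:
  assumes G: "\<Gamma> \<in> Ob C" and f: "f \<in> Ar (ty C \<Gamma>)"
  shows "Cmp D (tau F \<Gamma> (Cod (ty C \<Gamma>) f)) (Fa F (comp_ar C \<Gamma> f)) =
    Cmp D (comp_ar D (Fo F \<Gamma>) (Fa (nTp F \<Gamma>) f)) (tau F \<Gamma> (Dom (ty C \<Gamma>) f))"
proof (rule ext_eq[of D "Fo F \<Gamma>" "Fo (nTp F \<Gamma>) (Cod (ty C \<Gamma>) f)"])
  let ?A = "Dom (ty C \<Gamma>) f" and ?B = "Cod (ty C \<Gamma>) f"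
  let ?FA = "Fo (nTp F \<Gamma>) ?A" and ?FB = "Fo (nTp F \<Gamma>) ?B" and ?Ff = "Fa (nTp F \<Gamma>) f"
  have AB: "?A \<in> Ob (ty C \<Gamma>)" "?B \<in> Ob (ty C \<Gamma>)" using G f by auto
  note c = Prj_comp_ar[of D "Fo F \<Gamma>" ?Ff] comp_ar_ar[of D "Fo F \<Gamma>" ?Ff]
    Dom_comp_ar[of D "Fo F \<Gamma>" ?Ff] Cod_comp_ar[of D "Fo F \<Gamma>" ?Ff]
  have e1: "Cmp D (Fa F (Prj C \<Gamma> ?B)) (Fa F (comp_ar C \<Gamma> f)) = Fa F (Prj C \<Gamma> ?A)"
    by (rule Fa_triangle[OF Prj_comp_ar]) (use AB f G in auto)
  show "Cmp D (Prj D (Fo F \<Gamma>) ?FB) (Cmp D (tau F \<Gamma> ?B) (Fa F (comp_ar C \<Gamma> f))) =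
    Cmp D (Prj D (Fo F \<Gamma>) ?FB) (Cmp D (comp_ar D (Fo F \<Gamma>) ?Ff) (tau F \<Gamma> ?A))"
    using Cmp_reassoc[OF Prj_tau[of \<Gamma> ?B], of "Fa F (comp_ar C \<Gamma> f)"]
      Cmp_reassoc[OF Prj_comp_ar[of D "Fo F \<Gamma>" ?Ff], of "tau F \<Gamma> ?A"] G f AB e1
    by (simp add: Prj_tau)
  have "msb D (Cmp D (tau F \<Gamma> ?B) (Fa F (comp_ar C \<Gamma> f))) (Var D (Fo F \<Gamma>) ?FB) =
      Fo (nTm F (ext C \<Gamma> ?A)) (msb C (comp_ar C \<Gamma> f) (Var C \<Gamma> ?B))"
    using G f AB by (simp add: msb_Cmp Var_tau)
  also have "\<dots> = push D (Fo F (ext C \<Gamma> ?A)) (Fo (nTm F (ext C \<Gamma> ?A)) (Var C \<Gamma> ?A)) (tsa D (Fa F (Prj C \<Gamma> ?A)) ?Ff)"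
    using G f AB by (simp add: Var_comp_ar Ftm_push del: Ftm_msb)
  finally show "msb D (Cmp D (tau F \<Gamma> ?B) (Fa F (comp_ar C \<Gamma> f))) (Var D (Fo F \<Gamma>) ?FB) =
    msb D (Cmp D (comp_ar D (Fo F \<Gamma>) ?Ff) (tau F \<Gamma> ?A)) (Var D (Fo F \<Gamma>) ?FB)"
    using Var_comp_ar_Cmp[of D "Fo F \<Gamma>" ?Ff "tau F \<Gamma> ?A"] G f AB by (simp add: Var_tau Prj_tau)
qed (use G f in auto)

text \<open>Up to \<open>tau\<close>, the action on terms is the action on sections of displays, so
  the functor on contexts together with \<open>tau\<close> determines it.\<close>

lemma tau_sect:
  assumes G: "\<Gamma> \<in> Ob C" and t: "t \<in> Ob (tm C \<Gamma>)"
  shows "Cmp D (tau F \<Gamma> (tyof C \<Gamma> t)) (Fa F (sect C \<Gamma> t)) = sect D (Fo F \<Gamma>) (Fo (nTm F \<Gamma>) t)"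
proof (rule ext_eq[of D "Fo F \<Gamma>" "Fo (nTp F \<Gamma>) (tyof C \<Gamma> t)"])
  let ?A = "tyof C \<Gamma> t" and ?Ft = "Fo (nTm F \<Gamma>) t"
  let ?FA = "Fo (nTp F \<Gamma>) ?A"
  note s = Prj_sect[of D "Fo F \<Gamma>" ?Ft] Var_sect[of D "Fo F \<Gamma>" ?Ft]
  have e1: "Cmp D (Fa F (Prj C \<Gamma> ?A)) (Fa F (sect C \<Gamma> t)) = Fa F (Idn C \<Gamma>)"
    by (rule Fa_triangle[OF Prj_sect]) (use G t in auto)
  show "Cmp D (Prj D (Fo F \<Gamma>) ?FA) (Cmp D (tau F \<Gamma> ?A) (Fa F (sect C \<Gamma> t))) = Cmp D (Prj D (Fo F \<Gamma>) ?FA) (sect D (Fo F \<Gamma>) ?Ft)"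
    using Cmp_reassoc[OF Prj_tau[of \<Gamma> ?A], of "Fa F (sect C \<Gamma> t)"] G t e1 s by simp
  have "msb D (Cmp D (tau F \<Gamma> ?A) (Fa F (sect C \<Gamma> t))) (Var D (Fo F \<Gamma>) ?FA) =
      Fo (nTm F \<Gamma>) (msb C (sect C \<Gamma> t) (Var C \<Gamma> ?A))"
    using G t by (simp add: msb_Cmp Var_tau)
  then show "msb D (Cmp D (tau F \<Gamma> ?A) (Fa F (sect C \<Gamma> t))) (Var D (Fo F \<Gamma>) ?FA) = msb D (sect D (Fo F \<Gamma>) ?Ft) (Var D (Fo F \<Gamma>) ?FA)"
    using G t s by (simp add: Var_sect del: Ftm_msb)
qed (use G t in auto)

end


section \<open>Transformations between morphisms of natural models\<close>

text \<open>
  The type component of a 2-morphism at \<open>A\<close> is the unique arrow whose comprehension is compatible with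
  the underlying natural transformation at \<open>\<Gamma>.A\<close>, and its term component at \<open>t : A\<close> is the lift of that
  arrow.
\<close>

locale nat_trans = F: nat_mor F C D + G: nat_mor G C D
  for F G :: "'u nmor" and C D :: "'u natmod" +
  fixes a :: "'u \<Rightarrow> 'u"
  assumes natural: "is_nat C D F G a" and natm [simp]: "natm D"
begin

lemma
  assumes "\<Gamma> \<in> Ob C"
  shows a_ar [simp]: "a \<Gamma> \<in> Ar D" and Dom_a [simp]: "Dom D (a \<Gamma>) = Fo F \<Gamma>" and Cod_a [simp]: "Cod D (a \<Gamma>) = Fo G \<Gamma>"
  using natural assms by (auto simp: is_nat_def)

lemma a_pullback:
  "\<Gamma> \<in> Ob C \<Longrightarrow> B \<in> Ob (ty D (Fo G \<Gamma>)) \<Longrightarrow>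
    is_pullback D (a \<Gamma>) (Prj D (Fo G \<Gamma>) B) (Prj D (Fo F \<Gamma>) (tsb D (a \<Gamma>) B)) (q_ext D (Fo G \<Gamma>) B (a \<Gamma>))"
  using q_ext_pullback[of D "Fo G \<Gamma>" B "a \<Gamma>"] by simp

lemma a_natural: "u \<in> Ar C \<Longrightarrow> Dom C u = \<Delta> \<Longrightarrow> Cod C u = \<Gamma> \<Longrightarrow> Cmp D (a \<Gamma>) (Fa F u) = Cmp D (Fa G u) (a \<Delta>)"
  using natural by (auto simp: is_nat_def)

text \<open>The square that relates \<open>\<phi>\<close> to \<open>a\<close> at
  \<open>\<Gamma>.A\<close>. The codomain of \<open>\<phi>\<close> is substituted along
  \<open>a \<Gamma>\<close>, hence the \<open>q_ext\<close>; the two \<open>tau\<close> replace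
  \<open>F (\<Gamma>.A)\<close> and \<open>G (\<Gamma>.A)\<close> by extensions of
  \<open>F \<Gamma>\<close> and \<open>G \<Gamma>\<close>.\<close>

definition compatible :: "'u \<Rightarrow> 'u \<Rightarrow> 'u \<Rightarrow> bool" where
  "compatible \<Gamma> A \<phi> \<longleftrightarrow> \<phi> \<in> Ar (ty D (Fo F \<Gamma>)) \<and> Dom (ty D (Fo F \<Gamma>)) \<phi> = Fo (nTp F \<Gamma>) A \<and>
     Cod (ty D (Fo F \<Gamma>)) \<phi> = tsb D (a \<Gamma>) (Fo (nTp G \<Gamma>) A) \<and>
     Cmp D (q_ext D (Fo G \<Gamma>) (Fo (nTp G \<Gamma>) A) (a \<Gamma>)) (Cmp D (comp_ar D (Fo F \<Gamma>) \<phi>) (tau F \<Gamma> A)) =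
     Cmp D (tau G \<Gamma> A) (a (ext C \<Gamma> A))"

text \<open>The component of \<open>a\<close> at \<open>\<Gamma>.A\<close>, conjugated with the two
  comparisons, lies over \<open>a \<Gamma>\<close> by naturality at the projection. It therefore
  factors through the pullback along \<open>a \<Gamma>\<close>, and fullness of comprehension turns
  the factor into an arrow of types.\<close>

lemma compatible_ex:
  assumes G: "\<Gamma> \<in> Ob C" and A: "A \<in> Ob (ty C \<Gamma>)"
  shows "\<exists>\<phi>. compatible \<Gamma> A \<phi>"
proof -
  let ?FA = "Fo (nTp F \<Gamma>) A" and ?GA = "Fo (nTp G \<Gamma>) A"
  let ?b = "Cmp D (tau G \<Gamma> A) (Cmp D (a (ext C \<Gamma> A)) (inv_ar D (tau F \<Gamma> A)))"
  let ?p = "Prj D (Fo F \<Gamma>) ?FA"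
  have b: "?b \<in> Ar D" "Dom D ?b = Dom D ?p" "Cod D ?b = ext D (Fo G \<Gamma>) ?GA" using G A by auto
  have "Cmp D (Prj D (Fo G \<Gamma>) ?GA) ?b = Cmp D (Fa G (Prj C \<Gamma> A)) (Cmp D (a (ext C \<Gamma> A)) (inv_ar D (tau F \<Gamma> A)))"
    using G A by (intro Cmp_reassoc[OF G.Prj_tau]) auto
  also have "\<dots> = Cmp D (Cmp D (a \<Gamma>) (Fa F (Prj C \<Gamma> A))) (inv_ar D (tau F \<Gamma> A))"
    using G A by (simp add: a_natural[of "Prj C \<Gamma> A" "ext C \<Gamma> A" \<Gamma>])
  also have "\<dots> = Cmp D (a \<Gamma>) ?p" using G A by (simp add: F.Prj_inv_tau)
  finally have e: "Cmp D (a \<Gamma>) ?p = Cmp D (Prj D (Fo G \<Gamma>) ?GA) ?b" ..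
  obtain h where h: "h \<in> Ar D" "Dom D h = Dom D ?p" "Cod D h = ext D (Fo F \<Gamma>) (tsb D (a \<Gamma>) ?GA)"
    "Cmp D (Prj D (Fo F \<Gamma>) (tsb D (a \<Gamma>) ?GA)) h = ?p" "Cmp D (q_ext D (Fo G \<Gamma>) ?GA (a \<Gamma>)) h = ?b"
    by (rule pullback_ex[OF q_ext_pullback[of D "Fo G \<Gamma>" ?GA "a \<Gamma>"], of ?p ?b]) (use G A b e in auto)
  obtain \<phi> where p: "\<phi> \<in> Ar (ty D (Fo F \<Gamma>))" "Dom (ty D (Fo F \<Gamma>)) \<phi> = ?FA"
    "Cod (ty D (Fo F \<Gamma>)) \<phi> = tsb D (a \<Gamma>) ?GA" "comp_ar D (Fo F \<Gamma>) \<phi> = h"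
    using comp_ar_full[OF natm, of "Fo F \<Gamma>" ?FA "tsb D (a \<Gamma>) ?GA" h] G A h by auto
  have "Cmp D (q_ext D (Fo G \<Gamma>) ?GA (a \<Gamma>)) (Cmp D h (tau F \<Gamma> A)) = Cmp D ?b (tau F \<Gamma> A)"
    using G A h by (intro Cmp_reassoc) auto
  also have "\<dots> = Cmp D (tau G \<Gamma> A) (a (ext C \<Gamma> A))" using G A by (simp add: inv_left)
  finally have "compatible \<Gamma> A \<phi>" using p by (simp add: compatible_def)
  then show ?thesis ..
qed

text \<open>The isomorphism \<open>tau F\<close> cancels, the pullback projections are jointly
  monic, and comprehension is faithful.\<close>

lemma compatible_unique:
  assumes G: "\<Gamma> \<in> Ob C" and A: "A \<in> Ob (ty C \<Gamma>)" and p: "compatible \<Gamma> A \<phi>" and q: "compatible \<Gamma> A \<psi>"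
  shows "\<phi> = \<psi>"
proof -
  let ?FA = "Fo (nTp F \<Gamma>) A" and ?GA = "Fo (nTp G \<Gamma>) A"
  let ?q = "q_ext D (Fo G \<Gamma>) ?GA (a \<Gamma>)" and ?c = "comp_ar D (Fo F \<Gamma>)"
  have ar: "?c x \<in> Ar D" "Dom D (?c x) = ext D (Fo F \<Gamma>) ?FA" "Cod D (?c x) = ext D (Fo F \<Gamma>) (tsb D (a \<Gamma>) ?GA)"
      "Cmp D (Prj D (Fo F \<Gamma>) (tsb D (a \<Gamma>) ?GA)) (?c x) = Prj D (Fo F \<Gamma>) ?FA"
    if "compatible \<Gamma> A x" for x
    using that G Prj_comp_ar[of D "Fo F \<Gamma>" x] by (auto simp: compatible_def)
  note arp = ar[OF p] and arq = ar[OF q]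
  have "Cmp D (Cmp D ?q (?c \<phi>)) (tau F \<Gamma> A) = Cmp D (Cmp D ?q (?c \<psi>)) (tau F \<Gamma> A)"
    using p q arp arq G A by (simp add: compatible_def)
  then have qq: "Cmp D ?q (?c \<phi>) = Cmp D ?q (?c \<psi>)"
    using iso_cancel_right[of D "tau F \<Gamma> A" "Cmp D ?q (?c \<phi>)" "Cmp D ?q (?c \<psi>)"] arp arq G A by simp
  have "?c \<phi> = ?c \<psi>"
    by (rule pullback_eq[OF _ a_pullback _ _ _ _ _ _ qq]) (use arp arq G A in auto)
  then show ?thesis
    using comp_ar_faithful[OF natm, of "Fo F \<Gamma>" \<phi> \<psi>] \<open>compatible \<Gamma> A \<phi>\<close> \<open>compatible \<Gamma> A \<psi>\<close> G
    by (simp add: compatible_def)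
qed

definition trans_ty :: "'u \<Rightarrow> 'u \<Rightarrow> 'u" where
  "trans_ty = (\<lambda>\<Gamma>\<in>Ob C. \<lambda>A\<in>Ob (ty C \<Gamma>). THE \<phi>. compatible \<Gamma> A \<phi>)"

definition trans_tm :: "'u \<Rightarrow> 'u \<Rightarrow> 'u" where
  "trans_tm = (\<lambda>\<Gamma>\<in>Ob C. \<lambda>t\<in>Ob (tm C \<Gamma>). lift D (Fo F \<Gamma>) (Fo (nTm F \<Gamma>) t) (trans_ty \<Gamma> (tyof C \<Gamma> t)))"

lemma trans_ty_compatible:
  assumes "\<Gamma> \<in> Ob C" "A \<in> Ob (ty C \<Gamma>)"
  shows "compatible \<Gamma> A (trans_ty \<Gamma> A)"
proof -
  obtain x where x: "compatible \<Gamma> A x" using compatible_ex assms by blast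
  then have "(THE \<phi>. compatible \<Gamma> A \<phi>) = x" by (rule the_equality) (use compatible_unique assms x in blast)
  then show ?thesis using x assms by (simp add: trans_ty_def)
qed

lemma
  assumes "\<Gamma> \<in> Ob C" "A \<in> Ob (ty C \<Gamma>)"
  shows trans_ty_ar [simp]: "trans_ty \<Gamma> A \<in> Ar (ty D (Fo F \<Gamma>))"
    and Dom_trans_ty [simp]: "Dom (ty D (Fo F \<Gamma>)) (trans_ty \<Gamma> A) = Fo (nTp F \<Gamma>) A"
    and Cod_trans_ty [simp]: "Cod (ty D (Fo F \<Gamma>)) (trans_ty \<Gamma> A) = tsb D (a \<Gamma>) (Fo (nTp G \<Gamma>) A)"
    and comp_trans_ty: "Cmp D (q_ext D (Fo G \<Gamma>) (Fo (nTp G \<Gamma>) A) (a \<Gamma>)) (Cmp D (comp_ar D (Fo F \<Gamma>) (trans_ty \<Gamma> A)) (tau F \<Gamma> A)) =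
     Cmp D (tau G \<Gamma> A) (a (ext C \<Gamma> A))"
  using trans_ty_compatible[OF assms] by (auto simp: compatible_def)

lemma
  assumes "\<Gamma> \<in> Ob C" "A \<in> Ob (ty C \<Gamma>)"
  shows comp_trans_ar [simp]: "comp_ar D (Fo F \<Gamma>) (trans_ty \<Gamma> A) \<in> Ar D"
    and Dom_comp_trans [simp]: "Dom D (comp_ar D (Fo F \<Gamma>) (trans_ty \<Gamma> A)) = ext D (Fo F \<Gamma>) (Fo (nTp F \<Gamma>) A)"
    and Cod_comp_trans [simp]: "Cod D (comp_ar D (Fo F \<Gamma>) (trans_ty \<Gamma> A)) = ext D (Fo F \<Gamma>) (tsb D (a \<Gamma>) (Fo (nTp G \<Gamma>) A))"
  using assms by auto

text \<open>By faithfulness it suffices to compare comprehensions, which end in a pullback along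
  \<open>a \<Gamma>\<close>. Their projections to \<open>F \<Gamma>\<close> agree because both are
  maps over it; the other component is computed after precomposing with the isomorphism
  \<open>tau F\<close>, from naturality of \<open>a\<close> at \<open>\<Gamma>.f\<close>.\<close>

lemma trans_ty_natural:
  assumes G: "\<Gamma> \<in> Ob C" and f: "f \<in> Ar (ty C \<Gamma>)"
  shows "Cmp (ty D (Fo F \<Gamma>)) (trans_ty \<Gamma> (Cod (ty C \<Gamma>) f)) (Fa (nTp F \<Gamma>) f) =
    Cmp (ty D (Fo F \<Gamma>)) (tsa D (a \<Gamma>) (Fa (nTp G \<Gamma>) f)) (trans_ty \<Gamma> (Dom (ty C \<Gamma>) f))" (is "?l = ?r")
proof (rule comp_ar_faithful[OF natm, of "Fo F \<Gamma>"])
  let ?A = "Dom (ty C \<Gamma>) f" and ?B = "Cod (ty C \<Gamma>) f" and ?c = "comp_ar D (Fo F \<Gamma>)"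
  let ?Ff = "Fa (nTp F \<Gamma>) f" and ?Gf = "Fa (nTp G \<Gamma>) f"
  let ?GA = "Fo (nTp G \<Gamma>) ?A" and ?GB = "Fo (nTp G \<Gamma>) ?B"
  have AB: "?A \<in> Ob (ty C \<Gamma>)" "?B \<in> Ob (ty C \<Gamma>)" using G f by auto
  note [simp] = comp_ar_ar[of D "Fo F \<Gamma>" ?Ff] Dom_comp_ar[of D "Fo F \<Gamma>" ?Ff] Cod_comp_ar[of D "Fo F \<Gamma>" ?Ff]
    comp_ar_ar[of D "Fo G \<Gamma>" ?Gf] Dom_comp_ar[of D "Fo G \<Gamma>" ?Gf] Cod_comp_ar[of D "Fo G \<Gamma>" ?Gf]
    comp_ar_ar[of D "Fo F \<Gamma>" "tsa D (a \<Gamma>) ?Gf"] Dom_comp_ar[of D "Fo F \<Gamma>" "tsa D (a \<Gamma>) ?Gf"] Cod_comp_ar[of D "Fo F \<Gamma>" "tsa D (a \<Gamma>) ?Gf"]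
  let ?qA = "q_ext D (Fo G \<Gamma>) ?GA (a \<Gamma>)" and ?qB = "q_ext D (Fo G \<Gamma>) ?GB (a \<Gamma>)"
  have l: "?c ?l = Cmp D (?c (trans_ty \<Gamma> ?B)) (?c ?Ff)" and r: "?c ?r = Cmp D (?c (tsa D (a \<Gamma>) ?Gf)) (?c (trans_ty \<Gamma> ?A))"
    using G f AB by (auto simp: comp_ar_Cmp)
  have "Cmp D (Cmp D ?qB (?c ?l)) (tau F \<Gamma> ?A) = Cmp D ?qB (Cmp D (?c (trans_ty \<Gamma> ?B)) (Cmp D (?c ?Ff) (tau F \<Gamma> ?A)))"
    using G f AB by (simp add: l)
  also have "\<dots> = Cmp D (Cmp D ?qB (Cmp D (?c (trans_ty \<Gamma> ?B)) (tau F \<Gamma> ?B))) (Fa F (comp_ar C \<Gamma> f))"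
    using G f AB by (simp add: F.tau_comp_ar[symmetric])
  also have "\<dots> = Cmp D (tau G \<Gamma> ?B) (Cmp D (a (ext C \<Gamma> ?B)) (Fa F (comp_ar C \<Gamma> f)))"
    using G f AB by (simp only: comp_trans_ty) simp
  also have "\<dots> = Cmp D (Cmp D (tau G \<Gamma> ?B) (Fa G (comp_ar C \<Gamma> f))) (a (ext C \<Gamma> ?A))"
    using G f AB a_natural[of "comp_ar C \<Gamma> f"] by simp
  also have "\<dots> = Cmp D (comp_ar D (Fo G \<Gamma>) ?Gf) (Cmp D (tau G \<Gamma> ?A) (a (ext C \<Gamma> ?A)))"
    using G f AB by (simp add: G.tau_comp_ar)
  also have "\<dots> = Cmp D (Cmp D (comp_ar D (Fo G \<Gamma>) ?Gf) ?qA) (Cmp D (?c (trans_ty \<Gamma> ?A)) (tau F \<Gamma> ?A))"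
    using G f AB by (simp add: comp_trans_ty[symmetric])
  also have "Cmp D (comp_ar D (Fo G \<Gamma>) ?Gf) ?qA = Cmp D ?qB (?c (tsa D (a \<Gamma>) ?Gf))"
    using q_ext_comp_ar[of D "Fo G \<Gamma>" ?Gf "a \<Gamma>"] G f AB by simp
  also have "Cmp D (Cmp D ?qB (?c (tsa D (a \<Gamma>) ?Gf))) (Cmp D (?c (trans_ty \<Gamma> ?A)) (tau F \<Gamma> ?A)) =
      Cmp D (Cmp D ?qB (?c ?r)) (tau F \<Gamma> ?A)"
    using G f AB by (simp add: r)
  finally have e: "Cmp D (Cmp D ?qB (?c ?l)) (tau F \<Gamma> ?A) = Cmp D (Cmp D ?qB (?c ?r)) (tau F \<Gamma> ?A)" .
  have q: "Cmp D ?qB (?c ?l) = Cmp D ?qB (?c ?r)"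
    by (rule iso_cancel_right[OF _ _ _ _ _ _ e]) (use G f AB in \<open>auto simp: l r\<close>)
  have p: "Cmp D (Prj D (Fo F \<Gamma>) (tsb D (a \<Gamma>) ?GB)) (?c ?l) = Cmp D (Prj D (Fo F \<Gamma>) (tsb D (a \<Gamma>) ?GB)) (?c ?r)"
    using Prj_comp_ar[of D "Fo F \<Gamma>" ?l] Prj_comp_ar[of D "Fo F \<Gamma>" ?r] G f AB by (simp del: Cmp_assoc)
  show "?c ?l = ?c ?r"
    by (rule pullback_eq[OF _ a_pullback _ _ _ _ _ p q])
       (use G f AB in \<open>auto simp: l r\<close>)
qed (use G f in auto)

text \<open>The substituted component satisfies the square that characterises the component at
  \<open>A[u]\<close>. Both sides of that square end in a pullback along \<open>G u\<close>, so they
  are compared after its two projections.\<close>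

lemma trans_ty_tsb:
  assumes u: "u \<in> Ar C" and A: "A \<in> Ob (ty C (Cod C u))"
  shows "trans_ty (Dom C u) (tsb C u A) = tsa D (Fa F u) (trans_ty (Cod C u) A)"
proof (rule compatible_unique[of "Dom C u" "tsb C u A"])
  let ?\<Gamma> = "Cod C u" and ?\<Delta> = "Dom C u" and ?uA = "tsb C u A"
  let ?GA = "Fo (nTp G ?\<Gamma>) A" and ?\<phi> = "trans_ty ?\<Gamma> A"
  let ?u\<phi> = "tsa D (Fa F u) ?\<phi>"
  have G: "?\<Gamma> \<in> Ob C" "?\<Delta> \<in> Ob C" and uA: "?uA \<in> Ob (ty C ?\<Delta>)" using u A by auto
  \<comment> \<open>Naturality of \<open>a\<close> at \<open>u\<close>, read on types; it gives the
    candidate the right codomain.\<close>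
  have e: "tsb D (Fa F u) (tsb D (a ?\<Gamma>) ?GA) = tsb D (a ?\<Delta>) (tsb D (Fa G u) ?GA)"
    using u A G a_natural[OF u refl refl] by (simp add: tsb_Cmp[symmetric])
  have p: "?u\<phi> \<in> Ar (ty D (Fo F ?\<Delta>))" "Dom (ty D (Fo F ?\<Delta>)) ?u\<phi> = Fo (nTp F ?\<Delta>) ?uA"
    "Cod (ty D (Fo F ?\<Delta>)) ?u\<phi> = tsb D (a ?\<Delta>) (Fo (nTp G ?\<Delta>) ?uA)"
    using u A G e by auto
  note [simp] = comp_ar_ar[OF F.D _ p(1)] Dom_comp_ar[OF F.D _ p(1)] Cod_comp_ar[OF F.D _ p(1)]
  let ?l = "Cmp D (q_ext D (Fo G ?\<Delta>) (Fo (nTp G ?\<Delta>) ?uA) (a ?\<Delta>)) (Cmp D (comp_ar D (Fo F ?\<Delta>) ?u\<phi>) (tau F ?\<Delta> ?uA))"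
  let ?r = "Cmp D (tau G ?\<Delta> ?uA) (a (ext C ?\<Delta> ?uA))"
  let ?qG = "q_ext D (Fo G ?\<Gamma>) ?GA (Fa G u)"
  have "Cmp D ?qG ?l = Cmp D (Cmp D ?qG (q_ext D (Fo G ?\<Delta>) (tsb D (Fa G u) ?GA) (a ?\<Delta>))) (Cmp D (comp_ar D (Fo F ?\<Delta>) ?u\<phi>) (tau F ?\<Delta> ?uA))"
    using u A G uA p e by simp
  also have "Cmp D ?qG (q_ext D (Fo G ?\<Delta>) (tsb D (Fa G u) ?GA) (a ?\<Delta>)) = q_ext D (Fo G ?\<Gamma>) ?GA (Cmp D (Fa G u) (a ?\<Delta>))"
    using q_ext_Cmp[of D "Fa G u" "a ?\<Delta>" ?GA] u A G by simp
  also have "\<dots> = Cmp D (q_ext D (Fo G ?\<Gamma>) ?GA (a ?\<Gamma>)) (q_ext D (Fo F ?\<Gamma>) (tsb D (a ?\<Gamma>) ?GA) (Fa F u))"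
    using q_ext_Cmp[of D "a ?\<Gamma>" "Fa F u" ?GA] u A G a_natural[OF u refl refl] by simp
  also have "Cmp D \<dots> (Cmp D (comp_ar D (Fo F ?\<Delta>) ?u\<phi>) (tau F ?\<Delta> ?uA)) =
      Cmp D (q_ext D (Fo G ?\<Gamma>) ?GA (a ?\<Gamma>)) (Cmp D (Cmp D (q_ext D (Fo F ?\<Gamma>) (tsb D (a ?\<Gamma>) ?GA) (Fa F u)) (comp_ar D (Fo F ?\<Delta>) ?u\<phi>)) (tau F ?\<Delta> ?uA))"
    using u A G uA p e by simp
  also have "Cmp D (q_ext D (Fo F ?\<Gamma>) (tsb D (a ?\<Gamma>) ?GA) (Fa F u)) (comp_ar D (Fo F ?\<Delta>) ?u\<phi>) =
      Cmp D (comp_ar D (Fo F ?\<Gamma>) ?\<phi>) (q_ext D (Fo F ?\<Gamma>) (Fo (nTp F ?\<Gamma>) A) (Fa F u))"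
    using q_ext_comp_ar[of D "Fo F ?\<Gamma>" ?\<phi> "Fa F u"] u A G by simp
  also have "Cmp D (q_ext D (Fo G ?\<Gamma>) ?GA (a ?\<Gamma>)) (Cmp D \<dots> (tau F ?\<Delta> ?uA)) =
      Cmp D (q_ext D (Fo G ?\<Gamma>) ?GA (a ?\<Gamma>)) (Cmp D (comp_ar D (Fo F ?\<Gamma>) ?\<phi>) (Cmp D (q_ext D (Fo F ?\<Gamma>) (Fo (nTp F ?\<Gamma>) A) (Fa F u)) (tau F ?\<Delta> ?uA)))"
    using u A G uA by simp
  also have "\<dots> = Cmp D (Cmp D (q_ext D (Fo G ?\<Gamma>) ?GA (a ?\<Gamma>)) (Cmp D (comp_ar D (Fo F ?\<Gamma>) ?\<phi>) (tau F ?\<Gamma> A))) (Fa F (q_ext C ?\<Gamma> A u))"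
    using u A G uA by (simp add: F.tau_q_ext[symmetric])
  also have "\<dots> = Cmp D (tau G ?\<Gamma> A) (Cmp D (a (ext C ?\<Gamma> A)) (Fa F (q_ext C ?\<Gamma> A u)))"
    using u A G uA by (simp only: comp_trans_ty) simp
  also have "\<dots> = Cmp D (Cmp D (tau G ?\<Gamma> A) (Fa G (q_ext C ?\<Gamma> A u))) (a (ext C ?\<Delta> ?uA))"
    using u A G uA a_natural[of "q_ext C ?\<Gamma> A u"] by simp
  also have "\<dots> = Cmp D ?qG ?r" using u A G uA by (simp add: G.tau_q_ext)
  finally have q: "Cmp D ?qG ?l = Cmp D ?qG ?r" .
  have "Cmp D (Prj D (Fo G ?\<Delta>) (tsb D (Fa G u) ?GA)) ?l =
      Cmp D (a ?\<Delta>) (Cmp D (Prj D (Fo F ?\<Delta>) (Fo (nTp F ?\<Delta>) ?uA)) (tau F ?\<Delta> ?uA))"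
    using Cmp_reassoc[OF Prj_q_ext[of D "Fo G ?\<Delta>" "tsb D (Fa G u) ?GA" "a ?\<Delta>"], of "Cmp D (comp_ar D (Fo F ?\<Delta>) ?u\<phi>) (tau F ?\<Delta> ?uA)"]
      Cmp_reassoc[OF Prj_comp_ar[OF F.D _ p(1)], of "tau F ?\<Delta> ?uA"] u A G uA p e by simp
  also have "\<dots> = Cmp D (a ?\<Delta>) (Fa F (Prj C ?\<Delta> ?uA))" using F.Prj_tau[OF G(2) uA] by simp
  also have "\<dots> = Cmp D (Fa G (Prj C ?\<Delta> ?uA)) (a (ext C ?\<Delta> ?uA))" using G uA by (simp add: a_natural)
  also have "\<dots> = Cmp D (Prj D (Fo G ?\<Delta>) (tsb D (Fa G u) ?GA)) ?r"
    using Cmp_reassoc[OF G.Prj_tau[OF G(2) uA], of "a (ext C ?\<Delta> ?uA)"] u A G uA by simp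
  finally have pr: "Cmp D (Prj D (Fo G ?\<Delta>) (tsb D (Fa G u) ?GA)) ?l = Cmp D (Prj D (Fo G ?\<Delta>) (tsb D (Fa G u) ?GA)) ?r" .
  have "is_pullback D (Fa G u) (Prj D (Fo G ?\<Gamma>) ?GA) (Prj D (Fo G ?\<Delta>) (tsb D (Fa G u) ?GA)) ?qG"
    using q_ext_pullback[of D "Fo G ?\<Gamma>" ?GA "Fa G u"] u A G by simp
  from pullback_eq[OF _ this _ _ _ _ _ pr q] have "?l = ?r" using u A G uA p e by simp
  then show "compatible ?\<Delta> ?uA ?u\<phi>" using p by (simp add: compatible_def)
qed (use u A trans_ty_compatible in auto)

text \<open>The lift that defines the term component has the right source by construction; this
  lemma supplies its target. The two terms are compared through their sections, where the
  compatibility square and naturality of \<open>a\<close> at the section of \<open>t\<close>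
  apply.\<close>

lemma push_trans_ty:
  assumes G: "\<Gamma> \<in> Ob C" and t: "t \<in> Ob (tm C \<Gamma>)"
  shows "push D (Fo F \<Gamma>) (Fo (nTm F \<Gamma>) t) (trans_ty \<Gamma> (tyof C \<Gamma> t)) = msb D (a \<Gamma>) (Fo (nTm G \<Gamma>) t)"
proof -
  let ?A = "tyof C \<Gamma> t" and ?Ft = "Fo (nTm F \<Gamma>) t" and ?Gt = "Fo (nTm G \<Gamma>) t"
  let ?FA = "Fo (nTp F \<Gamma>) ?A" and ?GA = "Fo (nTp G \<Gamma>) ?A" and ?\<phi> = "trans_ty \<Gamma> ?A"
  let ?c = "comp_ar D (Fo F \<Gamma>) ?\<phi>" and ?q = "q_ext D (Fo G \<Gamma>) ?GA (a \<Gamma>)"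
  have A: "?A \<in> Ob (ty C \<Gamma>)" using G t by simp
  have s: "sect D (Fo F \<Gamma>) ?Ft \<in> Ar D" "Dom D (sect D (Fo F \<Gamma>) ?Ft) = Fo F \<Gamma>" "Cod D (sect D (Fo F \<Gamma>) ?Ft) = ext D (Fo F \<Gamma>) ?FA"
    using G t A by auto
  let ?p = "push D (Fo F \<Gamma>) ?Ft ?\<phi>"
  have p: "?p \<in> Ob (tm D (Fo F \<Gamma>))" "tyof D (Fo F \<Gamma>) ?p = tsb D (a \<Gamma>) ?GA" using G t A by auto
  have "sect D (Fo F \<Gamma>) ?p = Cmp D ?c (sect D (Fo F \<Gamma>) ?Ft)"
    using G t A by (intro sect_push) auto
  then have "Cmp D ?q (sect D (Fo F \<Gamma>) ?p) = Cmp D ?q (Cmp D ?c (Cmp D (tau F \<Gamma> ?A) (Fa F (sect C \<Gamma> t))))"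
    using G t by (simp add: F.tau_sect)
  also have "\<dots> = Cmp D (Cmp D ?q (Cmp D ?c (tau F \<Gamma> ?A))) (Fa F (sect C \<Gamma> t))"
    using G t A by simp
  also have "\<dots> = Cmp D (tau G \<Gamma> ?A) (Cmp D (a (ext C \<Gamma> ?A)) (Fa F (sect C \<Gamma> t)))"
    using G t A by (simp only: comp_trans_ty) simp
  also have "\<dots> = Cmp D (Cmp D (tau G \<Gamma> ?A) (Fa G (sect C \<Gamma> t))) (a \<Gamma>)"
    using G t A a_natural[of "sect C \<Gamma> t"] by simp
  also have "\<dots> = Cmp D (sect D (Fo G \<Gamma>) ?Gt) (a \<Gamma>)" using G t by (simp add: G.tau_sect)
  finally have e: "Cmp D ?q (sect D (Fo F \<Gamma>) ?p) = Cmp D (sect D (Fo G \<Gamma>) ?Gt) (a \<Gamma>)" .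
  have "?p = msb D (sect D (Fo F \<Gamma>) ?p) (Var D (Fo F \<Gamma>) (tsb D (a \<Gamma>) ?GA))"
    using Var_sect[of D "Fo F \<Gamma>" ?p] p G by simp
  also have "\<dots> = msb D (sect D (Fo F \<Gamma>) ?p) (msb D ?q (Var D (Fo G \<Gamma>) ?GA))"
    using G A by (simp add: Var_q_ext)
  also have "\<dots> = msb D (Cmp D ?q (sect D (Fo F \<Gamma>) ?p)) (Var D (Fo G \<Gamma>) ?GA)"
    using sect_ar[of D "Fo F \<Gamma>" ?p] Cod_sect[of D "Fo F \<Gamma>" ?p] p G A by (intro msb_Cmp[symmetric]) auto
  also have "\<dots> = msb D (a \<Gamma>) (msb D (sect D (Fo G \<Gamma>) ?Gt) (Var D (Fo G \<Gamma>) ?GA))"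
    using G t A by (simp add: e msb_Cmp)
  also have "\<dots> = msb D (a \<Gamma>) ?Gt" using Var_sect[of D "Fo G \<Gamma>" ?Gt] G t by simp
  finally show ?thesis .
qed

lemma
  assumes "\<Gamma> \<in> Ob C" "t \<in> Ob (tm C \<Gamma>)"
  shows trans_tm_ar [simp]: "trans_tm \<Gamma> t \<in> Ar (tm D (Fo F \<Gamma>))"
    and Dom_trans_tm [simp]: "Dom (tm D (Fo F \<Gamma>)) (trans_tm \<Gamma> t) = Fo (nTm F \<Gamma>) t"
    and Cod_trans_tm [simp]: "Cod (tm D (Fo F \<Gamma>)) (trans_tm \<Gamma> t) = msb D (a \<Gamma>) (Fo (nTm G \<Gamma>) t)"
    and tyofa_trans_tm [simp]: "tyofa D (Fo F \<Gamma>) (trans_tm \<Gamma> t) = trans_ty \<Gamma> (tyof C \<Gamma> t)"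
  using assms push_trans_ty[OF assms] by (auto simp: trans_tm_def push_def)

lemma trans_ty_indexed: "indexed_nat C F a (Tp C) (Tp D) (nTp F) (nTp G) trans_ty"
  unfolding indexed_nat_def is_nat_def using trans_ty_natural trans_ty_tsb by auto

lemma trans_tm_indexed: "indexed_nat C F a (Tm C) (Tm D) (nTm F) (nTm G) trans_tm"
  unfolding indexed_nat_def is_nat_def
proof (intro conjI ballI)
  fix \<Gamma> g assume G: "\<Gamma> \<in> Ob C" and g: "g \<in> Ar (tm C \<Gamma>)"
  have PC: "tyofa D (Fo F \<Gamma>) (Cmp (tm D (Fo F \<Gamma>)) y x) = Cmp (ty D (Fo F \<Gamma>)) (tyofa D (Fo F \<Gamma>) y) (tyofa D (Fo F \<Gamma>) x)"
    if "x \<in> Ar (tm D (Fo F \<Gamma>))" "y \<in> Ar (tm D (Fo F \<Gamma>))" "Cod (tm D (Fo F \<Gamma>)) x = Dom (tm D (Fo F \<Gamma>)) y" for x y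
    using functor_Cmp[OF Pr_functor[of D "Fo F \<Gamma>"]] that G by simp
  have "Cmp (tm D (Fo F \<Gamma>)) (trans_tm \<Gamma> (Cod (tm C \<Gamma>) g)) (Fa (nTm F \<Gamma>) g) =
    Cmp (tm D (Fo F \<Gamma>)) (msa D (a \<Gamma>) (Fa (nTm G \<Gamma>) g)) (trans_tm \<Gamma> (Dom (tm C \<Gamma>) g))"
    by (rule arrow_of_terms_eq[of D "Fo F \<Gamma>"])
      (use G g trans_ty_natural[OF G, of "tyofa C \<Gamma> g"] in \<open>auto simp: PC\<close>)
  then show "Cmp (tm D (Fo F \<Gamma>)) (trans_tm \<Gamma> (Cod (tm C \<Gamma>) g)) (Fa (nTm F \<Gamma>) g) =
    Cmp (tm D (Fo F \<Gamma>)) (Fa (cmp_fct (tm C \<Gamma>) (Re (Tm D) (a \<Gamma>)) (nTm G \<Gamma>)) g) (trans_tm \<Gamma> (Dom (tm C \<Gamma>) g))"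
    using g by simp
next
  fix u t assume u: "u \<in> Ar C" and t: "t \<in> Ob (tm C (Cod C u))"
  show "trans_tm (Dom C u) (msb C u t) = msa D (Fa F u) (trans_tm (Cod C u) t)"
    by (rule arrow_of_terms_eq[of D "Fo F (Dom C u)"])
      (use u t trans_ty_tsb[of u "tyof C (Cod C u) t"] in auto)
qed auto

text \<open>At the generic term of \<open>\<Gamma>.A\<close> the codomain of \<open>y\<close> is
  prescribed, which is a statement about transport along the substituted
  \<open>x \<Gamma> A\<close>. It is the generic-term half of the compatibility square, so
  \<open>x\<close> is forced; \<open>y\<close> is then forced as a lift of \<open>x\<close>.\<close>

lemma trans_unique:
  assumes ty: "indexed_nat C F a (Tp C) (Tp D) (nTp F) (nTp G) x"
    and tm: "indexed_nat C F a (Tm C) (Tm D) (nTm F) (nTm G) y"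
    and xy: "\<And>\<Gamma> t. \<Gamma> \<in> Ob C \<Longrightarrow> t \<in> Ob (tm C \<Gamma>) \<Longrightarrow> tyofa D (Fo F \<Gamma>) (y \<Gamma> t) = x \<Gamma> (tyof C \<Gamma> t)"
    and G: "\<Gamma> \<in> Ob C"
  shows "A \<in> Ob (ty C \<Gamma>) \<Longrightarrow> x \<Gamma> A = trans_ty \<Gamma> A" "t \<in> Ob (tm C \<Gamma>) \<Longrightarrow> y \<Gamma> t = trans_tm \<Gamma> t"
proof -
  have x: "x \<Gamma> A \<in> Ar (ty D (Fo F \<Gamma>))" "Dom (ty D (Fo F \<Gamma>)) (x \<Gamma> A) = Fo (nTp F \<Gamma>) A"
    "Cod (ty D (Fo F \<Gamma>)) (x \<Gamma> A) = tsb D (a \<Gamma>) (Fo (nTp G \<Gamma>) A)"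
    if "\<Gamma> \<in> Ob C" "A \<in> Ob (ty C \<Gamma>)" for \<Gamma> A
    using ty that by (auto simp: indexed_nat_def is_nat_def)
  have xs: "x (Dom C u) (tsb C u A) = tsa D (Fa F u) (x (Cod C u) A)" if "u \<in> Ar C" "A \<in> Ob (ty C (Cod C u))" for u A
    using ty that by (auto simp: indexed_nat_def)
  have y: "y \<Gamma> t \<in> Ar (tm D (Fo F \<Gamma>))" "Dom (tm D (Fo F \<Gamma>)) (y \<Gamma> t) = Fo (nTm F \<Gamma>) t"
    "Cod (tm D (Fo F \<Gamma>)) (y \<Gamma> t) = msb D (a \<Gamma>) (Fo (nTm G \<Gamma>) t)"
    if "\<Gamma> \<in> Ob C" "t \<in> Ob (tm C \<Gamma>)" for \<Gamma> t
    using tm that by (auto simp: indexed_nat_def is_nat_def)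
  have xA: "x \<Gamma> A = trans_ty \<Gamma> A" if A: "A \<in> Ob (ty C \<Gamma>)" for A
  proof (rule compatible_unique[OF G A])
    let ?GA = "Fo (nTp G \<Gamma>) A" and ?FA = "Fo (nTp F \<Gamma>) A" and ?X = "ext C \<Gamma> A" and ?v = "Var C \<Gamma> A"
    let ?q = "q_ext D (Fo G \<Gamma>) ?GA (a \<Gamma>)" and ?c = "comp_ar D (Fo F \<Gamma>) (x \<Gamma> A)"
    note x' = x[OF G A]
    note [simp] = comp_ar_ar[OF F.D _ x'(1)] Dom_comp_ar[OF F.D _ x'(1)] Cod_comp_ar[OF F.D _ x'(1)]
    have X: "?X \<in> Ob C" "?v \<in> Ob (tm C ?X)" using G A by auto
    have "push D (Fo F ?X) (Fo (nTm F ?X) ?v) (tyofa D (Fo F ?X) (y ?X ?v)) = msb D (a ?X) (Fo (nTm G ?X) ?v)"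
      using push_tyofa[of D "Fo F ?X" "y ?X ?v"] y[OF X] X by simp
    then have pv: "push D (Fo F ?X) (Fo (nTm F ?X) ?v) (tsa D (Fa F (Prj C \<Gamma> A)) (x \<Gamma> A)) = msb D (a ?X) (Fo (nTm G ?X) ?v)"
      using xy[OF X] xs[of "Prj C \<Gamma> A" A] G A by simp
    have "Cmp D ?q (Cmp D ?c (tau F \<Gamma> A)) = Cmp D (tau G \<Gamma> A) (a ?X)"
    proof (rule ext_eq[of D "Fo G \<Gamma>" ?GA])
      have "Cmp D (Prj D (Fo G \<Gamma>) ?GA) (Cmp D ?q (Cmp D ?c (tau F \<Gamma> A))) = Cmp D (a \<Gamma>) (Fa F (Prj C \<Gamma> A))"
        using Cmp_reassoc[OF Prj_q_ext[of D "Fo G \<Gamma>" ?GA "a \<Gamma>"], of "Cmp D ?c (tau F \<Gamma> A)"]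
          Cmp_reassoc[OF Prj_comp_ar[OF F.D _ x'(1)], of "tau F \<Gamma> A"] G A x' by (simp add: F.Prj_tau)
      also have "\<dots> = Cmp D (Prj D (Fo G \<Gamma>) ?GA) (Cmp D (tau G \<Gamma> A) (a ?X))"
        using Cmp_reassoc[OF G.Prj_tau[OF G A], of "a ?X"] G A by (simp add: a_natural)
      finally show "Cmp D (Prj D (Fo G \<Gamma>) ?GA) (Cmp D ?q (Cmp D ?c (tau F \<Gamma> A))) = Cmp D (Prj D (Fo G \<Gamma>) ?GA) (Cmp D (tau G \<Gamma> A) (a ?X))" .
      have "msb D (Cmp D ?q (Cmp D ?c (tau F \<Gamma> A))) (Var D (Fo G \<Gamma>) ?GA) =
          msb D (Cmp D ?c (tau F \<Gamma> A)) (Var D (Fo F \<Gamma>) (tsb D (a \<Gamma>) ?GA))"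
        using G A x' by (simp add: msb_Cmp[of D "Cmp D ?c (tau F \<Gamma> A)" ?q] Var_q_ext)
      also have "\<dots> = msb D (a ?X) (Fo (nTm G ?X) ?v)"
        using Var_comp_ar_Cmp[OF F.D _ x'(1), of "tau F \<Gamma> A"] G A x' pv by (simp add: F.Var_tau F.Prj_tau)
      also have "\<dots> = msb D (Cmp D (tau G \<Gamma> A) (a ?X)) (Var D (Fo G \<Gamma>) ?GA)"
        using G A by (simp add: msb_Cmp G.Var_tau)
      finally show "msb D (Cmp D ?q (Cmp D ?c (tau F \<Gamma> A))) (Var D (Fo G \<Gamma>) ?GA) = msb D (Cmp D (tau G \<Gamma> A) (a ?X)) (Var D (Fo G \<Gamma>) ?GA)" .
    qed (use G A x' in auto)
    then show "compatible \<Gamma> A (x \<Gamma> A)" using x' by (simp add: compatible_def)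
  qed (use G A trans_ty_compatible in auto)
  then show "A \<in> Ob (ty C \<Gamma>) \<Longrightarrow> x \<Gamma> A = trans_ty \<Gamma> A" .
  assume t: "t \<in> Ob (tm C \<Gamma>)"
  show "y \<Gamma> t = trans_tm \<Gamma> t"
    by (rule arrow_of_terms_eq[of D "Fo F \<Gamma>"]) (use y[OF G t] xy[OF G t] xA[of "tyof C \<Gamma> t"] G t in auto)
qed

end


section \<open>Lifting display functors to morphisms of natural models\<close>

text \<open>A display in a pullback square may be replaced by an isomorphic one. This exchanges the
  image of the generic display for a comprehension.\<close>

lemma pullback_iso_right:
  assumes C: "category C" and pb: "is_pullback C f g p q" and i: "is_iso C i" "Dom C i = Dom C g"
    and g': "g' \<in> Ar C" "Dom C g' = Cod C i" "Cmp C g' i = g"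
  shows "is_pullback C f g' p (Cmp C i q)"
proof -
  note p = pullback_ar[OF pb] pullback_bd[OF pb]
  have cg: "Cod C g' = Cod C g" using Cod_Cmp[of C i g'] C i g' by simp
  show ?thesis
  proof (rule is_pullbackI)
    show "Cmp C f p = Cmp C g' (Cmp C i q)"
      using Cmp_reassoc[OF g'(3), of q] pullback_comm[OF pb] C p i g' by simp
  next
    fix a b assume a: "a \<in> Ar C" and b: "b \<in> Ar C" and ab: "Dom C a = Dom C b" "Cod C a = Dom C f"
      "Cod C b = Dom C g'" "Cmp C f a = Cmp C g' b"
    let ?b = "Cmp C (inv_ar C i) b"
    have b': "?b \<in> Ar C" "Dom C ?b = Dom C b" "Cod C ?b = Dom C g" using C i g' b ab by auto
    have "Cmp C g ?b = Cmp C g' (Cmp C i ?b)"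
      using Cmp_reassoc[OF g'(3), of ?b] C b' i g' by simp
    also have "\<dots> = Cmp C f a" using C i g' b ab by (simp add: inv_right_Cmp)
    finally have e: "Cmp C f a = Cmp C g ?b" ..
    obtain h where "h \<in> Ar C" "Dom C h = Dom C a" "Cod C h = Dom C p" "Cmp C p h = a" "Cmp C q h = ?b"
      by (rule pullback_ex[OF pb a b'(1) _ ab(2) b'(3) e]) (use b' ab in auto)
    moreover have "Cmp C i ?b = b" using C i g' b ab by (simp add: inv_right_Cmp)
    ultimately show "\<exists>h. h \<in> Ar C \<and> Dom C h = Dom C a \<and> Cod C h = Dom C p \<and> Cmp C p h = a \<and> Cmp C (Cmp C i q) h = b"
      using C i p by (intro exI[of _ h]) auto
  next
    fix h k assume h: "h \<in> Ar C" "k \<in> Ar C" "Dom C h = Dom C k" "Cod C h = Dom C p" "Cod C k = Dom C p"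
      "Cmp C p h = Cmp C p k" "Cmp C (Cmp C i q) h = Cmp C (Cmp C i q) k"
    have "Cmp C i (Cmp C q h) = Cmp C i (Cmp C q k)" using h C p i by simp
    then have e: "Cmp C q h = Cmp C q k"
      using iso_cancel_left[OF C i(1), of "Cmp C q h" "Cmp C q k"] h C p i by simp
    show "h = k" by (rule pullback_eq[OF C pb h(1,2,4,5,3,6) e])
  qed (use C p i g' cg in auto)
qed

text \<open>
  \<open>A0\<close> is the generic type over the object \<open>E\<close> classifying types, and \<open>B0\<close> is a type whose comprehension
  is isomorphic, through \<open>i0\<close>, to the image of the comprehension of \<open>A0\<close>.
\<close>

locale functor_lift =
  fixes C D :: "'u natmod" and H :: "('u, 'u, 'u, 'u) fct" and E A0 B0 i0 :: 'u
  assumes C [simp]: "prenat C" and D [simp]: "natm D" and H: "display_functor C D H"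
    and E [simp]: "E \<in> Ob C" and A0 [simp]: "A0 \<in> Ob (ty C E)"
    and classify: "\<And>\<Gamma> A. \<Gamma> \<in> Ob C \<Longrightarrow> A \<in> Ob (ty C \<Gamma>) \<Longrightarrow> \<exists>!u. u \<in> hom C \<Gamma> E \<and> tsb C u A0 = A"
    and B0 [simp]: "B0 \<in> Ob (ty D (Fo H E))"
    and i0 [simp]: "is_iso D i0" "Dom D i0 = Fo H (ext C E A0)" "Cod D i0 = ext D (Fo H E) B0"
    and Prj_i0: "Cmp D (Prj D (Fo H E) B0) i0 = Fa H (Prj C E A0)"
begin

lemma is_functor: "is_functor C D H"
  using H by (simp add: display_functor_def)

lemma Ho [simp]: "\<Gamma> \<in> Ob C \<Longrightarrow> Fo H \<Gamma> \<in> Ob D"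
  and Ha [simp]: "u \<in> Ar C \<Longrightarrow> Fa H u \<in> Ar D"
  and Dom_H [simp]: "u \<in> Ar C \<Longrightarrow> Dom D (Fa H u) = Fo H (Dom C u)"
  and Cod_H [simp]: "u \<in> Ar C \<Longrightarrow> Cod D (Fa H u) = Fo H (Cod C u)"
  and H_Idn [simp]: "\<Gamma> \<in> Ob C \<Longrightarrow> Fa H (Idn C \<Gamma>) = Idn D (Fo H \<Gamma>)"
  using is_functor by (auto simp: functor_Dom functor_Cod functor_Idn)

lemma H_Cmp: "f \<in> Ar C \<Longrightarrow> g \<in> Ar C \<Longrightarrow> Cod C f = Dom C g \<Longrightarrow> Fa H (Cmp C g f) = Cmp D (Fa H g) (Fa H f)"
  by (rule functor_Cmp[OF is_functor])

lemmas H_triangle = functor_triangle[OF is_functor] and H_square = functor_square[OF is_functor]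

section \<open>Lifted types and their comparison with the functor on contexts\<close>

definition cls :: "'u \<Rightarrow> 'u \<Rightarrow> 'u" where
  "cls \<Gamma> A = (THE u. u \<in> hom C \<Gamma> E \<and> tsb C u A0 = A)"

lemma
  assumes "\<Gamma> \<in> Ob C" "A \<in> Ob (ty C \<Gamma>)"
  shows cls_ar [simp]: "cls \<Gamma> A \<in> Ar C" and Dom_cls [simp]: "Dom C (cls \<Gamma> A) = \<Gamma>"
    and Cod_cls [simp]: "Cod C (cls \<Gamma> A) = E" and tsb_cls [simp]: "tsb C (cls \<Gamma> A) A0 = A"
  using theI'[OF classify[OF assms], folded cls_def] by auto

lemma cls_unique: "u \<in> Ar C \<Longrightarrow> Cod C u = E \<Longrightarrow> tsb C u A0 = A \<Longrightarrow> Dom C u = \<Gamma> \<Longrightarrow> cls \<Gamma> A = u"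
  using the1_equality[OF classify, of \<Gamma> A u] tsb_ob[of C u \<Gamma> A0] A0 C Dom_ob[of C u] by (simp add: cls_def)

lemma cls_tsb:
  "u \<in> Ar C \<Longrightarrow> Dom C u = \<Delta> \<Longrightarrow> A \<in> Ob (ty C (Cod C u)) \<Longrightarrow> cls \<Delta> (tsb C u A) = Cmp C (cls (Cod C u) A) u"
  by (rule cls_unique) (auto simp: tsb_Cmp)

definition lty :: "'u \<Rightarrow> 'u \<Rightarrow> 'u" where
  "lty \<Gamma> A = tsb D (Fa H (cls \<Gamma> A)) B0"

lemma lty_ob [simp]: "\<Gamma> \<in> Ob C \<Longrightarrow> A \<in> Ob (ty C \<Gamma>) \<Longrightarrow> lty \<Gamma> A \<in> Ob (ty D (Fo H \<Gamma>))"
  by (simp add: lty_def)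

text \<open>The classifying map of \<open>A[u]\<close> is that of \<open>A\<close> composed with
  \<open>u\<close>, so both sides substitute \<open>B0\<close> along the same arrow. This is the
  strictness that a choice made separately for each type would not provide.\<close>

lemma lty_tsb [simp]:
  "u \<in> Ar C \<Longrightarrow> Dom C u = \<Delta> \<Longrightarrow> A \<in> Ob (ty C (Cod C u)) \<Longrightarrow> lty \<Delta> (tsb C u A) = tsb D (Fa H u) (lty (Cod C u) A)"
  by (auto simp: lty_def cls_tsb H_Cmp tsb_Cmp)

text \<open>The comparison between two pullbacks of the display of \<open>B0\<close> along the image
  of the classifying map. Both projections are prescribed, so \<open>SOME\<close> has only one value
  to pick.\<close>

definition ltau :: "'u \<Rightarrow> 'u \<Rightarrow> 'u" where
  "ltau \<Gamma> A = (SOME h. is_iso D h \<and> Dom D h = Fo H (ext C \<Gamma> A) \<and> Cod D h = ext D (Fo H \<Gamma>) (lty \<Gamma> A) \<and>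
     Cmp D (Prj D (Fo H \<Gamma>) (lty \<Gamma> A)) h = Fa H (Prj C \<Gamma> A) \<and>
     Cmp D (q_ext D (Fo H E) B0 (Fa H (cls \<Gamma> A))) h = Cmp D i0 (Fa H (q_ext C E A0 (cls \<Gamma> A))))"

lemma lty_pullback:
  assumes "\<Gamma> \<in> Ob C" "A \<in> Ob (ty C \<Gamma>)"
  shows "is_pullback D (Fa H (cls \<Gamma> A)) (Prj D (Fo H E) B0) (Prj D (Fo H \<Gamma>) (lty \<Gamma> A)) (q_ext D (Fo H E) B0 (Fa H (cls \<Gamma> A)))"
  using q_ext_pullback[of D "Fo H E" B0 "Fa H (cls \<Gamma> A)"] assms by (simp add: lty_def)

lemma
  assumes G: "\<Gamma> \<in> Ob C" and A: "A \<in> Ob (ty C \<Gamma>)"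
  shows ltau_iso [simp]: "is_iso D (ltau \<Gamma> A)"
    and Dom_ltau [simp]: "Dom D (ltau \<Gamma> A) = Fo H (ext C \<Gamma> A)"
    and Cod_ltau [simp]: "Cod D (ltau \<Gamma> A) = ext D (Fo H \<Gamma>) (lty \<Gamma> A)"
    and Prj_ltau: "Cmp D (Prj D (Fo H \<Gamma>) (lty \<Gamma> A)) (ltau \<Gamma> A) = Fa H (Prj C \<Gamma> A)"
    and q_ltau: "Cmp D (q_ext D (Fo H E) B0 (Fa H (cls \<Gamma> A))) (ltau \<Gamma> A) = Cmp D i0 (Fa H (q_ext C E A0 (cls \<Gamma> A)))"
proof -
  let ?u = "cls \<Gamma> A"
  have "is_pullback C ?u (Prj C E A0) (Prj C \<Gamma> A) (q_ext C E A0 ?u)"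
    using q_ext_pullback[of C E A0 ?u] G A by simp
  \<comment> \<open>Here \<open>H\<close> enters as a display functor, preserving a pullback of a
    display. The isomorphism \<open>i0\<close> next replaces the image of the generic display by the
    comprehension of \<open>B0\<close>.\<close>
  then have "is_pullback D (Fa H ?u) (Fa H (Prj C E A0)) (Fa H (Prj C \<Gamma> A)) (Fa H (q_ext C E A0 ?u))"
    using H unfolding display_functor_def by (metis C E A0 Prj_Disp)
  then have pb: "is_pullback D (Fa H ?u) (Prj D (Fo H E) B0) (Fa H (Prj C \<Gamma> A)) (Cmp D i0 (Fa H (q_ext C E A0 ?u)))"
    by (rule pullback_iso_right[rotated]) (auto simp: Prj_i0)
  note p = pullback_ar[OF pb] pullback_bd[OF pb] pullback_comm[OF pb]
  have cod: "Cod D (Cmp D i0 (Fa H (q_ext C E A0 ?u))) = ext D (Fo H E) B0" using p by simp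
  obtain h where h: "h \<in> Ar D" "Dom D h = Dom D (Fa H (Prj C \<Gamma> A))" "Cod D h = Dom D (Prj D (Fo H \<Gamma>) (lty \<Gamma> A))"
    "Cmp D (Prj D (Fo H \<Gamma>) (lty \<Gamma> A)) h = Fa H (Prj C \<Gamma> A)"
    "Cmp D (q_ext D (Fo H E) B0 (Fa H ?u)) h = Cmp D i0 (Fa H (q_ext C E A0 ?u))"
    by (rule pullback_ex[OF lty_pullback[OF G A] p(3,4,6,7,8,9)])
  have "is_iso D h"
    by (rule pullback_comparison_iso[OF _ lty_pullback[OF G A] pb h]) simp
  then have "\<exists>h. is_iso D h \<and> Dom D h = Fo H (ext C \<Gamma> A) \<and> Cod D h = ext D (Fo H \<Gamma>) (lty \<Gamma> A) \<and>
     Cmp D (Prj D (Fo H \<Gamma>) (lty \<Gamma> A)) h = Fa H (Prj C \<Gamma> A) \<and>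
     Cmp D (q_ext D (Fo H E) B0 (Fa H (cls \<Gamma> A))) h = Cmp D i0 (Fa H (q_ext C E A0 (cls \<Gamma> A)))"
    using h G A by (intro exI[of _ h]) auto
  from someI_ex[OF this, folded ltau_def]
  show "is_iso D (ltau \<Gamma> A)" "Dom D (ltau \<Gamma> A) = Fo H (ext C \<Gamma> A)" "Cod D (ltau \<Gamma> A) = ext D (Fo H \<Gamma>) (lty \<Gamma> A)"
    "Cmp D (Prj D (Fo H \<Gamma>) (lty \<Gamma> A)) (ltau \<Gamma> A) = Fa H (Prj C \<Gamma> A)"
    "Cmp D (q_ext D (Fo H E) B0 (Fa H (cls \<Gamma> A))) (ltau \<Gamma> A) = Cmp D i0 (Fa H (q_ext C E A0 (cls \<Gamma> A)))"
    by auto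
qed

lemma ltau_ar [simp]: "\<Gamma> \<in> Ob C \<Longrightarrow> A \<in> Ob (ty C \<Gamma>) \<Longrightarrow> ltau \<Gamma> A \<in> Ar D"
  by simp

text \<open>Both sides end in the pullback that presents the lifted type over
  \<open>\<Gamma>\<close>. Projected to the extension of \<open>B0\<close> they agree, because the
  squares of \<open>q_ext\<close> paste strictly in both models and \<open>cls\<close> commutes with
  substitution.\<close>

lemma ltau_q_ext:
  assumes u: "u \<in> Ar C" "Cod C u = \<Gamma>" and A: "A \<in> Ob (ty C \<Gamma>)"
  shows "Cmp D (q_ext D (Fo H \<Gamma>) (lty \<Gamma> A) (Fa H u)) (ltau (Dom C u) (tsb C u A)) =
    Cmp D (ltau \<Gamma> A) (Fa H (q_ext C \<Gamma> A u))" (is "Cmp D ?q ?t = Cmp D ?t' ?q'")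
proof -
  let ?\<Delta> = "Dom C u" and ?uA = "tsb C u A"
  let ?v = "cls \<Gamma> A"
  have G: "\<Gamma> \<in> Ob C" "?\<Delta> \<in> Ob C" using u by auto
  have uA: "?uA \<in> Ob (ty C ?\<Delta>)" using u A by simp
  let ?Q = "q_ext D (Fo H E) B0 (Fa H ?v)"
  have Q: "?Q \<in> Ar D" "Dom D ?Q = ext D (Fo H \<Gamma>) (lty \<Gamma> A)" "Cod D ?Q = ext D (Fo H E) B0"
    using G A by (auto simp: lty_def)
  have "Cmp D ?Q (Cmp D ?q ?t) = Cmp D (Cmp D ?Q ?q) ?t"
    using G A u uA Q by simp
  also have "Cmp D ?Q ?q = q_ext D (Fo H E) B0 (Fa H (cls ?\<Delta> ?uA))"
    using q_ext_Cmp[of D "Fa H ?v" "Fa H u" B0] G A u by (simp add: lty_def cls_tsb H_Cmp)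
  also have "Cmp D \<dots> ?t = Cmp D i0 (Fa H (q_ext C E A0 (cls ?\<Delta> ?uA)))"
    by (rule q_ltau[OF G(2) uA])
  also have "q_ext C E A0 (cls ?\<Delta> ?uA) = Cmp C (q_ext C E A0 ?v) (q_ext C \<Gamma> A u)"
    using q_ext_Cmp[of C ?v u A0] G A u by (simp add: cls_tsb)
  also have "Cmp D i0 (Fa H \<dots>) = Cmp D (Cmp D i0 (Fa H (q_ext C E A0 ?v))) (Fa H (q_ext C \<Gamma> A u))"
    using G A u by (simp add: H_Cmp)
  also have "\<dots> = Cmp D (Cmp D ?Q ?t') ?q'" using q_ltau[OF G(1) A] by simp
  also have "\<dots> = Cmp D ?Q (Cmp D ?t' ?q')" using G A u Q by simp
  finally have q: "Cmp D ?Q (Cmp D ?q ?t) = Cmp D ?Q (Cmp D ?t' ?q')" .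
  let ?P = "Prj D (Fo H \<Gamma>) (lty \<Gamma> A)"
  have "Cmp D ?P (Cmp D ?q ?t) = Cmp D (Fa H u) (Cmp D (Prj D (Fo H ?\<Delta>) (tsb D (Fa H u) (lty \<Gamma> A))) ?t)"
    using Cmp_reassoc[OF Prj_q_ext[of D "Fo H \<Gamma>" "lty \<Gamma> A" "Fa H u"], of ?t] G A u uA by simp
  also have "\<dots> = Cmp D (Fa H u) (Fa H (Prj C ?\<Delta> ?uA))"
    using Prj_ltau[OF G(2) uA] u A by simp
  also have "\<dots> = Cmp D (Fa H (Prj C \<Gamma> A)) ?q'"
    by (rule H_square[OF Prj_q_ext[symmetric]]) (use G A u uA in auto)
  also have "\<dots> = Cmp D ?P (Cmp D ?t' ?q')"
    using Cmp_reassoc[OF Prj_ltau[OF G(1) A], of ?q'] G A u by simp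
  finally have p: "Cmp D ?P (Cmp D ?q ?t) = Cmp D ?P (Cmp D ?t' ?q')" .
  show ?thesis
    by (rule pullback_eq[OF _ lty_pullback[OF G(1) A] _ _ _ _ _ p q]) (use G A u uA in auto)
qed

section \<open>Lifted arrows of types\<close>

definition ltya :: "'u \<Rightarrow> 'u \<Rightarrow> 'u" where
  "ltya \<Gamma> f = (SOME \<phi>. \<phi> \<in> Ar (ty D (Fo H \<Gamma>)) \<and> Dom (ty D (Fo H \<Gamma>)) \<phi> = lty \<Gamma> (Dom (ty C \<Gamma>) f) \<and>
     Cod (ty D (Fo H \<Gamma>)) \<phi> = lty \<Gamma> (Cod (ty C \<Gamma>) f) \<and>
     Cmp D (comp_ar D (Fo H \<Gamma>) \<phi>) (ltau \<Gamma> (Dom (ty C \<Gamma>) f)) = Cmp D (ltau \<Gamma> (Cod (ty C \<Gamma>) f)) (Fa H (comp_ar C \<Gamma> f)))"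

lemma
  assumes G: "\<Gamma> \<in> Ob C" and f: "f \<in> Ar (ty C \<Gamma>)"
  shows ltya_ar [simp]: "ltya \<Gamma> f \<in> Ar (ty D (Fo H \<Gamma>))"
    and Dom_ltya [simp]: "Dom (ty D (Fo H \<Gamma>)) (ltya \<Gamma> f) = lty \<Gamma> (Dom (ty C \<Gamma>) f)"
    and Cod_ltya [simp]: "Cod (ty D (Fo H \<Gamma>)) (ltya \<Gamma> f) = lty \<Gamma> (Cod (ty C \<Gamma>) f)"
    and comp_ltya: "Cmp D (comp_ar D (Fo H \<Gamma>) (ltya \<Gamma> f)) (ltau \<Gamma> (Dom (ty C \<Gamma>) f)) =
      Cmp D (ltau \<Gamma> (Cod (ty C \<Gamma>) f)) (Fa H (comp_ar C \<Gamma> f))"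
proof -
  let ?A = "Dom (ty C \<Gamma>) f" and ?B = "Cod (ty C \<Gamma>) f"
  have AB: "?A \<in> Ob (ty C \<Gamma>)" "?B \<in> Ob (ty C \<Gamma>)" using G f by auto
  \<comment> \<open>The image of \<open>\<Gamma>.f\<close> conjugated with the comparisons. It is a
    map over \<open>H \<Gamma>\<close>, so fullness of comprehension reaches it.\<close>
  let ?h = "Cmp D (ltau \<Gamma> ?B) (Cmp D (Fa H (comp_ar C \<Gamma> f)) (inv_ar D (ltau \<Gamma> ?A)))"
  let ?P = "Prj D (Fo H \<Gamma>) (lty \<Gamma> ?B)"
  have "Cmp D (Fa H (Prj C \<Gamma> ?B)) (Fa H (comp_ar C \<Gamma> f)) = Fa H (Prj C \<Gamma> ?A)"
    by (rule H_triangle[OF Prj_comp_ar]) (use G f AB in auto)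
  then have "Cmp D (Fa H (Prj C \<Gamma> ?B)) (Cmp D (Fa H (comp_ar C \<Gamma> f)) (inv_ar D (ltau \<Gamma> ?A))) =
      Cmp D (Fa H (Prj C \<Gamma> ?A)) (inv_ar D (ltau \<Gamma> ?A))"
    by (rule Cmp_reassoc) (use G f AB in auto)
  also have "\<dots> = Cmp D (Prj D (Fo H \<Gamma>) (lty \<Gamma> ?A)) (Cmp D (ltau \<Gamma> ?A) (inv_ar D (ltau \<Gamma> ?A)))"
    using G AB by (simp add: Prj_ltau[symmetric])
  also have "\<dots> = Prj D (Fo H \<Gamma>) (lty \<Gamma> ?A)" using G AB by (simp add: inv_right)
  finally have "Cmp D ?P ?h = Prj D (Fo H \<Gamma>) (lty \<Gamma> ?A)"
    using Cmp_reassoc[OF Prj_ltau[OF G AB(2)], of "Cmp D (Fa H (comp_ar C \<Gamma> f)) (inv_ar D (ltau \<Gamma> ?A))"] G f AB by simp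
  then obtain \<phi> where \<phi>: "\<phi> \<in> Ar (ty D (Fo H \<Gamma>))" "Dom (ty D (Fo H \<Gamma>)) \<phi> = lty \<Gamma> ?A"
     "Cod (ty D (Fo H \<Gamma>)) \<phi> = lty \<Gamma> ?B" "comp_ar D (Fo H \<Gamma>) \<phi> = ?h"
    using comp_ar_full[OF D, of "Fo H \<Gamma>" "lty \<Gamma> ?A" "lty \<Gamma> ?B" ?h] G f AB by auto
  have "Cmp D ?h (ltau \<Gamma> ?A) = Cmp D (ltau \<Gamma> ?B) (Fa H (comp_ar C \<Gamma> f))"
    using G f AB by (simp add: inv_left)
  then have "\<exists>\<phi>. \<phi> \<in> Ar (ty D (Fo H \<Gamma>)) \<and> Dom (ty D (Fo H \<Gamma>)) \<phi> = lty \<Gamma> ?A \<and>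
     Cod (ty D (Fo H \<Gamma>)) \<phi> = lty \<Gamma> ?B \<and>
     Cmp D (comp_ar D (Fo H \<Gamma>) \<phi>) (ltau \<Gamma> ?A) = Cmp D (ltau \<Gamma> ?B) (Fa H (comp_ar C \<Gamma> f))"
    using \<phi> by metis
  from someI_ex[OF this, folded ltya_def]
  show "ltya \<Gamma> f \<in> Ar (ty D (Fo H \<Gamma>))" "Dom (ty D (Fo H \<Gamma>)) (ltya \<Gamma> f) = lty \<Gamma> (Dom (ty C \<Gamma>) f)"
    "Cod (ty D (Fo H \<Gamma>)) (ltya \<Gamma> f) = lty \<Gamma> (Cod (ty C \<Gamma>) f)"
    "Cmp D (comp_ar D (Fo H \<Gamma>) (ltya \<Gamma> f)) (ltau \<Gamma> (Dom (ty C \<Gamma>) f)) =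
      Cmp D (ltau \<Gamma> (Cod (ty C \<Gamma>) f)) (Fa H (comp_ar C \<Gamma> f))"
    by auto
qed

text \<open>First \<open>ltau\<close> is cancelled, then faithfulness of comprehension applies. The
  functor laws of \<open>ltya\<close> and its compatibility with substitution all go through
  this.\<close>

lemma ltya_unique:
  assumes G: "\<Gamma> \<in> Ob C" and A: "A \<in> Ob (ty C \<Gamma>)" and f: "f \<in> Ar (ty D (Fo H \<Gamma>))" and g: "g \<in> Ar (ty D (Fo H \<Gamma>))"
    and "Dom (ty D (Fo H \<Gamma>)) f = lty \<Gamma> A" "Dom (ty D (Fo H \<Gamma>)) g = lty \<Gamma> A"
    and "Cod (ty D (Fo H \<Gamma>)) f = Cod (ty D (Fo H \<Gamma>)) g"
    and e: "Cmp D (comp_ar D (Fo H \<Gamma>) f) (ltau \<Gamma> A) = Cmp D (comp_ar D (Fo H \<Gamma>) g) (ltau \<Gamma> A)"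
  shows "f = g"
proof (rule comp_ar_faithful[OF D, of "Fo H \<Gamma>"])
  show "comp_ar D (Fo H \<Gamma>) f = comp_ar D (Fo H \<Gamma>) g"
    by (rule iso_cancel_right[OF _ _ _ _ _ _ e])
       (use comp_ar_ar[of D "Fo H \<Gamma>" f] Dom_comp_ar[of D "Fo H \<Gamma>" f] comp_ar_ar[of D "Fo H \<Gamma>" g]
         Dom_comp_ar[of D "Fo H \<Gamma>" g] assms in auto)
qed (use assms in auto)

lemma ltya_Idn:
  assumes G: "\<Gamma> \<in> Ob C" and A: "A \<in> Ob (ty C \<Gamma>)"
  shows "ltya \<Gamma> (Idn (ty C \<Gamma>) A) = Idn (ty D (Fo H \<Gamma>)) (lty \<Gamma> A)"
  by (rule ltya_unique[OF G A])
     (use comp_ltya[OF G, of "Idn (ty C \<Gamma>) A"] G A in \<open>auto simp: comp_ar_Idn\<close>)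

lemma ltya_Cmp:
  assumes G: "\<Gamma> \<in> Ob C" and f: "f \<in> Ar (ty C \<Gamma>)" and g: "g \<in> Ar (ty C \<Gamma>)" and fg: "Cod (ty C \<Gamma>) f = Dom (ty C \<Gamma>) g"
  shows "ltya \<Gamma> (Cmp (ty C \<Gamma>) g f) = Cmp (ty D (Fo H \<Gamma>)) (ltya \<Gamma> g) (ltya \<Gamma> f)"
proof (rule ltya_unique[OF G])
  let ?A = "Dom (ty C \<Gamma>) f" and ?B = "Dom (ty C \<Gamma>) g" and ?c = "comp_ar D (Fo H \<Gamma>)"
  let ?K = "Cod (ty C \<Gamma>) g"
  have gf: "Cmp (ty C \<Gamma>) g f \<in> Ar (ty C \<Gamma>)" "Dom (ty C \<Gamma>) (Cmp (ty C \<Gamma>) g f) = ?A" "Cod (ty C \<Gamma>) (Cmp (ty C \<Gamma>) g f) = ?K"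
    using G f g fg by auto
  have AB: "?A \<in> Ob (ty C \<Gamma>)" "?B \<in> Ob (ty C \<Gamma>)" "?K \<in> Ob (ty C \<Gamma>)" using G f g by auto
  have c: "?c (ltya \<Gamma> x) \<in> Ar D" "Dom D (?c (ltya \<Gamma> x)) = ext D (Fo H \<Gamma>) (lty \<Gamma> (Dom (ty C \<Gamma>) x))"
    "Cod D (?c (ltya \<Gamma> x)) = ext D (Fo H \<Gamma>) (lty \<Gamma> (Cod (ty C \<Gamma>) x))" if "x \<in> Ar (ty C \<Gamma>)" for x
    using G that comp_ar_ar[of D "Fo H \<Gamma>" "ltya \<Gamma> x"] by auto
  have "?c (Cmp (ty D (Fo H \<Gamma>)) (ltya \<Gamma> g) (ltya \<Gamma> f)) = Cmp D (?c (ltya \<Gamma> g)) (?c (ltya \<Gamma> f))"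
    using G f g fg by (intro comp_ar_Cmp) auto
  then have "Cmp D (?c (Cmp (ty D (Fo H \<Gamma>)) (ltya \<Gamma> g) (ltya \<Gamma> f))) (ltau \<Gamma> ?A) =
      Cmp D (?c (ltya \<Gamma> g)) (Cmp D (?c (ltya \<Gamma> f)) (ltau \<Gamma> ?A))"
    using c[OF f] c[OF g] G f g fg AB by simp
  also have "\<dots> = Cmp D (Cmp D (?c (ltya \<Gamma> g)) (ltau \<Gamma> ?B)) (Fa H (comp_ar C \<Gamma> f))"
    using comp_ltya[OF G f] c[OF f] c[OF g] G f g fg AB by simp
  also have "\<dots> = Cmp D (ltau \<Gamma> ?K) (Cmp D (Fa H (comp_ar C \<Gamma> g)) (Fa H (comp_ar C \<Gamma> f)))"
    using Cmp_reassoc[OF comp_ltya[OF G g], of "Fa H (comp_ar C \<Gamma> f)"] c[OF f] c[OF g] G f g fg AB by simp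
  also have "\<dots> = Cmp D (ltau \<Gamma> ?K) (Fa H (comp_ar C \<Gamma> (Cmp (ty C \<Gamma>) g f)))"
    using G f g fg by (simp add: comp_ar_Cmp H_Cmp)
  also have "\<dots> = Cmp D (?c (ltya \<Gamma> (Cmp (ty C \<Gamma>) g f))) (ltau \<Gamma> ?A)"
    using comp_ltya[OF G gf(1)] gf by simp
  finally show "Cmp D (?c (ltya \<Gamma> (Cmp (ty C \<Gamma>) g f))) (ltau \<Gamma> ?A) = Cmp D (?c (Cmp (ty D (Fo H \<Gamma>)) (ltya \<Gamma> g) (ltya \<Gamma> f))) (ltau \<Gamma> ?A)" ..
qed (use G f g fg in auto)

text \<open>The comprehensions of both arrows end in a pullback along \<open>H u\<close>. The
  components are matched by naturality of \<open>q_ext\<close> in the type, used in both models, and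
  by \<open>ltau_q_ext\<close> at the two ends of \<open>f\<close>.\<close>

lemma ltya_tsa [simp]:
  assumes u: "u \<in> Ar C" "Dom C u = \<Delta>" and f: "f \<in> Ar (ty C (Cod C u))"
  shows "ltya \<Delta> (tsa C u f) = tsa D (Fa H u) (ltya (Cod C u) f)"
proof (rule ltya_unique)
  let ?\<Gamma> = "Cod C u"
  let ?A = "Dom (ty C ?\<Gamma>) f" and ?B = "Cod (ty C ?\<Gamma>) f" and ?c = "comp_ar D"
  have G: "?\<Gamma> \<in> Ob C" "\<Delta> \<in> Ob C" using u by auto
  have AB: "?A \<in> Ob (ty C ?\<Gamma>)" "?B \<in> Ob (ty C ?\<Gamma>)" using G f by auto
  show "\<Delta> \<in> Ob C" by fact
  show uA: "tsb C u ?A \<in> Ob (ty C \<Delta>)" using u AB by simp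
  have uB: "tsb C u ?B \<in> Ob (ty C \<Delta>)" using u AB by simp
  let ?uf = "tsa C u f" and ?\<phi> = "tsa D (Fa H u) (ltya ?\<Gamma> f)"
  have uf: "?uf \<in> Ar (ty C \<Delta>)" "Dom (ty C \<Delta>) ?uf = tsb C u ?A" "Cod (ty C \<Delta>) ?uf = tsb C u ?B"
    using u f by auto
  have \<phi>: "?\<phi> \<in> Ar (ty D (Fo H \<Delta>))" "Dom (ty D (Fo H \<Delta>)) ?\<phi> = tsb D (Fa H u) (lty ?\<Gamma> ?A)" "Cod (ty D (Fo H \<Delta>)) ?\<phi> = tsb D (Fa H u) (lty ?\<Gamma> ?B)"
    using u f G by auto
  note [simp] = comp_ar_ar[of D "Fo H \<Delta>" ?\<phi>] Dom_comp_ar[of D "Fo H \<Delta>" ?\<phi>] Cod_comp_ar[of D "Fo H \<Delta>" ?\<phi>]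
    comp_ar_ar[of C \<Delta> ?uf] Dom_comp_ar[of C \<Delta> ?uf] Cod_comp_ar[of C \<Delta> ?uf]
    comp_ar_ar[of D "Fo H ?\<Gamma>" "ltya ?\<Gamma> f"] Dom_comp_ar[of D "Fo H ?\<Gamma>" "ltya ?\<Gamma> f"] Cod_comp_ar[of D "Fo H ?\<Gamma>" "ltya ?\<Gamma> f"]
  let ?q = "q_ext D (Fo H ?\<Gamma>) (lty ?\<Gamma> ?B) (Fa H u)" and ?q' = "q_ext D (Fo H ?\<Gamma>) (lty ?\<Gamma> ?A) (Fa H u)"
  let ?l = "Cmp D (?c (Fo H \<Delta>) ?\<phi>) (ltau \<Delta> (tsb C u ?A))" and ?r = "Cmp D (ltau \<Delta> (tsb C u ?B)) (Fa H (comp_ar C \<Delta> ?uf))"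
  have cc: "Cmp D ?q (?c (Fo H \<Delta>) ?\<phi>) = Cmp D (?c (Fo H ?\<Gamma>) (ltya ?\<Gamma> f)) ?q'"
    using q_ext_comp_ar[of D "Fo H ?\<Gamma>" "ltya ?\<Gamma> f" "Fa H u"] u f G by simp
  have tA: "Cmp D ?q' (ltau \<Delta> (tsb C u ?A)) = Cmp D (ltau ?\<Gamma> ?A) (Fa H (q_ext C ?\<Gamma> ?A u))"
    using ltau_q_ext[OF u(1) refl AB(1)] u by simp
  have tB: "Cmp D ?q (ltau \<Delta> (tsb C u ?B)) = Cmp D (ltau ?\<Gamma> ?B) (Fa H (q_ext C ?\<Gamma> ?B u))"
    using ltau_q_ext[OF u(1) refl AB(2)] u by simp
  have "Cmp D ?q ?l = Cmp D (Cmp D ?q (?c (Fo H \<Delta>) ?\<phi>)) (ltau \<Delta> (tsb C u ?A))"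
    using u f G AB uA uB \<phi> uf by simp
  also have "\<dots> = Cmp D (?c (Fo H ?\<Gamma>) (ltya ?\<Gamma> f)) (Cmp D ?q' (ltau \<Delta> (tsb C u ?A)))"
    unfolding cc using u f G AB uA uB \<phi> uf by simp
  also have "\<dots> = Cmp D (Cmp D (?c (Fo H ?\<Gamma>) (ltya ?\<Gamma> f)) (ltau ?\<Gamma> ?A)) (Fa H (q_ext C ?\<Gamma> ?A u))"
    unfolding tA using u f G AB uA uB \<phi> uf by simp
  also have "\<dots> = Cmp D (ltau ?\<Gamma> ?B) (Cmp D (Fa H (comp_ar C ?\<Gamma> f)) (Fa H (q_ext C ?\<Gamma> ?A u)))"
    unfolding comp_ltya[OF G(1) f] using u f G AB uA uB \<phi> uf by simp
  also have "Cmp D (Fa H (comp_ar C ?\<Gamma> f)) (Fa H (q_ext C ?\<Gamma> ?A u)) = Cmp D (Fa H (q_ext C ?\<Gamma> ?B u)) (Fa H (comp_ar C \<Delta> ?uf))"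
    using q_ext_comp_ar[of C ?\<Gamma> f u] u f G AB uA uB uf by (intro H_square) auto
  also have "Cmp D (ltau ?\<Gamma> ?B) \<dots> = Cmp D (Cmp D (ltau ?\<Gamma> ?B) (Fa H (q_ext C ?\<Gamma> ?B u))) (Fa H (comp_ar C \<Delta> ?uf))"
    using u f G AB uA uB \<phi> uf by simp
  also have "\<dots> = Cmp D ?q ?r"
    unfolding tB[symmetric] using u f G AB uA uB \<phi> uf by simp
  finally have q: "Cmp D ?q ?l = Cmp D ?q ?r" .
  let ?P = "Prj D (Fo H \<Delta>) (tsb D (Fa H u) (lty ?\<Gamma> ?B))"
  have "Cmp D ?P ?l = Cmp D (Prj D (Fo H \<Delta>) (tsb D (Fa H u) (lty ?\<Gamma> ?A))) (ltau \<Delta> (tsb C u ?A))"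
    using Cmp_reassoc[OF Prj_comp_ar[OF _ _ \<phi>(1)], of "ltau \<Delta> (tsb C u ?A)"] u f G AB uA uB \<phi> uf by simp
  also have "\<dots> = Fa H (Prj C \<Delta> (tsb C u ?A))" using Prj_ltau[OF G(2) uA] u AB by simp
  also have "\<dots> = Cmp D (Fa H (Prj C \<Delta> (tsb C u ?B))) (Fa H (comp_ar C \<Delta> ?uf))"
    using Prj_comp_ar[OF C G(2) uf(1)] u f G AB uA uB uf by (intro H_triangle[symmetric]) auto
  also have "\<dots> = Cmp D ?P ?r"
    using Cmp_reassoc[OF Prj_ltau[OF G(2) uB], of "Fa H (comp_ar C \<Delta> ?uf)"] u f G AB uA uB uf by simp
  finally have p: "Cmp D ?P ?l = Cmp D ?P ?r" .
  have pb: "is_pullback D (Fa H u) (Prj D (Fo H ?\<Gamma>) (lty ?\<Gamma> ?B)) ?P ?q"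
    using q_ext_pullback[of D "Fo H ?\<Gamma>" "lty ?\<Gamma> ?B" "Fa H u"] u G AB by simp
  have "?l = ?r" by (rule pullback_eq[OF _ pb _ _ _ _ _ p q]) (use u f G AB uA uB \<phi> uf in auto)
  then show "Cmp D (?c (Fo H \<Delta>) (ltya \<Delta> ?uf)) (ltau \<Delta> (tsb C u ?A)) = ?l"
    using comp_ltya[OF G(2) uf(1)] uf by simp
qed (use u f in auto)

section \<open>Lifted terms and arrows of terms\<close>

definition ltm :: "'u \<Rightarrow> 'u \<Rightarrow> 'u" where
  "ltm \<Gamma> t = msb D (Cmp D (ltau \<Gamma> (tyof C \<Gamma> t)) (Fa H (sect C \<Gamma> t))) (Var D (Fo H \<Gamma>) (lty \<Gamma> (tyof C \<Gamma> t)))"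

lemma Prj_ltau_sect:
  assumes G: "\<Gamma> \<in> Ob C" and t: "t \<in> Ob (tm C \<Gamma>)"
  shows "Cmp D (Prj D (Fo H \<Gamma>) (lty \<Gamma> (tyof C \<Gamma> t))) (Cmp D (ltau \<Gamma> (tyof C \<Gamma> t)) (Fa H (sect C \<Gamma> t))) = Idn D (Fo H \<Gamma>)"
proof -
  have "Cmp D (Fa H (Prj C \<Gamma> (tyof C \<Gamma> t))) (Fa H (sect C \<Gamma> t)) = Fa H (Idn C \<Gamma>)"
    by (rule H_triangle[OF Prj_sect]) (use G t in auto)
  then show ?thesis
    using Cmp_reassoc[OF Prj_ltau[OF G, of "tyof C \<Gamma> t"], of "Fa H (sect C \<Gamma> t)"] G t by simp
qed

text \<open>\<open>ltm\<close> sends the section of \<open>t\<close> through \<open>H\<close> and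
  \<open>ltau\<close> and reads off a term. As the transported map is again a section, it is the
  section of that term; equations about lifted terms are proved in this form.\<close>

lemma
  assumes G: "\<Gamma> \<in> Ob C" and t: "t \<in> Ob (tm C \<Gamma>)"
  shows ltm_ob [simp]: "ltm \<Gamma> t \<in> Ob (tm D (Fo H \<Gamma>))"
    and tyof_ltm [simp]: "tyof D (Fo H \<Gamma>) (ltm \<Gamma> t) = lty \<Gamma> (tyof C \<Gamma> t)"
    and sect_ltm: "sect D (Fo H \<Gamma>) (ltm \<Gamma> t) = Cmp D (ltau \<Gamma> (tyof C \<Gamma> t)) (Fa H (sect C \<Gamma> t))"
proof -
  let ?A = "tyof C \<Gamma> t"
  let ?s = "Cmp D (ltau \<Gamma> ?A) (Fa H (sect C \<Gamma> t))"
  have s: "?s \<in> Ar D" "Dom D ?s = Fo H \<Gamma>" "Cod D ?s = ext D (Fo H \<Gamma>) (lty \<Gamma> ?A)" using G t by auto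
  show o: "ltm \<Gamma> t \<in> Ob (tm D (Fo H \<Gamma>))" unfolding ltm_def using s G t by simp
  have "tsb D ?s (tsb D (Prj D (Fo H \<Gamma>) (lty \<Gamma> ?A)) (lty \<Gamma> ?A)) = tsb D (Cmp D (Prj D (Fo H \<Gamma>) (lty \<Gamma> ?A)) ?s) (lty \<Gamma> ?A)"
    using s G t tsb_Cmp[of D ?s "Prj D (Fo H \<Gamma>) (lty \<Gamma> ?A)" "lty \<Gamma> ?A"] by simp
  also have "\<dots> = lty \<Gamma> ?A" unfolding Prj_ltau_sect[OF G t] using G t by simp
  finally show ty: "tyof D (Fo H \<Gamma>) (ltm \<Gamma> t) = lty \<Gamma> ?A" unfolding ltm_def using s G t by simp
  note x = sect_ar[OF _ _ o] Dom_sect[OF _ _ o] Cod_sect[OF _ _ o] Prj_sect[OF _ _ o] Var_sect[OF _ _ o]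
  show "sect D (Fo H \<Gamma>) (ltm \<Gamma> t) = ?s"
  proof (rule ext_eq[of D "Fo H \<Gamma>" "lty \<Gamma> ?A"])
    show "Cmp D (Prj D (Fo H \<Gamma>) (lty \<Gamma> ?A)) (sect D (Fo H \<Gamma>) (ltm \<Gamma> t)) = Cmp D (Prj D (Fo H \<Gamma>) (lty \<Gamma> ?A)) ?s"
      using x G ty unfolding Prj_ltau_sect[OF G t] by simp
    show "msb D (sect D (Fo H \<Gamma>) (ltm \<Gamma> t)) (Var D (Fo H \<Gamma>) (lty \<Gamma> ?A)) = msb D ?s (Var D (Fo H \<Gamma>) (lty \<Gamma> ?A))"
      using x G ty by (simp add: ltm_def)
  qed (use s x G t ty in auto)
qed

text \<open>Substituting the generic term along the section gives the term back.\<close>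

lemma ltm_eqI:
  assumes "\<Gamma> \<in> Ob C" "x \<in> Ob (tm D (Fo H \<Gamma>))" "y \<in> Ob (tm D (Fo H \<Gamma>))"
    "tyof D (Fo H \<Gamma>) x = tyof D (Fo H \<Gamma>) y" "sect D (Fo H \<Gamma>) x = sect D (Fo H \<Gamma>) y"
  shows "x = y"
  using Var_sect[OF natm_prenat[OF D] Ho[OF assms(1)] assms(2)] Var_sect[OF natm_prenat[OF D] Ho[OF assms(1)] assms(3)]
    assms(4,5) by metis

text \<open>The section of \<open>t[u]\<close> is pulled back from that of \<open>t\<close>, and
  \<open>ltau_q_ext\<close> carries this relation through the comparisons.\<close>

lemma ltm_msb [simp]:
  assumes u: "u \<in> Ar C" "Dom C u = \<Delta>" and t: "t \<in> Ob (tm C (Cod C u))"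
  shows "ltm \<Delta> (msb C u t) = msb D (Fa H u) (ltm (Cod C u) t)"
proof -
  let ?\<Gamma> = "Cod C u"
  let ?A = "tyof C ?\<Gamma> t"
  have G: "?\<Gamma> \<in> Ob C" "\<Delta> \<in> Ob C" using u by auto
  have A: "?A \<in> Ob (ty C ?\<Gamma>)" using G t by simp
  have uA: "tsb C u ?A \<in> Ob (ty C \<Delta>)" using u A by simp
  have ut: "msb C u t \<in> Ob (tm C \<Delta>)" "tyof C \<Delta> (msb C u t) = tsb C u ?A" using u t by auto
  note s = sect_ar[OF C G(2) ut(1)] Dom_sect[OF C G(2) ut(1)] Cod_sect[OF C G(2) ut(1)]
  let ?q = "q_ext D (Fo H ?\<Gamma>) (lty ?\<Gamma> ?A) (Fa H u)"
  let ?s = "Cmp D (ltau \<Delta> (tsb C u ?A)) (Fa H (sect C \<Delta> (msb C u t)))"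
  let ?s' = "Cmp D (ltau ?\<Gamma> ?A) (Fa H (sect C ?\<Gamma> t))"
  have Q: "Var D (Fo H \<Delta>) (tsb D (Fa H u) (lty ?\<Gamma> ?A)) = msb D ?q (Var D (Fo H ?\<Gamma>) (lty ?\<Gamma> ?A))"
    using u G A by (simp add: Var_q_ext)
  have "Cmp D ?q ?s = Cmp D (Cmp D ?q (ltau \<Delta> (tsb C u ?A))) (Fa H (sect C \<Delta> (msb C u t)))"
    using u G A uA t ut s by simp
  also have "\<dots> = Cmp D (ltau ?\<Gamma> ?A) (Cmp D (Fa H (q_ext C ?\<Gamma> ?A u)) (Fa H (sect C \<Delta> (msb C u t))))"
    using ltau_q_ext[OF u(1) refl A] u G A uA t ut s by simp
  also have "Cmp D (Fa H (q_ext C ?\<Gamma> ?A u)) (Fa H (sect C \<Delta> (msb C u t))) = Cmp D (Fa H (sect C ?\<Gamma> t)) (Fa H u)"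
    using sect_msb[OF C u(1) t] u G A uA t ut s by (intro H_square) auto
  finally have e: "Cmp D ?q ?s = Cmp D ?s' (Fa H u)" using u G A t by simp
  have "ltm \<Delta> (msb C u t) = msb D ?s (msb D ?q (Var D (Fo H ?\<Gamma>) (lty ?\<Gamma> ?A)))"
    unfolding ltm_def Q[symmetric] using ut u A by simp
  also have "\<dots> = msb D (Cmp D ?q ?s) (Var D (Fo H ?\<Gamma>) (lty ?\<Gamma> ?A))"
    by (rule msb_Cmp[symmetric]) (use u G A uA t ut s in auto)
  also have "\<dots> = msb D (Fa H u) (msb D ?s' (Var D (Fo H ?\<Gamma>) (lty ?\<Gamma> ?A)))"
    unfolding e by (rule msb_Cmp) (use u G A t in auto)
  finally show ?thesis by (simp add: ltm_def)
qed

definition ltma :: "'u \<Rightarrow> 'u \<Rightarrow> 'u" where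
  "ltma \<Gamma> g = lift D (Fo H \<Gamma>) (ltm \<Gamma> (Dom (tm C \<Gamma>) g)) (ltya \<Gamma> (tyofa C \<Gamma> g))"

lemma
  assumes G: "\<Gamma> \<in> Ob C" and g: "g \<in> Ar (tm C \<Gamma>)"
  shows ltma_ar [simp]: "ltma \<Gamma> g \<in> Ar (tm D (Fo H \<Gamma>))"
    and Dom_ltma [simp]: "Dom (tm D (Fo H \<Gamma>)) (ltma \<Gamma> g) = ltm \<Gamma> (Dom (tm C \<Gamma>) g)"
    and Cod_ltma [simp]: "Cod (tm D (Fo H \<Gamma>)) (ltma \<Gamma> g) = ltm \<Gamma> (Cod (tm C \<Gamma>) g)"
    and tyofa_ltma [simp]: "tyofa D (Fo H \<Gamma>) (ltma \<Gamma> g) = ltya \<Gamma> (tyofa C \<Gamma> g)"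
proof -
  let ?t = "Dom (tm C \<Gamma>) g" and ?t' = "Cod (tm C \<Gamma>) g" and ?f = "tyofa C \<Gamma> g"
  let ?\<phi> = "ltya \<Gamma> ?f" and ?c = "comp_ar D (Fo H \<Gamma>)"
  have t: "?t \<in> Ob (tm C \<Gamma>)" "?t' \<in> Ob (tm C \<Gamma>)" using G g by auto
  have f: "?f \<in> Ar (ty C \<Gamma>)" "Dom (ty C \<Gamma>) ?f = tyof C \<Gamma> ?t" "Cod (ty C \<Gamma>) ?f = tyof C \<Gamma> ?t'" using G g by auto
  have AB: "tyof C \<Gamma> ?t \<in> Ob (ty C \<Gamma>)" "tyof C \<Gamma> ?t' \<in> Ob (ty C \<Gamma>)" using G t by auto
  have \<phi>: "?\<phi> \<in> Ar (ty D (Fo H \<Gamma>))" "Dom (ty D (Fo H \<Gamma>)) ?\<phi> = lty \<Gamma> (tyof C \<Gamma> ?t)" "Cod (ty D (Fo H \<Gamma>)) ?\<phi> = lty \<Gamma> (tyof C \<Gamma> ?t')"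
    using G f by auto
  show "ltma \<Gamma> g \<in> Ar (tm D (Fo H \<Gamma>))" "Dom (tm D (Fo H \<Gamma>)) (ltma \<Gamma> g) = ltm \<Gamma> ?t" "tyofa D (Fo H \<Gamma>) (ltma \<Gamma> g) = ?\<phi>"
    using G t \<phi> by (auto simp: ltma_def)
  \<comment> \<open>What remains is the target of the lift: transport along the lifted arrow of
    types has to give the lifted codomain. On sections this is the defining square of
    \<open>ltya\<close>.\<close>
  let ?p = "push D (Fo H \<Gamma>) (ltm \<Gamma> ?t) ?\<phi>"
  note c = comp_ar_ar[OF _ _ \<phi>(1)] Dom_comp_ar[OF _ _ \<phi>(1)] Cod_comp_ar[OF _ _ \<phi>(1)]
    comp_ar_ar[OF C G f(1)] Dom_comp_ar[OF C G f(1)] Cod_comp_ar[OF C G f(1)]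
  have "sect D (Fo H \<Gamma>) ?p = Cmp D (?c ?\<phi>) (Cmp D (ltau \<Gamma> (tyof C \<Gamma> ?t)) (Fa H (sect C \<Gamma> ?t)))"
    using sect_push[of D "Fo H \<Gamma>" "ltm \<Gamma> ?t" ?\<phi>] G t \<phi> by (simp add: sect_ltm)
  also have "\<dots> = Cmp D (Cmp D (?c ?\<phi>) (ltau \<Gamma> (tyof C \<Gamma> ?t))) (Fa H (sect C \<Gamma> ?t))"
    using G t \<phi> AB c by simp
  also have "\<dots> = Cmp D (ltau \<Gamma> (tyof C \<Gamma> ?t')) (Cmp D (Fa H (comp_ar C \<Gamma> ?f)) (Fa H (sect C \<Gamma> ?t)))"
    using comp_ltya[OF G f(1)] G t AB c f by simp
  also have "Cmp D (Fa H (comp_ar C \<Gamma> ?f)) (Fa H (sect C \<Gamma> ?t)) = Fa H (sect C \<Gamma> ?t')"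
    using sect_push[OF C G t(1) f(1,2)] push_tyofa[OF C G g] G t f AB c by (intro H_triangle) auto
  also have "Cmp D (ltau \<Gamma> (tyof C \<Gamma> ?t')) \<dots> = sect D (Fo H \<Gamma>) (ltm \<Gamma> ?t')" using G t by (simp add: sect_ltm)
  finally have "?p = ltm \<Gamma> ?t'" by (rule ltm_eqI[OF G, rotated 3]) (use G t \<phi> in auto)
  then show "Cod (tm D (Fo H \<Gamma>)) (ltma \<Gamma> g) = ltm \<Gamma> ?t'" by (simp add: ltma_def push_def)
qed

section \<open>Assembly of the lifted morphism\<close>

definition lmor :: "'u nmor" where
  "lmor = \<lparr>Fo = Fo H, Fa = Fa H, nsrc = C, ntgt = D,
     nTp = (\<lambda>\<Gamma>\<in>Ob C. \<lparr>Fo = (\<lambda>A\<in>Ob (ty C \<Gamma>). lty \<Gamma> A), Fa = (\<lambda>f\<in>Ar (ty C \<Gamma>). ltya \<Gamma> f)\<rparr>),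
     nTm = (\<lambda>\<Gamma>\<in>Ob C. \<lparr>Fo = (\<lambda>t\<in>Ob (tm C \<Gamma>). ltm \<Gamma> t), Fa = (\<lambda>g\<in>Ar (tm C \<Gamma>). ltma \<Gamma> g)\<rparr>)\<rparr>"

lemma lmor_simps [simp]:
  "nsrc lmor = C" "ntgt lmor = D" "Fo lmor = Fo H" "Fa lmor = Fa H"
  "\<Gamma> \<in> Ob C \<Longrightarrow> A \<in> Ob (ty C \<Gamma>) \<Longrightarrow> Fo (nTp lmor \<Gamma>) A = lty \<Gamma> A"
  "\<Gamma> \<in> Ob C \<Longrightarrow> f \<in> Ar (ty C \<Gamma>) \<Longrightarrow> Fa (nTp lmor \<Gamma>) f = ltya \<Gamma> f"
  "\<Gamma> \<in> Ob C \<Longrightarrow> t \<in> Ob (tm C \<Gamma>) \<Longrightarrow> Fo (nTm lmor \<Gamma>) t = ltm \<Gamma> t"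
  "\<Gamma> \<in> Ob C \<Longrightarrow> g \<in> Ar (tm C \<Gamma>) \<Longrightarrow> Fa (nTm lmor \<Gamma>) g = ltma \<Gamma> g"
  by (auto simp: lmor_def)

text \<open>This allows \<open>ltau\<close> to be recognised as the comparison \<open>tau\<close> of
  the lifted morphism, which is defined through the image of the generic term.\<close>

lemma Var_ltau:
  assumes G: "\<Gamma> \<in> Ob C" and A: "A \<in> Ob (ty C \<Gamma>)"
  shows "msb D (ltau \<Gamma> A) (Var D (Fo H \<Gamma>) (lty \<Gamma> A)) = ltm (ext C \<Gamma> A) (Var C \<Gamma> A)"
proof -
  let ?X = "ext C \<Gamma> A" and ?p = "Prj C \<Gamma> A" and ?v = "Var C \<Gamma> A"
  have X: "?X \<in> Ob C" "?v \<in> Ob (tm C ?X)" "tyof C ?X ?v = tsb C ?p A" using G A by auto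
  have pA: "tsb C ?p A \<in> Ob (ty C ?X)" using G A by simp
  note s = sect_ar[OF C X(1,2)] Dom_sect[OF C X(1,2)] Cod_sect[OF C X(1,2)] Prj_sect[OF C X(1,2)] Var_sect[OF C X(1,2)]
  let ?s = "sect C ?X ?v" and ?q = "q_ext C \<Gamma> A ?p"
  \<comment> \<open>The section of the generic term is the diagonal of \<open>\<Gamma>.A\<close>
    over \<open>\<Gamma>\<close>, and \<open>q_ext\<close> is one of the two projections of the
    fibre product.\<close>
  have qs: "Cmp C ?q ?s = Idn C ?X"
  proof (rule ext_eq[OF C G A])
    show "Cmp C ?p (Cmp C ?q ?s) = Cmp C ?p (Idn C ?X)"
      using Cmp_reassoc[OF Prj_q_ext[OF C G A, of ?p], of ?s] s G A X by simp
    show "msb C (Cmp C ?q ?s) ?v = msb C (Idn C ?X) ?v"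
      using s G A X by (simp add: msb_Cmp Var_q_ext)
  qed (use s G A X in auto)
  let ?Q = "q_ext D (Fo H \<Gamma>) (lty \<Gamma> A) (Fa H ?p)" and ?V = "Var D (Fo H \<Gamma>) (lty \<Gamma> A)"
  let ?w = "Cmp D (ltau ?X (tsb C ?p A)) (Fa H ?s)"
  have w: "?w \<in> Ar D" "Cod D ?w = ext D (Fo H ?X) (tsb D (Fa H ?p) (lty \<Gamma> A))"
    using s G A X pA by auto
  have Hqs: "Cmp D (Fa H ?q) (Fa H ?s) = Fa H (Idn C ?X)"
    by (rule H_triangle[OF qs]) (use s G A X pA in auto)
  have "Cmp D ?Q ?w = Cmp D (Cmp D ?Q (ltau ?X (tsb C ?p A))) (Fa H ?s)"
    using s G A X pA by simp
  also have "\<dots> = Cmp D (ltau \<Gamma> A) (Cmp D (Fa H ?q) (Fa H ?s))"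
    using ltau_q_ext[of ?p \<Gamma> A] s G A X pA by simp
  also have "\<dots> = ltau \<Gamma> A" unfolding Hqs using G A X by simp
  finally have e: "Cmp D ?Q ?w = ltau \<Gamma> A" .
  have "ltm ?X ?v = msb D ?w (msb D ?Q ?V)"
    using X G A by (simp add: ltm_def Var_q_ext)
  also have "\<dots> = msb D (Cmp D ?Q ?w) ?V"
    by (rule msb_Cmp[symmetric]) (use w G A in auto)
  finally show ?thesis unfolding e by simp
qed

text \<open>Both maps have the same projection and the same generic-term component. Invertibility of
  the comparison is thereby that of \<open>ltau\<close>.\<close>

lemma tau_lmor:
  assumes G: "\<Gamma> \<in> Ob C" and A: "A \<in> Ob (ty C \<Gamma>)"
  shows "tau lmor \<Gamma> A = ltau \<Gamma> A"
proof -
  let ?X = "ext C \<Gamma> A"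
  have X: "?X \<in> Ob C" "Var C \<Gamma> A \<in> Ob (tm C ?X)" using G A by auto
  have "tau lmor \<Gamma> A = ext_pair D (Fo H \<Gamma>) (lty \<Gamma> A) (Fa H (Prj C \<Gamma> A)) (ltm ?X (Var C \<Gamma> A))"
    using G A X by (simp add: tau_def)
  also have "\<dots> = ltau \<Gamma> A"
    by (rule ext_eq[of D "Fo H \<Gamma>" "lty \<Gamma> A"]) (use G A X in \<open>auto simp: Prj_ltau Var_ltau\<close>)
  finally show ?thesis .
qed

lemma lmor_morphism: "natural_model_morphism lmor"
  unfolding natural_model_morphism_def strict_indexed_functor_def lmor_simps(1-4)
proof (intro conjI ballI)
  show "display_functor C D lmor" using H by (simp only: display_functor_def is_functor_def lmor_simps(3,4))
next
  fix \<Gamma> assume G: "\<Gamma> \<in> Ob C"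
  show "Defs.is_functor (ty C \<Gamma>) (ty D (Fo H \<Gamma>)) (nTp lmor \<Gamma>)"
    by (rule is_functorI) (use G in \<open>auto simp: ltya_Idn ltya_Cmp\<close>)
  have PD: "tyofa D (Fo H \<Gamma>) (Cmp (tm D (Fo H \<Gamma>)) y x) = Cmp (ty D (Fo H \<Gamma>)) (tyofa D (Fo H \<Gamma>) y) (tyofa D (Fo H \<Gamma>) x)"
    if "x \<in> Ar (tm D (Fo H \<Gamma>))" "y \<in> Ar (tm D (Fo H \<Gamma>))" "Cod (tm D (Fo H \<Gamma>)) x = Dom (tm D (Fo H \<Gamma>)) y" for x y
    using functor_Cmp[OF Pr_functor[of D "Fo H \<Gamma>"]] that G by simp
  have PC: "tyofa C \<Gamma> (Cmp (tm C \<Gamma>) y x) = Cmp (ty C \<Gamma>) (tyofa C \<Gamma> y) (tyofa C \<Gamma> x)"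
    if "x \<in> Ar (tm C \<Gamma>)" "y \<in> Ar (tm C \<Gamma>)" "Cod (tm C \<Gamma>) x = Dom (tm C \<Gamma>) y" for x y
    using functor_Cmp[OF Pr_functor[of C \<Gamma>]] that G by simp
  have PI: "tyofa D (Fo H \<Gamma>) (Idn (tm D (Fo H \<Gamma>)) x) = Idn (ty D (Fo H \<Gamma>)) (tyof D (Fo H \<Gamma>) x)"
    if "x \<in> Ob (tm D (Fo H \<Gamma>))" for x using functor_Idn[OF Pr_functor[of D "Fo H \<Gamma>"]] that G by simp
  have PIC: "tyofa C \<Gamma> (Idn (tm C \<Gamma>) x) = Idn (ty C \<Gamma>) (tyof C \<Gamma> x)"
    if "x \<in> Ob (tm C \<Gamma>)" for x using functor_Idn[OF Pr_functor[of C \<Gamma>]] that G by simp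
  show "Defs.is_functor (tm C \<Gamma>) (tm D (Fo H \<Gamma>)) (nTm lmor \<Gamma>)"
  proof (rule is_functorI)
    fix t assume "t \<in> Ob (tm C \<Gamma>)"
    then have "ltma \<Gamma> (Idn (tm C \<Gamma>) t) = Idn (tm D (Fo H \<Gamma>)) (ltm \<Gamma> t)"
      by - (rule arrow_of_terms_eq[of D "Fo H \<Gamma>"], use G in \<open>auto simp: PI PIC ltya_Idn\<close>)
    then show "Fa (nTm lmor \<Gamma>) (Idn (tm C \<Gamma>) t) = Idn (tm D (Fo H \<Gamma>)) (Fo (nTm lmor \<Gamma>) t)"
      using \<open>t \<in> Ob (tm C \<Gamma>)\<close> G by simp
  next
    fix f g assume fg: "f \<in> Ar (tm C \<Gamma>)" "g \<in> Ar (tm C \<Gamma>)" "Cod (tm C \<Gamma>) f = Dom (tm C \<Gamma>) g"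
    have "ltma \<Gamma> (Cmp (tm C \<Gamma>) g f) = Cmp (tm D (Fo H \<Gamma>)) (ltma \<Gamma> g) (ltma \<Gamma> f)"
      by (rule arrow_of_terms_eq[of D "Fo H \<Gamma>"]) (use G fg in \<open>auto simp: PD PC ltya_Cmp\<close>)
    then show "Fa (nTm lmor \<Gamma>) (Cmp (tm C \<Gamma>) g f) = Cmp (tm D (Fo H \<Gamma>)) (Fa (nTm lmor \<Gamma>) g) (Fa (nTm lmor \<Gamma>) f)"
      using fg G by simp
  qed (use G in auto)
next
  fix u g assume u: "u \<in> Ar C" and g: "g \<in> Ar (tm C (Cod C u))"
  have "ltma (Dom C u) (msa C u g) = msa D (Fa H u) (ltma (Cod C u) g)"
    by (rule arrow_of_terms_eq[of D "Fo H (Dom C u)"]) (use u g in auto)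
  then show "Fa (nTm lmor (Dom C u)) (msa C u g) = msa D (Fa H u) (Fa (nTm lmor (Cod C u)) g)"
    using u g by simp
qed (auto simp: tau_lmor)

lemma lmor_extensional: "fct_extensional C H \<Longrightarrow> nmor_extensional lmor"
  unfolding nmor_extensional_def fct_extensional_def by (simp add: lmor_def)

end


section \<open>Internal categories\<close>

text \<open>A pullback is a limit over the cospan shape, which is written with numbers because
  finite diagrams have numerical shapes here.\<close>

lemma finite_limits_pullback:
  assumes C: "category C" and lim: "has_finite_limits C" and f: "f \<in> Ar C" and g: "g \<in> Ar C" and fg: "Cod C f = Cod C g"
  shows "\<exists>p q. is_pullback C f g p q"
proof -
  \<comment> \<open>The numbers \<open>0\<close>, \<open>1\<close>, \<open>2\<close> are the objects
    and also their identities; \<open>3\<close> goes from \<open>0\<close> to \<open>2\<close> and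
    \<open>4\<close> from \<open>1\<close> to \<open>2\<close>. In any composable pair one arrow is
    an identity, which explains the formula for composition.\<close>
  define J :: "(nat, nat) cat" where "J = \<lparr>Ob = {0, 1, 2}, Ar = {0, 1, 2, 3, 4},
    Dom = (\<lambda>k. if k = 3 then 0 else if k = 4 then 1 else k), Cod = (\<lambda>k. if k = 3 \<or> k = 4 then 2 else k),
    Idn = (\<lambda>j. j), Cmp = (\<lambda>l k. if k \<le> 2 then l else k)\<rparr>"
  define X :: "(nat, nat, 'a, 'b) fct" where "X = \<lparr>
    Fo = (\<lambda>j. if j = 0 then Dom C f else if j = 1 then Dom C g else Cod C f),
    Fa = (\<lambda>k. if k = 3 then f else if k = 4 then g else
       Idn C (if k = 0 then Dom C f else if k = 1 then Dom C g else Cod C f))\<rparr>"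
  have ObJ: "Ob J = {0, 1, 2}" and ArJ: "Ar J = {0, 1, 2, 3, 4}" by (auto simp: J_def)
  have J: "finite_category J"
    unfolding finite_category_def category_def by (simp add: J_def)
  have X: "is_functor J C X"
    by (rule is_functorI) (use C f g fg in \<open>auto simp: J_def X_def\<close>)
  obtain x l where l: "is_limit J C X x l" using lim J X unfolding has_finite_limits_def by blast
  then have cone: "is_cone J C X x l" by (simp add: is_limit_def)
  have l0: "l 0 \<in> hom C x (Dom C f)" and l1: "l 1 \<in> hom C x (Dom C g)" and l2: "l 2 \<in> hom C x (Cod C f)"
    and lf: "Cmp C f (l 0) = l 2" and lg: "Cmp C g (l 1) = l 2"
    using cone unfolding is_cone_def ObJ ArJ by (auto simp: X_def J_def)
  have "is_pullback C f g (l 0) (l 1)"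
    unfolding is_pullback_def
  proof (intro conjI allI ballI impI)
    fix z a b assume a: "a \<in> hom C z (Dom C f)" and b: "b \<in> hom C z (Dom C g)" and ab: "Cmp C f a = Cmp C g b"
    define m where "m j = (if j = 0 then a else if j = 1 then b else Cmp C f a)" for j :: nat
    have "is_cone J C X z m"
      unfolding is_cone_def ObJ ArJ using C f g fg a b ab by (auto simp: X_def J_def m_def)
    then have ex: "\<exists>!h. h \<in> hom C z x \<and> (\<forall>j\<in>Ob J. Cmp C (l j) h = m j)"
      using l unfolding is_limit_def by blast
    \<comment> \<open>The leg at \<open>2\<close> imposes no further condition: it is
      \<open>f\<close> after the leg at \<open>0\<close>.\<close>
    have "(\<forall>j\<in>Ob J. Cmp C (l j) h = m j) \<longleftrightarrow> Cmp C (l 0) h = a \<and> Cmp C (l 1) h = b" if "h \<in> hom C z x" for h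
      using Cmp_reassoc[OF lf, of h] that l0 C f by (auto simp: ObJ m_def)
    then have "(\<lambda>h. h \<in> hom C z x \<and> (\<forall>j\<in>Ob J. Cmp C (l j) h = m j)) =
        (\<lambda>h. h \<in> hom C z (Dom C (l 0)) \<and> Cmp C (l 0) h = a \<and> Cmp C (l 1) h = b)"
      using l0 by (intro ext) auto
    then show "\<exists>!h. h \<in> hom C z (Dom C (l 0)) \<and> Cmp C (l 0) h = a \<and> Cmp C (l 1) h = b"
      using ex by simp
  qed (use f g fg l0 l1 lf lg in auto)
  then show ?thesis by blast
qed

locale int_cat =
  fixes C :: "('u, 'u, 'z) cat_scheme" and E :: "'u internal"
  assumes C [simp]: "category C" and E: "internal_category C E"
begin

lemma int_simps [simp]:
  "I0 E \<in> Ob C" "I1 E \<in> Ob C" "Ip E \<in> Ob C"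
  "Idm E \<in> Ar C" "Dom C (Idm E) = I1 E" "Cod C (Idm E) = I0 E"
  "Icd E \<in> Ar C" "Dom C (Icd E) = I1 E" "Cod C (Icd E) = I0 E"
  "Iid E \<in> Ar C" "Dom C (Iid E) = I0 E" "Cod C (Iid E) = I1 E"
  "Ip1 E \<in> Ar C" "Dom C (Ip1 E) = Ip E" "Cod C (Ip1 E) = I1 E"
  "Ip2 E \<in> Ar C" "Dom C (Ip2 E) = Ip E" "Cod C (Ip2 E) = I1 E"
  "Imul E \<in> Ar C" "Dom C (Imul E) = Ip E" "Cod C (Imul E) = I1 E"
  using E by (simp_all add: internal_category_def)

lemma int_laws:
  "is_pullback C (Icd E) (Idm E) (Ip1 E) (Ip2 E)"
  "Cmp C (Idm E) (Iid E) = Idn C (I0 E)" "Cmp C (Icd E) (Iid E) = Idn C (I0 E)"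
  "Cmp C (Idm E) (Imul E) = Cmp C (Idm E) (Ip1 E)" "Cmp C (Icd E) (Imul E) = Cmp C (Icd E) (Ip2 E)"
  using E unfolding internal_category_def by blast+

lemma int_unit:
  assumes "f \<in> Ar C" "Cod C f = I1 E"
  shows "icmp C E f (Cmp C (Iid E) (Cmp C (Idm E) f)) = f" "icmp C E (Cmp C (Iid E) (Cmp C (Icd E) f)) f = f"
proof -
  have "f \<in> hom C (Dom C f) (I1 E)" using assms by simp
  then show "icmp C E f (Cmp C (Iid E) (Cmp C (Idm E) f)) = f" "icmp C E (Cmp C (Iid E) (Cmp C (Icd E) f)) f = f"
    using E unfolding internal_category_def by blast+
qed

lemma int_assoc:
  assumes "f \<in> Ar C" "Cod C f = I1 E" "g \<in> Ar C" "Cod C g = I1 E" "h \<in> Ar C" "Cod C h = I1 E"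
    "Dom C f = Dom C g" "Dom C g = Dom C h"
    "Cmp C (Icd E) f = Cmp C (Idm E) g" "Cmp C (Icd E) g = Cmp C (Idm E) h"
  shows "icmp C E h (icmp C E g f) = icmp C E (icmp C E h g) f"
proof -
  have "f \<in> hom C (Dom C f) (I1 E)" "g \<in> hom C (Dom C f) (I1 E)" "h \<in> hom C (Dom C f) (I1 E)" using assms by auto
  then show ?thesis using E assms(9,10) unfolding internal_category_def by blast
qed

lemma icmp_eq:
  assumes "h \<in> Ar C" "Cod C h = Ip E" "Cmp C (Ip1 E) h = f" "Cmp C (Ip2 E) h = g"
  shows "icmp C E g f = Cmp C (Imul E) h"
proof -
  have "Dom C f = Dom C h" using assms by auto
  then have "(THE h. h \<in> hom C (Dom C f) (Ip E) \<and> Cmp C (Ip1 E) h = f \<and> Cmp C (Ip2 E) h = g) = h"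
  proof (intro the_equality)
    fix k assume "Dom C f = Dom C h" "k \<in> hom C (Dom C f) (Ip E) \<and> Cmp C (Ip1 E) k = f \<and> Cmp C (Ip2 E) k = g"
    then show "k = h" using pullback_eq[OF C int_laws(1), of k h] assms by simp
  qed (use assms in auto)
  then show ?thesis by (simp add: icmp_def)
qed

lemma icmp_pair:
  assumes "f \<in> Ar C" "Cod C f = I1 E" "g \<in> Ar C" "Cod C g = I1 E" "Dom C f = Dom C g"
    "Cmp C (Icd E) f = Cmp C (Idm E) g"
  obtains h where "h \<in> Ar C" "Dom C h = Dom C f" "Cod C h = Ip E" "Cmp C (Ip1 E) h = f" "Cmp C (Ip2 E) h = g"
    "icmp C E g f = Cmp C (Imul E) h"
proof -
  obtain h where h: "h \<in> Ar C" "Dom C h = Dom C f" "Cod C h = Dom C (Ip1 E)" "Cmp C (Ip1 E) h = f" "Cmp C (Ip2 E) h = g"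
    by (rule pullback_ex[OF int_laws(1), of f g]) (use assms in auto)
  then show ?thesis using that[of h] icmp_eq[of h f g] by simp
qed

text \<open>All clauses come from one map into the object of composable pairs. The last one,
  stability under precomposition, makes reindexing of the externalization functorial.\<close>

lemma
  assumes "f \<in> Ar C" "Cod C f = I1 E" "g \<in> Ar C" "Cod C g = I1 E" "Dom C f = Dom C g"
    "Cmp C (Icd E) f = Cmp C (Idm E) g"
  shows icmp_ar [simp]: "icmp C E g f \<in> Ar C"
    and Dom_icmp [simp]: "Dom C (icmp C E g f) = Dom C f"
    and Cod_icmp [simp]: "Cod C (icmp C E g f) = I1 E"
    and Idm_icmp: "Cmp C (Idm E) (icmp C E g f) = Cmp C (Idm E) f"
    and Icd_icmp: "Cmp C (Icd E) (icmp C E g f) = Cmp C (Icd E) g"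
    and icmp_Cmp: "u \<in> Ar C \<Longrightarrow> Cod C u = Dom C f \<Longrightarrow> icmp C E (Cmp C g u) (Cmp C f u) = Cmp C (icmp C E g f) u"
proof -
  obtain h where h: "h \<in> Ar C" "Dom C h = Dom C f" "Cod C h = Ip E" "Cmp C (Ip1 E) h = f" "Cmp C (Ip2 E) h = g"
    "icmp C E g f = Cmp C (Imul E) h"
    by (rule icmp_pair[OF assms])
  then show "icmp C E g f \<in> Ar C" "Dom C (icmp C E g f) = Dom C f" "Cod C (icmp C E g f) = I1 E" by auto
  show "Cmp C (Idm E) (icmp C E g f) = Cmp C (Idm E) f"
    using Cmp_reassoc[OF int_laws(4), of h] h by simp
  show "Cmp C (Icd E) (icmp C E g f) = Cmp C (Icd E) g"
    using Cmp_reassoc[OF int_laws(5), of h] h by simp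
  assume u: "u \<in> Ar C" "Cod C u = Dom C f"
  have "Cmp C (Ip1 E) (Cmp C h u) = Cmp C f u" "Cmp C (Ip2 E) (Cmp C h u) = Cmp C g u"
    using Cmp_reassoc[OF h(4), of u] Cmp_reassoc[OF h(5), of u] h(1-3) u by auto
  then have "icmp C E (Cmp C g u) (Cmp C f u) = Cmp C (Imul E) (Cmp C h u)"
    using h(1-3) u by (intro icmp_eq) auto
  then show "icmp C E (Cmp C g u) (Cmp C f u) = Cmp C (icmp C E g f) u"
    using h(1-3) u unfolding h(6) by simp
qed

lemma externalization_simps [simp]:
  "A \<in> Ob (Fib (externalization C E) \<Gamma>) \<longleftrightarrow> A \<in> Ar C \<and> Dom C A = \<Gamma> \<and> Cod C A = I0 E"
  "f \<in> Ar (Fib (externalization C E) \<Gamma>) \<longleftrightarrow> f \<in> Ar C \<and> Dom C f = \<Gamma> \<and> Cod C f = I1 E"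
  "Dom (Fib (externalization C E) \<Gamma>) = Cmp C (Idm E)" "Cod (Fib (externalization C E) \<Gamma>) = Cmp C (Icd E)"
  "Idn (Fib (externalization C E) \<Gamma>) = Cmp C (Iid E)" "Cmp (Fib (externalization C E) \<Gamma>) = icmp C E"
  "Fo (Re (externalization C E) u) A = Cmp C A u" "Fa (Re (externalization C E) u) f = Cmp C f u"
  by (auto simp: externalization_def)

lemma externalization_category: "category (Fib (externalization C E) \<Gamma>)"
proof (rule categoryI)
  fix A assume A: "A \<in> Ob (Fib (externalization C E) \<Gamma>)"
  then show "Idn (Fib (externalization C E) \<Gamma>) A \<in> Ar (Fib (externalization C E) \<Gamma>) \<and>
    Dom (Fib (externalization C E) \<Gamma>) (Idn (Fib (externalization C E) \<Gamma>) A) = A \<and>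
    Cod (Fib (externalization C E) \<Gamma>) (Idn (Fib (externalization C E) \<Gamma>) A) = A"
    using Cmp_reassoc[OF int_laws(2), of A] Cmp_reassoc[OF int_laws(3), of A] by auto
qed (auto simp: Idm_icmp Icd_icmp int_unit int_assoc)

lemma externalization_strict: "strict_indexed_category C (externalization C E)"
  unfolding strict_indexed_category_def
proof (intro conjI ballI)
  fix u assume u: "u \<in> Ar C"
  show "is_functor (Fib (externalization C E) (Cod C u)) (Fib (externalization C E) (Dom C u)) (Re (externalization C E) u)"
    by (rule is_functorI) (use u in \<open>auto simp: icmp_Cmp\<close>)
qed (auto simp: externalization_category)

lemma externalization_iso: "strict_indexed_iso C (externalization C E) (externalization C E)"
proof -
  let ?I = "\<lambda>\<Gamma>. id_fct (Fib (externalization C E) \<Gamma>)"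
  have "strict_indexed_functor C (id_fct C) (externalization C E) (externalization C E) ?I"
    unfolding strict_indexed_functor_def using externalization_category
    by (auto intro!: id_fct_functor)
  then show ?thesis unfolding strict_indexed_iso_def by (intro exI[of _ ?I]) auto
qed

end

text \<open>
  A strict indexed category whose objects and arrows are represented by objects \<open>R0\<close> and \<open>R1\<close> of a
  category with pullbacks comes, by Yoneda, from an internal category.
\<close>

locale represented_icat =
  fixes C :: "('u, 'u, 'z) cat_scheme" and X :: "('u, 'u, 'u, 'u) icat" and R0 R1 v0 v1 :: 'u
  assumes C [simp]: "category C" and X: "strict_indexed_category C X"
    and R [simp]: "R0 \<in> Ob C" "R1 \<in> Ob C" and v [simp]: "v0 \<in> Ob (Fib X R0)" "v1 \<in> Ar (Fib X R1)"
    and univ0: "\<And>\<Gamma> t. \<Gamma> \<in> Ob C \<Longrightarrow> t \<in> Ob (Fib X \<Gamma>) \<Longrightarrow> \<exists>!w. w \<in> hom C \<Gamma> R0 \<and> Fo (Re X w) v0 = t"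
    and univ1: "\<And>\<Gamma> g. \<Gamma> \<in> Ob C \<Longrightarrow> g \<in> Ar (Fib X \<Gamma>) \<Longrightarrow> \<exists>!w. w \<in> hom C \<Gamma> R1 \<and> Fa (Re X w) v1 = g"
begin

lemma X_category [simp]: "\<Gamma> \<in> Ob C \<Longrightarrow> category (Fib X \<Gamma>)"
  by (rule strict_indexed_categoryD(1)[OF X])

lemma X_functor: "u \<in> Ar C \<Longrightarrow> Dom C u = \<Delta> \<Longrightarrow> Cod C u = \<Gamma> \<Longrightarrow> is_functor (Fib X \<Gamma>) (Fib X \<Delta>) (Re X u)"
  using strict_indexed_categoryD(2)[OF X] by auto

lemma
  assumes "u \<in> Ar C" "Dom C u = \<Delta>"
  shows el_ob [simp]: "Cod C u = R0 \<Longrightarrow> Fo (Re X u) v0 \<in> Ob (Fib X \<Delta>)"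
    and el_ar [simp]: "Cod C u = R1 \<Longrightarrow> Fa (Re X u) v1 \<in> Ar (Fib X \<Delta>)"
  using functor_Fo[OF X_functor[OF assms]] functor_Fa[OF X_functor[OF assms]] by auto

lemma el_Cmp0: "u \<in> Ar C \<Longrightarrow> w \<in> Ar C \<Longrightarrow> Cod C u = Dom C w \<Longrightarrow> Cod C w = R0 \<Longrightarrow>
    Fo (Re X (Cmp C w u)) v0 = Fo (Re X u) (Fo (Re X w) v0)"
  and el_Cmp1: "u \<in> Ar C \<Longrightarrow> w \<in> Ar C \<Longrightarrow> Cod C u = Dom C w \<Longrightarrow> Cod C w = R1 \<Longrightarrow>
    Fa (Re X (Cmp C w u)) v1 = Fa (Re X u) (Fa (Re X w) v1)"
  using strict_indexed_categoryD(5,6)[OF X, of u w] by auto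

lemma el_eq0: "u \<in> Ar C \<Longrightarrow> w \<in> Ar C \<Longrightarrow> Dom C u = Dom C w \<Longrightarrow> Cod C u = R0 \<Longrightarrow> Cod C w = R0 \<Longrightarrow>
    Fo (Re X u) v0 = Fo (Re X w) v0 \<Longrightarrow> u = w"
  using univ0[of "Dom C w" "Fo (Re X w) v0"] by auto

lemma el_eq1: "u \<in> Ar C \<Longrightarrow> w \<in> Ar C \<Longrightarrow> Dom C u = Dom C w \<Longrightarrow> Cod C u = R1 \<Longrightarrow> Cod C w = R1 \<Longrightarrow>
    Fa (Re X u) v1 = Fa (Re X w) v1 \<Longrightarrow> u = w"
  using univ1[of "Dom C w" "Fa (Re X w) v1"] by auto

text \<open>Every structure map classifies the corresponding datum of a universal element: domain
  and codomain of the universal arrow, identity of the universal object, composite of the universal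
  composable pair. Equations between structure maps hold because the elements they classify are
  equal in the fibres of \<open>X\<close>.\<close>

lemma internalize:
  assumes pbs: "\<And>f g. f \<in> Ar C \<Longrightarrow> g \<in> Ar C \<Longrightarrow> Cod C f = Cod C g \<Longrightarrow> \<exists>p q. is_pullback C f g p q"
  obtains T where "internal_category C T" "I0 T = R0" "I1 T = R1"
    "Fo (Re X (Idm T)) v0 = Dom (Fib X R1) v1" "Fo (Re X (Icd T)) v0 = Cod (Fib X R1) v1"
    "Fa (Re X (Iid T)) v1 = Idn (Fib X R0) v0"
    "Fa (Re X (Imul T)) v1 = Cmp (Fib X (Ip T)) (Fa (Re X (Ip2 T)) v1) (Fa (Re X (Ip1 T)) v1)"
proof -
  let ?r = "\<lambda>f. Fa (Re X f) v1" and ?s = "\<lambda>f. Fo (Re X f) v0"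
  obtain dm where dm: "dm \<in> Ar C" "Dom C dm = R1" "Cod C dm = R0" "?s dm = Dom (Fib X R1) v1"
    using univ0[of R1 "Dom (Fib X R1) v1"] by auto
  obtain cd where cd: "cd \<in> Ar C" "Dom C cd = R1" "Cod C cd = R0" "?s cd = Cod (Fib X R1) v1"
    using univ0[of R1 "Cod (Fib X R1) v1"] by auto
  obtain ii where ii: "ii \<in> Ar C" "Dom C ii = R0" "Cod C ii = R1" "?r ii = Idn (Fib X R0) v0"
    using univ1[of R0 "Idn (Fib X R0) v0"] by auto
  obtain p q where pq: "is_pullback C cd dm p q" using pbs[of cd dm] dm cd by auto
  define P where "P = Dom C p"
  have p: "p \<in> Ar C" "Dom C p = P" "Cod C p = R1" "q \<in> Ar C" "Dom C q = P" "Cod C q = R1"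
    using pullback_ar[OF pq] pullback_bd[OF pq] dm cd by (auto simp: P_def)
  have P: "P \<in> Ob C" using p by (auto simp: P_def)
  have rD: "Dom (Fib X \<Gamma>) (?r f) = ?s (Cmp C dm f)" "Cod (Fib X \<Gamma>) (?r f) = ?s (Cmp C cd f)"
    if "f \<in> Ar C" "Dom C f = \<Gamma>" "Cod C f = R1" for f \<Gamma>
    using functor_Dom[OF X_functor[OF that] v(2)] functor_Cod[OF X_functor[OF that] v(2)] el_Cmp0[of f dm] el_Cmp0[of f cd] dm cd that
    by auto
  have c: "Cod (Fib X P) (?r p) = Dom (Fib X P) (?r q)"
    using rD(2)[OF p(1-3)] rD(1)[OF p(4-6)] pullback_comm[OF pq] by simp
  have qp: "Cmp (Fib X P) (?r q) (?r p) \<in> Ar (Fib X P)" using c p P by simp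
  obtain mul where mul: "mul \<in> Ar C" "Dom C mul = P" "Cod C mul = R1" "?r mul = Cmp (Fib X P) (?r q) (?r p)"
    using univ1[OF P qp] by auto
  define T where "T = \<lparr>I0 = R0, I1 = R1, Idm = dm, Icd = cd, Iid = ii, Ip = P, Ip1 = p, Ip2 = q, Imul = mul\<rparr>"
  have T: "I0 T = R0" "I1 T = R1" "Idm T = dm" "Icd T = cd" "Iid T = ii" "Ip T = P" "Ip1 T = p" "Ip2 T = q" "Imul T = mul"
    by (auto simp: T_def)
  \<comment> \<open>Composition of generalised elements classifies composition in the fibre; the
    unit and associativity laws are read off from this.\<close>
  have icmp: "icmp C T g f \<in> Ar C \<and> Dom C (icmp C T g f) = \<Gamma> \<and> Cod C (icmp C T g f) = R1 \<and>
      ?r (icmp C T g f) = Cmp (Fib X \<Gamma>) (?r g) (?r f)"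
    if f: "f \<in> Ar C" "Dom C f = \<Gamma>" "Cod C f = R1" and g: "g \<in> Ar C" "Dom C g = \<Gamma>" "Cod C g = R1"
      and fg: "Cmp C cd f = Cmp C dm g" for f g \<Gamma>
  proof -
    obtain h where h: "h \<in> Ar C" "Dom C h = Dom C f" "Cod C h = Dom C p" "Cmp C p h = f" "Cmp C q h = g"
      by (rule pullback_ex[OF pq, of f g]) (use f g fg dm cd in auto)
    have "(THE h. h \<in> hom C (Dom C f) (Ip T) \<and> Cmp C (Ip1 T) h = f \<and> Cmp C (Ip2 T) h = g) = h"
    proof (rule the_equality)
      fix k assume "k \<in> hom C (Dom C f) (Ip T) \<and> Cmp C (Ip1 T) k = f \<and> Cmp C (Ip2 T) k = g"
      then show "k = h" using pullback_eq[OF C pq, of k h] h p by (simp add: T)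
    qed (use h p in \<open>auto simp: T\<close>)
    then have e: "icmp C T g f = Cmp C mul h" by (simp add: icmp_def T)
    have "?r (Cmp C mul h) = Fa (Re X h) (Cmp (Fib X P) (?r q) (?r p))"
      using el_Cmp1[of h mul] h mul p by simp
    also have "\<dots> = Cmp (Fib X \<Gamma>) (Fa (Re X h) (?r q)) (Fa (Re X h) (?r p))"
      by (rule functor_Cmp[OF X_functor]) (use h p f c in auto)
    also have "\<dots> = Cmp (Fib X \<Gamma>) (?r g) (?r f)"
      using el_Cmp1[of h p] el_Cmp1[of h q] h p by simp
    finally show ?thesis unfolding e using h mul p f by simp
  qed
  have ar_ii: "Cmp C ii A \<in> Ar C" "Dom C (Cmp C ii A) = \<Gamma>" "Cod C (Cmp C ii A) = R1" "?r (Cmp C ii A) = Idn (Fib X \<Gamma>) (?s A)"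
    if "A \<in> Ar C" "Dom C A = \<Gamma>" "Cod C A = R0" for A \<Gamma>
    using that ii el_Cmp1[of A ii] functor_Idn[OF X_functor[OF that] v(1)] by auto
  have dmii: "Cmp C dm ii = Idn C R0" "Cmp C cd ii = Idn C R0"
  proof -
    have i: "Fo (Re X (Idn C R0)) v0 = v0" using strict_indexed_categoryD(3)[OF X] by simp
    show "Cmp C dm ii = Idn C R0"
      by (rule el_eq0) (use dm ii rD(1)[OF ii(1-3)] i in auto)
    show "Cmp C cd ii = Idn C R0"
      by (rule el_eq0) (use cd ii rD(2)[OF ii(1-3)] i in auto)
  qed
  have "internal_category C T"
    unfolding internal_category_def T
  proof (intro conjI allI ballI impI)
    show "Cmp C dm mul = Cmp C dm p"
      by (rule el_eq0) (use dm mul p P rD(1)[OF mul(1-3)] rD(1)[OF p(1-3)] c in auto)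
    show "Cmp C cd mul = Cmp C cd q"
      by (rule el_eq0) (use cd mul p P rD(2)[OF mul(1-3)] rD(2)[OF p(4-6)] c in auto)
  next
    fix \<Gamma> f assume "f \<in> hom C \<Gamma> R1"
    then have f: "f \<in> Ar C" "Dom C f = \<Gamma>" "Cod C f = R1" by auto
    have G: "\<Gamma> \<in> Ob C" using f by auto
    have a: "Cmp C dm f \<in> Ar C" "Dom C (Cmp C dm f) = \<Gamma>" "Cod C (Cmp C dm f) = R0"
      "Cmp C cd f \<in> Ar C" "Dom C (Cmp C cd f) = \<Gamma>" "Cod C (Cmp C cd f) = R0"
      using f dm cd by auto
    have e1: "Cmp C cd (Cmp C ii (Cmp C dm f)) = Cmp C dm f" "Cmp C dm (Cmp C ii (Cmp C cd f)) = Cmp C cd f"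
      using Cmp_reassoc[OF dmii(2), of "Cmp C dm f"] Cmp_reassoc[OF dmii(1), of "Cmp C cd f"] a ii cd dm by auto
    note k1 = icmp[OF ar_ii(1-3)[OF a(1-3)] f e1(1)] and k2 = icmp[OF f ar_ii(1-3)[OF a(4-6)] e1(2)[symmetric]]
    show "icmp C T f (Cmp C ii (Cmp C dm f)) = f"
      by (rule el_eq1) (use k1 f ar_ii(4)[OF a(1-3)] rD(1)[OF f] G in auto)
    show "icmp C T (Cmp C ii (Cmp C cd f)) f = f"
      by (rule el_eq1) (use k2 f ar_ii(4)[OF a(4-6)] rD(2)[OF f] G in auto)
  next
    fix \<Gamma> f g h assume "f \<in> hom C \<Gamma> R1" "g \<in> hom C \<Gamma> R1" "h \<in> hom C \<Gamma> R1"
      and fgh: "Cmp C cd f = Cmp C dm g \<and> Cmp C cd g = Cmp C dm h"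
    then have f: "f \<in> Ar C" "Dom C f = \<Gamma>" "Cod C f = R1" and g: "g \<in> Ar C" "Dom C g = \<Gamma>" "Cod C g = R1"
      and h: "h \<in> Ar C" "Dom C h = \<Gamma>" "Cod C h = R1" by auto
    have G: "\<Gamma> \<in> Ob C" using f by auto
    note gf = icmp[OF f g fgh[THEN conjunct1]] and hg = icmp[OF g h fgh[THEN conjunct2]]
    let ?gf = "icmp C T g f" and ?hg = "icmp C T h g"
    have rc: "Cod (Fib X \<Gamma>) (?r f) = Dom (Fib X \<Gamma>) (?r g)" "Cod (Fib X \<Gamma>) (?r g) = Dom (Fib X \<Gamma>) (?r h)"
      using rD[OF f] rD[OF g] rD[OF h] fgh by auto
    have ra: "?r f \<in> Ar (Fib X \<Gamma>)" "?r g \<in> Ar (Fib X \<Gamma>)" "?r h \<in> Ar (Fib X \<Gamma>)" using f g h by auto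
    have "Cmp C cd ?gf = Cmp C cd g"
      by (rule el_eq0) (use cd gf g rD(2)[of ?gf \<Gamma>] rD(2)[OF g] rc ra G in auto)
    then have e1: "Cmp C cd ?gf = Cmp C dm h" using fgh by simp
    have "Cmp C dm ?hg = Cmp C dm g"
      by (rule el_eq0) (use dm hg g rD(1)[of ?hg \<Gamma>] rD(1)[OF g] rc ra G in auto)
    then have e2: "Cmp C cd f = Cmp C dm ?hg" using fgh by simp
    have gf': "?gf \<in> Ar C" "Dom C ?gf = \<Gamma>" "Cod C ?gf = R1" and hg': "?hg \<in> Ar C" "Dom C ?hg = \<Gamma>" "Cod C ?hg = R1"
      using gf hg by auto
    show "icmp C T h ?gf = icmp C T ?hg f"
      by (rule el_eq1) (use icmp[OF gf' h e1] icmp[OF f hg' e2] gf hg rc ra G in auto)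
  qed (use dm cd ii p P mul pq dmii in auto)
  then show ?thesis using that[of T] T dm cd ii mul by simp
qed

end


section \<open>Universes and type classifiers\<close>

lemma truncate_simps [simp]:
  "Ob (dcat.truncate N) = Ob N" "Ar (dcat.truncate N) = Ar N" "Dom (dcat.truncate N) = Dom N"
  "Cod (dcat.truncate N) = Cod N" "Idn (dcat.truncate N) = Idn N" "Cmp (dcat.truncate N) = Cmp N"
  "Disp (dcat.truncate N) = Disp N" "Pbk (dcat.truncate N) = Pbk N" "Pbt (dcat.truncate N) = Pbt N"
  by (simp_all add: dcat.defs)

lemma truncate_hom [simp]: "hom (dcat.truncate N) = hom N"
  by (intro ext) (simp add: hom_def)

lemma truncate_cat [simp]:
  "category (dcat.truncate N) = category N"
  "is_iso (dcat.truncate N) = is_iso N"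
  "is_pullback (dcat.truncate N) = is_pullback N"
  "is_functor (dcat.truncate N) = is_functor N"
  "is_functor J (dcat.truncate N) = is_functor J N"
  "is_cone J (dcat.truncate N) = is_cone J N"
  unfolding category_def is_iso_def is_pullback_def is_functor_def is_cone_def fun_eq_iff truncate_simps truncate_hom
  by (rule refl | intro allI refl)+

lemma truncate_limit [simp]: "is_limit J (dcat.truncate N) = is_limit J N"
  unfolding is_limit_def fun_eq_iff truncate_cat truncate_simps truncate_hom by (intro allI refl)

lemma truncate_lim [simp]:
  "has_finite_limits (dcat.truncate N) = has_finite_limits N"
  "preserves_finite_limits (dcat.truncate N) = preserves_finite_limits N"
  "preserves_finite_limits C (dcat.truncate N) = preserves_finite_limits C N"
  unfolding has_finite_limits_def preserves_finite_limits_def fun_eq_iff truncate_cat truncate_limit truncate_simps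
  by (rule refl | intro allI refl)+

lemma truncate_slice [simp]: "slice (dcat.truncate N) = slice N"
  unfolding slice_def fun_eq_iff truncate_simps truncate_hom by (intro allI refl)

lemma truncate_disp [simp]:
  "disp_fib (dcat.truncate N) = disp_fib N"
  "disp_reindex (dcat.truncate N) = disp_reindex N"
  unfolding disp_fib_def disp_reindex_def fun_eq_iff truncate_simps truncate_hom truncate_slice by (intro allI refl)+

lemma truncate_incl [simp]: "disp_incl (dcat.truncate N) = disp_incl N"
  unfolding disp_incl_def fun_eq_iff truncate_disp by (intro allI refl)

lemma truncate_dcat [simp]:
  "display_category (dcat.truncate N) = display_category N"
  "cartesian_dcat (dcat.truncate N) = cartesian_dcat N"
  "display_functor (dcat.truncate N) = display_functor N"
  "display_functor C (dcat.truncate N) = display_functor C N"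
  "small_cat small (dcat.truncate N) = small_cat small N"
  unfolding display_category_def cartesian_dcat_def display_functor_def small_cat_def fun_eq_iff
    truncate_simps truncate_cat truncate_disp truncate_lim truncate_slice truncate_incl
  by (rule refl | intro allI refl)+

lemma truncate_icmp [simp]: "icmp (dcat.truncate N) = icmp N"
  unfolding icmp_def fun_eq_iff truncate_simps truncate_hom by (intro allI refl)

lemma truncate_internal [simp]:
  "internal_category (dcat.truncate N) = internal_category N"
  "internal_functor (dcat.truncate N) = internal_functor N"
  "externalization (dcat.truncate N) = externalization N"
  "universe_functor (dcat.truncate N) = universe_functor N"
  unfolding internal_category_def internal_functor_def externalization_def universe_functor_def fun_eq_iff
    truncate_simps truncate_hom truncate_icmp truncate_cat
  by (rule refl | intro allI refl)+

lemma truncate_universe [simp]: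
  "is_universe (dcat.truncate N) = is_universe N" "admits_universe (dcat.truncate N) = admits_universe N"
  unfolding is_universe_def internal_discrete_opfibration_def admits_universe_def fun_eq_iff
    truncate_simps truncate_internal truncate_disp truncate_cat
  by (rule refl | intro allI refl)+

text \<open>The definitions are such that the comprehension of this model is literally \<open>universe_functor\<close>.\<close>

definition univ_model :: "'u dcat \<Rightarrow> 'u internal \<Rightarrow> 'u internal \<Rightarrow> 'u \<Rightarrow> 'u \<Rightarrow> 'u natmod" where
  "univ_model C T E p0 p1 = dcat.extend C (natmod.fields (externalization C E) (externalization C T)
     (\<lambda>\<Gamma>. \<lparr>Fo = Cmp C p0, Fa = Cmp C p1\<rparr>) (\<lambda>\<Gamma> A. Pbk C A p0) (\<lambda>\<Gamma> A. Pbt C A p0))"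

lemma truncate_univ_model [simp]: "dcat.truncate (univ_model C T E p0 p1) = C"
  by (simp add: univ_model_def dcat.defs)

section \<open>Natural models from universes\<close>

locale disp_opfib =
  fixes C :: "'u dcat" and T E :: "'u internal" and p0 p1 :: 'u
  assumes display: "display_category C" and op: "internal_discrete_opfibration C T E p0 p1" and p0 [simp]: "p0 \<in> Disp C"
begin

abbreviation N where "N \<equiv> univ_model C T E p0 p1"

lemma N_simps [simp]:
  "Ob N = Ob C" "Ar N = Ar C" "Dom N = Dom C" "Cod N = Cod C" "Idn N = Idn C" "Cmp N = Cmp C" "Disp N = Disp C"
  "Tp N = externalization C E" "Tm N = externalization C T"
  "Fo (Pr N \<Gamma>) = Cmp C p0" "Fa (Pr N \<Gamma>) = Cmp C p1" "Prj N \<Gamma> A = Pbk C A p0" "Var N \<Gamma> A = Pbt C A p0"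
  by (simp_all add: univ_model_def dcat.defs natmod.defs)

lemma C [simp]: "category C"
  using display by simp

sublocale E: int_cat C E
  using op by unfold_locales (auto simp: internal_discrete_opfibration_def)

sublocale T: int_cat C T
  using op by unfold_locales (auto simp: internal_discrete_opfibration_def)

lemma p_simps [simp]:
  "p0 \<in> Ar C" "Dom C p0 = I0 T" "Cod C p0 = I0 E" "p1 \<in> Ar C" "Dom C p1 = I1 T" "Cod C p1 = I1 E"
  using op by (auto simp: internal_discrete_opfibration_def internal_functor_def)

lemma p_laws:
  "is_pullback C (Idm E) p0 p1 (Idm T)"
  "Cmp C (Icd E) p1 = Cmp C p0 (Icd T)" "Cmp C p1 (Iid T) = Cmp C (Iid E) p0"
  "Cmp C p1 (Imul T) = icmp C E (Cmp C p1 (Ip2 T)) (Cmp C p1 (Ip1 T))"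
  using op by (auto simp: internal_discrete_opfibration_def internal_functor_def)

text \<open>On generalised elements the pullback square of \<open>p0\<close> and the domain maps is
  the unique lifting property. Preservation of composites is the internal law for
  \<open>Imul\<close>, precomposed with the map that classifies a composable pair.\<close>

lemma Pr_opfib: "is_discrete_opfibration (Fib (externalization C T) \<Gamma>) (Fib (externalization C E) \<Gamma>) (Pr N \<Gamma>)"
  unfolding is_discrete_opfibration_def
proof (intro conjI ballI impI)
  show "is_functor (Fib (externalization C T) \<Gamma>) (Fib (externalization C E) \<Gamma>) (Pr N \<Gamma>)"
  proof (rule is_functorI)
    fix f assume "f \<in> Ar (Fib (externalization C T) \<Gamma>)"
    then show "Fa (Pr N \<Gamma>) f \<in> Ar (Fib (externalization C E) \<Gamma>) \<and>
        Dom (Fib (externalization C E) \<Gamma>) (Fa (Pr N \<Gamma>) f) = Fo (Pr N \<Gamma>) (Dom (Fib (externalization C T) \<Gamma>) f) \<and>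
        Cod (Fib (externalization C E) \<Gamma>) (Fa (Pr N \<Gamma>) f) = Fo (Pr N \<Gamma>) (Cod (Fib (externalization C T) \<Gamma>) f)"
      using Cmp_reassoc[OF pullback_comm[OF p_laws(1)], of f] Cmp_reassoc[OF p_laws(2), of f] by auto
  next
    fix t assume "t \<in> Ob (Fib (externalization C T) \<Gamma>)"
    then show "Fa (Pr N \<Gamma>) (Idn (Fib (externalization C T) \<Gamma>) t) = Idn (Fib (externalization C E) \<Gamma>) (Fo (Pr N \<Gamma>) t)"
      using Cmp_reassoc[OF p_laws(3), of t] by auto
  next
    fix f g assume "f \<in> Ar (Fib (externalization C T) \<Gamma>)" "g \<in> Ar (Fib (externalization C T) \<Gamma>)"
      "Cod (Fib (externalization C T) \<Gamma>) f = Dom (Fib (externalization C T) \<Gamma>) g"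
    then have f: "f \<in> Ar C" "Cod C f = I1 T" "Dom C f = \<Gamma>" and g: "g \<in> Ar C" "Cod C g = I1 T" "Dom C g = \<Gamma>"
      and fg: "Cmp C (Icd T) f = Cmp C (Idm T) g" by auto
    obtain h where h: "h \<in> Ar C" "Dom C h = Dom C f" "Cod C h = Ip T" "Cmp C (Ip1 T) h = f" "Cmp C (Ip2 T) h = g"
      "icmp C T g f = Cmp C (Imul T) h"
      by (rule T.icmp_pair) (use f g fg in auto)
    let ?a = "Cmp C p1 (Ip1 T)" and ?b = "Cmp C p1 (Ip2 T)"
    have ab: "Cmp C (Icd E) ?a = Cmp C (Idm E) ?b"
      using Cmp_reassoc[OF p_laws(2), of "Ip1 T"] Cmp_reassoc[OF pullback_comm[OF p_laws(1)], of "Ip2 T"]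
        pullback_comm[OF T.int_laws(1)] by simp
    have "Cmp C p1 (icmp C T g f) = Cmp C (icmp C E ?b ?a) h"
      using Cmp_reassoc[OF p_laws(4), of h] h by simp
    also have "\<dots> = icmp C E (Cmp C ?b h) (Cmp C ?a h)"
      by (rule E.icmp_Cmp[symmetric]) (use h ab in auto)
    also have "\<dots> = icmp C E (Cmp C p1 g) (Cmp C p1 f)" using h(1-5) by auto
    finally show "Fa (Pr N \<Gamma>) (Cmp (Fib (externalization C T) \<Gamma>) g f) =
      Cmp (Fib (externalization C E) \<Gamma>) (Fa (Pr N \<Gamma>) g) (Fa (Pr N \<Gamma>) f)" by simp
  qed auto
next
  fix t f assume "t \<in> Ob (Fib (externalization C T) \<Gamma>)" "f \<in> Ar (Fib (externalization C E) \<Gamma>)"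
    "Dom (Fib (externalization C E) \<Gamma>) f = Fo (Pr N \<Gamma>) t"
  then have "\<exists>!g. g \<in> hom C (Dom C f) (Dom C p1) \<and> Cmp C p1 g = f \<and> Cmp C (Idm T) g = t"
    by (intro pullback_ex1[OF p_laws(1)]) auto
  then show "\<exists>!g. g \<in> Ar (Fib (externalization C T) \<Gamma>) \<and> Dom (Fib (externalization C T) \<Gamma>) g = t \<and> Fa (Pr N \<Gamma>) g = f"
    using \<open>f \<in> Ar (Fib (externalization C E) \<Gamma>)\<close> by (simp add: conj_ac)
qed

text \<open>Fibres of an externalization are sets of arrows of \<open>C\<close>, hence the closure
  of \<open>small\<close> under subsets. Representability is the universal property of the chosen
  pullback of \<open>p0\<close>.\<close>

lemma N_prenat:
  assumes "small_cat small C" "\<And>A B. small A \<Longrightarrow> B \<subseteq> A \<Longrightarrow> small B"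
  shows "pre_natural_model small N"
  unfolding pre_natural_model_def
proof (intro conjI ballI)
  have e: "externalization N = externalization C" and sc: "strict_indexed_category N = strict_indexed_category C"
    using truncate_internal(3)[of N] by (auto simp: strict_indexed_category_def fun_eq_iff)
  show "display_category N" using truncate_dcat(1)[of N] display by simp
  show "small_cat small N" using assms by (simp add: small_cat_def)
  show "strict_indexed_category N (Tp N)" "strict_indexed_category N (Tm N)"
    unfolding sc using E.externalization_strict T.externalization_strict by auto
  show "strict_indexed_functor N (id_fct N) (Tm N) (Tp N) (Pr N)"
    unfolding strict_indexed_functor_def
  proof (intro conjI ballI)
    fix \<Gamma> assume G: "\<Gamma> \<in> Ob N"
    show "is_functor (tm N \<Gamma>) (ty N (Fo (id_fct N) \<Gamma>)) (Pr N \<Gamma>)"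
      using Pr_opfib[of \<Gamma>] G by (simp add: is_discrete_opfibration_def)
  qed auto
next
  fix \<Gamma> assume G: "\<Gamma> \<in> Ob N"
  have s: "small (Ar C)" using assms by (simp add: small_cat_def)
  have "Ob (ty N \<Gamma>) \<subseteq> Ar C" "Ar (ty N \<Gamma>) \<subseteq> Ar C" "Ob (tm N \<Gamma>) \<subseteq> Ar C" "Ar (tm N \<Gamma>) \<subseteq> Ar C" by auto
  then show "small_cat small (ty N \<Gamma>)" "small_cat small (tm N \<Gamma>)"
    unfolding small_cat_def using assms(2)[OF s] by auto
  show "is_discrete_opfibration (tm N \<Gamma>) (ty N \<Gamma>) (Pr N \<Gamma>)" using Pr_opfib[of \<Gamma>] by simp
  fix A assume A: "A \<in> Ob (ty N \<Gamma>)"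
  then have A': "A \<in> Ar C" "Dom C A = \<Gamma>" "Cod C A = I0 E" by auto
  have pb: "Pbk C A p0 \<in> Disp C" "is_pullback C A p0 (Pbk C A p0) (Pbt C A p0)"
    using display_pullback[OF display p0 A'(1)] A' by auto
  note p = pullback_ar[OF pb(2)] pullback_bd[OF pb(2)] pullback_comm[OF pb(2)]
  show "Prj N \<Gamma> A \<in> Disp N" using pb by simp
  show "represents N \<Gamma> A (Prj N \<Gamma> A) (Var N \<Gamma> A)"
    unfolding represents_def
  proof (intro conjI allI ballI impI)
    fix \<Delta> u t assume u: "u \<in> hom N \<Delta> \<Gamma>" and t: "t \<in> Ob (tm N \<Delta>)" and ut: "tyof N \<Delta> t = tsb N u A"
    have "\<exists>!h. h \<in> hom C (Dom C u) (Dom C (Pbk C A p0)) \<and> Cmp C (Pbk C A p0) h = u \<and> Cmp C (Pbt C A p0) h = t"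
      by (rule pullback_ex1[OF pb(2)]) (use u t ut A' in auto)
    then show "\<exists>!w. w \<in> hom N \<Delta> (ext N \<Gamma> A) \<and> Cmp N (Prj N \<Gamma> A) w = u \<and> msb N w (Var N \<Gamma> A) = t"
      using u by (simp add: hom_def)
  qed (use p A' in auto)
qed

lemma prenat_N: "prenat N"
  unfolding prenat_def by (rule N_prenat) (auto simp: small_cat_def)

lemma comprehension_N: "comprehension N \<Gamma> = universe_functor C T E p0 p1"
  by (simp add: comprehension_def universe_functor_def fun_eq_iff Let_def ext_pair_def conj_ac hom_def externalization_def)

lemma disp_fib_N: "disp_fib N = disp_fib C"
  using truncate_disp(1)[of N] by simp

end

text \<open>The types of this model are by definition the externalization of \<open>E\<close>, so
  \<open>E\<close> itself is a type classifier.\<close>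

lemma universe_natural_model:
  assumes C: "display_category C" "cartesian_dcat C" and s: "small_cat small C" "\<And>A B. small A \<Longrightarrow> B \<subseteq> A \<Longrightarrow> small B"
    and u: "is_universe C T E p0 p1"
  shows "cnm_object small (univ_model C T E p0 p1)"
proof -
  interpret disp_opfib C T E p0 p1
    using C u by unfold_locales (auto simp: is_universe_def)
  have "natural_model small N"
    unfolding natural_model_def using N_prenat[OF s] u by (simp add: is_universe_def comprehension_N disp_fib_N)
  moreover have "admits_type_classifier N"
  proof -
    have iN: "internal_category N E" using E.E truncate_internal(1)[of N] by simp
    interpret NE: int_cat N E using iN prenat_N by unfold_locales auto
    have "externalization N E = Tp N" using truncate_internal(3)[of N] by simp
    then show ?thesis unfolding admits_type_classifier_def using NE.externalization_iso iN by (metis)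
  qed
  ultimately show ?thesis unfolding cnm_object_def using assms(2) by simp
qed

text \<open>
  Conversely, the terms of a natural model with a type classifier \<open>E\<close> are classified by an internal
  category over \<open>E\<close>: its object of objects is the comprehension of the generic type \<open>A0\<close>, and its object
  of arrows is the pullback of the domain map of \<open>E\<close>.
\<close>

locale classified_model =
  fixes N :: "'u natmod" and E :: "'u internal" and \<Phi> \<Psi> :: "'u \<Rightarrow> ('u, 'u, 'u, 'u) fct"
  assumes N [simp]: "prenat N" and E: "internal_category N E"
    and \<Phi>: "strict_indexed_functor N (id_fct N) (externalization N E) (Tp N) \<Phi>"
    and \<Psi>: "strict_indexed_functor N (id_fct N) (Tp N) (externalization N E) \<Psi>"
    and inverse: "\<And>\<Gamma> A. \<Gamma> \<in> Ob N \<Longrightarrow> A \<in> Ob (Fib (externalization N E) \<Gamma>) \<Longrightarrow> Fo (\<Psi> \<Gamma>) (Fo (\<Phi> \<Gamma>) A) = A"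
      "\<And>\<Gamma> f. \<Gamma> \<in> Ob N \<Longrightarrow> f \<in> Ar (Fib (externalization N E) \<Gamma>) \<Longrightarrow> Fa (\<Psi> \<Gamma>) (Fa (\<Phi> \<Gamma>) f) = f"
      "\<And>\<Gamma> B. \<Gamma> \<in> Ob N \<Longrightarrow> B \<in> Ob (ty N \<Gamma>) \<Longrightarrow> Fo (\<Phi> \<Gamma>) (Fo (\<Psi> \<Gamma>) B) = B"
      "\<And>\<Gamma> g. \<Gamma> \<in> Ob N \<Longrightarrow> g \<in> Ar (ty N \<Gamma>) \<Longrightarrow> Fa (\<Phi> \<Gamma>) (Fa (\<Psi> \<Gamma>) g) = g"
begin

sublocale E: int_cat N E
  using E by unfold_locales auto

lemma \<Phi>_functor: "\<Gamma> \<in> Ob N \<Longrightarrow> is_functor (Fib (externalization N E) \<Gamma>) (ty N \<Gamma>) (\<Phi> \<Gamma>)"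
  and \<Psi>_functor: "\<Gamma> \<in> Ob N \<Longrightarrow> is_functor (ty N \<Gamma>) (Fib (externalization N E) \<Gamma>) (\<Psi> \<Gamma>)"
  using \<Phi> \<Psi> by (auto simp: strict_indexed_functor_def)

lemma
  assumes "f \<in> Ar N" "Dom N f = \<Gamma>"
  shows \<Phi>_ob [simp]: "Cod N f = I0 E \<Longrightarrow> Fo (\<Phi> \<Gamma>) f \<in> Ob (ty N \<Gamma>)"
    and \<Phi>_ar [simp]: "Cod N f = I1 E \<Longrightarrow> Fa (\<Phi> \<Gamma>) f \<in> Ar (ty N \<Gamma>)"
    and Dom_\<Phi> [simp]: "Cod N f = I1 E \<Longrightarrow> Dom (ty N \<Gamma>) (Fa (\<Phi> \<Gamma>) f) = Fo (\<Phi> \<Gamma>) (Cmp N (Idm E) f)"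
    and Cod_\<Phi> [simp]: "Cod N f = I1 E \<Longrightarrow> Cod (ty N \<Gamma>) (Fa (\<Phi> \<Gamma>) f) = Fo (\<Phi> \<Gamma>) (Cmp N (Icd E) f)"
  using \<Phi>_functor[of \<Gamma>] assms functor_Fo[OF \<Phi>_functor, of \<Gamma> f] functor_Fa[OF \<Phi>_functor, of \<Gamma> f]
    functor_Dom[OF \<Phi>_functor, of \<Gamma> f] functor_Cod[OF \<Phi>_functor, of \<Gamma> f] Dom_ob[of N f]
  by auto

lemma \<Phi>_Cmp:
  assumes "u \<in> Ar N" "f \<in> Ar N" "Cod N u = Dom N f" "Dom N u = \<Delta>"
  shows "Cod N f = I0 E \<Longrightarrow> Fo (\<Phi> \<Delta>) (Cmp N f u) = tsb N u (Fo (\<Phi> (Dom N f)) f)"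
    "Cod N f = I1 E \<Longrightarrow> Fa (\<Phi> \<Delta>) (Cmp N f u) = tsa N u (Fa (\<Phi> (Dom N f)) f)"
  using \<Phi> assms unfolding strict_indexed_functor_def by auto

lemma \<Phi>_eq0:
  assumes "u \<in> Ar N" "w \<in> Ar N" "Dom N u = \<Gamma>" "Dom N w = \<Gamma>" "Cod N u = I0 E" "Cod N w = I0 E"
    "Fo (\<Phi> \<Gamma>) u = Fo (\<Phi> \<Gamma>) w"
  shows "u = w"
proof -
  have "Fo (\<Psi> \<Gamma>) (Fo (\<Phi> \<Gamma>) x) = x" if "x \<in> Ar N" "Dom N x = \<Gamma>" "Cod N x = I0 E" for x
    using inverse(1)[of \<Gamma> x] that by auto
  then show ?thesis using assms by metis
qed

lemma \<Phi>_eq1: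
  assumes "u \<in> Ar N" "w \<in> Ar N" "Dom N u = \<Gamma>" "Dom N w = \<Gamma>" "Cod N u = I1 E" "Cod N w = I1 E"
    "Fa (\<Phi> \<Gamma>) u = Fa (\<Phi> \<Gamma>) w"
  shows "u = w"
proof -
  have "Fa (\<Psi> \<Gamma>) (Fa (\<Phi> \<Gamma>) x) = x" if "x \<in> Ar N" "Dom N x = \<Gamma>" "Cod N x = I1 E" for x
    using inverse(2)[of \<Gamma> x] that by auto
  then show ?thesis using assms by metis
qed

lemma \<Phi>_surj0:
  assumes "\<Gamma> \<in> Ob N" "A \<in> Ob (ty N \<Gamma>)"
  obtains u where "u \<in> Ar N" "Dom N u = \<Gamma>" "Cod N u = I0 E" "Fo (\<Phi> \<Gamma>) u = A"
  using functor_Fo[OF \<Psi>_functor[OF assms(1)] assms(2)] inverse(3)[OF assms] that[of "Fo (\<Psi> \<Gamma>) A"] by simp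

lemma \<Phi>_surj1:
  assumes "\<Gamma> \<in> Ob N" "f \<in> Ar (ty N \<Gamma>)"
  obtains u where "u \<in> Ar N" "Dom N u = \<Gamma>" "Cod N u = I1 E" "Fa (\<Phi> \<Gamma>) u = f"
  using functor_Fa[OF \<Psi>_functor[OF assms(1)] assms(2)] inverse(4)[OF assms] that[of "Fa (\<Psi> \<Gamma>) f"] by simp

text \<open>The Yoneda element of \<open>\<Phi>\<close>: every type is a substitution instance of
  it, along a unique map.\<close>

definition A0 where "A0 = Fo (\<Phi> (I0 E)) (Idn N (I0 E))"

lemma A0 [simp]: "A0 \<in> Ob (ty N (I0 E))"
  by (simp add: A0_def)

lemma \<Phi>_A0: "u \<in> Ar N \<Longrightarrow> Dom N u = \<Gamma> \<Longrightarrow> Cod N u = I0 E \<Longrightarrow> Fo (\<Phi> \<Gamma>) u = tsb N u A0"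
  using \<Phi>_Cmp(1)[of u "Idn N (I0 E)" \<Gamma>] by (simp add: A0_def)

lemma classify:
  assumes "\<Gamma> \<in> Ob N" "A \<in> Ob (ty N \<Gamma>)"
  shows "\<exists>!u. u \<in> hom N \<Gamma> (I0 E) \<and> tsb N u A0 = A"
proof -
  obtain u where "u \<in> Ar N" "Dom N u = \<Gamma>" "Cod N u = I0 E" "Fo (\<Phi> \<Gamma>) u = A"
    by (rule \<Phi>_surj0[OF assms])
  then show ?thesis using \<Phi>_eq0 \<Phi>_A0 by (intro ex1I[of _ u]) auto
qed

definition p0 where "p0 = Prj N (I0 E) A0"
definition p1 where "p1 = Pbk N (Idm E) p0"
definition d where "d = Pbt N (Idm E) p0"
definition R0 where "R0 = Dom N p0"
definition R1 where "R1 = Dom N p1"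
definition v0 where "v0 = Var N (I0 E) A0"
text \<open>The universal arrow of terms. It lives over \<open>R1\<close>, the object of pairs of an
  arrow of types and a term of its domain; it starts at that term and lies over that arrow.\<close>

definition v1 where "v1 = lift N R1 (msb N d v0) (Fa (\<Phi> R1) p1)"

lemma p0_simps [simp]: "p0 \<in> Disp N" "p0 \<in> Ar N" "Cod N p0 = I0 E" "Dom N p0 = R0" "v0 \<in> Ob (tm N R0)"
  "tyof N R0 v0 = tsb N p0 A0"
  by (auto simp: p0_def v0_def R0_def)

lemma p1_pullback: "is_pullback N (Idm E) p0 p1 d"
  using display_pullback(2)[of N p0 "Idm E"] by (simp add: p1_def d_def)

lemma p1_simps [simp]: "p1 \<in> Ar N" "Cod N p1 = I1 E" "Dom N p1 = R1" "d \<in> Ar N" "Dom N d = R1" "Cod N d = R0"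
  using pullback_ar[OF p1_pullback] pullback_bd[OF p1_pullback] by (auto simp: R1_def)

lemma R [simp]: "R0 \<in> Ob N" "R1 \<in> Ob N"
  using Dom_ob[of N p0] Dom_ob[of N p1] by auto

lemma v1_simps [simp]: "v1 \<in> Ar (tm N R1)" "Dom (tm N R1) v1 = msb N d v0" "tyofa N R1 v1 = Fa (\<Phi> R1) p1"
proof -
  have "Fo (\<Phi> R1) (Cmp N (Idm E) p1) = tsb N d (tsb N p0 A0)"
    using \<Phi>_A0[of "Cmp N p0 d" R1] pullback_comm[OF p1_pullback] by (simp add: tsb_Cmp)
  then show "v1 \<in> Ar (tm N R1)" "Dom (tm N R1) v1 = msb N d v0" "tyofa N R1 v1 = Fa (\<Phi> R1) p1"
    by (auto simp: v1_def)
qed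

lemma tyof_v0: "t \<in> Ar N \<Longrightarrow> Dom N t = \<Gamma> \<Longrightarrow> Cod N t = R0 \<Longrightarrow> tyof N \<Gamma> (msb N t v0) = Fo (\<Phi> \<Gamma>) (Cmp N p0 t)"
  by (auto simp: \<Phi>_A0 tsb_Cmp)

lemma tyofa_v1: "g \<in> Ar N \<Longrightarrow> Dom N g = \<Gamma> \<Longrightarrow> Cod N g = R1 \<Longrightarrow> tyofa N \<Gamma> (msa N g v1) = Fa (\<Phi> \<Gamma>) (Cmp N p1 g)"
  by (auto simp: \<Phi>_Cmp)

lemma Dom_v1: "g \<in> Ar N \<Longrightarrow> Dom N g = \<Gamma> \<Longrightarrow> Cod N g = R1 \<Longrightarrow> Dom (tm N \<Gamma>) (msa N g v1) = msb N (Cmp N d g) v0"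
  by (auto simp: msb_Cmp)

text \<open>A term determines its type and hence, \<open>\<Phi>\<close> being injective, the
  composite with \<open>p0\<close>. Equality of projections, which \<open>ext_eq\<close> requires,
  thus follows from equality of terms.\<close>

lemma v0_unique:
  assumes "w \<in> Ar N" "w' \<in> Ar N" "Dom N w = \<Gamma>" "Dom N w' = \<Gamma>" "Cod N w = R0" "Cod N w' = R0" "msb N w v0 = msb N w' v0"
  shows "w = w'"
proof (rule ext_eq[of N "I0 E" A0])
  have "Fo (\<Phi> \<Gamma>) (Cmp N p0 w) = Fo (\<Phi> \<Gamma>) (Cmp N p0 w')" using tyof_v0[of w \<Gamma>] tyof_v0[of w' \<Gamma>] assms by simp
  then show "Cmp N (Prj N (I0 E) A0) w = Cmp N (Prj N (I0 E) A0) w'"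
    unfolding p0_def[symmetric] using \<Phi>_eq0[of "Cmp N p0 w" "Cmp N p0 w'" \<Gamma>] assms by simp
  show "msb N w (Var N (I0 E) A0) = msb N w' (Var N (I0 E) A0)" using assms by (simp add: v0_def)
qed (use assms in \<open>auto simp: R0_def p0_def\<close>)

lemma univ0:
  assumes G: "\<Gamma> \<in> Ob N" and t: "t \<in> Ob (tm N \<Gamma>)"
  shows "\<exists>!w. w \<in> hom N \<Gamma> R0 \<and> msb N w v0 = t"
proof -
  obtain u where u: "u \<in> Ar N" "Dom N u = \<Gamma>" "Cod N u = I0 E" "tsb N u A0 = tyof N \<Gamma> t"
    using classify[OF G, of "tyof N \<Gamma> t"] G t by auto
  let ?w = "ext_pair N (I0 E) A0 u t"
  have w: "?w \<in> Ar N" "Dom N ?w = \<Gamma>" "Cod N ?w = R0" "msb N ?w v0 = t"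
    using u t by (auto simp: v0_def R0_def p0_def)
  show ?thesis
    by (rule ex1I[of _ ?w]) (use w v0_unique in auto)
qed

text \<open>By the discrete opfibration property an arrow of terms amounts to a term and an arrow of
  types out of its type, that is, to a map into the pullback \<open>R1\<close>.\<close>

lemma univ1:
  assumes G: "\<Gamma> \<in> Ob N" and g: "g \<in> Ar (tm N \<Gamma>)"
  shows "\<exists>!w. w \<in> hom N \<Gamma> R1 \<and> msa N w v1 = g"
proof (rule ex_ex1I)
  obtain b where b: "b \<in> Ar N" "Dom N b = \<Gamma>" "Cod N b = R0" "msb N b v0 = Dom (tm N \<Gamma>) g"
    using univ0[OF G, of "Dom (tm N \<Gamma>) g"] G g by auto
  obtain a where a: "a \<in> Ar N" "Dom N a = \<Gamma>" "Cod N a = I1 E" "Fa (\<Phi> \<Gamma>) a = tyofa N \<Gamma> g"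
    using \<Phi>_surj1[OF G, of "tyofa N \<Gamma> g"] G g by auto
  have "Fo (\<Phi> \<Gamma>) (Cmp N (Idm E) a) = Dom (ty N \<Gamma>) (tyofa N \<Gamma> g)"
    using Dom_\<Phi>[of a \<Gamma>] a by simp
  also have "\<dots> = Fo (\<Phi> \<Gamma>) (Cmp N p0 b)" using tyof_v0[of b \<Gamma>] b g G by simp
  finally have e: "Cmp N (Idm E) a = Cmp N p0 b" using \<Phi>_eq0[of "Cmp N (Idm E) a" "Cmp N p0 b" \<Gamma>] a b by simp
  obtain h where h: "h \<in> Ar N" "Dom N h = Dom N a" "Cod N h = Dom N p1" "Cmp N p1 h = a" "Cmp N d h = b"
    by (rule pullback_ex[OF p1_pullback, of a b]) (use a b e in auto)
  have "msa N h v1 = g"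
    by (rule arrow_of_terms_eq[of N \<Gamma>]) (use h a b g G tyofa_v1[of h \<Gamma>] Dom_v1[of h \<Gamma>] in \<open>auto simp del: tyofa_msa Dom_msa\<close>)
  then show "\<exists>w. w \<in> hom N \<Gamma> R1 \<and> msa N w v1 = g" using h a by auto
next
  fix w w' assume "w \<in> hom N \<Gamma> R1 \<and> msa N w v1 = g" "w' \<in> hom N \<Gamma> R1 \<and> msa N w' v1 = g"
  then have w: "w \<in> Ar N" "Dom N w = \<Gamma>" "Cod N w = R1" and w': "w' \<in> Ar N" "Dom N w' = \<Gamma>" "Cod N w' = R1"
    and e: "msa N w v1 = msa N w' v1" by auto
  have e1: "Cmp N p1 w = Cmp N p1 w'"
    by (rule \<Phi>_eq1[of _ _ \<Gamma>]) (use w w' e tyofa_v1[OF w] tyofa_v1[OF w'] in auto)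
  have e2: "Cmp N d w = Cmp N d w'"
    by (rule v0_unique[of _ _ \<Gamma>]) (use w w' e Dom_v1[OF w] Dom_v1[OF w'] in auto)
  show "w = w'"
    by (rule pullback_eq[OF _ p1_pullback _ _ _ _ _ e1 e2]) (use w w' in auto)
qed

sublocale T: represented_icat N "Tm N" R0 R1 v0 v1
  by unfold_locales (use univ0 univ1 prenat_Tm[OF N] in \<open>simp_all del: mem_hom\<close>)

text \<open>Equations of maps into \<open>E\<close> can be tested after applying
  \<open>\<Phi>\<close>; those for \<open>p0\<close> and \<open>p1\<close> then say that
  \<open>Pr\<close> is a functor. The equivalence with displays is transferred from the
  comprehension of \<open>N\<close>.\<close>

lemma universe:
  assumes lim: "has_finite_limits N" and eq: "\<And>\<Gamma>. \<Gamma> \<in> Ob N \<Longrightarrow> is_equivalence (ty N \<Gamma>) (disp_fib N \<Gamma>) (comprehension N \<Gamma>)"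
  obtains T where "is_universe N T E p0 p1"
proof -
  obtain T where iT: "internal_category N T" and T [simp]: "I0 T = R0" "I1 T = R1"
    and T': "msb N (Idm T) v0 = Dom (tm N R1) v1" "msb N (Icd T) v0 = Cod (tm N R1) v1"
    "msa N (Iid T) v1 = Idn (tm N R0) v0"
    "msa N (Imul T) v1 = Cmp (tm N (Ip T)) (msa N (Ip2 T) v1) (msa N (Ip1 T) v1)"
    by (rule T.internalize) (use lim in \<open>auto intro: finite_limits_pullback\<close>)
  interpret T: int_cat N T using iT by unfold_locales auto
  have Ts [simp]: "Idm T \<in> Ar N" "Dom N (Idm T) = R1" "Cod N (Idm T) = R0"
    "Icd T \<in> Ar N" "Dom N (Icd T) = R1" "Cod N (Icd T) = R0"
    "Iid T \<in> Ar N" "Dom N (Iid T) = R0" "Cod N (Iid T) = R1"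
    "Imul T \<in> Ar N" "Dom N (Imul T) = Ip T" "Cod N (Imul T) = R1"
    "Ip1 T \<in> Ar N" "Dom N (Ip1 T) = Ip T" "Cod N (Ip1 T) = R1"
    "Ip2 T \<in> Ar N" "Dom N (Ip2 T) = Ip T" "Cod N (Ip2 T) = R1"
    using T.int_simps by auto
  have IT: "Ip T \<in> Ob N" by simp
  \<comment> \<open>The domain map returned by \<open>internalize\<close> classifies the source of
    the universal arrow, and so does \<open>d\<close>. The identification supplies the pullback
    square of the opfibration.\<close>
  have d: "Idm T = d"
    by (rule v0_unique[of _ _ R1]) (use T' in auto)
  have pb: "is_pullback N (Idm E) p0 p1 (Idm T)" unfolding d by (rule p1_pullback)
  have PC: "tyofa N \<Gamma> (Cmp (tm N \<Gamma>) y x) = Cmp (ty N \<Gamma>) (tyofa N \<Gamma> y) (tyofa N \<Gamma> x)"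
    if "\<Gamma> \<in> Ob N" "x \<in> Ar (tm N \<Gamma>)" "y \<in> Ar (tm N \<Gamma>)" "Cod (tm N \<Gamma>) x = Dom (tm N \<Gamma>) y" for x y \<Gamma>
    using functor_Cmp[OF Pr_functor[of N \<Gamma>]] that by simp
  have cd: "Cmp N (Icd E) p1 = Cmp N p0 (Icd T)"
  proof (rule \<Phi>_eq0[of _ _ R1])
    have "Fo (\<Phi> R1) (Cmp N (Icd E) p1) = Cod (ty N R1) (tyofa N R1 v1)" by simp
    also have "\<dots> = tyof N R1 (msb N (Icd T) v0)" using T'(2) by (simp del: v1_simps(3) tyof_msb)
    finally show "Fo (\<Phi> R1) (Cmp N (Icd E) p1) = Fo (\<Phi> R1) (Cmp N p0 (Icd T))" by (simp add: tyof_v0 del: tyof_msb)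
  qed auto
  have ii: "Cmp N p1 (Iid T) = Cmp N (Iid E) p0"
  proof (rule \<Phi>_eq1[of _ _ R0])
    have "Fa (\<Phi> R0) (Cmp N p1 (Iid T)) = tyofa N R0 (Idn (tm N R0) v0)"
      using tyofa_v1[of "Iid T" R0] T'(3) by (simp del: tyofa_msa)
    also have "\<dots> = Idn (ty N R0) (Fo (\<Phi> R0) p0)"
      using functor_Idn[OF Pr_functor[of N R0], of v0] by (simp add: \<Phi>_A0)
    also have "\<dots> = Fa (\<Phi> R0) (Cmp N (Iid E) p0)"
      using functor_Idn[OF \<Phi>_functor, of R0 p0] by simp
    finally show "Fa (\<Phi> R0) (Cmp N p1 (Iid T)) = Fa (\<Phi> R0) (Cmp N (Iid E) p0)" .
  qed auto
  let ?a = "Cmp N p1 (Ip1 T)" and ?b = "Cmp N p1 (Ip2 T)"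
  have ab: "Cmp N (Icd E) ?a = Cmp N (Idm E) ?b"
    using Cmp_reassoc[OF cd, of "Ip1 T"] Cmp_reassoc[OF pullback_comm[OF pb], of "Ip2 T"]
      pullback_comm[OF T.int_laws(1)] by simp
  have mul: "Cmp N p1 (Imul T) = icmp N E ?b ?a"
  proof (rule \<Phi>_eq1[of _ _ "Ip T"])
    have c: "Cod (tm N (Ip T)) (msa N (Ip1 T) v1) = Dom (tm N (Ip T)) (msa N (Ip2 T) v1)"
      using pullback_comm[OF T.int_laws(1)] msb_Cmp[of N "Ip1 T" "Icd T" v0] msb_Cmp[of N "Ip2 T" "Idm T" v0] T'(1,2)
      by simp
    have "Fa (\<Phi> (Ip T)) (Cmp N p1 (Imul T)) = tyofa N (Ip T) (Cmp (tm N (Ip T)) (msa N (Ip2 T) v1) (msa N (Ip1 T) v1))"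
      using tyofa_v1[of "Imul T" "Ip T"] T'(4) by (simp del: tyofa_msa)
    also have "\<dots> = Cmp (ty N (Ip T)) (Fa (\<Phi> (Ip T)) ?b) (Fa (\<Phi> (Ip T)) ?a)"
      using PC[OF IT _ _ c] tyofa_v1[of "Ip1 T" "Ip T"] tyofa_v1[of "Ip2 T" "Ip T"] by (simp del: tyofa_msa)
    also have "\<dots> = Fa (\<Phi> (Ip T)) (icmp N E ?b ?a)"
      using functor_Cmp[OF \<Phi>_functor[OF IT], of ?a ?b] ab by simp
    finally show "Fa (\<Phi> (Ip T)) (Cmp N p1 (Imul T)) = Fa (\<Phi> (Ip T)) (icmp N E ?b ?a)" .
  qed (use ab in auto)
  have op: "internal_discrete_opfibration N T E p0 p1"
    unfolding internal_discrete_opfibration_def internal_functor_def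
    using iT E pb pullback_comm[OF pb] cd ii mul by simp
  \<comment> \<open>The model of a universe is built over a bare display category, so the types and
    terms of \<open>N\<close> are dropped first.\<close>
  define C where "C = dcat.truncate N"
  have e: "externalization C = externalization N" "universe_functor C = universe_functor N" "disp_fib C = disp_fib N"
    by (auto simp: C_def)
  interpret M: disp_opfib C T E p0 p1
    using op by unfold_locales (auto simp: C_def internal_discrete_opfibration_def)
  note [simp] = M.prenat_N
  have Cs [simp]: "Ob C = Ob N" "Ar C = Ar N" "Dom C = Dom N" "Cod C = Cod N" "Idn C = Idn N" "Cmp C = Cmp N" "Disp C = Disp N"
    "Pbk C = Pbk N" "Pbt C = Pbt N" "id_fct C = id_fct N"
    by (auto simp: C_def id_fct_def)
  \<comment> \<open>The morphism from the reconstructed model to \<open>N\<close>: identity on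
    contexts, \<open>\<Phi>\<close> on types, substitution instances of \<open>v0\<close> and
    \<open>v1\<close> on terms. Its comparison maps connect the two comprehensions.\<close>
  define K :: "'u nmor" where "K = \<lparr>Fo = (\<lambda>\<Gamma>. \<Gamma>), Fa = (\<lambda>u. u), nsrc = M.N, ntgt = N, nTp = \<Phi>,
    nTm = (\<lambda>\<Gamma>. \<lparr>Fo = (\<lambda>t. msb N t v0), Fa = (\<lambda>g. msa N g v1)\<rparr>)\<rparr>"
  have K [simp]: "Fo K \<Gamma> = \<Gamma>" "Fa K u = u" "nsrc K = M.N" "ntgt K = N" "nTp K = \<Phi>"
    "Fo (nTm K \<Gamma>) t = msb N t v0" "Fa (nTm K \<Gamma>) g = msa N g v1" for \<Gamma> u t g
    by (auto simp: K_def)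
  have tau: "is_iso N (tau K \<Gamma> A)" if "\<Gamma> \<in> Ob N" "A \<in> Ob (ty M.N \<Gamma>)" for \<Gamma> A
  proof -
    have A: "A \<in> Ar N" "Dom N A = \<Gamma>" "Cod N A = I0 E" using that by (auto simp: e)
    let ?p = "Pbk N A p0" and ?t = "Pbt N A p0"
    have pb: "is_pullback N A p0 ?p ?t" using display_pullback(2)[of N p0 A] A by simp
    note p = pullback_ar[OF pb] pullback_bd[OF pb] pullback_comm[OF pb]
    have B: "Fo (\<Phi> \<Gamma>) A = tsb N A A0" using A by (simp add: \<Phi>_A0)
    \<comment> \<open>The chosen pullback of \<open>p0\<close> and the comprehension of the
      classified type are pullbacks of the same cospan; \<open>tau\<close> turns out to be the
      isomorphism between them.\<close>
    have pb': "is_pullback N A p0 (Prj N \<Gamma> (tsb N A A0)) (q_ext N (I0 E) A0 A)"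
      using q_ext_pullback[of N "I0 E" A0 A] A by (simp add: p0_def)
    obtain h where h: "h \<in> Ar N" "Dom N h = Dom N ?p" "Cod N h = Dom N (Prj N \<Gamma> (tsb N A A0))"
      "Cmp N (Prj N \<Gamma> (tsb N A A0)) h = ?p" "Cmp N (q_ext N (I0 E) A0 A) h = ?t"
      by (rule pullback_ex[OF pb', of ?p ?t]) (use p in auto)
    have i: "is_iso N h" by (rule pullback_comparison_iso[OF _ pb' pb h]) simp
    have t: "msb N ?t v0 \<in> Ob (tm N (Dom N ?p))" "tyof N (Dom N ?p) (msb N ?t v0) = tsb N ?p (tsb N A A0)"
      using p A tsb_Cmp[of N ?p A A0] tsb_Cmp[of N ?t p0 A0] by auto
    have "tau K \<Gamma> A = ext_pair N \<Gamma> (tsb N A A0) ?p (msb N ?t v0)"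
      by (simp add: tau_def B)
    also have "\<dots> = h"
    proof (rule ext_eq[of N \<Gamma> "tsb N A A0"])
      have "msb N h (Var N \<Gamma> (tsb N A A0)) = msb N h (msb N (q_ext N (I0 E) A0 A) v0)"
        using A by (simp add: Var_q_ext v0_def)
      also have "\<dots> = msb N ?t v0"
        using msb_Cmp[of N h "q_ext N (I0 E) A0 A" v0] h A by (simp add: R0_def p0_def v0_def)
      finally show "msb N (ext_pair N \<Gamma> (tsb N A A0) ?p (msb N ?t v0)) (Var N \<Gamma> (tsb N A A0)) = msb N h (Var N \<Gamma> (tsb N A A0))"
        using A p t that by simp
    qed (use A p t that h in auto)
    finally show ?thesis using i by simp
  qed
  have K_mor: "natural_model_morphism K"
    unfolding natural_model_morphism_def strict_indexed_functor_def K
  proof (intro conjI ballI)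
    have "is_pullback M.N = is_pullback N" using truncate_cat(3)[of M.N] truncate_cat(3)[of N] by (simp add: C_def)
    then show "display_functor M.N N K"
      by (auto simp: display_functor_def intro!: is_functorI)
  next
    fix \<Gamma> assume G: "\<Gamma> \<in> Ob M.N"
    show "is_functor (ty M.N \<Gamma>) (ty N \<Gamma>) (\<Phi> \<Gamma>)" using \<Phi>_functor G by (simp add: e)
    show "is_functor (tm M.N \<Gamma>) (tm N \<Gamma>) (nTm K \<Gamma>)"
    proof (rule is_functorI)
      fix t assume "t \<in> Ob (tm M.N \<Gamma>)"
      then have t: "t \<in> Ar N" "Dom N t = \<Gamma>" "Cod N t = R0" by auto
      have "msa N (Cmp N (Iid T) t) v1 = msa N t (Idn (tm N R0) v0)"
        using T.el_Cmp1[of t "Iid T"] t T' by simp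
      also have "\<dots> = Idn (tm N \<Gamma>) (msb N t v0)"
        using functor_Idn[OF T.X_functor[OF t], of v0] by simp
      finally show "Fa (nTm K \<Gamma>) (Idn (tm M.N \<Gamma>) t) = Idn (tm N \<Gamma>) (Fo (nTm K \<Gamma>) t)" by simp
    next
      fix f assume "f \<in> Ar (tm M.N \<Gamma>)"
      then have f: "f \<in> Ar N" "Dom N f = \<Gamma>" "Cod N f = R1" by auto
      show "Fa (nTm K \<Gamma>) f \<in> Ar (tm N \<Gamma>) \<and> Dom (tm N \<Gamma>) (Fa (nTm K \<Gamma>) f) = Fo (nTm K \<Gamma>) (Dom (tm M.N \<Gamma>) f) \<and>
          Cod (tm N \<Gamma>) (Fa (nTm K \<Gamma>) f) = Fo (nTm K \<Gamma>) (Cod (tm M.N \<Gamma>) f)"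
        using f T.el_Cmp0[of f "Icd T"] T.el_Cmp0[of f "Idm T"] T' by auto
    next
      fix f g assume "f \<in> Ar (tm M.N \<Gamma>)" "g \<in> Ar (tm M.N \<Gamma>)" "Cod (tm M.N \<Gamma>) f = Dom (tm M.N \<Gamma>) g"
      then have f: "f \<in> Ar N" "Dom N f = \<Gamma>" "Cod N f = R1" and g: "g \<in> Ar N" "Dom N g = \<Gamma>" "Cod N g = R1"
        and fg: "Cmp N (Icd T) f = Cmp N (Idm T) g" by auto
      obtain h where h: "h \<in> Ar N" "Dom N h = Dom N f" "Cod N h = Ip T" "Cmp N (Ip1 T) h = f" "Cmp N (Ip2 T) h = g"
        "icmp N T g f = Cmp N (Imul T) h"
        by (rule T.icmp_pair) (use f g fg in auto)
      have c: "Cod (tm N (Ip T)) (msa N (Ip1 T) v1) = Dom (tm N (Ip T)) (msa N (Ip2 T) v1)"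
        using pullback_comm[OF T.int_laws(1)] msb_Cmp[of N "Ip1 T" "Icd T" v0] msb_Cmp[of N "Ip2 T" "Idm T" v0] T'(1,2)
        by simp
      have "msa N (icmp N T g f) v1 = msa N h (Cmp (tm N (Ip T)) (msa N (Ip2 T) v1) (msa N (Ip1 T) v1))"
        using T.el_Cmp1[of h "Imul T"] h T' by simp
      also have "\<dots> = Cmp (tm N \<Gamma>) (msa N h (msa N (Ip2 T) v1)) (msa N h (msa N (Ip1 T) v1))"
        by (rule functor_Cmp[OF T.X_functor]) (use h f c in auto)
      also have "\<dots> = Cmp (tm N \<Gamma>) (msa N g v1) (msa N f v1)"
        using T.el_Cmp1[of h "Ip1 T"] T.el_Cmp1[of h "Ip2 T"] h(1-5) by simp
      finally have "msa N (icmp N T g f) v1 = Cmp (tm N \<Gamma>) (msa N g v1) (msa N f v1)" .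
      moreover have "icmp C = icmp N" by (simp add: C_def)
      ultimately show "Fa (nTm K \<Gamma>) (Cmp (tm M.N \<Gamma>) g f) = Cmp (tm N \<Gamma>) (Fa (nTm K \<Gamma>) g) (Fa (nTm K \<Gamma>) f)"
        by simp
    qed auto
  next
    fix \<Gamma> t assume "\<Gamma> \<in> Ob M.N" "t \<in> Ob (tm M.N \<Gamma>)"
    then show "tyof N \<Gamma> (msb N t v0) = Fo (\<Phi> \<Gamma>) (tyof M.N \<Gamma> t)" using tyof_v0[of t \<Gamma>] by (simp del: tyof_msb)
  next
    fix \<Gamma> t assume "\<Gamma> \<in> Ob M.N" "t \<in> Ar (tm M.N \<Gamma>)"
    then show "tyofa N \<Gamma> (msa N t v1) = Fa (\<Phi> \<Gamma>) (tyofa M.N \<Gamma> t)" using tyofa_v1[of t \<Gamma>] by (simp del: tyofa_msa)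
  next
    fix u A assume "u \<in> Ar M.N" "A \<in> Ob (ty M.N (Cod M.N u))"
    then show "Fo (\<Phi> (Dom M.N u)) (tsb M.N u A) = tsb N u (Fo (\<Phi> (Cod M.N u)) A)" using \<Phi>_Cmp(1)[of u A] by simp
  next
    fix u A assume "u \<in> Ar M.N" "A \<in> Ar (ty M.N (Cod M.N u))"
    then show "Fa (\<Phi> (Dom M.N u)) (tsa M.N u A) = tsa N u (Fa (\<Phi> (Cod M.N u)) A)" using \<Phi>_Cmp(2)[of u A] by simp
  qed (use tau in \<open>auto simp: T.el_Cmp0 T.el_Cmp1\<close>)
  interpret K: nat_mor K "M.N" N
    using K_mor by unfold_locales auto
  \<comment> \<open>The isomorphisms required by the transfer are the comparison maps of
    \<open>K\<close>, and \<open>tau_comp_ar\<close> is their naturality.\<close>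
  have "is_equivalence (ty M.N \<Gamma>) (disp_fib N \<Gamma>) (comprehension M.N \<Gamma>)" if G: "\<Gamma> \<in> Ob N" for \<Gamma>
  proof (rule equivalence_transfer[where F = "comprehension N \<Gamma>" and \<Phi> = "\<Phi> \<Gamma>" and \<Psi> = "\<Psi> \<Gamma>"
        and \<theta> = "\<lambda>A. (Prj M.N \<Gamma> A, tau K \<Gamma> A, Prj N \<Gamma> (Fo (\<Phi> \<Gamma>) A))"])
    have G': "\<Gamma> \<in> Ob M.N" using G by simp
    show "is_functor (ty M.N \<Gamma>) (disp_fib N \<Gamma>) (comprehension M.N \<Gamma>)"
      using comprehension_functor[OF M.prenat_N G'] unfolding M.disp_fib_N e(3) .
    show "is_functor (ty M.N \<Gamma>) (ty N \<Gamma>) (\<Phi> \<Gamma>)" "is_functor (ty N \<Gamma>) (ty M.N \<Gamma>) (\<Psi> \<Gamma>)"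
      using \<Phi>_functor[OF G] \<Psi>_functor[OF G] by (auto simp: e)
    fix A assume A: "A \<in> Ob (ty M.N \<Gamma>)"
    have PM: "Prj M.N \<Gamma> A \<in> Disp N" "Prj M.N \<Gamma> A \<in> Ar N" "Cod N (Prj M.N \<Gamma> A) = \<Gamma>"
      using Prj_Disp[OF M.prenat_N G' A] Prj_ar[OF M.prenat_N G' A] Cod_Prj[OF M.prenat_N G' A] by auto
    have FA: "Fo (\<Phi> \<Gamma>) A \<in> Ob (ty N \<Gamma>)" using K.Fty_ob[OF G' A] by simp
    have tA: "tau K \<Gamma> A \<in> Ar N" "Dom N (tau K \<Gamma> A) = Dom N (Prj M.N \<Gamma> A)" "Cod N (tau K \<Gamma> A) = ext N \<Gamma> (Fo (\<Phi> \<Gamma>) A)"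
      "Cmp N (Prj N \<Gamma> (Fo (\<Phi> \<Gamma>) A)) (tau K \<Gamma> A) = Prj M.N \<Gamma> A"
      using K.tau_ar[OF G' A] K.Dom_tau[OF G' A] K.Cod_tau[OF G' A] K.Prj_tau[OF G' A] by auto
    show "is_iso (disp_fib N \<Gamma>) (Prj M.N \<Gamma> A, tau K \<Gamma> A, Prj N \<Gamma> (Fo (\<Phi> \<Gamma>) A)) \<and>
        Dom (disp_fib N \<Gamma>) (Prj M.N \<Gamma> A, tau K \<Gamma> A, Prj N \<Gamma> (Fo (\<Phi> \<Gamma>) A)) = Fo (comprehension M.N \<Gamma>) A \<and>
        Cod (disp_fib N \<Gamma>) (Prj M.N \<Gamma> A, tau K \<Gamma> A, Prj N \<Gamma> (Fo (\<Phi> \<Gamma>) A)) = Fo (comprehension N \<Gamma>) (Fo (\<Phi> \<Gamma>) A)"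
      unfolding disp_fib_iso[OF prenat_display[OF N]] using PM FA tA tau[OF G A] G by (simp del: M.N_simps)
  next
    have G': "\<Gamma> \<in> Ob M.N" using G by simp
    fix f assume f: "f \<in> Ar (ty M.N \<Gamma>)"
    have Df: "Fo (\<Phi> \<Gamma>) (Dom (ty M.N \<Gamma>) f) = Dom (ty N \<Gamma>) (Fa (\<Phi> \<Gamma>) f)" "Fo (\<Phi> \<Gamma>) (Cod (ty M.N \<Gamma>) f) = Cod (ty N \<Gamma>) (Fa (\<Phi> \<Gamma>) f)"
      using K.Dom_Fty[OF G' f] K.Cod_Fty[OF G' f] by auto
    show "Cmp (disp_fib N \<Gamma>)
        (Prj M.N \<Gamma> (Cod (ty M.N \<Gamma>) f), tau K \<Gamma> (Cod (ty M.N \<Gamma>) f), Prj N \<Gamma> (Fo (\<Phi> \<Gamma>) (Cod (ty M.N \<Gamma>) f)))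
        (Fa (comprehension M.N \<Gamma>) f) =
      Cmp (disp_fib N \<Gamma>) (Fa (comprehension N \<Gamma>) (Fa (\<Phi> \<Gamma>) f))
        (Prj M.N \<Gamma> (Dom (ty M.N \<Gamma>) f), tau K \<Gamma> (Dom (ty M.N \<Gamma>) f), Prj N \<Gamma> (Fo (\<Phi> \<Gamma>) (Dom (ty M.N \<Gamma>) f)))"
      using K.tau_comp_ar[OF G' f] unfolding comprehension_simps disp_fib_simps Df by simp
  qed (use G eq inverse E.externalization_category in \<open>auto simp: e\<close>)
  then have "is_universe N T E p0 p1"
    unfolding is_universe_def using op M.comprehension_N by (simp add: e)
  then show ?thesis by (rule that)
qed

end

lemma type_classifier_cases:
  assumes N: "prenat N" and a: "admits_type_classifier N"
  obtains E \<Phi> \<Psi> where "classified_model N E \<Phi> \<Psi>"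
proof -
  obtain E \<Phi> \<Psi> where "internal_category N E" "strict_indexed_functor N (id_fct N) (externalization N E) (Tp N) \<Phi>"
    "strict_indexed_functor N (id_fct N) (Tp N) (externalization N E) \<Psi>"
    "\<forall>\<Gamma>\<in>Ob N.
           (\<forall>A\<in>Ob (Fib (externalization N E) \<Gamma>). Fo (\<Psi> \<Gamma>) (Fo (\<Phi> \<Gamma>) A) = A) \<and>
           (\<forall>f\<in>Ar (Fib (externalization N E) \<Gamma>). Fa (\<Psi> \<Gamma>) (Fa (\<Phi> \<Gamma>) f) = f) \<and>
           (\<forall>B\<in>Ob (ty N \<Gamma>). Fo (\<Phi> \<Gamma>) (Fo (\<Psi> \<Gamma>) B) = B) \<and>
           (\<forall>g\<in>Ar (ty N \<Gamma>). Fa (\<Phi> \<Gamma>) (Fa (\<Psi> \<Gamma>) g) = g)"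
    using a unfolding admits_type_classifier_def strict_indexed_iso_def by blast
  then have "classified_model N E \<Phi> \<Psi>" using N by unfold_locales auto
  then show ?thesis by (rule that)
qed

text \<open>The universe is reconstructed from the type classifier. Finite limits of the underlying
  category provide the object of composable pairs of arrows of terms.\<close>

lemma cnm_object_cdc:
  assumes "cnm_object small N"
  shows "cdc_object small (dcat.truncate N)"
proof -
  have nm: "natural_model small N" and cart: "cartesian_dcat N" and tc: "admits_type_classifier N"
    using assms by (auto simp: cnm_object_def)
  have N: "prenat N" using nm by (simp add: natural_model_natm)
  obtain E \<Phi> \<Psi> where "classified_model N E \<Phi> \<Psi>" by (rule type_classifier_cases[OF N tc])
  then interpret classified_model N E \<Phi> \<Psi> .
  obtain T where "is_universe N T E p0 p1"
    by (rule universe) (use nm cart in \<open>auto simp: natural_model_def cartesian_dcat_def\<close>)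
  then have "admits_universe N" unfolding admits_universe_def by blast
  then show ?thesis using nm cart
    by (simp add: cdc_object_def natural_model_def pre_natural_model_def)
qed


section \<open>Strict 2-categories and strictly surjective 2-functors\<close>

lemma cat1_simps [simp]:
  "Ob (cat1 K) = Obj K" "Ar (cat1 K) = Mor K" "Dom (cat1 K) = src1 K" "Cod (cat1 K) = tgt1 K"
  "Idn (cat1 K) = id1 K" "Cmp (cat1 K) = cmp1 K"
  by (simp_all add: cat1_def)

lemma vcat_simps [simp]:
  "Ob (vcat K) = Mor K" "Ar (vcat K) = Cel K" "Dom (vcat K) = src2 K" "Cod (vcat K) = tgt2 K"
  "Idn (vcat K) = id2 K" "Cmp (vcat K) = vcmp K"
  by (simp_all add: vcat_def)

lemma hcat_simps [simp]:
  "Ob (hcat K) = Obj K" "Ar (hcat K) = Cel K" "Dom (hcat K) = (\<lambda>\<alpha>. src1 K (src2 K \<alpha>))"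
  "Cod (hcat K) = (\<lambda>\<alpha>. tgt1 K (src2 K \<alpha>))" "Idn (hcat K) = (\<lambda>a. id2 K (id1 K a))" "Cmp (hcat K) = hcmp K"
  by (simp_all add: hcat_def)

lemma strict_2_categoryD:
  assumes "strict_2_category K"
  shows "category (cat1 K)" "category (vcat K)" "category (hcat K)"
    "\<alpha> \<in> Cel K \<Longrightarrow> src1 K (src2 K \<alpha>) = src1 K (tgt2 K \<alpha>) \<and> tgt1 K (src2 K \<alpha>) = tgt1 K (tgt2 K \<alpha>)"
    "\<alpha> \<in> Cel K \<Longrightarrow> \<beta> \<in> Cel K \<Longrightarrow> tgt1 K (src2 K \<alpha>) = src1 K (src2 K \<beta>) \<Longrightarrow>
      src2 K (hcmp K \<beta> \<alpha>) = cmp1 K (src2 K \<beta>) (src2 K \<alpha>) \<and> tgt2 K (hcmp K \<beta> \<alpha>) = cmp1 K (tgt2 K \<beta>) (tgt2 K \<alpha>)"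
    "f \<in> Mor K \<Longrightarrow> g \<in> Mor K \<Longrightarrow> tgt1 K f = src1 K g \<Longrightarrow> id2 K (cmp1 K g f) = hcmp K (id2 K g) (id2 K f)"
    "\<alpha> \<in> Cel K \<Longrightarrow> \<alpha>' \<in> Cel K \<Longrightarrow> \<beta> \<in> Cel K \<Longrightarrow> \<beta>' \<in> Cel K \<Longrightarrow> tgt2 K \<alpha> = src2 K \<alpha>' \<Longrightarrow> tgt2 K \<beta> = src2 K \<beta>' \<Longrightarrow>
      tgt1 K (src2 K \<alpha>) = src1 K (src2 K \<beta>) \<Longrightarrow>
      hcmp K (vcmp K \<beta>' \<beta>) (vcmp K \<alpha>' \<alpha>) = vcmp K (hcmp K \<beta>' \<alpha>') (hcmp K \<beta> \<alpha>)"
  using assms unfolding strict_2_category_def by blast+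

text \<open>
  The equations between 2-cells of \<open>K\<close> hold because they hold in \<open>L\<close> and \<open>U\<close> is faithful on 2-cells.
\<close>

locale reflecting_2_functor =
  fixes K :: "('o, 'm, 'c) twocat" and L :: "('o', 'm', 'c') twocat" and U :: "('o, 'm, 'c, 'o', 'm', 'c') fct2"
  assumes L: "strict_2_category L" and K1: "category (cat1 K)"
    and U1: "is_functor (cat1 K) (cat1 L) \<lparr>Fo = on0 U, Fa = on1 U\<rparr>"
    and bd: "\<And>\<alpha>. \<alpha> \<in> Cel K \<Longrightarrow> src2 K \<alpha> \<in> Mor K \<and> tgt2 K \<alpha> \<in> Mor K \<and>
      src1 K (src2 K \<alpha>) = src1 K (tgt2 K \<alpha>) \<and> tgt1 K (src2 K \<alpha>) = tgt1 K (tgt2 K \<alpha>)"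
    and U2: "\<And>\<alpha>. \<alpha> \<in> Cel K \<Longrightarrow> on2 U \<alpha> \<in> Cel L \<and> src2 L (on2 U \<alpha>) = on1 U (src2 K \<alpha>) \<and> tgt2 L (on2 U \<alpha>) = on1 U (tgt2 K \<alpha>)"
    and inj: "\<And>\<alpha> \<beta>. \<alpha> \<in> Cel K \<Longrightarrow> \<beta> \<in> Cel K \<Longrightarrow> src2 K \<alpha> = src2 K \<beta> \<Longrightarrow> tgt2 K \<alpha> = tgt2 K \<beta> \<Longrightarrow> on2 U \<alpha> = on2 U \<beta> \<Longrightarrow> \<alpha> = \<beta>"
    and id2: "\<And>f. f \<in> Mor K \<Longrightarrow> id2 K f \<in> Cel K \<and> src2 K (id2 K f) = f \<and> tgt2 K (id2 K f) = f \<and> on2 U (id2 K f) = id2 L (on1 U f)"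
    and vcmp: "\<And>\<alpha> \<beta>. \<alpha> \<in> Cel K \<Longrightarrow> \<beta> \<in> Cel K \<Longrightarrow> tgt2 K \<alpha> = src2 K \<beta> \<Longrightarrow>
      vcmp K \<beta> \<alpha> \<in> Cel K \<and> src2 K (vcmp K \<beta> \<alpha>) = src2 K \<alpha> \<and> tgt2 K (vcmp K \<beta> \<alpha>) = tgt2 K \<beta> \<and>
      on2 U (vcmp K \<beta> \<alpha>) = vcmp L (on2 U \<beta>) (on2 U \<alpha>)"
    and hcmp: "\<And>\<alpha> \<beta>. \<alpha> \<in> Cel K \<Longrightarrow> \<beta> \<in> Cel K \<Longrightarrow> tgt1 K (src2 K \<alpha>) = src1 K (src2 K \<beta>) \<Longrightarrow>
      hcmp K \<beta> \<alpha> \<in> Cel K \<and> src2 K (hcmp K \<beta> \<alpha>) = cmp1 K (src2 K \<beta>) (src2 K \<alpha>) \<and>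
      tgt2 K (hcmp K \<beta> \<alpha>) = cmp1 K (tgt2 K \<beta>) (tgt2 K \<alpha>) \<and> on2 U (hcmp K \<beta> \<alpha>) = hcmp L (on2 U \<beta>) (on2 U \<alpha>)"
begin

lemma mor1 [simp]:
  "f \<in> Mor K \<Longrightarrow> src1 K f \<in> Obj K" "f \<in> Mor K \<Longrightarrow> tgt1 K f \<in> Obj K"
  "a \<in> Obj K \<Longrightarrow> id1 K a \<in> Mor K \<and> src1 K (id1 K a) = a \<and> tgt1 K (id1 K a) = a"
  "f \<in> Mor K \<Longrightarrow> g \<in> Mor K \<Longrightarrow> tgt1 K f = src1 K g \<Longrightarrow>
    cmp1 K g f \<in> Mor K \<and> src1 K (cmp1 K g f) = src1 K f \<and> tgt1 K (cmp1 K g f) = tgt1 K g"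
  "f \<in> Mor K \<Longrightarrow> cmp1 K f (id1 K (src1 K f)) = f" "f \<in> Mor K \<Longrightarrow> cmp1 K (id1 K (tgt1 K f)) f = f"
  "f \<in> Mor K \<Longrightarrow> g \<in> Mor K \<Longrightarrow> h \<in> Mor K \<Longrightarrow> tgt1 K f = src1 K g \<Longrightarrow> tgt1 K g = src1 K h \<Longrightarrow>
    cmp1 K (cmp1 K h g) f = cmp1 K h (cmp1 K g f)"
  using Dom_ob[OF K1, of f] Cod_ob[OF K1, of f] Idn_ar[OF K1, of a] Dom_Idn[OF K1, of a] Cod_Idn[OF K1, of a]
    Cmp_ar[OF K1, of f g] Dom_Cmp[OF K1, of f g] Cod_Cmp[OF K1, of f g] Cmp_Idn[OF K1, of f "src1 K f"]
    Idn_Cmp[OF K1, of f "tgt1 K f"] Cmp_assoc[OF K1, of f g h]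
  by auto

lemma U1_simps:
  "a \<in> Obj K \<Longrightarrow> on0 U a \<in> Obj L" "f \<in> Mor K \<Longrightarrow> on1 U f \<in> Mor L"
  "f \<in> Mor K \<Longrightarrow> src1 L (on1 U f) = on0 U (src1 K f)" "f \<in> Mor K \<Longrightarrow> tgt1 L (on1 U f) = on0 U (tgt1 K f)"
  "a \<in> Obj K \<Longrightarrow> on1 U (id1 K a) = id1 L (on0 U a)"
  using functor_Fo[OF U1, of a] functor_Fa[OF U1, of f] functor_Dom[OF U1, of f] functor_Cod[OF U1, of f] functor_Idn[OF U1, of a]
  by auto

lemma U2_simps:
  assumes "\<alpha> \<in> Cel K"
  shows "on2 U \<alpha> \<in> Cel L" "src2 L (on2 U \<alpha>) = on1 U (src2 K \<alpha>)" "tgt2 L (on2 U \<alpha>) = on1 U (tgt2 K \<alpha>)"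
    "src1 L (src2 L (on2 U \<alpha>)) = on0 U (src1 K (src2 K \<alpha>))" "tgt1 L (src2 L (on2 U \<alpha>)) = on0 U (tgt1 K (src2 K \<alpha>))"
  using U2[OF assms] bd[OF assms] U1_simps by auto

lemmas Lv = strict_2_categoryD(2)[OF L] and Lh = strict_2_categoryD(3)[OF L]

lemma vcat: "category (vcat K)"
proof (rule categoryI, unfold vcat_simps)
  fix \<alpha> assume a: "\<alpha> \<in> Cel K"
  show "vcmp K \<alpha> (id2 K (src2 K \<alpha>)) = \<alpha>"
    by (rule inj) (use a bd[OF a] id2[of "src2 K \<alpha>"] vcmp[of "id2 K (src2 K \<alpha>)" \<alpha>] U2_simps[OF a] Cmp_Idn[OF Lv, of "on2 U \<alpha>"] in auto)
  show "vcmp K (id2 K (tgt2 K \<alpha>)) \<alpha> = \<alpha>"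
    by (rule inj) (use a bd[OF a] id2[of "tgt2 K \<alpha>"] vcmp[of \<alpha> "id2 K (tgt2 K \<alpha>)"] U2_simps[OF a] Idn_Cmp[OF Lv, of "on2 U \<alpha>"] in auto)
next
  fix \<alpha> \<beta> \<gamma> assume c: "\<alpha> \<in> Cel K" "\<beta> \<in> Cel K" "\<gamma> \<in> Cel K" "tgt2 K \<alpha> = src2 K \<beta>" "tgt2 K \<beta> = src2 K \<gamma>"
  show "vcmp K \<gamma> (vcmp K \<beta> \<alpha>) = vcmp K (vcmp K \<gamma> \<beta>) \<alpha>"
    by (rule inj)
       (use c vcmp[OF c(1,2,4)] vcmp[OF c(2,3,5)] vcmp[of "vcmp K \<beta> \<alpha>" \<gamma>] vcmp[of \<alpha> "vcmp K \<gamma> \<beta>"]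
         U2_simps[OF c(1)] U2_simps[OF c(2)] U2_simps[OF c(3)] Cmp_assoc[OF Lv, of "on2 U \<alpha>" "on2 U \<beta>" "on2 U \<gamma>"] in auto)
qed (use bd id2 vcmp in auto)

lemma hcat: "category (hcat K)"
proof (rule categoryI, unfold hcat_simps)
  fix \<alpha> assume a: "\<alpha> \<in> Cel K"
  let ?x = "src1 K (src2 K \<alpha>)" and ?y = "tgt1 K (src2 K \<alpha>)"
  have x: "?x \<in> Obj K" "?y \<in> Obj K" using bd[OF a] by auto
  have s: "cmp1 K (src2 K \<alpha>) (id1 K ?x) = src2 K \<alpha>" "cmp1 K (tgt2 K \<alpha>) (id1 K ?x) = tgt2 K \<alpha>"
    "cmp1 K (id1 K ?y) (src2 K \<alpha>) = src2 K \<alpha>" "cmp1 K (id1 K ?y) (tgt2 K \<alpha>) = tgt2 K \<alpha>"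
    using bd[OF a] mor1(5)[of "src2 K \<alpha>"] mor1(5)[of "tgt2 K \<alpha>"] mor1(6)[of "src2 K \<alpha>"] mor1(6)[of "tgt2 K \<alpha>"] by auto
  have ix: "id1 K ?x \<in> Mor K" "id1 K ?y \<in> Mor K" "tgt1 K (id1 K ?x) = ?x" "src1 K (id1 K ?y) = ?y" using x by auto
  note i = id2[OF ix(1)] id2[OF ix(2)]
  have hx: "hcmp L (on2 U \<alpha>) (id2 L (id1 L (on0 U ?x))) = on2 U \<alpha>" "hcmp L (id2 L (id1 L (on0 U ?y))) (on2 U \<alpha>) = on2 U \<alpha>"
    using Cmp_Idn[OF Lh, of "on2 U \<alpha>" "on0 U ?x"] Idn_Cmp[OF Lh, of "on2 U \<alpha>" "on0 U ?y"] U2_simps[OF a] by auto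
  show "hcmp K \<alpha> (id2 K (id1 K ?x)) = \<alpha>"
    by (rule inj) (use a s i ix hx U1_simps(5)[OF x(1)] hcmp[of "id2 K (id1 K ?x)" \<alpha>] in auto)
  show "hcmp K (id2 K (id1 K ?y)) \<alpha> = \<alpha>"
    by (rule inj) (use a s i ix hx U1_simps(5)[OF x(2)] hcmp[of \<alpha> "id2 K (id1 K ?y)"] in auto)
next
  fix \<alpha> \<beta> assume c: "\<alpha> \<in> Cel K" "\<beta> \<in> Cel K" "tgt1 K (src2 K \<alpha>) = src1 K (src2 K \<beta>)"
  then show "hcmp K \<beta> \<alpha> \<in> Cel K \<and> src1 K (src2 K (hcmp K \<beta> \<alpha>)) = src1 K (src2 K \<alpha>) \<and>
      tgt1 K (src2 K (hcmp K \<beta> \<alpha>)) = tgt1 K (src2 K \<beta>)"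
    using hcmp[OF c] bd[OF c(1)] bd[OF c(2)] by simp
next
  fix \<alpha> \<beta> \<gamma> assume c: "\<alpha> \<in> Cel K" "\<beta> \<in> Cel K" "\<gamma> \<in> Cel K" "tgt1 K (src2 K \<alpha>) = src1 K (src2 K \<beta>)"
    "tgt1 K (src2 K \<beta>) = src1 K (src2 K \<gamma>)"
  note b = bd[OF c(1)] bd[OF c(2)] bd[OF c(3)]
  note ab = hcmp[OF c(1,2,4)] and bc = hcmp[OF c(2,3,5)]
  have "hcmp L (on2 U \<gamma>) (hcmp L (on2 U \<beta>) (on2 U \<alpha>)) = hcmp L (hcmp L (on2 U \<gamma>) (on2 U \<beta>)) (on2 U \<alpha>)"
    using Cmp_assoc[OF Lh, of "on2 U \<alpha>" "on2 U \<beta>" "on2 U \<gamma>"] U2_simps[OF c(1)] U2_simps[OF c(2)] U2_simps[OF c(3)] c by auto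
  then show "hcmp K \<gamma> (hcmp K \<beta> \<alpha>) = hcmp K (hcmp K \<gamma> \<beta>) \<alpha>"
    by (intro inj) (use c b ab bc hcmp[of "hcmp K \<beta> \<alpha>" \<gamma>] hcmp[of \<alpha> "hcmp K \<gamma> \<beta>"] in auto)
qed (use bd id2 in auto)

lemma strict_2_category: "strict_2_category K"
  unfolding strict_2_category_def
proof (intro conjI ballI impI)
  fix f g assume fg: "f \<in> Mor K" "g \<in> Mor K" "tgt1 K f = src1 K g"
  show "id2 K (cmp1 K g f) = hcmp K (id2 K g) (id2 K f)"
    by (rule inj)
       (use fg id2[OF fg(1)] id2[OF fg(2)] id2[of "cmp1 K g f"] mor1(4)[OF fg] hcmp[of "id2 K f" "id2 K g"]
         functor_Cmp[OF U1, of f g] strict_2_categoryD(6)[OF L, of "on1 U f" "on1 U g"] U1_simps in auto)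
next
  fix \<alpha> \<alpha>' \<beta> \<beta>' assume c: "\<alpha> \<in> Cel K" "\<alpha>' \<in> Cel K" "\<beta> \<in> Cel K" "\<beta>' \<in> Cel K"
    "tgt2 K \<alpha> = src2 K \<alpha>' \<and> tgt2 K \<beta> = src2 K \<beta>' \<and> tgt1 K (src2 K \<alpha>) = src1 K (src2 K \<beta>)"
  have d: "tgt2 K \<alpha> = src2 K \<alpha>'" "tgt2 K \<beta> = src2 K \<beta>'" "tgt1 K (src2 K \<alpha>) = src1 K (src2 K \<beta>)"
    "tgt1 K (src2 K \<alpha>') = src1 K (src2 K \<beta>')"
    using c bd[OF c(1)] bd[OF c(3)] by auto
  note v = vcmp[OF c(1,2) d(1)] vcmp[OF c(3,4) d(2)] and h = hcmp[OF c(1,3) d(3)] hcmp[OF c(2,4) d(4)]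
  have e: "hcmp L (vcmp L (on2 U \<beta>') (on2 U \<beta>)) (vcmp L (on2 U \<alpha>') (on2 U \<alpha>)) =
      vcmp L (hcmp L (on2 U \<beta>') (on2 U \<alpha>')) (hcmp L (on2 U \<beta>) (on2 U \<alpha>))"
    using strict_2_categoryD(7)[OF L, of "on2 U \<alpha>" "on2 U \<alpha>'" "on2 U \<beta>" "on2 U \<beta>'"]
      U2_simps[OF c(1)] U2_simps[OF c(2)] U2_simps[OF c(3)] U2_simps[OF c(4)] d by auto
  show "hcmp K (vcmp K \<beta>' \<beta>) (vcmp K \<alpha>' \<alpha>) = vcmp K (hcmp K \<beta>' \<alpha>') (hcmp K \<beta> \<alpha>)"
    by (rule inj)
       (use c d v h e hcmp[of "vcmp K \<alpha>' \<alpha>" "vcmp K \<beta>' \<beta>"] vcmp[of "hcmp K \<beta> \<alpha>" "hcmp K \<beta>' \<alpha>'"] in auto)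
qed (use K1 vcat hcat bd hcmp in auto)

lemma strict_2_functor: "strict_2_functor K L U"
  unfolding strict_2_functor_def
proof (intro conjI)
  show "is_functor (vcat K) (vcat L) \<lparr>Fo = on1 U, Fa = on2 U\<rparr>"
    by (rule is_functorI) (use U1_simps U2_simps bd id2 vcmp in auto)
  show "is_functor (hcat K) (hcat L) \<lparr>Fo = on0 U, Fa = on2 U\<rparr>"
    by (rule is_functorI) (use U1_simps U2_simps bd id2 hcmp in auto)
qed (rule U1)

end

section \<open>Full sub-2-categories\<close>

lemma full_sub2_simps [simp]:
  "Obj (full_sub2 K S) = Obj K \<inter> S" "Mor (full_sub2 K S) = {f \<in> Mor K. src1 K f \<in> S \<and> tgt1 K f \<in> S}"
  "Cel (full_sub2 K S) = {\<alpha> \<in> Cel K. src1 K (src2 K \<alpha>) \<in> S \<and> tgt1 K (src2 K \<alpha>) \<in> S}"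
  "src1 (full_sub2 K S) = src1 K" "tgt1 (full_sub2 K S) = tgt1 K" "src2 (full_sub2 K S) = src2 K"
  "tgt2 (full_sub2 K S) = tgt2 K" "id1 (full_sub2 K S) = id1 K" "cmp1 (full_sub2 K S) = cmp1 K"
  "id2 (full_sub2 K S) = id2 K" "vcmp (full_sub2 K S) = vcmp K" "hcmp (full_sub2 K S) = hcmp K"
  by (auto simp: full_sub2_def)

text \<open>Membership of a 2-cell is tested on the ends of its source 1-cell; these are also the
  ends of its target 1-cell.\<close>

lemma strict_2_category_full_sub2:
  assumes K: "strict_2_category K"
  shows "strict_2_category (full_sub2 K S)"
proof -
  note D = strict_2_categoryD[OF K]
  note c1 = Dom_ob[OF D(1)] Cod_ob[OF D(1)] Idn_ar[OF D(1)] Dom_Idn[OF D(1)] Cod_Idn[OF D(1)] Cmp_ar[OF D(1)]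
    Dom_Cmp[OF D(1)] Cod_Cmp[OF D(1)] Cmp_Idn[OF D(1)] Idn_Cmp[OF D(1)] Cmp_assoc[OF D(1)]
  note c2 = Dom_ob[OF D(2)] Cod_ob[OF D(2)] Idn_ar[OF D(2)] Dom_Idn[OF D(2)] Cod_Idn[OF D(2)] Cmp_ar[OF D(2)]
    Dom_Cmp[OF D(2)] Cod_Cmp[OF D(2)] Cmp_Idn[OF D(2)] Idn_Cmp[OF D(2)] Cmp_assoc[OF D(2)]
  note c3 = Dom_ob[OF D(3)] Cod_ob[OF D(3)] Idn_ar[OF D(3)] Dom_Idn[OF D(3)] Cod_Idn[OF D(3)] Cmp_ar[OF D(3)]
    Dom_Cmp[OF D(3)] Cod_Cmp[OF D(3)] Cmp_Idn[OF D(3)] Idn_Cmp[OF D(3)] Cmp_assoc[OF D(3)]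
  note c1' = c1[unfolded cat1_simps] and c2' = c2[unfolded vcat_simps] and c3' = c3[unfolded hcat_simps]
  have D4: "src1 K (tgt2 K \<alpha>) = src1 K (src2 K \<alpha>)" "tgt1 K (tgt2 K \<alpha>) = tgt1 K (src2 K \<alpha>)" if "\<alpha> \<in> Cel K" for \<alpha>
    using D(4)[OF that] by auto
  have "category (cat1 (full_sub2 K S))" by (rule categoryI) (simp_all add: c1')
  moreover have "category (vcat (full_sub2 K S))" by (rule categoryI) (simp_all add: c2' D4)
  moreover have "category (hcat (full_sub2 K S))" by (rule categoryI) (simp_all add: c3' c1' c2')
  ultimately show ?thesis
    using K unfolding strict_2_category_def full_sub2_simps mem_Collect_eq by blast
qed

lemma strict_2_functor_full_sub2:
  assumes U: "strict_2_functor K L U" and K: "strict_2_category K"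
  shows "strict_2_functor (full_sub2 K {a. on0 U a \<in> S}) (full_sub2 L S) U"
proof -
  have U1: "is_functor (cat1 K) (cat1 L) \<lparr>Fo = on0 U, Fa = on1 U\<rparr>"
    and U2: "is_functor (vcat K) (vcat L) \<lparr>Fo = on1 U, Fa = on2 U\<rparr>"
    and U3: "is_functor (hcat K) (hcat L) \<lparr>Fo = on0 U, Fa = on2 U\<rparr>"
    using U by (auto simp: strict_2_functor_def)
  note u = functor_Fo[OF U1] functor_Fa[OF U1] functor_Dom[OF U1] functor_Cod[OF U1] functor_Idn[OF U1] functor_Cmp[OF U1]
  note v = functor_Fo[OF U2] functor_Fa[OF U2] functor_Dom[OF U2] functor_Cod[OF U2] functor_Idn[OF U2] functor_Cmp[OF U2]
  note w = functor_Fo[OF U3] functor_Fa[OF U3] functor_Dom[OF U3] functor_Cod[OF U3] functor_Idn[OF U3] functor_Cmp[OF U3]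
  note u' = u[simplified] and v' = v[simplified] and w' = w[simplified]
  have K2: "\<alpha> \<in> Cel K \<Longrightarrow> src2 K \<alpha> \<in> Mor K" for \<alpha> using Dom_ob[OF strict_2_categoryD(2)[OF K]] by simp
  show ?thesis
    unfolding strict_2_functor_def is_functor_def using u' v' w' K2 by simp
qed

section \<open>2-functors strictly surjective on objects and 1-cells\<close>

lemma iso_1cells_refl:
  assumes K: "strict_2_category K" and f: "f \<in> Mor K"
  shows "iso_1cells K f f"
proof -
  note c = strict_2_categoryD(2)[OF K]
  have "id2 K f \<in> hom (vcat K) f f" "is_iso (vcat K) (id2 K f)"
    using Idn_ar[OF c, of f] Dom_Idn[OF c, of f] Cod_Idn[OF c, of f] iso_Idn[OF c, of f] f by auto
  then show ?thesis unfolding iso_1cells_def by blast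
qed

lemma equivalent_objects_refl:
  assumes K: "strict_2_category K" and a: "a \<in> Obj K"
  shows "equivalent_objects K a a"
proof -
  note c = strict_2_categoryD(1)[OF K]
  have i: "id1 K a \<in> Mor K" "src1 K (id1 K a) = a" "tgt1 K (id1 K a) = a" "cmp1 K (id1 K a) (id1 K a) = id1 K a"
    using Idn_ar[OF c, of a] Dom_Idn[OF c, of a] Cod_Idn[OF c, of a] Cmp_Idn[OF c, of "id1 K a" a] a by auto
  have "id1 K a \<in> hom (cat1 K) a a" using i by simp
  moreover have "iso_1cells K (cmp1 K (id1 K a) (id1 K a)) (id1 K a)" using iso_1cells_refl[OF K] i by simp
  ultimately show ?thesis unfolding equivalent_objects_def by blast
qed

text \<open>Identities witness the equivalences and isomorphisms that essential surjectivity asks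
  for.\<close>

lemma strictly_surjective_2_equivalence:
  assumes K: "strict_2_category K" and L: "strict_2_category L" and U: "strict_2_functor K L U"
    and s0: "\<And>b. b \<in> Obj L \<Longrightarrow> \<exists>a\<in>Obj K. on0 U a = b"
    and s1: "\<And>a b g. a \<in> Obj K \<Longrightarrow> b \<in> Obj K \<Longrightarrow> g \<in> hom (cat1 L) (on0 U a) (on0 U b) \<Longrightarrow> \<exists>f\<in>hom (cat1 K) a b. on1 U f = g"
    and s2: "\<And>a b f g. a \<in> Obj K \<Longrightarrow> b \<in> Obj K \<Longrightarrow> f \<in> hom (cat1 K) a b \<Longrightarrow> g \<in> hom (cat1 K) a b \<Longrightarrow>
      bij_betw (on2 U) (hom (vcat K) f g) (hom (vcat L) (on1 U f) (on1 U g))"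
  shows "is_2_equivalence K L U"
  unfolding is_2_equivalence_def
proof (intro conjI ballI)
  fix b assume "b \<in> Obj L"
  then show "\<exists>a\<in>Obj K. equivalent_objects L (on0 U a) b" using s0 equivalent_objects_refl[OF L] by metis
next
  fix a b g assume "a \<in> Obj K" "b \<in> Obj K" and g: "g \<in> hom (cat1 L) (on0 U a) (on0 U b)"
  then obtain f where f: "f \<in> hom (cat1 K) a b" "on1 U f = g" using s1 by blast
  moreover have "iso_1cells L g g" using iso_1cells_refl[OF L] g by simp
  ultimately show "\<exists>f\<in>hom (cat1 K) a b. iso_1cells L (on1 U f) g" by blast
qed (use K L U s2 in auto)

text \<open>Hom-categories of a full sub-2-category are those of the ambient one, and the condition
  upstairs is the preimage of \<open>S\<close>, so preimages of objects and 1-cells stay inside.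
  Natural typoses and natural display toposes are cut out by a condition on the underlying display
  category and hence have this form.\<close>

lemma strictly_surjective_full_sub2:
  assumes K: "strict_2_category K" and L: "strict_2_category L" and U: "strict_2_functor K L U"
    and s0: "\<And>b. b \<in> Obj L \<Longrightarrow> \<exists>a\<in>Obj K. on0 U a = b"
    and s1: "\<And>a b g. a \<in> Obj K \<Longrightarrow> b \<in> Obj K \<Longrightarrow> g \<in> hom (cat1 L) (on0 U a) (on0 U b) \<Longrightarrow> \<exists>f\<in>hom (cat1 K) a b. on1 U f = g"
    and s2: "\<And>a b f g. a \<in> Obj K \<Longrightarrow> b \<in> Obj K \<Longrightarrow> f \<in> hom (cat1 K) a b \<Longrightarrow> g \<in> hom (cat1 K) a b \<Longrightarrow>
      bij_betw (on2 U) (hom (vcat K) f g) (hom (vcat L) (on1 U f) (on1 U g))"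
  shows "is_2_equivalence (full_sub2 K {a. on0 U a \<in> S}) (full_sub2 L S) U" (is "is_2_equivalence ?K ?L U")
proof (rule strictly_surjective_2_equivalence)
  show "strict_2_category ?K" "strict_2_category ?L" using strict_2_category_full_sub2 K L by auto
  show "strict_2_functor ?K ?L U" by (rule strict_2_functor_full_sub2[OF U K])
next
  fix b assume "b \<in> Obj ?L"
  then show "\<exists>a\<in>Obj ?K. on0 U a = b" using s0[of b] by auto
next
  fix a b g assume a: "a \<in> Obj ?K" and b: "b \<in> Obj ?K" and g: "g \<in> hom (cat1 ?L) (on0 U a) (on0 U b)"
  obtain f where "f \<in> hom (cat1 K) a b" "on1 U f = g" using s1[of a b g] a b g by auto
  then show "\<exists>f\<in>hom (cat1 ?K) a b. on1 U f = g" using a b by (intro bexI[of _ f]) auto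
next
  fix a b f g assume a: "a \<in> Obj ?K" and b: "b \<in> Obj ?K" and f: "f \<in> hom (cat1 ?K) a b" and g: "g \<in> hom (cat1 ?K) a b"
  have "src1 L (on1 U f) = on0 U a" "tgt1 L (on1 U f) = on0 U b"
    using U f functor_Dom[of "cat1 K" "cat1 L" "\<lparr>Fo = on0 U, Fa = on1 U\<rparr>" f] functor_Cod[of "cat1 K" "cat1 L" "\<lparr>Fo = on0 U, Fa = on1 U\<rparr>" f]
    by (auto simp: strict_2_functor_def)
  then have "hom (vcat ?K) f g = hom (vcat K) f g" "hom (vcat ?L) (on1 U f) (on1 U g) = hom (vcat L) (on1 U f) (on1 U g)"
    using a b f by auto
  then show "bij_betw (on2 U) (hom (vcat ?K) f g) (hom (vcat ?L) (on1 U f) (on1 U g))"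
    using s2[of a b f g] a b f g by simp
qed

section \<open>The 2-category of Cartesian display categories\<close>

lemma CDC_simps [simp]:
  "Obj (CDC small) = {C. cdc_object small C}" "Mor (CDC small) = {F. cdc_mor small F}" "Cel (CDC small) = {\<alpha>. cdc_cell small \<alpha>}"
  "src1 (CDC small) = dsrc" "tgt1 (CDC small) = dtgt" "src2 (CDC small) = dnsrc" "tgt2 (CDC small) = dntgt"
  "id1 (CDC small) = cdc_id1" "cmp1 (CDC small) = cdc_cmp1" "id2 (CDC small) = cdc_id2" "vcmp (CDC small) = cdc_vcmp"
  "hcmp (CDC small) = cdc_hcmp"
  by (simp_all add: CDC_def)

lemma cdc_id1_simps [simp]:
  "Fo (cdc_id1 C) = Fo (id_fct C)" "Fa (cdc_id1 C) = Fa (id_fct C)" "dsrc (cdc_id1 C) = C" "dtgt (cdc_id1 C) = C"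
  by (simp_all add: cdc_id1_def fct.defs dfun.defs)

lemma cdc_cmp1_simps [simp]:
  "Fo (cdc_cmp1 G F) = compose (Ob (dsrc F)) (Fo G) (Fo F)" "Fa (cdc_cmp1 G F) = compose (Ar (dsrc F)) (Fa G) (Fa F)"
  "dsrc (cdc_cmp1 G F) = dsrc F" "dtgt (cdc_cmp1 G F) = dtgt G"
  by (simp_all add: cdc_cmp1_def cmp_fct_def fct.defs dfun.defs)

lemma fct_cong_functor:
  assumes "\<And>a. a \<in> Ob C \<Longrightarrow> Fo F a = Fo G a" "\<And>f. f \<in> Ar C \<Longrightarrow> Fa F f = Fa G f" "category C"
  shows "is_functor C D F \<longleftrightarrow> is_functor C D G"
  unfolding is_functor_def using assms by simp

text \<open>\<open>F\<close> agrees with the identity only on carriers, so the composite diagram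
  need not equal \<open>X\<close>; the two diagrams do have the same cones.\<close>

lemma preserves_finite_limits_id:
  assumes "category C" "\<And>a. a \<in> Ob C \<Longrightarrow> Fo F a = a" "\<And>f. f \<in> Ar C \<Longrightarrow> Fa F f = f"
  shows "preserves_finite_limits C C F"
  unfolding preserves_finite_limits_def
proof (intro allI impI)
  fix J and X :: "(nat, nat, 'a, 'b) fct" and x l
  assume a: "finite_category J \<and> is_functor J C X \<and> is_limit J C X x l"
  have J: "category J" using a by (simp add: finite_category_def)
  have X: "is_functor J C X" using a by simp
  have l: "x \<in> Ob C" "\<And>j. j \<in> Ob J \<Longrightarrow> l j \<in> Ar C" using a by (auto simp: is_limit_def is_cone_def)
  let ?X = "cmp_fct J F X"
  have cone: "is_cone J C ?X y m = is_cone J C X y m" for y m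
    unfolding is_cone_def using X J assms by simp
  have "is_cone J C X x (\<lambda>j. Fa F (l j)) = is_cone J C X x l"
    unfolding is_cone_def using l J assms by simp
  then show "is_limit J C ?X (Fo F x) (\<lambda>j. Fa F (l j))"
    using a l assms unfolding is_limit_def cone by simp
qed

lemma preserves_finite_limits_comp:
  assumes F: "is_functor C D F" "preserves_finite_limits C D F" and G: "preserves_finite_limits D E G"
    and H: "\<And>a. a \<in> Ob C \<Longrightarrow> Fo H a = Fo G (Fo F a)" "\<And>f. f \<in> Ar C \<Longrightarrow> Fa H f = Fa G (Fa F f)"
  shows "preserves_finite_limits C E H"
  unfolding preserves_finite_limits_def
proof (intro allI impI)
  fix J and X :: "(nat, nat, 'a, 'b) fct" and x l
  assume a: "finite_category J \<and> is_functor J C X \<and> is_limit J C X x l"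
  have J: "category J" and X: "is_functor J C X" using a by (auto simp: finite_category_def)
  have l: "x \<in> Ob C" "\<And>j. j \<in> Ob J \<Longrightarrow> l j \<in> Ar C" using a by (auto simp: is_limit_def is_cone_def)
  have 1: "is_limit J D (cmp_fct J F X) (Fo F x) (\<lambda>j. Fa F (l j))"
    using F(2) a unfolding preserves_finite_limits_def by blast
  have "is_functor J D (cmp_fct J F X)" by (rule cmp_fct_functor[OF J X F(1)])
  then have 2: "is_limit J E (cmp_fct J G (cmp_fct J F X)) (Fo G (Fo F x)) (\<lambda>j. Fa G (Fa F (l j)))"
    using G a 1 unfolding preserves_finite_limits_def by blast
  \<comment> \<open>Both sides are restricted to the shape \<open>J\<close>, so agreement of
    \<open>H\<close> with the composite on the carriers of \<open>C\<close> makes the diagrams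
    equal.\<close>
  have "cmp_fct J H X = cmp_fct J G (cmp_fct J F X)"
    unfolding cmp_fct_def compose_def using X H by (auto simp: fun_eq_iff restrict_def)
  moreover have "is_limit J E Y z (\<lambda>j. Fa G (Fa F (l j))) = is_limit J E Y z (\<lambda>j. Fa H (l j))" for Y :: "(nat, nat, _, _) fct" and z
    using H l J unfolding is_limit_def is_cone_def by simp
  ultimately show "is_limit J E (cmp_fct J H X) (Fo H x) (\<lambda>j. Fa H (l j))"
    using 2 H l by simp
qed

lemma display_functor_id:
  assumes "display_category C" "\<And>a. a \<in> Ob C \<Longrightarrow> Fo F a = a" "\<And>f. f \<in> Ar C \<Longrightarrow> Fa F f = f"
  shows "display_functor C C F"
  unfolding display_functor_def
proof (intro conjI ballI allI impI)
  show "is_functor C C F" by (rule is_functorI) (use assms in auto)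
  fix f p q t assume "p \<in> Disp C \<and> is_pullback C f p q t"
  then show "is_pullback C (Fa F f) (Fa F p) (Fa F q) (Fa F t)"
    using pullback_ar[of C f p q t] assms by auto
qed (use assms in auto)

lemma display_functor_comp:
  assumes C: "display_category C" and F: "display_functor C D F" and G: "display_functor D E G"
    and H: "\<And>a. a \<in> Ob C \<Longrightarrow> Fo H a = Fo G (Fo F a)" "\<And>f. f \<in> Ar C \<Longrightarrow> Fa H f = Fa G (Fa F f)"
  shows "display_functor C E H"
  unfolding display_functor_def
proof (intro conjI ballI allI impI)
  have "is_functor C E (cmp_fct C G F)"
    using F G C by (intro cmp_fct_functor[of C D F E G]) (auto simp: display_functor_def)
  then show "is_functor C E H" using fct_cong_functor[of C H "cmp_fct C G F" E] C H by simp
next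
  fix p assume "p \<in> Disp C"
  then show "Fa H p \<in> Disp E" using H F G C by (simp add: display_functor_def)
next
  fix f p q t assume a: "p \<in> Disp C \<and> is_pullback C f p q t"
  have "is_pullback E (Fa G (Fa F f)) (Fa G (Fa F p)) (Fa G (Fa F q)) (Fa G (Fa F t))"
    using a F G unfolding display_functor_def by blast
  then show "is_pullback E (Fa H f) (Fa H p) (Fa H q) (Fa H t)"
    using pullback_ar[of C f p q t] a H by simp
qed

lemma cdc_morD:
  assumes "cdc_mor small F"
  shows "cdc_object small (dsrc F)" "cdc_object small (dtgt F)" "display_category (dsrc F)" "display_category (dtgt F)"
    "category (dsrc F)" "category (dtgt F)" "is_functor (dsrc F) (dtgt F) F" "display_functor (dsrc F) (dtgt F) F"
    "preserves_finite_limits (dsrc F) (dtgt F) F" "Fo F \<in> extensional (Ob (dsrc F))" "Fa F \<in> extensional (Ar (dsrc F))"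
  using assms by (auto simp: cdc_mor_def cdc_object_def display_functor_def fct_extensional_def)

lemma cdc_mor_id1: "cdc_object small C \<Longrightarrow> cdc_mor small (cdc_id1 C)"
  by (auto simp: cdc_mor_def cdc_object_def fct_extensional_def id_fct_def intro: display_functor_id preserves_finite_limits_id)

lemma cdc_mor_cmp1:
  assumes F: "cdc_mor small F" and G: "cdc_mor small G" and FG: "dtgt F = dsrc G"
  shows "cdc_mor small (cdc_cmp1 G F)"
proof -
  note f = cdc_morD[OF F] and g = cdc_morD[OF G]
  have "display_functor (dsrc F) (dtgt G) (cdc_cmp1 G F)"
    by (rule display_functor_comp[of _ "dtgt F" F _ G]) (use f g FG in \<open>auto simp: compose_eq\<close>)
  moreover have "preserves_finite_limits (dsrc F) (dtgt G) (cdc_cmp1 G F)"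
    by (rule preserves_finite_limits_comp[of _ "dtgt F" F _ G]) (use f g FG in \<open>auto simp: compose_eq\<close>)
  ultimately show ?thesis using f g by (simp add: cdc_mor_def fct_extensional_def)
qed

lemma dfun_eqI:
  assumes "cdc_mor small F" "cdc_mor small G" "dsrc F = dsrc G" "dtgt F = dtgt G"
    "\<And>a. a \<in> Ob (dsrc F) \<Longrightarrow> Fo F a = Fo G a" "\<And>f. f \<in> Ar (dsrc F) \<Longrightarrow> Fa F f = Fa G f"
  shows "F = G"
proof (rule dfun.equality)
  show "Fo F = Fo G" using assms cdc_morD(10)[OF assms(1)] cdc_morD(10)[OF assms(2)] by (intro extensionalityI[of "Fo F" "Ob (dsrc F)"]) auto
  show "Fa F = Fa G" using assms cdc_morD(11)[OF assms(1)] cdc_morD(11)[OF assms(2)] by (intro extensionalityI[of "Fa F" "Ar (dsrc F)"]) auto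
qed (use assms in auto)

lemma CDC_cat1: "category (cat1 (CDC small))"
proof (rule categoryI, unfold cat1_simps CDC_simps mem_Collect_eq)
  fix F assume F: "cdc_mor small F"
  note f = cdc_morD[OF F]
  show "cdc_object small (dsrc F)" "cdc_object small (dtgt F)" using f by auto
  show "cdc_cmp1 F (cdc_id1 (dsrc F)) = F"
    by (rule dfun_eqI[of small]) (use F f cdc_mor_cmp1[OF cdc_mor_id1 F] in \<open>auto simp: compose_eq\<close>)
  show "cdc_cmp1 (cdc_id1 (dtgt F)) F = F"
    by (rule dfun_eqI[of small]) (use F f cdc_mor_cmp1[OF F cdc_mor_id1] in \<open>auto simp: compose_eq\<close>)
next
  fix F G H assume a: "cdc_mor small F" "cdc_mor small G" "cdc_mor small H" "dtgt F = dsrc G" "dtgt G = dsrc H"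
  note f = cdc_morD[OF a(1)] and g = cdc_morD[OF a(2)] and h = cdc_morD[OF a(3)]
  note FG = cdc_mor_cmp1[OF a(1,2,4)] and GH = cdc_mor_cmp1[OF a(2,3,5)]
  show "cdc_cmp1 H (cdc_cmp1 G F) = cdc_cmp1 (cdc_cmp1 H G) F"
    by (rule dfun_eqI[of small])
       (use a f g h cdc_mor_cmp1[OF FG a(3)] cdc_mor_cmp1[OF a(1) GH] functor_Fo[OF f(7)] functor_Fa[OF f(7)] in \<open>auto simp: compose_eq\<close>)
qed (auto simp: cdc_mor_id1 cdc_mor_cmp1)

lemma cdc_cellD:
  assumes "cdc_cell small \<alpha>"
  shows "cdc_mor small (dnsrc \<alpha>)" "cdc_mor small (dntgt \<alpha>)" "dsrc (dntgt \<alpha>) = dsrc (dnsrc \<alpha>)" "dtgt (dntgt \<alpha>) = dtgt (dnsrc \<alpha>)"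
    "dncomp \<alpha> \<in> extensional (Ob (dsrc (dnsrc \<alpha>)))"
    "\<And>a. a \<in> Ob (dsrc (dnsrc \<alpha>)) \<Longrightarrow> dncomp \<alpha> a \<in> Ar (dtgt (dnsrc \<alpha>))"
    "\<And>a. a \<in> Ob (dsrc (dnsrc \<alpha>)) \<Longrightarrow> Dom (dtgt (dnsrc \<alpha>)) (dncomp \<alpha> a) = Fo (dnsrc \<alpha>) a"
    "\<And>a. a \<in> Ob (dsrc (dnsrc \<alpha>)) \<Longrightarrow> Cod (dtgt (dnsrc \<alpha>)) (dncomp \<alpha> a) = Fo (dntgt \<alpha>) a"
    "\<And>f. f \<in> Ar (dsrc (dnsrc \<alpha>)) \<Longrightarrow> Cmp (dtgt (dnsrc \<alpha>)) (dncomp \<alpha> (Cod (dsrc (dnsrc \<alpha>)) f)) (Fa (dnsrc \<alpha>) f) =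
      Cmp (dtgt (dnsrc \<alpha>)) (Fa (dntgt \<alpha>) f) (dncomp \<alpha> (Dom (dsrc (dnsrc \<alpha>)) f))"
  using assms by (auto simp: cdc_cell_def is_nat_def)

lemma cdc_cellI:
  assumes "cdc_mor small F" "cdc_mor small G" "dsrc G = dsrc F" "dtgt G = dtgt F" "is_nat (dsrc F) (dtgt F) F G a"
    "a \<in> extensional (Ob (dsrc F))" "dnsrc \<alpha> = F" "dntgt \<alpha> = G" "dncomp \<alpha> = a"
  shows "cdc_cell small \<alpha>"
  using assms by (auto simp: cdc_cell_def)

lemma dnat_eqI:
  assumes "cdc_cell small \<alpha>" "cdc_cell small \<beta>" "dnsrc \<alpha> = dnsrc \<beta>" "dntgt \<alpha> = dntgt \<beta>"
    "\<And>a. a \<in> Ob (dsrc (dnsrc \<alpha>)) \<Longrightarrow> dncomp \<alpha> a = dncomp \<beta> a"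
  shows "\<alpha> = \<beta>"
proof (rule dnat.equality)
  show "dncomp \<alpha> = dncomp \<beta>"
    using assms cdc_cellD(5)[OF assms(1)] cdc_cellD(5)[OF assms(2)] by (intro extensionalityI[of _ "Ob (dsrc (dnsrc \<alpha>))"]) auto
qed (use assms in auto)

lemma is_nat_id: "category C \<Longrightarrow> category D \<Longrightarrow> is_functor C D F \<Longrightarrow> is_nat C D F F (\<lambda>\<Gamma>\<in>Ob C. Idn D (Fo F \<Gamma>))"
  by (auto simp: is_nat_def functor_Dom functor_Cod)

lemma is_nat_vcmp:
  assumes C: "category C" and D: "category D" and F: "is_functor C D F" and G: "is_functor C D G" and H: "is_functor C D H"
    and a: "is_nat C D F G a" and b: "is_nat C D G H b"
  shows "is_nat C D F H (\<lambda>\<Gamma>\<in>Ob C. Cmp D (b \<Gamma>) (a \<Gamma>))"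
  unfolding is_nat_def
proof (intro conjI ballI)
  fix f assume f: "f \<in> Ar C"
  let ?x = "Dom C f" and ?y = "Cod C f"
  have ob: "?x \<in> Ob C" "?y \<in> Ob C" using C f by auto
  have s: "a x \<in> Ar D \<and> Dom D (a x) = Fo F x \<and> Cod D (a x) = Fo G x" "b x \<in> Ar D \<and> Dom D (b x) = Fo G x \<and> Cod D (b x) = Fo H x"
    if "x \<in> Ob C" for x using a b that by (auto simp: is_nat_def)
  have n: "Cmp D (a ?y) (Fa F f) = Cmp D (Fa G f) (a ?x)" "Cmp D (b ?y) (Fa G f) = Cmp D (Fa H f) (b ?x)"
    using a b f by (auto simp: is_nat_def)
  note fs = functor_Fa[OF F f] functor_Dom[OF F f] functor_Cod[OF F f] functor_Fa[OF G f] functor_Dom[OF G f] functor_Cod[OF G f]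
    functor_Fa[OF H f] functor_Dom[OF H f] functor_Cod[OF H f]
  have "Cmp D (Cmp D (b ?y) (a ?y)) (Fa F f) = Cmp D (Cmp D (b ?y) (Fa G f)) (a ?x)"
    using D fs s[OF ob(1)] s[OF ob(2)] n(1) by simp
  also have "\<dots> = Cmp D (Fa H f) (Cmp D (b ?x) (a ?x))"
    unfolding n(2) using D fs s[OF ob(1)] s[OF ob(2)] by simp
  finally show "Cmp D ((\<lambda>\<Gamma>\<in>Ob C. Cmp D (b \<Gamma>) (a \<Gamma>)) (Cod C f)) (Fa F f) = Cmp D (Fa H f) ((\<lambda>\<Gamma>\<in>Ob C. Cmp D (b \<Gamma>) (a \<Gamma>)) (Dom C f))"
    using ob by simp
qed (use D a b in \<open>auto simp: is_nat_def\<close>)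

text \<open>The image under \<open>G\<close> of the naturality square of \<open>a\<close> is pasted
  with the naturality square of \<open>b\<close> at \<open>F' f\<close>. \<open>H\<close> and
  \<open>H'\<close> are specified only on carriers, so that the lemma serves both
  2-categories.\<close>

lemma is_nat_hcmp:
  assumes C: "category C" and D: "category D" and E: "category E"
    and F: "is_functor C D F" and F': "is_functor C D F'" and G: "is_functor D E G" and G': "is_functor D E G'"
    and a: "is_nat C D F F' a" and b: "is_nat D E G G' b"
    and H: "\<And>x. x \<in> Ob C \<Longrightarrow> Fo H x = Fo G (Fo F x)" "\<And>f. f \<in> Ar C \<Longrightarrow> Fa H f = Fa G (Fa F f)"
    and H': "\<And>x. x \<in> Ob C \<Longrightarrow> Fo H' x = Fo G' (Fo F' x)" "\<And>f. f \<in> Ar C \<Longrightarrow> Fa H' f = Fa G' (Fa F' f)"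
  shows "is_nat C E H H' (\<lambda>\<Gamma>\<in>Ob C. Cmp E (b (Fo F' \<Gamma>)) (Fa G (a \<Gamma>)))"
  unfolding is_nat_def
proof (intro conjI ballI)
  have s: "a x \<in> Ar D" "Dom D (a x) = Fo F x" "Cod D (a x) = Fo F' x" if "x \<in> Ob C" for x
    using a that by (auto simp: is_nat_def)
  have t: "b y \<in> Ar E" "Dom E (b y) = Fo G y" "Cod E (b y) = Fo G' y" if "y \<in> Ob D" for y
    using b that by (auto simp: is_nat_def)
  have Ga: "Fa G g \<in> Ar E" "Dom E (Fa G g) = Fo G (Dom D g)" "Cod E (Fa G g) = Fo G (Cod D g)" if "g \<in> Ar D" for g
    using functor_Fa[OF G that] functor_Dom[OF G that] functor_Cod[OF G that] by auto
  have Ga': "Fa G' g \<in> Ar E" "Dom E (Fa G' g) = Fo G' (Dom D g)" "Cod E (Fa G' g) = Fo G' (Cod D g)" if "g \<in> Ar D" for g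
    using functor_Fa[OF G' that] functor_Dom[OF G' that] functor_Cod[OF G' that] by auto
  have o: "Fo F x \<in> Ob D" "Fo F' x \<in> Ob D" if "x \<in> Ob C" for x using F F' that by auto
  {
    fix x assume x: "x \<in> Ob C"
    show "(\<lambda>\<Gamma>\<in>Ob C. Cmp E (b (Fo F' \<Gamma>)) (Fa G (a \<Gamma>))) x \<in> hom E (Fo H x) (Fo H' x)"
      using x s[OF x] t[OF o(2)[OF x]] Ga[OF s(1)[OF x]] E H(1)[OF x] H'(1)[OF x] by simp
  }
  fix f assume f: "f \<in> Ar C"
  let ?x = "Dom C f" and ?y = "Cod C f"
  have ob: "?x \<in> Ob C" "?y \<in> Ob C" using C f by auto
  note sx = s[OF ob(1)] and sy = s[OF ob(2)]
  note tx = t[OF o(2)[OF ob(1)]] and ty = t[OF o(2)[OF ob(2)]]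
  have Ff: "Fa F f \<in> Ar D" "Dom D (Fa F f) = Fo F ?x" "Cod D (Fa F f) = Fo F ?y"
    "Fa F' f \<in> Ar D" "Dom D (Fa F' f) = Fo F' ?x" "Cod D (Fa F' f) = Fo F' ?y"
    using functor_Fa[OF F f] functor_Dom[OF F f] functor_Cod[OF F f] functor_Fa[OF F' f] functor_Dom[OF F' f] functor_Cod[OF F' f] by auto
  note ga = Ga[OF sx(1)] Ga[OF sy(1)] Ga[OF Ff(1)] Ga[OF Ff(4)] Ga'[OF Ff(4)]
  have n1: "Cmp D (a ?y) (Fa F f) = Cmp D (Fa F' f) (a ?x)" using a f by (auto simp: is_nat_def)
  have n: "Cmp E (Fa G (a ?y)) (Fa G (Fa F f)) = Cmp E (Fa G (Fa F' f)) (Fa G (a ?x))"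
    by (rule functor_square[OF G n1]) (use sx sy Ff in auto)
  have m: "Cmp E (b (Fo F' ?y)) (Fa G (Fa F' f)) = Cmp E (Fa G' (Fa F' f)) (b (Fo F' ?x))"
    using b Ff by (auto simp: is_nat_def)
  have "Cmp E (Cmp E (b (Fo F' ?y)) (Fa G (a ?y))) (Fa G (Fa F f)) = Cmp E (Cmp E (b (Fo F' ?y)) (Fa G (Fa F' f))) (Fa G (a ?x))"
    using E sx sy tx ty Ff ga n by simp
  also have "\<dots> = Cmp E (Fa G' (Fa F' f)) (Cmp E (b (Fo F' ?x)) (Fa G (a ?x)))"
    unfolding m using E sx sy tx ty Ff ga by simp
  finally show "Cmp E ((\<lambda>\<Gamma>\<in>Ob C. Cmp E (b (Fo F' \<Gamma>)) (Fa G (a \<Gamma>))) (Cod C f)) (Fa H f) =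
    Cmp E (Fa H' f) ((\<lambda>\<Gamma>\<in>Ob C. Cmp E (b (Fo F' \<Gamma>)) (Fa G (a \<Gamma>))) (Dom C f))"
    using ob H(2)[OF f] H'(2)[OF f] by simp
qed

lemma cdc_id2_simps [simp]:
  "dnsrc (cdc_id2 F) = F" "dntgt (cdc_id2 F) = F" "\<Gamma> \<in> Ob (dsrc F) \<Longrightarrow> dncomp (cdc_id2 F) \<Gamma> = Idn (dtgt F) (Fo F \<Gamma>)"
  by (simp_all add: cdc_id2_def)

lemma cdc_vcmp_simps [simp]:
  "dnsrc (cdc_vcmp \<beta> \<alpha>) = dnsrc \<alpha>" "dntgt (cdc_vcmp \<beta> \<alpha>) = dntgt \<beta>"
  "\<Gamma> \<in> Ob (dsrc (dnsrc \<alpha>)) \<Longrightarrow> dncomp (cdc_vcmp \<beta> \<alpha>) \<Gamma> = Cmp (dtgt (dnsrc \<alpha>)) (dncomp \<beta> \<Gamma>) (dncomp \<alpha> \<Gamma>)"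
  by (simp_all add: cdc_vcmp_def)

lemma cdc_hcmp_simps [simp]:
  "dnsrc (cdc_hcmp \<beta> \<alpha>) = cdc_cmp1 (dnsrc \<beta>) (dnsrc \<alpha>)" "dntgt (cdc_hcmp \<beta> \<alpha>) = cdc_cmp1 (dntgt \<beta>) (dntgt \<alpha>)"
  "\<Gamma> \<in> Ob (dsrc (dnsrc \<alpha>)) \<Longrightarrow> dncomp (cdc_hcmp \<beta> \<alpha>) \<Gamma> =
     Cmp (dtgt (dnsrc \<beta>)) (dncomp \<beta> (Fo (dntgt \<alpha>) \<Gamma>)) (Fa (dnsrc \<beta>) (dncomp \<alpha> \<Gamma>))"
  by (simp_all add: cdc_hcmp_def)

lemma cdc_cell_id2: "cdc_mor small F \<Longrightarrow> cdc_cell small (cdc_id2 F)"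
  by (rule cdc_cellI[of small F F]) (use cdc_morD in \<open>auto simp: cdc_id2_def intro!: is_nat_id\<close>)

lemma cdc_cell_vcmp:
  assumes a: "cdc_cell small \<alpha>" and b: "cdc_cell small \<beta>" and ab: "dntgt \<alpha> = dnsrc \<beta>"
  shows "cdc_cell small (cdc_vcmp \<beta> \<alpha>)"
proof (rule cdc_cellI[of small "dnsrc \<alpha>" "dntgt \<beta>"])
  let ?F = "dnsrc \<alpha>" and ?G = "dntgt \<alpha>" and ?H = "dntgt \<beta>"
  note ca = cdc_cellD[OF a] and cb = cdc_cellD[OF b]
  note mF = cdc_morD[OF ca(1)] and mG = cdc_morD[OF ca(2)] and mH = cdc_morD[OF cb(2)]
  show "is_nat (dsrc ?F) (dtgt ?F) ?F ?H (\<lambda>\<Gamma>\<in>Ob (dsrc ?F). Cmp (dtgt ?F) (dncomp \<beta> \<Gamma>) (dncomp \<alpha> \<Gamma>))"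
    by (rule is_nat_vcmp[of _ _ ?F ?G ?H]) (use a b ab ca cb mF mG mH in \<open>auto simp: cdc_cell_def\<close>)
qed (use cdc_cellD[OF a] cdc_cellD[OF b] ab in \<open>auto simp: cdc_vcmp_def\<close>)

lemma cdc_cell_hcmp:
  assumes a: "cdc_cell small \<alpha>" and b: "cdc_cell small \<beta>" and ab: "dtgt (dnsrc \<alpha>) = dsrc (dnsrc \<beta>)"
  shows "cdc_cell small (cdc_hcmp \<beta> \<alpha>)"
proof (rule cdc_cellI[of small "cdc_cmp1 (dnsrc \<beta>) (dnsrc \<alpha>)" "cdc_cmp1 (dntgt \<beta>) (dntgt \<alpha>)"])
  let ?F = "dnsrc \<alpha>" and ?F' = "dntgt \<alpha>" and ?G = "dnsrc \<beta>" and ?G' = "dntgt \<beta>"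
  note ca = cdc_cellD[OF a] and cb = cdc_cellD[OF b]
  note m = cdc_morD[OF ca(1)] cdc_morD[OF ca(2)] cdc_morD[OF cb(1)] cdc_morD[OF cb(2)]
  have "is_nat (dsrc ?F) (dtgt ?G) (cdc_cmp1 ?G ?F) (cdc_cmp1 ?G' ?F')
    (\<lambda>\<Gamma>\<in>Ob (dsrc ?F). Cmp (dtgt ?G) (dncomp \<beta> (Fo ?F' \<Gamma>)) (Fa ?G (dncomp \<alpha> \<Gamma>)))"
    by (rule is_nat_hcmp[of _ "dtgt ?F" _ ?F ?F' ?G ?G']) (use a b ab ca(3,4) cb(3,4) m in \<open>auto simp: cdc_cell_def compose_eq\<close>)
  then show "is_nat (dsrc (cdc_cmp1 ?G ?F)) (dtgt (cdc_cmp1 ?G ?F)) (cdc_cmp1 ?G ?F) (cdc_cmp1 ?G' ?F')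
    (\<lambda>\<Gamma>\<in>Ob (dsrc ?F). Cmp (dtgt ?G) (dncomp \<beta> (Fo ?F' \<Gamma>)) (Fa ?G (dncomp \<alpha> \<Gamma>)))" by simp
  show "cdc_mor small (cdc_cmp1 ?G ?F)" "cdc_mor small (cdc_cmp1 ?G' ?F')"
    using cdc_mor_cmp1[OF ca(1) cb(1) ab] cdc_mor_cmp1[OF ca(2) cb(2)] ab ca(4) cb(3) by auto
qed (use cdc_cellD[OF a] cdc_cellD[OF b] ab in \<open>auto simp: cdc_hcmp_def\<close>)

lemma CDC_2_category: "strict_2_category (CDC small)"
  unfolding strict_2_category_def
proof (intro conjI ballI impI CDC_cat1)
  show "category (vcat (CDC small))"
  proof (rule categoryI, unfold vcat_simps CDC_simps mem_Collect_eq)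
    fix \<alpha> assume a: "cdc_cell small \<alpha>"
    note ca = cdc_cellD[OF a] and m = cdc_morD[OF cdc_cellD(1)[OF a]]
    show "cdc_vcmp \<alpha> (cdc_id2 (dnsrc \<alpha>)) = \<alpha>"
      by (rule dnat_eqI[of small]) (use a ca m cdc_cell_vcmp[OF cdc_cell_id2 a] in auto)
    show "cdc_vcmp (cdc_id2 (dntgt \<alpha>)) \<alpha> = \<alpha>"
      by (rule dnat_eqI[of small]) (use a ca m cdc_cell_vcmp[OF a cdc_cell_id2] in auto)
  next
    fix \<alpha> \<beta> \<gamma> assume c: "cdc_cell small \<alpha>" "cdc_cell small \<beta>" "cdc_cell small \<gamma>" "dntgt \<alpha> = dnsrc \<beta>" "dntgt \<beta> = dnsrc \<gamma>"
    note ca = cdc_cellD[OF c(1)] and cb = cdc_cellD[OF c(2)] and cc = cdc_cellD[OF c(3)] and m = cdc_morD[OF cdc_cellD(1)[OF c(1)]]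
    show "cdc_vcmp \<gamma> (cdc_vcmp \<beta> \<alpha>) = cdc_vcmp (cdc_vcmp \<gamma> \<beta>) \<alpha>"
      by (rule dnat_eqI[of small])
         (use c ca cb cc m cdc_cell_vcmp[OF cdc_cell_vcmp[OF c(1,2,4)] c(3)] cdc_cell_vcmp[OF c(1) cdc_cell_vcmp[OF c(2,3,5)]] in auto)
  qed (auto simp: cdc_cell_id2 cdc_cell_vcmp cdc_cellD)
next
  show "category (hcat (CDC small))"
  proof (rule categoryI, unfold hcat_simps CDC_simps mem_Collect_eq)
    fix \<alpha> assume a: "cdc_cell small \<alpha>"
    let ?F = "dnsrc \<alpha>" and ?F' = "dntgt \<alpha>"
    note ca = cdc_cellD[OF a] and m = cdc_morD[OF cdc_cellD(1)[OF a]] and m' = cdc_morD[OF cdc_cellD(2)[OF a]]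
    have i: "cdc_cmp1 ?F (cdc_id1 (dsrc ?F)) = ?F" "cdc_cmp1 (cdc_id1 (dtgt ?F)) ?F = ?F"
      "cdc_cmp1 ?F' (cdc_id1 (dsrc ?F)) = ?F'" "cdc_cmp1 (cdc_id1 (dtgt ?F)) ?F' = ?F'"
      using Cmp_Idn[OF CDC_cat1, of ?F small] Idn_Cmp[OF CDC_cat1, of ?F small] Cmp_Idn[OF CDC_cat1, of ?F' small]
        Idn_Cmp[OF CDC_cat1, of ?F' small] ca by auto
    note c1 = cdc_cell_id2[OF cdc_mor_id1[OF m(1)]] and c2 = cdc_cell_id2[OF cdc_mor_id1[OF m(2)]]
    show "cdc_hcmp \<alpha> (cdc_id2 (cdc_id1 (dsrc ?F))) = \<alpha>"
      by (rule dnat_eqI[of small])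
         (use a ca m m' i cdc_cell_hcmp[OF c1 a] in \<open>auto simp: functor_Idn[OF m(7)]\<close>)
    show "cdc_hcmp (cdc_id2 (cdc_id1 (dtgt ?F))) \<alpha> = \<alpha>"
      by (rule dnat_eqI[of small])
         (use a ca m m' i cdc_cell_hcmp[OF a c2] functor_Fo[OF m'(7)] in auto)
  next
    fix \<alpha> \<beta> \<gamma> assume c: "cdc_cell small \<alpha>" "cdc_cell small \<beta>" "cdc_cell small \<gamma>" "dtgt (dnsrc \<alpha>) = dsrc (dnsrc \<beta>)"
      "dtgt (dnsrc \<beta>) = dsrc (dnsrc \<gamma>)"
    note ca = cdc_cellD[OF c(1)] and cb = cdc_cellD[OF c(2)] and cc = cdc_cellD[OF c(3)]
    note ma = cdc_morD[OF ca(1)] and mb = cdc_morD[OF cb(1)] and mc = cdc_morD[OF cc(1)]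
    note ma' = cdc_morD[OF ca(2)] and mb' = cdc_morD[OF cb(2)] and mc' = cdc_morD[OF cc(2)]
    note ab = cdc_cell_hcmp[OF c(1,2,4)] and bc = cdc_cell_hcmp[OF c(2,3,5)]
    have as: "cdc_cmp1 (dnsrc \<gamma>) (cdc_cmp1 (dnsrc \<beta>) (dnsrc \<alpha>)) = cdc_cmp1 (cdc_cmp1 (dnsrc \<gamma>) (dnsrc \<beta>)) (dnsrc \<alpha>)"
      "cdc_cmp1 (dntgt \<gamma>) (cdc_cmp1 (dntgt \<beta>) (dntgt \<alpha>)) = cdc_cmp1 (cdc_cmp1 (dntgt \<gamma>) (dntgt \<beta>)) (dntgt \<alpha>)"
      using Cmp_assoc[OF CDC_cat1, of "dnsrc \<alpha>" small "dnsrc \<beta>" "dnsrc \<gamma>"] Cmp_assoc[OF CDC_cat1, of "dntgt \<alpha>" small "dntgt \<beta>" "dntgt \<gamma>"]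
        ca cb cc c by auto
    show "cdc_hcmp \<gamma> (cdc_hcmp \<beta> \<alpha>) = cdc_hcmp (cdc_hcmp \<gamma> \<beta>) \<alpha>"
    proof (rule dnat_eqI[of small])
      show "cdc_cell small (cdc_hcmp \<gamma> (cdc_hcmp \<beta> \<alpha>))" "cdc_cell small (cdc_hcmp (cdc_hcmp \<gamma> \<beta>) \<alpha>)"
        using cdc_cell_hcmp[OF ab c(3)] cdc_cell_hcmp[OF c(1) bc] c by auto
      fix x assume "x \<in> Ob (dsrc (dnsrc (cdc_hcmp \<gamma> (cdc_hcmp \<beta> \<alpha>))))"
      then have x: "x \<in> Ob (dsrc (dnsrc \<alpha>))" by simp
      let ?D = "dtgt (dnsrc \<alpha>)" and ?E = "dtgt (dnsrc \<beta>)" and ?K = "dtgt (dnsrc \<gamma>)"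
      let ?y = "Fo (dntgt \<alpha>) x"
      have y: "?y \<in> Ob (dsrc (dnsrc \<beta>))" using functor_Fo[OF ma'(7), of x] x ca c(4) by simp
      have z: "Fo (dntgt \<beta>) ?y \<in> Ob (dsrc (dnsrc \<gamma>))" using functor_Fo[OF mb'(7), of ?y] y cb c(5) by simp
      let ?a = "dncomp \<alpha> x" and ?b = "dncomp \<beta> ?y" and ?c = "dncomp \<gamma> (Fo (dntgt \<beta>) ?y)"
      have a: "?a \<in> Ar (dsrc (dnsrc \<beta>))" "Cod (dsrc (dnsrc \<beta>)) ?a = ?y" using ca(6,8)[OF x] c(4) by auto
      have Ga: "Fa (dnsrc \<beta>) ?a \<in> Ar ?E" "Cod ?E (Fa (dnsrc \<beta>) ?a) = Fo (dnsrc \<beta>) ?y"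
        using functor_Fa[OF mb(7) a(1)] functor_Cod[OF mb(7) a(1)] a by auto
      have b: "?b \<in> Ar ?E" "Dom ?E ?b = Fo (dnsrc \<beta>) ?y" "Cod ?E ?b = Fo (dntgt \<beta>) ?y" using cb(6-8)[OF y] by auto
      have HGa: "Fa (dnsrc \<gamma>) (Fa (dnsrc \<beta>) ?a) \<in> Ar ?K" "Cod ?K (Fa (dnsrc \<gamma>) (Fa (dnsrc \<beta>) ?a)) = Fo (dnsrc \<gamma>) (Fo (dnsrc \<beta>) ?y)"
        using functor_Fa[OF mc(7), of "Fa (dnsrc \<beta>) ?a"] functor_Cod[OF mc(7), of "Fa (dnsrc \<beta>) ?a"] Ga c(5) by auto
      have Hb: "Fa (dnsrc \<gamma>) ?b \<in> Ar ?K" "Dom ?K (Fa (dnsrc \<gamma>) ?b) = Fo (dnsrc \<gamma>) (Fo (dnsrc \<beta>) ?y)"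
         "Cod ?K (Fa (dnsrc \<gamma>) ?b) = Fo (dnsrc \<gamma>) (Fo (dntgt \<beta>) ?y)"
        using functor_Fa[OF mc(7), of ?b] functor_Dom[OF mc(7), of ?b] functor_Cod[OF mc(7), of ?b] b c(5) by auto
      \<comment> \<open>The two bracketings differ in whether the source functor of
        \<open>\<gamma>\<close> is applied to a composite or to its factors.\<close>
      have cmp: "Fa (dnsrc \<gamma>) (Cmp ?E ?b (Fa (dnsrc \<beta>) ?a)) = Cmp ?K (Fa (dnsrc \<gamma>) ?b) (Fa (dnsrc \<gamma>) (Fa (dnsrc \<beta>) ?a))"
        using functor_Cmp[OF mc(7), of "Fa (dnsrc \<beta>) ?a" ?b] Ga b c(5) by simp
      have xx: "x \<in> Ob (dsrc (dntgt \<alpha>))" using x ca by simp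
      show "dncomp (cdc_hcmp \<gamma> (cdc_hcmp \<beta> \<alpha>)) x = dncomp (cdc_hcmp (cdc_hcmp \<gamma> \<beta>) \<alpha>) x"
        using x xx y a cmp HGa Hb cc(6-8)[OF z] mc(6) by (simp add: compose_eq)
    qed (use as in auto)
  qed (auto simp: cdc_mor_id1 cdc_cell_id2 cdc_cell_hcmp intro: cdc_morD(1,2) cdc_cellD(1))
next
  fix F G assume F: "F \<in> Mor (CDC small)" and G: "G \<in> Mor (CDC small)" and FG: "tgt1 (CDC small) F = src1 (CDC small) G"
  then have F: "cdc_mor small F" and G: "cdc_mor small G" and FG: "dtgt F = dsrc G" by auto
  note mF = cdc_morD[OF F] and mG = cdc_morD[OF G]
  have "cdc_id2 (cdc_cmp1 G F) = cdc_hcmp (cdc_id2 G) (cdc_id2 F)"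
    by (rule dnat_eqI[of small])
       (use cdc_cell_id2[OF cdc_mor_cmp1[OF F G FG]] cdc_cell_hcmp[OF cdc_cell_id2[OF F] cdc_cell_id2[OF G]] FG
         functor_Fo[OF mF(7)] functor_Fo[OF mG(7)] functor_Idn[OF mG(7)] mG in \<open>auto simp: compose_eq\<close>)
  then show "id2 (CDC small) (cmp1 (CDC small) G F) = hcmp (CDC small) (id2 (CDC small) G) (id2 (CDC small) F)" by simp
next
  fix \<alpha> \<alpha>' \<beta> \<beta>'
  assume "\<alpha> \<in> Cel (CDC small)" "\<alpha>' \<in> Cel (CDC small)" "\<beta> \<in> Cel (CDC small)" "\<beta>' \<in> Cel (CDC small)"
    "tgt2 (CDC small) \<alpha> = src2 (CDC small) \<alpha>' \<and> tgt2 (CDC small) \<beta> = src2 (CDC small) \<beta>' \<and>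
     tgt1 (CDC small) (src2 (CDC small) \<alpha>) = src1 (CDC small) (src2 (CDC small) \<beta>)"
  then have c: "cdc_cell small \<alpha>" "cdc_cell small \<alpha>'" "cdc_cell small \<beta>" "cdc_cell small \<beta>'"
    and d: "dntgt \<alpha> = dnsrc \<alpha>'" "dntgt \<beta> = dnsrc \<beta>'" "dtgt (dnsrc \<alpha>) = dsrc (dnsrc \<beta>)" by auto
  note ca = cdc_cellD[OF c(1)] and ca' = cdc_cellD[OF c(2)] and cb = cdc_cellD[OF c(3)] and cb' = cdc_cellD[OF c(4)]
  have d': "dtgt (dnsrc \<alpha>') = dsrc (dnsrc \<beta>')" using ca cb d by simp
  note va = cdc_cell_vcmp[OF c(1,2) d(1)] and vb = cdc_cell_vcmp[OF c(3,4) d(2)]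
  note h = cdc_cell_hcmp[OF c(1,3) d(3)] and h' = cdc_cell_hcmp[OF c(2,4) d']
  have "cdc_hcmp (cdc_vcmp \<beta>' \<beta>) (cdc_vcmp \<alpha>' \<alpha>) = cdc_vcmp (cdc_hcmp \<beta>' \<alpha>') (cdc_hcmp \<beta> \<alpha>)"
  proof (rule dnat_eqI[of small])
    show "cdc_cell small (cdc_hcmp (cdc_vcmp \<beta>' \<beta>) (cdc_vcmp \<alpha>' \<alpha>))" using cdc_cell_hcmp[OF va vb] d by simp
    show "cdc_cell small (cdc_vcmp (cdc_hcmp \<beta>' \<alpha>') (cdc_hcmp \<beta> \<alpha>))" using cdc_cell_vcmp[OF h h'] d by simp
    fix x assume "x \<in> Ob (dsrc (dnsrc (cdc_hcmp (cdc_vcmp \<beta>' \<beta>) (cdc_vcmp \<alpha>' \<alpha>))))"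
    then have x: "x \<in> Ob (dsrc (dnsrc \<alpha>))" by simp
    have x': "x \<in> Ob (dsrc (dnsrc \<alpha>'))" using x ca(3) d(1) by simp
    let ?F = "dnsrc \<alpha>" and ?F1 = "dnsrc \<alpha>'" and ?F2 = "dntgt \<alpha>'" and ?G = "dnsrc \<beta>" and ?G1 = "dnsrc \<beta>'" and ?G2 = "dntgt \<beta>'"
    let ?D = "dsrc ?G" and ?E = "dtgt ?G"
    note mG = cdc_morD[OF cb(1)] and mF1 = cdc_morD[OF ca'(1)] and mF2 = cdc_morD[OF ca'(2)] and mG1 = cdc_morD[OF cb'(1)]
    have E1: "dtgt ?G1 = ?E" "dsrc ?G1 = ?D" using cb(3,4) d(2) by auto
    have D1: "dtgt ?F1 = ?D" "dtgt ?F = ?D" "dtgt ?F2 = ?D" using ca(4) ca'(4) d(1,3) by auto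
    have S1: "dsrc ?F1 = dsrc ?F" "dsrc ?F2 = dsrc ?F" using ca(3) ca'(3) d(1) by auto
    let ?y = "Fo ?F2 x" and ?y1 = "Fo ?F1 x"
    have y: "?y \<in> Ob ?D" "?y1 \<in> Ob ?D" using functor_Fo[OF mF2(7), of x] functor_Fo[OF mF1(7), of x] x S1 D1 by auto
    let ?a = "dncomp \<alpha> x" and ?a' = "dncomp \<alpha>' x" and ?b = "dncomp \<beta> ?y" and ?b' = "dncomp \<beta>' ?y" and ?b1 = "dncomp \<beta> ?y1"
    have a: "?a \<in> Ar ?D" "Cod ?D ?a = ?y1" "?a' \<in> Ar ?D" "Dom ?D ?a' = ?y1" "Cod ?D ?a' = ?y"
      using ca(6,8)[OF x] ca'(6-8)[OF x'] D1 d(1) by auto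
    have b: "?b \<in> Ar ?E" "Dom ?E ?b = Fo ?G ?y" "Cod ?E ?b = Fo ?G1 ?y" "?b1 \<in> Ar ?E" "Dom ?E ?b1 = Fo ?G ?y1" "Cod ?E ?b1 = Fo ?G1 ?y1"
      "?b' \<in> Ar ?E" "Dom ?E ?b' = Fo ?G1 ?y"
      using cb(6-8)[OF y(1)] cb(6-8)[OF y(2)] cb'(6,7)[of ?y] y E1 d(2) by auto
    have Ga: "Fa ?G ?a \<in> Ar ?E" "Cod ?E (Fa ?G ?a) = Fo ?G ?y1" "Fa ?G ?a' \<in> Ar ?E" "Dom ?E (Fa ?G ?a') = Fo ?G ?y1" "Cod ?E (Fa ?G ?a') = Fo ?G ?y"
      using functor_Fa[OF mG(7)] functor_Dom[OF mG(7)] functor_Cod[OF mG(7)] a by auto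
    have G1a: "Fa ?G1 ?a' \<in> Ar ?E" "Dom ?E (Fa ?G1 ?a') = Fo ?G1 ?y1" "Cod ?E (Fa ?G1 ?a') = Fo ?G1 ?y"
      using functor_Fa[OF mG1(7), of ?a'] functor_Dom[OF mG1(7), of ?a'] functor_Cod[OF mG1(7), of ?a'] a E1 by auto
    \<comment> \<open>Interchange comes down to naturality of \<open>\<beta>\<close> at a component
      of \<open>\<alpha>'\<close>.\<close>
    have n: "Cmp ?E ?b (Fa ?G ?a') = Cmp ?E (Fa ?G1 ?a') ?b1" using cb(9)[OF a(3)] a d(2) by simp
    have "Cmp ?E (Cmp ?E ?b' ?b) (Fa ?G (Cmp ?D ?a' ?a)) = Cmp ?E ?b' (Cmp ?E (Cmp ?E ?b (Fa ?G ?a')) (Fa ?G ?a))"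
      using functor_Cmp[OF mG(7), of ?a ?a'] a b Ga mG(6) by simp
    also have "\<dots> = Cmp ?E (Cmp ?E ?b' (Fa ?G1 ?a')) (Cmp ?E ?b1 (Fa ?G ?a))"
      unfolding n using a b Ga G1a mG(6) by simp
    finally show "dncomp (cdc_hcmp (cdc_vcmp \<beta>' \<beta>) (cdc_vcmp \<alpha>' \<alpha>)) x = dncomp (cdc_vcmp (cdc_hcmp \<beta>' \<alpha>') (cdc_hcmp \<beta> \<alpha>)) x"
      using x x' y E1 D1 d by simp
  qed (use d in auto)
  then show "hcmp (CDC small) (vcmp (CDC small) \<beta>' \<beta>) (vcmp (CDC small) \<alpha>' \<alpha>) =
    vcmp (CDC small) (hcmp (CDC small) \<beta>' \<alpha>') (hcmp (CDC small) \<beta> \<alpha>)" by simp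
qed (auto simp: cdc_cellD)


section \<open>The 2-category of natural models\<close>

lemma CNM_simps [simp]:
  "Obj (CNM small) = {C. cnm_object small C}" "Mor (CNM small) = {F. cnm_mor small F}" "Cel (CNM small) = {\<alpha>. cnm_cell small \<alpha>}"
  "src1 (CNM small) = nsrc" "tgt1 (CNM small) = ntgt" "src2 (CNM small) = ncsrc" "tgt2 (CNM small) = nctgt"
  "id1 (CNM small) = cnm_id1" "cmp1 (CNM small) = cnm_cmp1" "id2 (CNM small) = cnm_id2" "vcmp (CNM small) = cnm_vcmp"
  "hcmp (CNM small) = cnm_hcmp"
  by (simp_all add: CNM_def)

lemma cnm_id1_simps [simp]:
  "Fo (cnm_id1 N) = Fo (id_fct N)" "Fa (cnm_id1 N) = Fa (id_fct N)" "nsrc (cnm_id1 N) = N" "ntgt (cnm_id1 N) = N"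
  "nTp (cnm_id1 N) = (\<lambda>\<Gamma>\<in>Ob N. id_fct (ty N \<Gamma>))" "nTm (cnm_id1 N) = (\<lambda>\<Gamma>\<in>Ob N. id_fct (tm N \<Gamma>))"
  by (simp_all add: cnm_id1_def fct.defs nmor.defs)

lemma cnm_cmp1_simps [simp]:
  "Fo (cnm_cmp1 G F) = compose (Ob (nsrc F)) (Fo G) (Fo F)" "Fa (cnm_cmp1 G F) = compose (Ar (nsrc F)) (Fa G) (Fa F)"
  "nsrc (cnm_cmp1 G F) = nsrc F" "ntgt (cnm_cmp1 G F) = ntgt G"
  "nTp (cnm_cmp1 G F) = (\<lambda>\<Gamma>\<in>Ob (nsrc F). cmp_fct (ty (nsrc F) \<Gamma>) (nTp G (Fo F \<Gamma>)) (nTp F \<Gamma>))"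
  "nTm (cnm_cmp1 G F) = (\<lambda>\<Gamma>\<in>Ob (nsrc F). cmp_fct (tm (nsrc F) \<Gamma>) (nTm G (Fo F \<Gamma>)) (nTm F \<Gamma>))"
  by (simp_all add: cnm_cmp1_def cmp_fct_def fct.defs nmor.defs)

lemma ext_pair_eqI:
  assumes N: "prenat N" "\<Gamma> \<in> Ob N" "A \<in> Ob (ty N \<Gamma>)" and w: "w \<in> Ar N" "Cod N w = ext N \<Gamma> A"
    and u: "Cmp N (Prj N \<Gamma> A) w = u" and t: "msb N w (Var N \<Gamma> A) = t"
  shows "ext_pair N \<Gamma> A u t = w"
proof -
  have u': "u \<in> Ar N" "Cod N u = \<Gamma>" "Dom N u = Dom N w" using N w u by auto
  have t': "t \<in> Ob (tm N (Dom N u))" "tyof N (Dom N u) t = tsb N u A"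
    using N w u' tsb_Cmp[OF N(1) w(1), of "Prj N \<Gamma> A" A] unfolding t[symmetric] by (auto simp: u)
  show ?thesis
    by (rule ext_eq[OF N]) (use N w u u' t t' in auto)
qed

lemma natural_model_morphism_id:
  assumes C [simp]: "prenat C"
  shows "natural_model_morphism (cnm_id1 C)"
proof -
  have tau: "is_iso C (tau (cnm_id1 C) \<Gamma> A)" if "\<Gamma> \<in> Ob C" "A \<in> Ob (ty C \<Gamma>)" for \<Gamma> A
  proof -
    have "tau (cnm_id1 C) \<Gamma> A = Idn C (ext C \<Gamma> A)"
      unfolding tau_def using that by (auto intro!: ext_pair_eqI)
    then show ?thesis using that by simp
  qed
  have "display_functor C C (cnm_id1 C)" by (rule display_functor_id) auto
  moreover have "is_functor (ty C \<Gamma>) (ty C \<Gamma>) (id_fct (ty C \<Gamma>))" "is_functor (tm C \<Gamma>) (tm C \<Gamma>) (id_fct (tm C \<Gamma>))"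
    if "\<Gamma> \<in> Ob C" for \<Gamma>
    using that by (auto intro: id_fct_functor)
  ultimately show ?thesis
    unfolding natural_model_morphism_def strict_indexed_functor_def using tau by simp
qed

text \<open>The comparison of the composite is \<open>tau G\<close> after the image under
  \<open>G\<close> of \<open>tau F\<close>, and functors preserve isomorphisms.\<close>

lemma natural_model_morphism_comp:
  assumes F: "nat_mor F C D" and G: "nat_mor G D E"
  shows "natural_model_morphism (cnm_cmp1 G F)"
proof -
  interpret F: nat_mor F C D by fact
  interpret G: nat_mor G D E by fact
  let ?H = "cnm_cmp1 G F"
  have H [simp]: "\<Gamma> \<in> Ob C \<Longrightarrow> Fo ?H \<Gamma> = Fo G (Fo F \<Gamma>)" "u \<in> Ar C \<Longrightarrow> Fa ?H u = Fa G (Fa F u)" for \<Gamma> u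
    by (auto simp: compose_eq)
  have tau: "is_iso E (tau ?H \<Gamma> A)" if G': "\<Gamma> \<in> Ob C" and A: "A \<in> Ob (ty C \<Gamma>)" for \<Gamma> A
  proof -
    let ?FA = "Fo (nTp F \<Gamma>) A"
    let ?t = "tau G (Fo F \<Gamma>) ?FA" and ?s = "Fa G (tau F \<Gamma> A)"
    have X: "ext C \<Gamma> A \<in> Ob C" "Var C \<Gamma> A \<in> Ob (tm C (ext C \<Gamma> A))" using G' A by auto
    have ts: "?t \<in> Ar E" "?s \<in> Ar E" "Dom E ?t = Fo G (ext D (Fo F \<Gamma>) ?FA)" "Cod E ?s = Fo G (ext D (Fo F \<Gamma>) ?FA)"
      "Dom E ?s = Fo G (Fo F (ext C \<Gamma> A))"
      using G' A by auto
    have tr: "Cmp E (Fa G (Prj D (Fo F \<Gamma>) ?FA)) ?s = Fa G (Fa F (Prj C \<Gamma> A))"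
      by (rule G.Fa_triangle[OF F.Prj_tau]) (use G' A in auto)
    have "tau ?H \<Gamma> A = ext_pair E (Fo G (Fo F \<Gamma>)) (Fo (nTp G (Fo F \<Gamma>)) ?FA) (Fa G (Fa F (Prj C \<Gamma> A)))
        (Fo (nTm G (Fo F (ext C \<Gamma> A))) (Fo (nTm F (ext C \<Gamma> A)) (Var C \<Gamma> A)))"
      using G' A X by (simp add: tau_def compose_eq)
    also have "\<dots> = Cmp E ?t ?s"
    proof (rule ext_pair_eqI)
      show "Cmp E (Prj E (Fo G (Fo F \<Gamma>)) (Fo (nTp G (Fo F \<Gamma>)) ?FA)) (Cmp E ?t ?s) = Fa G (Fa F (Prj C \<Gamma> A))"
        using Cmp_reassoc[OF G.Prj_tau[of "Fo F \<Gamma>" ?FA], of ?s] G' A ts tr by simp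
      have "msb E (Cmp E ?t ?s) (Var E (Fo G (Fo F \<Gamma>)) (Fo (nTp G (Fo F \<Gamma>)) ?FA)) =
          msb E ?s (Fo (nTm G (ext D (Fo F \<Gamma>) ?FA)) (Var D (Fo F \<Gamma>) ?FA))"
        using msb_Cmp[of E ?s ?t "Var E (Fo G (Fo F \<Gamma>)) (Fo (nTp G (Fo F \<Gamma>)) ?FA)"] G' A ts by (simp add: G.Var_tau)
      also have "\<dots> = Fo (nTm G (Fo F (ext C \<Gamma> A))) (msb D (tau F \<Gamma> A) (Var D (Fo F \<Gamma>) ?FA))"
        using G' A G.Ftm_msb[of "tau F \<Gamma> A" "Fo F (ext C \<Gamma> A)" "Var D (Fo F \<Gamma>) ?FA"] by simp
      finally show "msb E (Cmp E ?t ?s) (Var E (Fo G (Fo F \<Gamma>)) (Fo (nTp G (Fo F \<Gamma>)) ?FA)) =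
          Fo (nTm G (Fo F (ext C \<Gamma> A))) (Fo (nTm F (ext C \<Gamma> A)) (Var C \<Gamma> A))"
        using F.Var_tau[OF G' A] by simp
    qed (use G' A ts in auto)
    finally show ?thesis
      using iso_Cmp[of E ?s ?t] functor_iso[OF _ G.is_functor F.tau_iso[OF G' A]] G' A ts by simp
  qed
  have "display_functor C E ?H"
    by (rule display_functor_comp[OF _ F.display_functor G.display_functor]) (auto simp: compose_eq)
  moreover have "is_functor (ty C \<Gamma>) (ty E (Fo G (Fo F \<Gamma>))) (cmp_fct (ty C \<Gamma>) (nTp G (Fo F \<Gamma>)) (nTp F \<Gamma>))"
    "is_functor (tm C \<Gamma>) (tm E (Fo G (Fo F \<Gamma>))) (cmp_fct (tm C \<Gamma>) (nTm G (Fo F \<Gamma>)) (nTm F \<Gamma>))"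
    if "\<Gamma> \<in> Ob C" for \<Gamma>
    using that cmp_fct_functor[OF _ F.nTp_functor[OF that] G.nTp_functor] cmp_fct_functor[OF _ F.nTm_functor[OF that] G.nTm_functor]
    by auto
  ultimately show ?thesis
    unfolding natural_model_morphism_def strict_indexed_functor_def using tau by (simp add: compose_eq)
qed

lemma cnm_objectD:
  assumes "cnm_object small N"
  shows "natm N" "prenat N" "cartesian_dcat N" "admits_type_classifier N" "cdc_object small (underlying N)"
  using assms cnm_object_cdc[OF assms] by (auto simp: cnm_object_def natural_model_natm)

lemma cnm_morD:
  assumes "cnm_mor small F"
  shows "cnm_object small (nsrc F)" "cnm_object small (ntgt F)" "nat_mor F (nsrc F) (ntgt F)"
    "preserves_finite_limits (nsrc F) (ntgt F) F" "nmor_extensional F"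
proof -
  show a: "cnm_object small (nsrc F)" "cnm_object small (ntgt F)" "preserves_finite_limits (nsrc F) (ntgt F) F" "nmor_extensional F"
    using assms by (auto simp: cnm_mor_def)
  show "nat_mor F (nsrc F) (ntgt F)"
    using assms cnm_objectD(2)[OF a(1)] cnm_objectD(2)[OF a(2)] by unfold_locales (auto simp: cnm_mor_def)
qed

lemma cnm_mor_id1: "cnm_object small N \<Longrightarrow> cnm_mor small (cnm_id1 N)"
  using preserves_finite_limits_id[of N "cnm_id1 N"]
  by (auto simp: cnm_mor_def cnm_objectD natural_model_morphism_id nmor_extensional_def fct_extensional_def id_fct_def)

lemma cnm_mor_cmp1:
  assumes F: "cnm_mor small F" and G: "cnm_mor small G" and FG: "ntgt F = nsrc G"
  shows "cnm_mor small (cnm_cmp1 G F)"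
proof -
  note f = cnm_morD[OF F] and g = cnm_morD[OF G]
  have "preserves_finite_limits (nsrc F) (ntgt G) (cnm_cmp1 G F)"
    by (rule preserves_finite_limits_comp[OF nat_mor.is_functor[OF f(3)] f(4) g(4)[folded FG]]) (auto simp: compose_eq)
  moreover have "natural_model_morphism (cnm_cmp1 G F)"
    by (rule natural_model_morphism_comp[OF f(3) g(3)[folded FG]])
  moreover have "nmor_extensional (cnm_cmp1 G F)"
    by (auto simp: nmor_extensional_def fct_extensional_def cmp_fct_def)
  ultimately show ?thesis using f g by (simp add: cnm_mor_def)
qed

lemma nmor_eqI:
  assumes F: "cnm_mor small F" and G: "cnm_mor small G" and s: "nsrc F = nsrc G" "ntgt F = ntgt G"
    and 0: "\<And>\<Gamma>. \<Gamma> \<in> Ob (nsrc F) \<Longrightarrow> Fo F \<Gamma> = Fo G \<Gamma>" "\<And>u. u \<in> Ar (nsrc F) \<Longrightarrow> Fa F u = Fa G u"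
    and 1: "\<And>\<Gamma> A. \<Gamma> \<in> Ob (nsrc F) \<Longrightarrow> A \<in> Ob (ty (nsrc F) \<Gamma>) \<Longrightarrow> Fo (nTp F \<Gamma>) A = Fo (nTp G \<Gamma>) A"
      "\<And>\<Gamma> f. \<Gamma> \<in> Ob (nsrc F) \<Longrightarrow> f \<in> Ar (ty (nsrc F) \<Gamma>) \<Longrightarrow> Fa (nTp F \<Gamma>) f = Fa (nTp G \<Gamma>) f"
    and 2: "\<And>\<Gamma> t. \<Gamma> \<in> Ob (nsrc F) \<Longrightarrow> t \<in> Ob (tm (nsrc F) \<Gamma>) \<Longrightarrow> Fo (nTm F \<Gamma>) t = Fo (nTm G \<Gamma>) t"
      "\<And>\<Gamma> g. \<Gamma> \<in> Ob (nsrc F) \<Longrightarrow> g \<in> Ar (tm (nsrc F) \<Gamma>) \<Longrightarrow> Fa (nTm F \<Gamma>) g = Fa (nTm G \<Gamma>) g"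
  shows "F = G"
proof -
  have f: "fct_extensional (nsrc F) F" "nTp F \<in> extensional (Ob (nsrc F))" "nTm F \<in> extensional (Ob (nsrc F))"
    "\<And>\<Gamma>. \<Gamma> \<in> Ob (nsrc F) \<Longrightarrow> fct_extensional (ty (nsrc F) \<Gamma>) (nTp F \<Gamma>)"
    "\<And>\<Gamma>. \<Gamma> \<in> Ob (nsrc F) \<Longrightarrow> fct_extensional (tm (nsrc F) \<Gamma>) (nTm F \<Gamma>)"
    using cnm_morD(5)[OF F] by (auto simp: nmor_extensional_def)
  have g: "fct_extensional (nsrc F) G" "nTp G \<in> extensional (Ob (nsrc F))" "nTm G \<in> extensional (Ob (nsrc F))"
    "\<And>\<Gamma>. \<Gamma> \<in> Ob (nsrc F) \<Longrightarrow> fct_extensional (ty (nsrc F) \<Gamma>) (nTp G \<Gamma>)"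
    "\<And>\<Gamma>. \<Gamma> \<in> Ob (nsrc F) \<Longrightarrow> fct_extensional (tm (nsrc F) \<Gamma>) (nTm G \<Gamma>)"
    using cnm_morD(5)[OF G] s by (auto simp: nmor_extensional_def)
  have eq: "Fo X = Fo Y \<and> Fa X = Fa Y" if "fct_extensional C X" "fct_extensional C Y"
    "\<And>a. a \<in> Ob C \<Longrightarrow> Fo X a = Fo Y a" "\<And>f. f \<in> Ar C \<Longrightarrow> Fa X f = Fa Y f"
    for C :: "('u, 'u, 'x) cat_scheme" and X :: "('u, 'u, 'u, 'u, 'y) fct_scheme" and Y :: "('u, 'u, 'u, 'u, 'y) fct_scheme"
    using that by (auto simp: fct_extensional_def intro!: extensionalityI[of "Fo X" "Ob C"] extensionalityI[of "Fa X" "Ar C"])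
  show ?thesis
  proof (rule nmor.equality)
    show "Fo F = Fo G" "Fa F = Fa G" using eq[OF f(1) g(1) 0] by auto
    show "nTp F = nTp G"
    proof (rule extensionalityI[OF f(2) g(2)])
      fix \<Gamma> assume G': "\<Gamma> \<in> Ob (nsrc F)"
      show "nTp F \<Gamma> = nTp G \<Gamma>"
        by (rule fct.equality) (use eq[OF f(4)[OF G'] g(4)[OF G'] 1[OF G']] in auto)
    qed
    show "nTm F = nTm G"
    proof (rule extensionalityI[OF f(3) g(3)])
      fix \<Gamma> assume G': "\<Gamma> \<in> Ob (nsrc F)"
      show "nTm F \<Gamma> = nTm G \<Gamma>"
        by (rule fct.equality) (use eq[OF f(5)[OF G'] g(5)[OF G'] 2[OF G']] in auto)
    qed
  qed (use s in auto)
qed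

lemma CNM_cat1: "category (cat1 (CNM small))"
proof (rule categoryI, unfold cat1_simps CNM_simps mem_Collect_eq)
  fix F assume F: "cnm_mor small F"
  note f = cnm_morD[OF F]
  show "cnm_object small (nsrc F)" "cnm_object small (ntgt F)" using f by auto
  obtain C D where CD: "nsrc F = C" "ntgt F = D" by blast
  interpret F: nat_mor F C D using f(3) CD by simp
  show "cnm_cmp1 F (cnm_id1 (nsrc F)) = F"
    by (rule nmor_eqI[of small]) (use F f cnm_mor_cmp1[OF cnm_mor_id1 F] in \<open>auto simp: compose_eq\<close>)
  show "cnm_cmp1 (cnm_id1 (ntgt F)) F = F"
    by (rule nmor_eqI[of small]) (use F f cnm_mor_cmp1[OF F cnm_mor_id1] in \<open>auto simp: compose_eq\<close>)
next
  fix F G H assume a: "cnm_mor small F" "cnm_mor small G" "cnm_mor small H" "ntgt F = nsrc G" "ntgt G = nsrc H"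
  note f = cnm_morD[OF a(1)] and g = cnm_morD[OF a(2)]
  obtain C D E where CD: "nsrc F = C" "nsrc G = D" "nsrc H = E" by blast
  interpret F: nat_mor F C D using f(3) a(4) CD by simp
  interpret G: nat_mor G D E using g(3) a(5) CD by simp
  note FG = cnm_mor_cmp1[OF a(1,2,4)] and GH = cnm_mor_cmp1[OF a(2,3,5)]
  show "cnm_cmp1 H (cnm_cmp1 G F) = cnm_cmp1 (cnm_cmp1 H G) F"
    by (rule nmor_eqI[of small])
       (use a cnm_mor_cmp1[OF FG a(3)] cnm_mor_cmp1[OF a(1) GH] in \<open>auto simp: compose_eq\<close>)
qed (auto simp: cnm_mor_id1 cnm_mor_cmp1)

lemma indexed_natD:
  assumes "indexed_nat C F \<alpha> X Y \<Phi> \<Psi> a"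
  shows "\<Gamma> \<in> Ob C \<Longrightarrow> A \<in> Ob (Fib X \<Gamma>) \<Longrightarrow> a \<Gamma> A \<in> Ar (Fib Y (Fo F \<Gamma>))"
    "\<Gamma> \<in> Ob C \<Longrightarrow> A \<in> Ob (Fib X \<Gamma>) \<Longrightarrow> Dom (Fib Y (Fo F \<Gamma>)) (a \<Gamma> A) = Fo (\<Phi> \<Gamma>) A"
    "\<Gamma> \<in> Ob C \<Longrightarrow> A \<in> Ob (Fib X \<Gamma>) \<Longrightarrow> Cod (Fib Y (Fo F \<Gamma>)) (a \<Gamma> A) = Fo (Re Y (\<alpha> \<Gamma>)) (Fo (\<Psi> \<Gamma>) A)"
    "\<Gamma> \<in> Ob C \<Longrightarrow> f \<in> Ar (Fib X \<Gamma>) \<Longrightarrow> Cmp (Fib Y (Fo F \<Gamma>)) (a \<Gamma> (Cod (Fib X \<Gamma>) f)) (Fa (\<Phi> \<Gamma>) f) =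
       Cmp (Fib Y (Fo F \<Gamma>)) (Fa (Re Y (\<alpha> \<Gamma>)) (Fa (\<Psi> \<Gamma>) f)) (a \<Gamma> (Dom (Fib X \<Gamma>) f))"
    "u \<in> Ar C \<Longrightarrow> A \<in> Ob (Fib X (Cod C u)) \<Longrightarrow> a (Dom C u) (Fo (Re X u) A) = Fa (Re Y (Fa F u)) (a (Cod C u) A)"
  using assms by (auto simp: indexed_nat_def is_nat_def)

lemma indexed_natI:
  assumes "\<And>\<Gamma> A. \<Gamma> \<in> Ob C \<Longrightarrow> A \<in> Ob (Fib X \<Gamma>) \<Longrightarrow> a \<Gamma> A \<in> Ar (Fib Y (Fo F \<Gamma>)) \<and>
      Dom (Fib Y (Fo F \<Gamma>)) (a \<Gamma> A) = Fo (\<Phi> \<Gamma>) A \<and> Cod (Fib Y (Fo F \<Gamma>)) (a \<Gamma> A) = Fo (Re Y (\<alpha> \<Gamma>)) (Fo (\<Psi> \<Gamma>) A)"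
    "\<And>\<Gamma> f. \<Gamma> \<in> Ob C \<Longrightarrow> f \<in> Ar (Fib X \<Gamma>) \<Longrightarrow> Cmp (Fib Y (Fo F \<Gamma>)) (a \<Gamma> (Cod (Fib X \<Gamma>) f)) (Fa (\<Phi> \<Gamma>) f) =
       Cmp (Fib Y (Fo F \<Gamma>)) (Fa (Re Y (\<alpha> \<Gamma>)) (Fa (\<Psi> \<Gamma>) f)) (a \<Gamma> (Dom (Fib X \<Gamma>) f))"
    "\<And>u A. u \<in> Ar C \<Longrightarrow> A \<in> Ob (Fib X (Cod C u)) \<Longrightarrow> a (Dom C u) (Fo (Re X u) A) = Fa (Re Y (Fa F u)) (a (Cod C u) A)"
  shows "indexed_nat C F \<alpha> X Y \<Phi> \<Psi> a"
  using assms by (auto simp: indexed_nat_def is_nat_def)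

lemma indexed_nat_id:
  assumes C: "category C" and D: "category D" and X: "strict_indexed_category C X" and Y: "strict_indexed_category D Y"
    and F: "is_functor C D F" and \<Phi>: "strict_indexed_functor C F X Y \<Phi>"
  shows "indexed_nat C F (\<lambda>\<Gamma>\<in>Ob C. Idn D (Fo F \<Gamma>)) X Y \<Phi> \<Phi>
    (\<lambda>\<Gamma>\<in>Ob C. \<lambda>A\<in>Ob (Fib X \<Gamma>). Idn (Fib Y (Fo F \<Gamma>)) (Fo (\<Phi> \<Gamma>) A))"
proof (rule indexed_natI)
  note x = strict_indexed_categoryD[OF X] and y = strict_indexed_categoryD[OF Y]
  have \<Phi>F: "is_functor (Fib X \<Gamma>) (Fib Y (Fo F \<Gamma>)) (\<Phi> \<Gamma>)" and FG: "Fo F \<Gamma> \<in> Ob D" if "\<Gamma> \<in> Ob C" for \<Gamma>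
    using \<Phi> F that by (auto simp: strict_indexed_functor_def)
  {
    fix \<Gamma> A assume G: "\<Gamma> \<in> Ob C" and A: "A \<in> Ob (Fib X \<Gamma>)"
    show "(\<lambda>\<Gamma>\<in>Ob C. \<lambda>A\<in>Ob (Fib X \<Gamma>). Idn (Fib Y (Fo F \<Gamma>)) (Fo (\<Phi> \<Gamma>) A)) \<Gamma> A \<in> Ar (Fib Y (Fo F \<Gamma>)) \<and>
      Dom (Fib Y (Fo F \<Gamma>)) ((\<lambda>\<Gamma>\<in>Ob C. \<lambda>A\<in>Ob (Fib X \<Gamma>). Idn (Fib Y (Fo F \<Gamma>)) (Fo (\<Phi> \<Gamma>) A)) \<Gamma> A) = Fo (\<Phi> \<Gamma>) A \<and>
      Cod (Fib Y (Fo F \<Gamma>)) ((\<lambda>\<Gamma>\<in>Ob C. \<lambda>A\<in>Ob (Fib X \<Gamma>). Idn (Fib Y (Fo F \<Gamma>)) (Fo (\<Phi> \<Gamma>) A)) \<Gamma> A) =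
      Fo (Re Y ((\<lambda>\<Gamma>\<in>Ob C. Idn D (Fo F \<Gamma>)) \<Gamma>)) (Fo (\<Phi> \<Gamma>) A)"
      using G A y(1)[OF FG[OF G]] y(3)[OF FG[OF G]] functor_Fo[OF \<Phi>F[OF G] A] by simp
  next
    fix \<Gamma> f assume G: "\<Gamma> \<in> Ob C" and f: "f \<in> Ar (Fib X \<Gamma>)"
    show "Cmp (Fib Y (Fo F \<Gamma>)) ((\<lambda>\<Gamma>\<in>Ob C. \<lambda>A\<in>Ob (Fib X \<Gamma>). Idn (Fib Y (Fo F \<Gamma>)) (Fo (\<Phi> \<Gamma>) A)) \<Gamma> (Cod (Fib X \<Gamma>) f)) (Fa (\<Phi> \<Gamma>) f) =
      Cmp (Fib Y (Fo F \<Gamma>)) (Fa (Re Y ((\<lambda>\<Gamma>\<in>Ob C. Idn D (Fo F \<Gamma>)) \<Gamma>)) (Fa (\<Phi> \<Gamma>) f))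
        ((\<lambda>\<Gamma>\<in>Ob C. \<lambda>A\<in>Ob (Fib X \<Gamma>). Idn (Fib Y (Fo F \<Gamma>)) (Fo (\<Phi> \<Gamma>) A)) \<Gamma> (Dom (Fib X \<Gamma>) f))"
      using G f x(1)[OF G] y(1)[OF FG[OF G]] y(4)[OF FG[OF G]] functor_Fa[OF \<Phi>F[OF G] f]
        functor_Dom[OF \<Phi>F[OF G] f] functor_Cod[OF \<Phi>F[OF G] f] by simp
  }
  fix u A assume u: "u \<in> Ar C" and A: "A \<in> Ob (Fib X (Cod C u))"
  have uA: "Fo (Re X u) A \<in> Ob (Fib X (Dom C u))" using functor_Fo[OF x(2)[OF u] A] .
  have Fu: "Fa F u \<in> Ar D" "Dom D (Fa F u) = Fo F (Dom C u)" "Cod D (Fa F u) = Fo F (Cod C u)"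
    using functor_Fa[OF F u] functor_Dom[OF F u] functor_Cod[OF F u] by auto
  have G: "Cod C u \<in> Ob C" "Dom C u \<in> Ob C" using C u by auto
  have "Fo (\<Phi> (Dom C u)) (Fo (Re X u) A) = Fo (Re Y (Fa F u)) (Fo (\<Phi> (Cod C u)) A)"
    using \<Phi> u A by (auto simp: strict_indexed_functor_def)
  then show "(\<lambda>\<Gamma>\<in>Ob C. \<lambda>A\<in>Ob (Fib X \<Gamma>). Idn (Fib Y (Fo F \<Gamma>)) (Fo (\<Phi> \<Gamma>) A)) (Dom C u) (Fo (Re X u) A) =
    Fa (Re Y (Fa F u)) ((\<lambda>\<Gamma>\<in>Ob C. \<lambda>A\<in>Ob (Fib X \<Gamma>). Idn (Fib Y (Fo F \<Gamma>)) (Fo (\<Phi> \<Gamma>) A)) (Cod C u) A)"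
    using u A uA G functor_Idn[OF y(2)[OF Fu(1)], of "Fo (\<Phi> (Cod C u)) A"] Fu functor_Fo[OF \<Phi>F[OF G(1)] A] by simp
qed

text \<open>Stated for arbitrary strict indexed categories, so that it covers types and terms alike.
  The component of \<open>b\<close> is first reindexed along \<open>\<alpha>\<close>, which is where
  strict functoriality of reindexing enters.\<close>

lemma indexed_nat_vcmp:
  assumes C: "category C" and D: "category D" and X: "strict_indexed_category C X" and Y: "strict_indexed_category D Y"
    and F: "is_functor C D F" and G: "is_functor C D G" and H: "is_functor C D H"
    and \<alpha>: "is_nat C D F G \<alpha>" and \<beta>: "is_nat C D G H \<beta>"
    and \<Phi>: "strict_indexed_functor C F X Y \<Phi>" and \<Psi>: "strict_indexed_functor C G X Y \<Psi>" and \<Theta>: "strict_indexed_functor C H X Y \<Theta>"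
    and a: "indexed_nat C F \<alpha> X Y \<Phi> \<Psi> a" and b: "indexed_nat C G \<beta> X Y \<Psi> \<Theta> b"
  shows "indexed_nat C F (\<lambda>\<Gamma>\<in>Ob C. Cmp D (\<beta> \<Gamma>) (\<alpha> \<Gamma>)) X Y \<Phi> \<Theta>
    (\<lambda>\<Gamma>\<in>Ob C. \<lambda>A\<in>Ob (Fib X \<Gamma>). Cmp (Fib Y (Fo F \<Gamma>)) (Fa (Re Y (\<alpha> \<Gamma>)) (b \<Gamma> A)) (a \<Gamma> A))"
    (is "indexed_nat C F ?g X Y \<Phi> \<Theta> ?c")
proof (rule indexed_natI)
  note x = strict_indexed_categoryD[OF X] and y = strict_indexed_categoryD[OF Y]
  note aD = indexed_natD[OF a] and bD = indexed_natD[OF b]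
  have st: "\<alpha> \<Gamma> \<in> Ar D" "Dom D (\<alpha> \<Gamma>) = Fo F \<Gamma>" "Cod D (\<alpha> \<Gamma>) = Fo G \<Gamma>" "\<beta> \<Gamma> \<in> Ar D" "Dom D (\<beta> \<Gamma>) = Fo G \<Gamma>" "Cod D (\<beta> \<Gamma>) = Fo H \<Gamma>"
    if "\<Gamma> \<in> Ob C" for \<Gamma> using \<alpha> \<beta> that by (auto simp: is_nat_def)
  have fct: "is_functor (Fib X \<Gamma>) (Fib Y (Fo F \<Gamma>)) (\<Phi> \<Gamma>)" "is_functor (Fib X \<Gamma>) (Fib Y (Fo G \<Gamma>)) (\<Psi> \<Gamma>)"
    "is_functor (Fib X \<Gamma>) (Fib Y (Fo H \<Gamma>)) (\<Theta> \<Gamma>)"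
    "is_functor (Fib Y (Fo G \<Gamma>)) (Fib Y (Fo F \<Gamma>)) (Re Y (\<alpha> \<Gamma>))" "is_functor (Fib Y (Fo H \<Gamma>)) (Fib Y (Fo G \<Gamma>)) (Re Y (\<beta> \<Gamma>))"
    "category (Fib Y (Fo F \<Gamma>))" "category (Fib Y (Fo G \<Gamma>))"
    if "\<Gamma> \<in> Ob C" for \<Gamma>
    using \<Phi> \<Psi> \<Theta> y(2)[OF st(1)[OF that]] y(2)[OF st(4)[OF that]] y(1) st[OF that] F G that by (auto simp: strict_indexed_functor_def)
  have Rb: "Fa (Re Y (\<alpha> \<Gamma>)) (b \<Gamma> A) \<in> Ar (Fib Y (Fo F \<Gamma>))"
    "Dom (Fib Y (Fo F \<Gamma>)) (Fa (Re Y (\<alpha> \<Gamma>)) (b \<Gamma> A)) = Fo (Re Y (\<alpha> \<Gamma>)) (Fo (\<Psi> \<Gamma>) A)"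
    "Cod (Fib Y (Fo F \<Gamma>)) (Fa (Re Y (\<alpha> \<Gamma>)) (b \<Gamma> A)) = Fo (Re Y (\<alpha> \<Gamma>)) (Fo (Re Y (\<beta> \<Gamma>)) (Fo (\<Theta> \<Gamma>) A))"
    if "\<Gamma> \<in> Ob C" "A \<in> Ob (Fib X \<Gamma>)" for \<Gamma> A
    using functor_Fa[OF fct(4)[OF that(1)] bD(1)[OF that]] functor_Dom[OF fct(4)[OF that(1)] bD(1)[OF that]]
      functor_Cod[OF fct(4)[OF that(1)] bD(1)[OF that]] bD(2,3)[OF that] by auto
  {
    fix \<Gamma> A assume g: "\<Gamma> \<in> Ob C" and A: "A \<in> Ob (Fib X \<Gamma>)"
    have "Fo (Re Y (Cmp D (\<beta> \<Gamma>) (\<alpha> \<Gamma>))) (Fo (\<Theta> \<Gamma>) A) = Fo (Re Y (\<alpha> \<Gamma>)) (Fo (Re Y (\<beta> \<Gamma>)) (Fo (\<Theta> \<Gamma>) A))"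
      using y(5)[of "\<alpha> \<Gamma>" "\<beta> \<Gamma>" "Fo (\<Theta> \<Gamma>) A"] st[OF g] functor_Fo[OF fct(3)[OF g] A] by simp
    then show "?c \<Gamma> A \<in> Ar (Fib Y (Fo F \<Gamma>)) \<and> Dom (Fib Y (Fo F \<Gamma>)) (?c \<Gamma> A) = Fo (\<Phi> \<Gamma>) A \<and>
      Cod (Fib Y (Fo F \<Gamma>)) (?c \<Gamma> A) = Fo (Re Y (?g \<Gamma>)) (Fo (\<Theta> \<Gamma>) A)"
      using g A fct(6)[OF g] Rb[OF g A] aD(1-3)[OF g A] by simp
  next
    fix \<Gamma> f assume g: "\<Gamma> \<in> Ob C" and f: "f \<in> Ar (Fib X \<Gamma>)"
    let ?A = "Dom (Fib X \<Gamma>) f" and ?B = "Cod (Fib X \<Gamma>) f" and ?Y = "Fib Y (Fo F \<Gamma>)" and ?R = "Fa (Re Y (\<alpha> \<Gamma>))"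
    have A: "?A \<in> Ob (Fib X \<Gamma>)" and B: "?B \<in> Ob (Fib X \<Gamma>)" using x(1)[OF g] f by auto
    have ff: "Fa (\<Phi> \<Gamma>) f \<in> Ar ?Y" "Cod ?Y (Fa (\<Phi> \<Gamma>) f) = Fo (\<Phi> \<Gamma>) ?B"
      using functor_Fa[OF fct(1)[OF g] f] functor_Cod[OF fct(1)[OF g] f] by auto
    have pf: "Fa (\<Psi> \<Gamma>) f \<in> Ar (Fib Y (Fo G \<Gamma>))" "Dom (Fib Y (Fo G \<Gamma>)) (Fa (\<Psi> \<Gamma>) f) = Fo (\<Psi> \<Gamma>) ?A" "Cod (Fib Y (Fo G \<Gamma>)) (Fa (\<Psi> \<Gamma>) f) = Fo (\<Psi> \<Gamma>) ?B"
      using functor_Fa[OF fct(2)[OF g] f] functor_Dom[OF fct(2)[OF g] f] functor_Cod[OF fct(2)[OF g] f] by auto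
    have tf: "Fa (\<Theta> \<Gamma>) f \<in> Ar (Fib Y (Fo H \<Gamma>))" "Dom (Fib Y (Fo H \<Gamma>)) (Fa (\<Theta> \<Gamma>) f) = Fo (\<Theta> \<Gamma>) ?A"
      using functor_Fa[OF fct(3)[OF g] f] functor_Dom[OF fct(3)[OF g] f] by auto
    let ?tf = "Fa (Re Y (\<beta> \<Gamma>)) (Fa (\<Theta> \<Gamma>) f)"
    have rtf: "?tf \<in> Ar (Fib Y (Fo G \<Gamma>))" "Dom (Fib Y (Fo G \<Gamma>)) ?tf = Fo (Re Y (\<beta> \<Gamma>)) (Fo (\<Theta> \<Gamma>) ?A)"
      using functor_Fa[OF fct(5)[OF g] tf(1)] functor_Dom[OF fct(5)[OF g] tf(1)] tf by auto
    have Rpf: "?R (Fa (\<Psi> \<Gamma>) f) \<in> Ar ?Y" "Dom ?Y (?R (Fa (\<Psi> \<Gamma>) f)) = Fo (Re Y (\<alpha> \<Gamma>)) (Fo (\<Psi> \<Gamma>) ?A)"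
      "Cod ?Y (?R (Fa (\<Psi> \<Gamma>) f)) = Fo (Re Y (\<alpha> \<Gamma>)) (Fo (\<Psi> \<Gamma>) ?B)"
      using functor_Fa[OF fct(4)[OF g] pf(1)] functor_Dom[OF fct(4)[OF g] pf(1)] functor_Cod[OF fct(4)[OF g] pf(1)] pf by auto
    have Rtf: "?R ?tf \<in> Ar ?Y" "Dom ?Y (?R ?tf) = Fo (Re Y (\<alpha> \<Gamma>)) (Fo (Re Y (\<beta> \<Gamma>)) (Fo (\<Theta> \<Gamma>) ?A))"
      using functor_Fa[OF fct(4)[OF g] rtf(1)] functor_Dom[OF fct(4)[OF g] rtf(1)] rtf by auto
    have n: "Cmp ?Y (?R (b \<Gamma> ?B)) (?R (Fa (\<Psi> \<Gamma>) f)) = Cmp ?Y (?R ?tf) (?R (b \<Gamma> ?A))"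
      by (rule functor_square[OF fct(4)[OF g] bD(4)[OF g f]]) (use pf rtf bD(1-3)[OF g A] bD(1-3)[OF g B] in auto)
    have "Cmp ?Y (Cmp ?Y (?R (b \<Gamma> ?B)) (a \<Gamma> ?B)) (Fa (\<Phi> \<Gamma>) f) = Cmp ?Y (?R (b \<Gamma> ?B)) (Cmp ?Y (?R (Fa (\<Psi> \<Gamma>) f)) (a \<Gamma> ?A))"
      using fct(6)[OF g] Rb[OF g B] aD(1-3)[OF g B] ff aD(4)[OF g f] by simp
    also have "\<dots> = Cmp ?Y (Cmp ?Y (?R (b \<Gamma> ?B)) (?R (Fa (\<Psi> \<Gamma>) f))) (a \<Gamma> ?A)"
      using fct(6)[OF g] Rb[OF g B] aD(1-3)[OF g A] Rpf by simp
    also have "\<dots> = Cmp ?Y (?R ?tf) (Cmp ?Y (?R (b \<Gamma> ?A)) (a \<Gamma> ?A))"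
      unfolding n using fct(6)[OF g] Rb[OF g A] aD(1-3)[OF g A] Rtf by simp
    also have "?R ?tf = Fa (Re Y (Cmp D (\<beta> \<Gamma>) (\<alpha> \<Gamma>))) (Fa (\<Theta> \<Gamma>) f)"
      using y(6)[of "\<alpha> \<Gamma>" "\<beta> \<Gamma>" "Fa (\<Theta> \<Gamma>) f"] st[OF g] tf by simp
    finally show "Cmp ?Y (?c \<Gamma> ?B) (Fa (\<Phi> \<Gamma>) f) = Cmp ?Y (Fa (Re Y (?g \<Gamma>)) (Fa (\<Theta> \<Gamma>) f)) (?c \<Gamma> ?A)"
      using g A B by simp
  }
  fix u A assume u: "u \<in> Ar C" and A: "A \<in> Ob (Fib X (Cod C u))"
  let ?\<Gamma> = "Cod C u" and ?\<Delta> = "Dom C u"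
  have g: "?\<Gamma> \<in> Ob C" "?\<Delta> \<in> Ob C" using C u by auto
  have uA: "Fo (Re X u) A \<in> Ob (Fib X ?\<Delta>)" using functor_Fo[OF x(2)[OF u] A] .
  have Fu: "Fa F u \<in> Ar D" "Dom D (Fa F u) = Fo F ?\<Delta>" "Cod D (Fa F u) = Fo F ?\<Gamma>"
    and Gu: "Fa G u \<in> Ar D" "Dom D (Fa G u) = Fo G ?\<Delta>" "Cod D (Fa G u) = Fo G ?\<Gamma>"
    using functor_Fa[OF F u] functor_Dom[OF F u] functor_Cod[OF F u] functor_Fa[OF G u] functor_Dom[OF G u] functor_Cod[OF G u] by auto
  have fu: "is_functor (Fib Y (Fo F ?\<Gamma>)) (Fib Y (Fo F ?\<Delta>)) (Re Y (Fa F u))" using y(2)[OF Fu(1)] Fu by simp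
  have n: "Cmp D (\<alpha> ?\<Gamma>) (Fa F u) = Cmp D (Fa G u) (\<alpha> ?\<Delta>)" using \<alpha> u by (auto simp: is_nat_def)
  \<comment> \<open>Reindexing along the components of \<open>\<alpha>\<close> commutes with
    reindexing along \<open>u\<close>, by naturality of \<open>\<alpha>\<close>.\<close>
  have "Fa (Re Y (\<alpha> ?\<Delta>)) (Fa (Re Y (Fa G u)) (b ?\<Gamma> A)) = Fa (Re Y (Fa F u)) (Fa (Re Y (\<alpha> ?\<Gamma>)) (b ?\<Gamma> A))"
    using y(6)[of "\<alpha> ?\<Delta>" "Fa G u" "b ?\<Gamma> A"] y(6)[of "Fa F u" "\<alpha> ?\<Gamma>" "b ?\<Gamma> A"] n st[OF g(1)] st[OF g(2)] Fu Gu bD(1)[OF g(1) A] by simp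
  moreover have "Fa (Re Y (Fa F u)) (Cmp (Fib Y (Fo F ?\<Gamma>)) (Fa (Re Y (\<alpha> ?\<Gamma>)) (b ?\<Gamma> A)) (a ?\<Gamma> A)) =
      Cmp (Fib Y (Fo F ?\<Delta>)) (Fa (Re Y (Fa F u)) (Fa (Re Y (\<alpha> ?\<Gamma>)) (b ?\<Gamma> A))) (Fa (Re Y (Fa F u)) (a ?\<Gamma> A))"
    by (rule functor_Cmp[OF fu]) (use Rb[OF g(1) A] aD(1-3)[OF g(1) A] in auto)
  ultimately show "?c ?\<Delta> (Fo (Re X u) A) = Fa (Re Y (Fa F u)) (?c ?\<Gamma> A)"
    using g A uA aD(5)[OF u A] bD(5)[OF u A] by simp
qed

text \<open>Again used for types and for terms. The image under \<open>\<Psi>\<close> of a component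
  of \<open>a\<close> ends at the image of a reindexed object; strict naturality of
  \<open>\<Psi>\<close> at \<open>\<alpha>\<close> identifies this with the source of the reindexed
  component of \<open>b\<close>.\<close>

lemma indexed_nat_hcmp:
  assumes C: "category C" and D: "category D" and E: "category E"
    and X: "strict_indexed_category C X" and Y: "strict_indexed_category D Y" and Z: "strict_indexed_category E Z"
    and F: "is_functor C D F" and F': "is_functor C D F'" and G: "is_functor D E G" and G': "is_functor D E G'"
    and \<alpha>: "is_nat C D F F' \<alpha>" and \<beta>: "is_nat D E G G' \<beta>"
    and \<Phi>: "strict_indexed_functor C F X Y \<Phi>" and \<Phi>': "strict_indexed_functor C F' X Y \<Phi>'"
    and \<Psi>: "strict_indexed_functor D G Y Z \<Psi>" and \<Psi>': "strict_indexed_functor D G' Y Z \<Psi>'"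
    and a: "indexed_nat C F \<alpha> X Y \<Phi> \<Phi>' a" and b: "indexed_nat D G \<beta> Y Z \<Psi> \<Psi>' b"
    and H: "\<And>\<Gamma>. \<Gamma> \<in> Ob C \<Longrightarrow> Fo H \<Gamma> = Fo G (Fo F \<Gamma>)" "\<And>u. u \<in> Ar C \<Longrightarrow> Fa H u = Fa G (Fa F u)"
    and \<Theta>: "\<And>\<Gamma>. \<Gamma> \<in> Ob C \<Longrightarrow> \<Theta> \<Gamma> = cmp_fct (Fib X \<Gamma>) (\<Psi> (Fo F \<Gamma>)) (\<Phi> \<Gamma>)"
      "\<And>\<Gamma>. \<Gamma> \<in> Ob C \<Longrightarrow> \<Theta>' \<Gamma> = cmp_fct (Fib X \<Gamma>) (\<Psi>' (Fo F' \<Gamma>)) (\<Phi>' \<Gamma>)"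
  shows "indexed_nat C H (\<lambda>\<Gamma>\<in>Ob C. Cmp E (\<beta> (Fo F' \<Gamma>)) (Fa G (\<alpha> \<Gamma>))) X Z \<Theta> \<Theta>'
    (\<lambda>\<Gamma>\<in>Ob C. \<lambda>A\<in>Ob (Fib X \<Gamma>). Cmp (Fib Z (Fo G (Fo F \<Gamma>)))
       (Fa (Re Z (Fa G (\<alpha> \<Gamma>))) (b (Fo F' \<Gamma>) (Fo (\<Phi>' \<Gamma>) A))) (Fa (\<Psi> (Fo F \<Gamma>)) (a \<Gamma> A)))"
    (is "indexed_nat C H ?g X Z \<Theta> \<Theta>' ?c")
proof (rule indexed_natI)
  note x = strict_indexed_categoryD[OF X] and y = strict_indexed_categoryD[OF Y] and z = strict_indexed_categoryD[OF Z]
  note aD = indexed_natD[OF a] and bD = indexed_natD[OF b]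
  have o: "Fo F \<Gamma> \<in> Ob D" "Fo F' \<Gamma> \<in> Ob D" "Fo G (Fo F \<Gamma>) \<in> Ob E" if "\<Gamma> \<in> Ob C" for \<Gamma>
    using F F' G that by auto
  have st: "\<alpha> \<Gamma> \<in> Ar D" "Dom D (\<alpha> \<Gamma>) = Fo F \<Gamma>" "Cod D (\<alpha> \<Gamma>) = Fo F' \<Gamma>" if "\<Gamma> \<in> Ob C" for \<Gamma>
    using \<alpha> that by (auto simp: is_nat_def)
  have Gst: "Fa G (\<alpha> \<Gamma>) \<in> Ar E" "Dom E (Fa G (\<alpha> \<Gamma>)) = Fo G (Fo F \<Gamma>)" "Cod E (Fa G (\<alpha> \<Gamma>)) = Fo G (Fo F' \<Gamma>)" if "\<Gamma> \<in> Ob C" for \<Gamma>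
    using functor_Fa[OF G st(1)[OF that]] functor_Dom[OF G st(1)[OF that]] functor_Cod[OF G st(1)[OF that]] st[OF that] by auto
  have bt: "\<beta> y \<in> Ar E" "Dom E (\<beta> y) = Fo G y" "Cod E (\<beta> y) = Fo G' y" if "y \<in> Ob D" for y
    using \<beta> that by (auto simp: is_nat_def)
  have fct: "is_functor (Fib X \<Gamma>) (Fib Y (Fo F \<Gamma>)) (\<Phi> \<Gamma>)" "is_functor (Fib X \<Gamma>) (Fib Y (Fo F' \<Gamma>)) (\<Phi>' \<Gamma>)"
    "is_functor (Fib Y (Fo F \<Gamma>)) (Fib Z (Fo G (Fo F \<Gamma>))) (\<Psi> (Fo F \<Gamma>))"
    "is_functor (Fib Y (Fo F' \<Gamma>)) (Fib Z (Fo G (Fo F' \<Gamma>))) (\<Psi> (Fo F' \<Gamma>))"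
    "is_functor (Fib Y (Fo F' \<Gamma>)) (Fib Z (Fo G' (Fo F' \<Gamma>))) (\<Psi>' (Fo F' \<Gamma>))"
    "is_functor (Fib Z (Fo G (Fo F' \<Gamma>))) (Fib Z (Fo G (Fo F \<Gamma>))) (Re Z (Fa G (\<alpha> \<Gamma>)))"
    "is_functor (Fib Z (Fo G' (Fo F' \<Gamma>))) (Fib Z (Fo G (Fo F' \<Gamma>))) (Re Z (\<beta> (Fo F' \<Gamma>)))"
    "category (Fib Z (Fo G (Fo F \<Gamma>)))" "category (Fib Y (Fo F \<Gamma>))"
    if "\<Gamma> \<in> Ob C" for \<Gamma>
    using \<Phi> \<Phi>' \<Psi> \<Psi>' z(2)[OF Gst(1)[OF that]] z(2)[OF bt(1)[OF o(2)[OF that]]] z(1)[OF o(3)[OF that]] y(1)[OF o(1)[OF that]]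
      Gst[OF that] bt[OF o(2)[OF that]] o[OF that] that
    by (auto simp: strict_indexed_functor_def)
  let ?p = "\<lambda>\<Gamma> A. Fa (Re Z (Fa G (\<alpha> \<Gamma>))) (b (Fo F' \<Gamma>) (Fo (\<Phi>' \<Gamma>) A))" and ?s = "\<lambda>\<Gamma> A. Fa (\<Psi> (Fo F \<Gamma>)) (a \<Gamma> A)"
  have \<Phi>'A: "Fo (\<Phi>' \<Gamma>) A \<in> Ob (Fib Y (Fo F' \<Gamma>))" if "\<Gamma> \<in> Ob C" "A \<in> Ob (Fib X \<Gamma>)" for \<Gamma> A
    using functor_Fo[OF fct(2)[OF that(1)] that(2)] .
  have bA: "b (Fo F' \<Gamma>) (Fo (\<Phi>' \<Gamma>) A) \<in> Ar (Fib Z (Fo G (Fo F' \<Gamma>)))"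
    "Dom (Fib Z (Fo G (Fo F' \<Gamma>))) (b (Fo F' \<Gamma>) (Fo (\<Phi>' \<Gamma>) A)) = Fo (\<Psi> (Fo F' \<Gamma>)) (Fo (\<Phi>' \<Gamma>) A)"
    "Cod (Fib Z (Fo G (Fo F' \<Gamma>))) (b (Fo F' \<Gamma>) (Fo (\<Phi>' \<Gamma>) A)) = Fo (Re Z (\<beta> (Fo F' \<Gamma>))) (Fo (\<Psi>' (Fo F' \<Gamma>)) (Fo (\<Phi>' \<Gamma>) A))"
    if "\<Gamma> \<in> Ob C" "A \<in> Ob (Fib X \<Gamma>)" for \<Gamma> A
    using bD(1-3)[OF o(2)[OF that(1)] \<Phi>'A[OF that]] by auto
  have pA: "?p \<Gamma> A \<in> Ar (Fib Z (Fo G (Fo F \<Gamma>)))"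
    "Dom (Fib Z (Fo G (Fo F \<Gamma>))) (?p \<Gamma> A) = Fo (Re Z (Fa G (\<alpha> \<Gamma>))) (Fo (\<Psi> (Fo F' \<Gamma>)) (Fo (\<Phi>' \<Gamma>) A))"
    "Cod (Fib Z (Fo G (Fo F \<Gamma>))) (?p \<Gamma> A) = Fo (Re Z (Fa G (\<alpha> \<Gamma>))) (Fo (Re Z (\<beta> (Fo F' \<Gamma>))) (Fo (\<Psi>' (Fo F' \<Gamma>)) (Fo (\<Phi>' \<Gamma>) A)))"
    if "\<Gamma> \<in> Ob C" "A \<in> Ob (Fib X \<Gamma>)" for \<Gamma> A
    using functor_Fa[OF fct(6)[OF that(1)] bA(1)[OF that]] functor_Dom[OF fct(6)[OF that(1)] bA(1)[OF that]]
      functor_Cod[OF fct(6)[OF that(1)] bA(1)[OF that]] bA(2,3)[OF that] by auto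
  have \<Psi>\<alpha>: "Fo (\<Psi> (Fo F \<Gamma>)) (Fo (Re Y (\<alpha> \<Gamma>)) B) = Fo (Re Z (Fa G (\<alpha> \<Gamma>))) (Fo (\<Psi> (Fo F' \<Gamma>)) B)"
    "g \<in> Ar (Fib Y (Fo F' \<Gamma>)) \<Longrightarrow> Fa (\<Psi> (Fo F \<Gamma>)) (Fa (Re Y (\<alpha> \<Gamma>)) g) = Fa (Re Z (Fa G (\<alpha> \<Gamma>))) (Fa (\<Psi> (Fo F' \<Gamma>)) g)"
    if "\<Gamma> \<in> Ob C" "B \<in> Ob (Fib Y (Fo F' \<Gamma>))" for \<Gamma> B g
    using \<Psi> st[OF that(1)] that(2) unfolding strict_indexed_functor_def by metis+
  have sA: "?s \<Gamma> A \<in> Ar (Fib Z (Fo G (Fo F \<Gamma>)))"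
    "Dom (Fib Z (Fo G (Fo F \<Gamma>))) (?s \<Gamma> A) = Fo (\<Psi> (Fo F \<Gamma>)) (Fo (\<Phi> \<Gamma>) A)"
    "Cod (Fib Z (Fo G (Fo F \<Gamma>))) (?s \<Gamma> A) = Fo (Re Z (Fa G (\<alpha> \<Gamma>))) (Fo (\<Psi> (Fo F' \<Gamma>)) (Fo (\<Phi>' \<Gamma>) A))"
    if "\<Gamma> \<in> Ob C" "A \<in> Ob (Fib X \<Gamma>)" for \<Gamma> A
    using functor_Fa[OF fct(3)[OF that(1)] aD(1)[OF that]] functor_Dom[OF fct(3)[OF that(1)] aD(1)[OF that]]
      functor_Cod[OF fct(3)[OF that(1)] aD(1)[OF that]] aD(2,3)[OF that] \<Psi>\<alpha>(1)[OF that(1) \<Phi>'A[OF that]] by auto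
  {
    fix \<Gamma> A assume g: "\<Gamma> \<in> Ob C" and A: "A \<in> Ob (Fib X \<Gamma>)"
    have "Fo (Re Z (Cmp E (\<beta> (Fo F' \<Gamma>)) (Fa G (\<alpha> \<Gamma>)))) (Fo (\<Psi>' (Fo F' \<Gamma>)) (Fo (\<Phi>' \<Gamma>) A)) =
        Fo (Re Z (Fa G (\<alpha> \<Gamma>))) (Fo (Re Z (\<beta> (Fo F' \<Gamma>))) (Fo (\<Psi>' (Fo F' \<Gamma>)) (Fo (\<Phi>' \<Gamma>) A)))"
      by (rule z(5)) (use Gst[OF g] bt[OF o(2)[OF g]] functor_Fo[OF fct(5)[OF g] \<Phi>'A[OF g A]] in auto)
    then show "?c \<Gamma> A \<in> Ar (Fib Z (Fo H \<Gamma>)) \<and> Dom (Fib Z (Fo H \<Gamma>)) (?c \<Gamma> A) = Fo (\<Theta> \<Gamma>) A \<and>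
      Cod (Fib Z (Fo H \<Gamma>)) (?c \<Gamma> A) = Fo (Re Z (?g \<Gamma>)) (Fo (\<Theta>' \<Gamma>) A)"
      using g A fct(8)[OF g] pA[OF g A] sA[OF g A] by (simp add: H \<Theta>)
  next
    fix \<Gamma> f assume g: "\<Gamma> \<in> Ob C" and f: "f \<in> Ar (Fib X \<Gamma>)"
    let ?A = "Dom (Fib X \<Gamma>) f" and ?B = "Cod (Fib X \<Gamma>) f" and ?Z = "Fib Z (Fo G (Fo F \<Gamma>))" and ?R = "Fa (Re Z (Fa G (\<alpha> \<Gamma>)))"
    let ?P = "Fa (\<Psi> (Fo F \<Gamma>))" and ?P' = "Fa (\<Psi> (Fo F' \<Gamma>))"
    have A: "?A \<in> Ob (Fib X \<Gamma>)" and B: "?B \<in> Ob (Fib X \<Gamma>)" using x(1)[OF g] f by auto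
    have ff: "Fa (\<Phi> \<Gamma>) f \<in> Ar (Fib Y (Fo F \<Gamma>))" "Dom (Fib Y (Fo F \<Gamma>)) (Fa (\<Phi> \<Gamma>) f) = Fo (\<Phi> \<Gamma>) ?A" "Cod (Fib Y (Fo F \<Gamma>)) (Fa (\<Phi> \<Gamma>) f) = Fo (\<Phi> \<Gamma>) ?B"
      using functor_Fa[OF fct(1)[OF g] f] functor_Dom[OF fct(1)[OF g] f] functor_Cod[OF fct(1)[OF g] f] by auto
    have ff': "Fa (\<Phi>' \<Gamma>) f \<in> Ar (Fib Y (Fo F' \<Gamma>))" "Dom (Fib Y (Fo F' \<Gamma>)) (Fa (\<Phi>' \<Gamma>) f) = Fo (\<Phi>' \<Gamma>) ?A" "Cod (Fib Y (Fo F' \<Gamma>)) (Fa (\<Phi>' \<Gamma>) f) = Fo (\<Phi>' \<Gamma>) ?B"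
      using functor_Fa[OF fct(2)[OF g] f] functor_Dom[OF fct(2)[OF g] f] functor_Cod[OF fct(2)[OF g] f] by auto
    have Rff': "Fa (Re Y (\<alpha> \<Gamma>)) (Fa (\<Phi>' \<Gamma>) f) \<in> Ar (Fib Y (Fo F \<Gamma>))"
      "Dom (Fib Y (Fo F \<Gamma>)) (Fa (Re Y (\<alpha> \<Gamma>)) (Fa (\<Phi>' \<Gamma>) f)) = Fo (Re Y (\<alpha> \<Gamma>)) (Fo (\<Phi>' \<Gamma>) ?A)"
      using y(2)[OF st(1)[OF g]] st[OF g] functor_Fa[of "Fib Y (Fo F' \<Gamma>)" "Fib Y (Fo F \<Gamma>)" "Re Y (\<alpha> \<Gamma>)" "Fa (\<Phi>' \<Gamma>) f"]
        functor_Dom[of "Fib Y (Fo F' \<Gamma>)" "Fib Y (Fo F \<Gamma>)" "Re Y (\<alpha> \<Gamma>)" "Fa (\<Phi>' \<Gamma>) f"] ff' by auto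
    have Pff: "?P (Fa (\<Phi> \<Gamma>) f) \<in> Ar ?Z" "Cod ?Z (?P (Fa (\<Phi> \<Gamma>) f)) = Fo (\<Psi> (Fo F \<Gamma>)) (Fo (\<Phi> \<Gamma>) ?B)"
      using functor_Fa[OF fct(3)[OF g] ff(1)] functor_Cod[OF fct(3)[OF g] ff(1)] ff by auto
    have P'ff: "?P' (Fa (\<Phi>' \<Gamma>) f) \<in> Ar (Fib Z (Fo G (Fo F' \<Gamma>)))" "Dom (Fib Z (Fo G (Fo F' \<Gamma>))) (?P' (Fa (\<Phi>' \<Gamma>) f)) = Fo (\<Psi> (Fo F' \<Gamma>)) (Fo (\<Phi>' \<Gamma>) ?A)"
      "Cod (Fib Z (Fo G (Fo F' \<Gamma>))) (?P' (Fa (\<Phi>' \<Gamma>) f)) = Fo (\<Psi> (Fo F' \<Gamma>)) (Fo (\<Phi>' \<Gamma>) ?B)"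
      using functor_Fa[OF fct(4)[OF g] ff'(1)] functor_Dom[OF fct(4)[OF g] ff'(1)] functor_Cod[OF fct(4)[OF g] ff'(1)] ff' by auto
    have RP'ff: "?R (?P' (Fa (\<Phi>' \<Gamma>) f)) \<in> Ar ?Z" "Dom ?Z (?R (?P' (Fa (\<Phi>' \<Gamma>) f))) = Fo (Re Z (Fa G (\<alpha> \<Gamma>))) (Fo (\<Psi> (Fo F' \<Gamma>)) (Fo (\<Phi>' \<Gamma>) ?A))"
      "Cod ?Z (?R (?P' (Fa (\<Phi>' \<Gamma>) f))) = Fo (Re Z (Fa G (\<alpha> \<Gamma>))) (Fo (\<Psi> (Fo F' \<Gamma>)) (Fo (\<Phi>' \<Gamma>) ?B))"
      using functor_Fa[OF fct(6)[OF g] P'ff(1)] functor_Dom[OF fct(6)[OF g] P'ff(1)] functor_Cod[OF fct(6)[OF g] P'ff(1)] P'ff by auto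
    let ?q = "Fa (\<Psi>' (Fo F' \<Gamma>)) (Fa (\<Phi>' \<Gamma>) f)"
    have q: "?q \<in> Ar (Fib Z (Fo G' (Fo F' \<Gamma>)))" "Dom (Fib Z (Fo G' (Fo F' \<Gamma>))) ?q = Fo (\<Psi>' (Fo F' \<Gamma>)) (Fo (\<Phi>' \<Gamma>) ?A)"
      using functor_Fa[OF fct(5)[OF g] ff'(1)] functor_Dom[OF fct(5)[OF g] ff'(1)] ff' by auto
    let ?bq = "Fa (Re Z (\<beta> (Fo F' \<Gamma>))) ?q"
    have bq: "?bq \<in> Ar (Fib Z (Fo G (Fo F' \<Gamma>)))" "Dom (Fib Z (Fo G (Fo F' \<Gamma>))) ?bq = Fo (Re Z (\<beta> (Fo F' \<Gamma>))) (Fo (\<Psi>' (Fo F' \<Gamma>)) (Fo (\<Phi>' \<Gamma>) ?A))"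
      using functor_Fa[OF fct(7)[OF g] q(1)] functor_Dom[OF fct(7)[OF g] q(1)] q by auto
    have Rbq: "?R ?bq \<in> Ar ?Z" "Dom ?Z (?R ?bq) = Fo (Re Z (Fa G (\<alpha> \<Gamma>))) (Fo (Re Z (\<beta> (Fo F' \<Gamma>))) (Fo (\<Psi>' (Fo F' \<Gamma>)) (Fo (\<Phi>' \<Gamma>) ?A)))"
      using functor_Fa[OF fct(6)[OF g] bq(1)] functor_Dom[OF fct(6)[OF g] bq(1)] bq by auto
    \<comment> \<open>The two squares to be pasted: the image under \<open>\<Psi>\<close> of
      naturality of \<open>a\<close>, and naturality of \<open>b\<close> at the image of
      \<open>f\<close> under \<open>\<Phi>'\<close>, reindexed along
      \<open>G \<alpha>\<close>.\<close>
    have n1: "Cmp ?Z (?s \<Gamma> ?B) (?P (Fa (\<Phi> \<Gamma>) f)) = Cmp ?Z (?P (Fa (Re Y (\<alpha> \<Gamma>)) (Fa (\<Phi>' \<Gamma>) f))) (?s \<Gamma> ?A)"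
      by (rule functor_square[OF fct(3)[OF g] aD(4)[OF g f]]) (use ff Rff' aD(1-3)[OF g A] aD(1-3)[OF g B] in auto)
    have n2: "Cmp ?Z (?p \<Gamma> ?B) (?R (?P' (Fa (\<Phi>' \<Gamma>) f))) = Cmp ?Z (?R ?bq) (?p \<Gamma> ?A)"
      by (rule functor_square[OF fct(6)[OF g]])
         (use bD(4)[OF o(2)[OF g] ff'(1)] P'ff ff' bq bA[OF g A] bA[OF g B] in auto)
    have "Cmp ?Z (Cmp ?Z (?p \<Gamma> ?B) (?s \<Gamma> ?B)) (?P (Fa (\<Phi> \<Gamma>) f)) = Cmp ?Z (?p \<Gamma> ?B) (Cmp ?Z (?s \<Gamma> ?B) (?P (Fa (\<Phi> \<Gamma>) f)))"
      by (rule Cmp_assoc) (use fct(8)[OF g] pA[OF g B] sA[OF g B] Pff in auto)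
    also have "\<dots> = Cmp ?Z (?p \<Gamma> ?B) (Cmp ?Z (?R (?P' (Fa (\<Phi>' \<Gamma>) f))) (?s \<Gamma> ?A))"
      unfolding n1 \<Psi>\<alpha>(2)[OF g \<Phi>'A[OF g A] ff'(1)] by (rule refl)
    also have "\<dots> = Cmp ?Z (Cmp ?Z (?p \<Gamma> ?B) (?R (?P' (Fa (\<Phi>' \<Gamma>) f)))) (?s \<Gamma> ?A)"
      by (rule Cmp_assoc[symmetric]) (use fct(8)[OF g] pA[OF g B] sA[OF g A] RP'ff in auto)
    also have "\<dots> = Cmp ?Z (?R ?bq) (Cmp ?Z (?p \<Gamma> ?A) (?s \<Gamma> ?A))"
      unfolding n2 by (rule Cmp_assoc) (use fct(8)[OF g] pA[OF g A] sA[OF g A] Rbq in auto)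
    also have "?R ?bq = Fa (Re Z (Cmp E (\<beta> (Fo F' \<Gamma>)) (Fa G (\<alpha> \<Gamma>)))) ?q"
      by (rule z(6)[symmetric]) (use Gst[OF g] bt[OF o(2)[OF g]] q in auto)
    finally show "Cmp (Fib Z (Fo H \<Gamma>)) (?c \<Gamma> ?B) (Fa (\<Theta> \<Gamma>) f) = Cmp (Fib Z (Fo H \<Gamma>)) (Fa (Re Z (?g \<Gamma>)) (Fa (\<Theta>' \<Gamma>) f)) (?c \<Gamma> ?A)"
      using g A B f by (simp add: H \<Theta>)
  }
  fix u A assume u: "u \<in> Ar C" and A: "A \<in> Ob (Fib X (Cod C u))"
  let ?\<Gamma> = "Cod C u" and ?\<Delta> = "Dom C u" and ?uA = "Fo (Re X u) A"
  have g: "?\<Gamma> \<in> Ob C" "?\<Delta> \<in> Ob C" using C u by auto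
  have uA: "?uA \<in> Ob (Fib X ?\<Delta>)" using functor_Fo[OF x(2)[OF u] A] .
  have Fu: "Fa F u \<in> Ar D" "Dom D (Fa F u) = Fo F ?\<Delta>" "Cod D (Fa F u) = Fo F ?\<Gamma>"
    and F'u: "Fa F' u \<in> Ar D" "Dom D (Fa F' u) = Fo F' ?\<Delta>" "Cod D (Fa F' u) = Fo F' ?\<Gamma>"
    using functor_Fa[OF F u] functor_Dom[OF F u] functor_Cod[OF F u] functor_Fa[OF F' u] functor_Dom[OF F' u] functor_Cod[OF F' u] by auto
  have GF: "Fa G (Fa F u) \<in> Ar E" "Dom E (Fa G (Fa F u)) = Fo G (Fo F ?\<Delta>)" "Cod E (Fa G (Fa F u)) = Fo G (Fo F ?\<Gamma>)"
    "Fa G (Fa F' u) \<in> Ar E" "Dom E (Fa G (Fa F' u)) = Fo G (Fo F' ?\<Delta>)" "Cod E (Fa G (Fa F' u)) = Fo G (Fo F' ?\<Gamma>)"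
    using functor_Fa[OF G] functor_Dom[OF G] functor_Cod[OF G] Fu F'u by auto
  have fu: "is_functor (Fib Z (Fo G (Fo F ?\<Gamma>))) (Fib Z (Fo G (Fo F ?\<Delta>))) (Re Z (Fa G (Fa F u)))" using z(2)[OF GF(1)] GF by simp
  have n: "Cmp E (Fa G (\<alpha> ?\<Gamma>)) (Fa G (Fa F u)) = Cmp E (Fa G (Fa F' u)) (Fa G (\<alpha> ?\<Delta>))"
    by (rule functor_square[OF G]) (use \<alpha> u Fu F'u st[OF g(1)] st[OF g(2)] in \<open>auto simp: is_nat_def\<close>)
  let ?b = "b (Fo F' ?\<Gamma>) (Fo (\<Phi>' ?\<Gamma>) A)"
  have "Fo (\<Phi>' ?\<Delta>) ?uA = Fo (Re Y (Fa F' u)) (Fo (\<Phi>' ?\<Gamma>) A)" using \<Phi>' u A by (auto simp: strict_indexed_functor_def)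
  then have "b (Fo F' ?\<Delta>) (Fo (\<Phi>' ?\<Delta>) ?uA) = Fa (Re Z (Fa G (Fa F' u))) ?b"
    using bD(5)[OF F'u(1), of "Fo (\<Phi>' ?\<Gamma>) A"] F'u \<Phi>'A[OF g(1) A] by simp
  then have "?p ?\<Delta> ?uA = Fa (Re Z (Fa G (\<alpha> ?\<Delta>))) (Fa (Re Z (Fa G (Fa F' u))) ?b)" by simp
  also have "\<dots> = Fa (Re Z (Cmp E (Fa G (Fa F' u)) (Fa G (\<alpha> ?\<Delta>)))) ?b"
    by (rule z(6)[symmetric]) (use Gst[OF g(2)] GF bA(1)[OF g(1) A] in auto)
  also have "\<dots> = Fa (Re Z (Fa G (Fa F u))) (?p ?\<Gamma> A)"
    unfolding n[symmetric] by (rule z(6)) (use Gst[OF g(1)] GF bA(1)[OF g(1) A] in auto)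
  finally have 1: "?p ?\<Delta> ?uA = Fa (Re Z (Fa G (Fa F u))) (?p ?\<Gamma> A)" .
  have "?s ?\<Delta> ?uA = Fa (\<Psi> (Fo F ?\<Delta>)) (Fa (Re Y (Fa F u)) (a ?\<Gamma> A))" using aD(5)[OF u A] by simp
  also have "\<dots> = Fa (Re Z (Fa G (Fa F u))) (?s ?\<Gamma> A)"
    using \<Psi> Fu aD(1)[OF g(1) A] unfolding strict_indexed_functor_def by metis
  finally have 2: "?s ?\<Delta> ?uA = Fa (Re Z (Fa G (Fa F u))) (?s ?\<Gamma> A)" .
  have "Fa (Re Z (Fa G (Fa F u))) (Cmp (Fib Z (Fo G (Fo F ?\<Gamma>))) (?p ?\<Gamma> A) (?s ?\<Gamma> A)) =
      Cmp (Fib Z (Fo G (Fo F ?\<Delta>))) (?p ?\<Delta> ?uA) (?s ?\<Delta> ?uA)"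
    unfolding 1 2 by (rule functor_Cmp[OF fu]) (use pA[OF g(1) A] sA[OF g(1) A] in auto)
  then show "?c ?\<Delta> (Fo (Re X u) A) = Fa (Re Z (Fa H u)) (?c ?\<Gamma> A)"
    using g A uA u by (simp add: H)
qed


lemma cnm_cellD:
  assumes "cnm_cell small \<alpha>" and CD: "nsrc (ncsrc \<alpha>) = C" "ntgt (ncsrc \<alpha>) = D"
  shows "cnm_mor small (ncsrc \<alpha>)" "cnm_mor small (nctgt \<alpha>)" "nsrc (nctgt \<alpha>) = C" "ntgt (nctgt \<alpha>) = D"
    "nat_mor (ncsrc \<alpha>) C D" "nat_mor (nctgt \<alpha>) C D"
    "is_nat C D (ncsrc \<alpha>) (nctgt \<alpha>) (nccomp \<alpha>)"
    "indexed_nat C (ncsrc \<alpha>) (nccomp \<alpha>) (Tp C) (Tp D) (nTp (ncsrc \<alpha>)) (nTp (nctgt \<alpha>)) (ncTp \<alpha>)"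
    "indexed_nat C (ncsrc \<alpha>) (nccomp \<alpha>) (Tm C) (Tm D) (nTm (ncsrc \<alpha>)) (nTm (nctgt \<alpha>)) (ncTm \<alpha>)"
    "\<And>\<Gamma> t. \<Gamma> \<in> Ob C \<Longrightarrow> t \<in> Ob (tm C \<Gamma>) \<Longrightarrow> tyofa D (Fo (ncsrc \<alpha>) \<Gamma>) (ncTm \<alpha> \<Gamma> t) = ncTp \<alpha> \<Gamma> (tyof C \<Gamma> t)"
    "nccomp \<alpha> \<in> extensional (Ob C)" "ncTp \<alpha> \<in> extensional (Ob C)" "ncTm \<alpha> \<in> extensional (Ob C)"
    "\<And>\<Gamma>. \<Gamma> \<in> Ob C \<Longrightarrow> ncTp \<alpha> \<Gamma> \<in> extensional (Ob (ty C \<Gamma>))"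
    "\<And>\<Gamma>. \<Gamma> \<in> Ob C \<Longrightarrow> ncTm \<alpha> \<Gamma> \<in> extensional (Ob (tm C \<Gamma>))"
    "nat_trans (ncsrc \<alpha>) (nctgt \<alpha>) C D (nccomp \<alpha>)"
proof -
  have "natural_model_2_morphism \<alpha>" "ncell_extensional \<alpha>" and m: "cnm_mor small (ncsrc \<alpha>)" "cnm_mor small (nctgt \<alpha>)"
    using assms(1) by (auto simp: cnm_cell_def)
  then show "cnm_mor small (ncsrc \<alpha>)" "cnm_mor small (nctgt \<alpha>)"
    and s: "nsrc (nctgt \<alpha>) = C" "ntgt (nctgt \<alpha>) = D"
    and n: "is_nat C D (ncsrc \<alpha>) (nctgt \<alpha>) (nccomp \<alpha>)"
    and "indexed_nat C (ncsrc \<alpha>) (nccomp \<alpha>) (Tp C) (Tp D) (nTp (ncsrc \<alpha>)) (nTp (nctgt \<alpha>)) (ncTp \<alpha>)"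
    "indexed_nat C (ncsrc \<alpha>) (nccomp \<alpha>) (Tm C) (Tm D) (nTm (ncsrc \<alpha>)) (nTm (nctgt \<alpha>)) (ncTm \<alpha>)"
    "\<And>\<Gamma> t. \<Gamma> \<in> Ob C \<Longrightarrow> t \<in> Ob (tm C \<Gamma>) \<Longrightarrow> tyofa D (Fo (ncsrc \<alpha>) \<Gamma>) (ncTm \<alpha> \<Gamma> t) = ncTp \<alpha> \<Gamma> (tyof C \<Gamma> t)"
    "nccomp \<alpha> \<in> extensional (Ob C)" "ncTp \<alpha> \<in> extensional (Ob C)" "ncTm \<alpha> \<in> extensional (Ob C)"
    "\<And>\<Gamma>. \<Gamma> \<in> Ob C \<Longrightarrow> ncTp \<alpha> \<Gamma> \<in> extensional (Ob (ty C \<Gamma>))"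
    "\<And>\<Gamma>. \<Gamma> \<in> Ob C \<Longrightarrow> ncTm \<alpha> \<Gamma> \<in> extensional (Ob (tm C \<Gamma>))"
    by (auto simp: natural_model_2_morphism_def ncell_extensional_def Let_def CD)
  show f: "nat_mor (ncsrc \<alpha>) C D" "nat_mor (nctgt \<alpha>) C D"
    using cnm_morD(3)[OF m(1)] cnm_morD(3)[OF m(2)] CD s by auto
  have "natm D" using cnm_objectD(1)[OF cnm_morD(2)[OF m(1)]] CD by simp
  then show "nat_trans (ncsrc \<alpha>) (nctgt \<alpha>) C D (nccomp \<alpha>)"
    using f n by (simp add: nat_trans_def nat_trans_axioms_def)
qed

lemma cnm_cellI:
  assumes "cnm_mor small (ncsrc \<alpha>)" "cnm_mor small (nctgt \<alpha>)" "nsrc (ncsrc \<alpha>) = C" "ntgt (ncsrc \<alpha>) = D"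
    "nsrc (nctgt \<alpha>) = C" "ntgt (nctgt \<alpha>) = D"
    "is_nat C D (ncsrc \<alpha>) (nctgt \<alpha>) (nccomp \<alpha>)"
    "indexed_nat C (ncsrc \<alpha>) (nccomp \<alpha>) (Tp C) (Tp D) (nTp (ncsrc \<alpha>)) (nTp (nctgt \<alpha>)) (ncTp \<alpha>)"
    "indexed_nat C (ncsrc \<alpha>) (nccomp \<alpha>) (Tm C) (Tm D) (nTm (ncsrc \<alpha>)) (nTm (nctgt \<alpha>)) (ncTm \<alpha>)"
    "\<And>\<Gamma> t. \<Gamma> \<in> Ob C \<Longrightarrow> t \<in> Ob (tm C \<Gamma>) \<Longrightarrow> tyofa D (Fo (ncsrc \<alpha>) \<Gamma>) (ncTm \<alpha> \<Gamma> t) = ncTp \<alpha> \<Gamma> (tyof C \<Gamma> t)"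
    "nccomp \<alpha> \<in> extensional (Ob C)" "ncTp \<alpha> \<in> extensional (Ob C)" "ncTm \<alpha> \<in> extensional (Ob C)"
    "\<And>\<Gamma>. \<Gamma> \<in> Ob C \<Longrightarrow> ncTp \<alpha> \<Gamma> \<in> extensional (Ob (ty C \<Gamma>))"
    "\<And>\<Gamma>. \<Gamma> \<in> Ob C \<Longrightarrow> ncTm \<alpha> \<Gamma> \<in> extensional (Ob (tm C \<Gamma>))"
  shows "cnm_cell small \<alpha>"
  using assms by (auto simp: cnm_cell_def natural_model_2_morphism_def ncell_extensional_def Let_def)

text \<open>By \<open>trans_unique\<close> the type and term components of both cells are the
  canonical ones of their common natural transformation; extensionality settles the values off the
  carriers.\<close>

lemma ncell_eqI:
  assumes a: "cnm_cell small \<alpha>" and b: "cnm_cell small \<beta>"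
    and ab: "ncsrc \<alpha> = ncsrc \<beta>" "nctgt \<alpha> = nctgt \<beta>" "nccomp \<alpha> = nccomp \<beta>"
  shows "\<alpha> = \<beta>"
proof -
  obtain C D where CD: "nsrc (ncsrc \<alpha>) = C" "ntgt (ncsrc \<alpha>) = D" by blast
  note ca = cnm_cellD[OF a CD] and cb = cnm_cellD[OF b CD[unfolded ab]]
  interpret nat_trans "ncsrc \<alpha>" "nctgt \<alpha>" C D "nccomp \<alpha>" by (rule ca)
  note ua = trans_unique[OF ca(8,9,10)] and ub = trans_unique[OF cb(8,9,10)[folded ab]]
  show ?thesis
  proof (rule ncell.equality)
    show "ncTp \<alpha> = ncTp \<beta>"
    proof (rule extensionalityI[OF ca(12) cb(12)])
      fix \<Gamma> assume G: "\<Gamma> \<in> Ob C"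
      show "ncTp \<alpha> \<Gamma> = ncTp \<beta> \<Gamma>"
        by (rule extensionalityI[OF ca(14)[OF G] cb(14)[OF G]]) (use ua(1)[OF _ _ G] ub(1)[OF _ _ G] in auto)
    qed
    show "ncTm \<alpha> = ncTm \<beta>"
    proof (rule extensionalityI[OF ca(13) cb(13)])
      fix \<Gamma> assume G: "\<Gamma> \<in> Ob C"
      show "ncTm \<alpha> \<Gamma> = ncTm \<beta> \<Gamma>"
        by (rule extensionalityI[OF ca(15)[OF G] cb(15)[OF G]]) (use ua(2)[OF _ _ G] ub(2)[OF _ _ G] in auto)
    qed
  qed (use ab in auto)
qed

text \<open>The canonical components \<open>trans_ty\<close> and \<open>trans_tm\<close> do it. With
  \<open>ncell_eqI\<close> this gives the bijection on 2-cells.\<close>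

lemma cnm_cell_exists:
  assumes F: "cnm_mor small F" and G: "cnm_mor small G" and FG: "nsrc G = nsrc F" "ntgt G = ntgt F"
    and a: "is_nat (nsrc F) (ntgt F) F G a" "a \<in> extensional (Ob (nsrc F))"
  shows "\<exists>\<alpha>. cnm_cell small \<alpha> \<and> ncsrc \<alpha> = F \<and> nctgt \<alpha> = G \<and> nccomp \<alpha> = a"
proof -
  obtain C D where CD: "nsrc F = C" "ntgt F = D" by blast
  have D: "natm D" using cnm_objectD(1)[OF cnm_morD(2)[OF F]] CD by simp
  interpret nat_trans F G C D a
    using cnm_morD(3)[OF F] cnm_morD(3)[OF G] FG CD a D by (simp add: nat_trans_def nat_trans_axioms_def)
  have ext: "trans_ty \<in> extensional (Ob C)" "trans_tm \<in> extensional (Ob C)"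
    "\<Gamma> \<in> Ob C \<Longrightarrow> trans_ty \<Gamma> \<in> extensional (Ob (ty C \<Gamma>))" "\<Gamma> \<in> Ob C \<Longrightarrow> trans_tm \<Gamma> \<in> extensional (Ob (tm C \<Gamma>))" for \<Gamma>
    by (auto simp: trans_ty_def trans_tm_def)
  let ?\<alpha> = "\<lparr>ncsrc = F, nctgt = G, nccomp = a, ncTp = trans_ty, ncTm = trans_tm\<rparr>"
  have "cnm_cell small ?\<alpha>"
    by (rule cnm_cellI[of small _ C D])
       (use F G FG CD a trans_ty_indexed trans_tm_indexed ext in auto)
  then show ?thesis by (intro exI[of _ ?\<alpha>]) simp
qed

lemma cnm_cell_id2:
  assumes F: "cnm_mor small F"
  shows "cnm_cell small (cnm_id2 F)"
proof -
  obtain C D where CD: "nsrc F = C" "ntgt F = D" by blast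
  interpret F: nat_mor F C D using cnm_morD(3)[OF F] CD by simp
  have s: "ncsrc (cnm_id2 F) = F" "nctgt (cnm_id2 F) = F" "nccomp (cnm_id2 F) = (\<lambda>\<Gamma>\<in>Ob C. Idn D (Fo F \<Gamma>))"
    "ncTp (cnm_id2 F) = (\<lambda>\<Gamma>\<in>Ob C. \<lambda>A\<in>Ob (ty C \<Gamma>). Idn (ty D (Fo F \<Gamma>)) (Fo (nTp F \<Gamma>) A))"
    "ncTm (cnm_id2 F) = (\<lambda>\<Gamma>\<in>Ob C. \<lambda>t\<in>Ob (tm C \<Gamma>). Idn (tm D (Fo F \<Gamma>)) (Fo (nTm F \<Gamma>) t))"
    by (simp_all add: cnm_id2_def Let_def CD)
  show ?thesis
  proof (rule cnm_cellI[of small _ C D], unfold s)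
    show "indexed_nat C F (\<lambda>\<Gamma>\<in>Ob C. Idn D (Fo F \<Gamma>)) (Tp C) (Tp D) (nTp F) (nTp F)
        (\<lambda>\<Gamma>\<in>Ob C. \<lambda>A\<in>Ob (ty C \<Gamma>). Idn (ty D (Fo F \<Gamma>)) (Fo (nTp F \<Gamma>) A))"
      by (rule indexed_nat_id) (auto intro: F.is_functor F.strict_Tp prenat_Tp)
    show "indexed_nat C F (\<lambda>\<Gamma>\<in>Ob C. Idn D (Fo F \<Gamma>)) (Tm C) (Tm D) (nTm F) (nTm F)
        (\<lambda>\<Gamma>\<in>Ob C. \<lambda>t\<in>Ob (tm C \<Gamma>). Idn (tm D (Fo F \<Gamma>)) (Fo (nTm F \<Gamma>) t))"
      by (rule indexed_nat_id) (auto intro: F.is_functor F.strict_Tm prenat_Tm)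
    show "is_nat C D F F (\<lambda>\<Gamma>\<in>Ob C. Idn D (Fo F \<Gamma>))" by (rule is_nat_id) (use F.is_functor in auto)
    fix \<Gamma> t assume G: "\<Gamma> \<in> Ob C" "t \<in> Ob (tm C \<Gamma>)"
    then show "tyofa D (Fo F \<Gamma>) ((\<lambda>\<Gamma>\<in>Ob C. \<lambda>t\<in>Ob (tm C \<Gamma>). Idn (tm D (Fo F \<Gamma>)) (Fo (nTm F \<Gamma>) t)) \<Gamma> t) =
        (\<lambda>\<Gamma>\<in>Ob C. \<lambda>A\<in>Ob (ty C \<Gamma>). Idn (ty D (Fo F \<Gamma>)) (Fo (nTp F \<Gamma>) A)) \<Gamma> (tyof C \<Gamma> t)"
      using functor_Idn[OF Pr_functor[of D "Fo F \<Gamma>"], of "Fo (nTm F \<Gamma>) t"] by simp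
  qed (use F CD in auto)
qed

lemma cnm_cell_vcmp:
  assumes a: "cnm_cell small \<alpha>" and b: "cnm_cell small \<beta>" and ab: "nctgt \<alpha> = ncsrc \<beta>"
  shows "cnm_cell small (cnm_vcmp \<beta> \<alpha>)"
proof -
  obtain C D where CD: "nsrc (ncsrc \<alpha>) = C" "ntgt (ncsrc \<alpha>) = D" by blast
  note ca = cnm_cellD[OF a CD]
  have CD': "nsrc (ncsrc \<beta>) = C" "ntgt (ncsrc \<beta>) = D" using ca(3,4) ab by auto
  note cb = cnm_cellD[OF b CD']
  obtain F G H where FGH: "ncsrc \<alpha> = F" "nctgt \<alpha> = G" "ncsrc \<beta> = G" "nctgt \<beta> = H" using ab by auto
  interpret F: nat_mor F C D using ca(5) FGH by simp
  interpret G: nat_mor G C D using cb(5) FGH by simp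
  interpret H: nat_mor H C D using cb(6) FGH by simp
  let ?g = "\<lambda>\<Gamma>\<in>Ob C. Cmp D (nccomp \<beta> \<Gamma>) (nccomp \<alpha> \<Gamma>)"
  let ?p = "\<lambda>\<Gamma>\<in>Ob C. \<lambda>A\<in>Ob (ty C \<Gamma>). Cmp (ty D (Fo F \<Gamma>)) (tsa D (nccomp \<alpha> \<Gamma>) (ncTp \<beta> \<Gamma> A)) (ncTp \<alpha> \<Gamma> A)"
  let ?m = "\<lambda>\<Gamma>\<in>Ob C. \<lambda>t\<in>Ob (tm C \<Gamma>). Cmp (tm D (Fo F \<Gamma>)) (msa D (nccomp \<alpha> \<Gamma>) (ncTm \<beta> \<Gamma> t)) (ncTm \<alpha> \<Gamma> t)"
  have s: "ncsrc (cnm_vcmp \<beta> \<alpha>) = F" "nctgt (cnm_vcmp \<beta> \<alpha>) = H" "nccomp (cnm_vcmp \<beta> \<alpha>) = ?g"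
    "ncTp (cnm_vcmp \<beta> \<alpha>) = ?p" "ncTm (cnm_vcmp \<beta> \<alpha>) = ?m"
    by (simp_all add: cnm_vcmp_def Let_def CD[unfolded FGH] FGH)
  note ca' = ca[unfolded FGH] and cb' = cb[unfolded FGH]
  show ?thesis
  proof (rule cnm_cellI[of small _ C D], unfold s)
    show "indexed_nat C F ?g (Tp C) (Tp D) (nTp F) (nTp H) ?p"
      by (rule indexed_nat_vcmp[OF _ _ prenat_Tp prenat_Tp F.is_functor G.is_functor H.is_functor ca'(7) cb'(7)
            F.strict_Tp G.strict_Tp H.strict_Tp ca'(8) cb'(8)]) auto
    show "indexed_nat C F ?g (Tm C) (Tm D) (nTm F) (nTm H) ?m"
      by (rule indexed_nat_vcmp[OF _ _ prenat_Tm prenat_Tm F.is_functor G.is_functor H.is_functor ca'(7) cb'(7)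
            F.strict_Tm G.strict_Tm H.strict_Tm ca'(9) cb'(9)]) auto
    show "is_nat C D F H ?g"
      by (rule is_nat_vcmp[OF _ _ F.is_functor G.is_functor H.is_functor ca'(7) cb'(7)]) auto
    fix \<Gamma> t assume g: "\<Gamma> \<in> Ob C" and t: "t \<in> Ob (tm C \<Gamma>)"
    have al: "nccomp \<alpha> \<Gamma> \<in> Ar D" "Dom D (nccomp \<alpha> \<Gamma>) = Fo F \<Gamma>" "Cod D (nccomp \<alpha> \<Gamma>) = Fo G \<Gamma>"
      using ca'(7) g by (auto simp: is_nat_def)
    note x = indexed_natD(1-3)[OF ca'(9) g t] and y = indexed_natD(1-3)[OF cb'(9) g t]
    have "tyofa D (Fo F \<Gamma>) (Cmp (tm D (Fo F \<Gamma>)) (msa D (nccomp \<alpha> \<Gamma>) (ncTm \<beta> \<Gamma> t)) (ncTm \<alpha> \<Gamma> t)) =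
        Cmp (ty D (Fo F \<Gamma>)) (tyofa D (Fo F \<Gamma>) (msa D (nccomp \<alpha> \<Gamma>) (ncTm \<beta> \<Gamma> t))) (tyofa D (Fo F \<Gamma>) (ncTm \<alpha> \<Gamma> t))"
      by (rule functor_Cmp[OF Pr_functor]) (use g x y al in auto)
    then show "tyofa D (Fo F \<Gamma>) (?m \<Gamma> t) = ?p \<Gamma> (tyof C \<Gamma> t)"
      using g t al y ca'(10)[OF g t] cb'(10)[OF g t] by simp
  qed (use ca' cb' CD FGH in auto)
qed

lemma cnm_cell_hcmp:
  assumes a: "cnm_cell small \<alpha>" and b: "cnm_cell small \<beta>" and ab: "ntgt (ncsrc \<alpha>) = nsrc (ncsrc \<beta>)"
  shows "cnm_cell small (cnm_hcmp \<beta> \<alpha>)"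
proof -
  obtain C D E where CD: "nsrc (ncsrc \<alpha>) = C" "ntgt (ncsrc \<alpha>) = D" and DE: "nsrc (ncsrc \<beta>) = D" "ntgt (ncsrc \<beta>) = E"
    using ab by auto
  note ca = cnm_cellD[OF a CD] and cb = cnm_cellD[OF b DE]
  obtain F F' G G' where FG: "ncsrc \<alpha> = F" "nctgt \<alpha> = F'" "ncsrc \<beta> = G" "nctgt \<beta> = G'" by auto
  note ca' = ca[unfolded FG] and cb' = cb[unfolded FG]
  interpret F: nat_mor F C D by (rule ca')
  interpret F': nat_mor F' C D by (rule ca')
  interpret G: nat_mor G D E by (rule cb')
  interpret G': nat_mor G' D E by (rule cb')
  let ?H = "cnm_cmp1 G F" and ?H' = "cnm_cmp1 G' F'"
  let ?g = "\<lambda>\<Gamma>\<in>Ob C. Cmp E (nccomp \<beta> (Fo F' \<Gamma>)) (Fa G (nccomp \<alpha> \<Gamma>))"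
  let ?p = "\<lambda>\<Gamma>\<in>Ob C. \<lambda>A\<in>Ob (ty C \<Gamma>). Cmp (ty E (Fo G (Fo F \<Gamma>)))
      (tsa E (Fa G (nccomp \<alpha> \<Gamma>)) (ncTp \<beta> (Fo F' \<Gamma>) (Fo (nTp F' \<Gamma>) A))) (Fa (nTp G (Fo F \<Gamma>)) (ncTp \<alpha> \<Gamma> A))"
  let ?m = "\<lambda>\<Gamma>\<in>Ob C. \<lambda>t\<in>Ob (tm C \<Gamma>). Cmp (tm E (Fo G (Fo F \<Gamma>)))
      (msa E (Fa G (nccomp \<alpha> \<Gamma>)) (ncTm \<beta> (Fo F' \<Gamma>) (Fo (nTm F' \<Gamma>) t))) (Fa (nTm G (Fo F \<Gamma>)) (ncTm \<alpha> \<Gamma> t))"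
  have s: "ncsrc (cnm_hcmp \<beta> \<alpha>) = ?H" "nctgt (cnm_hcmp \<beta> \<alpha>) = ?H'" "nccomp (cnm_hcmp \<beta> \<alpha>) = ?g"
    "ncTp (cnm_hcmp \<beta> \<alpha>) = ?p" "ncTm (cnm_hcmp \<beta> \<alpha>) = ?m"
    by (simp_all add: cnm_hcmp_def Let_def FG)
  have m: "cnm_mor small ?H" "cnm_mor small ?H'"
    using cnm_mor_cmp1[OF ca'(1) cb'(1)] cnm_mor_cmp1[OF ca'(2) cb'(2)] by auto
  show ?thesis
  proof (rule cnm_cellI[of small _ C E], unfold s)
    show "indexed_nat C ?H ?g (Tp C) (Tp E) (nTp ?H) (nTp ?H') ?p"
      by (rule indexed_nat_hcmp[OF _ _ _ prenat_Tp prenat_Tp prenat_Tp F.is_functor F'.is_functor G.is_functor G'.is_functor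
            ca'(7) cb'(7) F.strict_Tp F'.strict_Tp G.strict_Tp G'.strict_Tp ca'(8) cb'(8)]) (auto simp: compose_eq)
    show "indexed_nat C ?H ?g (Tm C) (Tm E) (nTm ?H) (nTm ?H') ?m"
      by (rule indexed_nat_hcmp[OF _ _ _ prenat_Tm prenat_Tm prenat_Tm F.is_functor F'.is_functor G.is_functor G'.is_functor
            ca'(7) cb'(7) F.strict_Tm F'.strict_Tm G.strict_Tm G'.strict_Tm ca'(9) cb'(9)]) (auto simp: compose_eq)
    show "is_nat C E ?H ?H' ?g"
      by (rule is_nat_hcmp[OF _ _ _ F.is_functor F'.is_functor G.is_functor G'.is_functor ca'(7) cb'(7)]) (auto simp: compose_eq)
    fix \<Gamma> t assume g: "\<Gamma> \<in> Ob C" and t: "t \<in> Ob (tm C \<Gamma>)"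
    have al: "nccomp \<alpha> \<Gamma> \<in> Ar D" "Dom D (nccomp \<alpha> \<Gamma>) = Fo F \<Gamma>" "Cod D (nccomp \<alpha> \<Gamma>) = Fo F' \<Gamma>"
      using ca'(7) g by (auto simp: is_nat_def)
    have t': "Fo F' \<Gamma> \<in> Ob D" "Fo (nTm F' \<Gamma>) t \<in> Ob (tm D (Fo F' \<Gamma>))" using g t by auto
    note x = indexed_natD(1-3)[OF ca'(9) g t] and y = indexed_natD(1-3)[OF cb'(9) t']
    have "tyofa E (Fo G (Fo F \<Gamma>)) (Cmp (tm E (Fo G (Fo F \<Gamma>)))
          (msa E (Fa G (nccomp \<alpha> \<Gamma>)) (ncTm \<beta> (Fo F' \<Gamma>) (Fo (nTm F' \<Gamma>) t))) (Fa (nTm G (Fo F \<Gamma>)) (ncTm \<alpha> \<Gamma> t))) =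
        Cmp (ty E (Fo G (Fo F \<Gamma>)))
          (tyofa E (Fo G (Fo F \<Gamma>)) (msa E (Fa G (nccomp \<alpha> \<Gamma>)) (ncTm \<beta> (Fo F' \<Gamma>) (Fo (nTm F' \<Gamma>) t))))
          (tyofa E (Fo G (Fo F \<Gamma>)) (Fa (nTm G (Fo F \<Gamma>)) (ncTm \<alpha> \<Gamma> t)))"
      by (rule functor_Cmp[OF Pr_functor]) (use g t t' x y al in auto)
    then show "tyofa E (Fo ?H \<Gamma>) (?m \<Gamma> t) = ?p \<Gamma> (tyof C \<Gamma> t)"
      using g t t' al x y ca'(10)[OF g t] cb'(10)[OF t'] by (simp add: compose_eq)
  qed (use m CD DE FG in auto)
qed


section \<open>The forgetful 2-functor\<close>

lemma forgetful_simps [simp]: "on0 forgetful = dcat.truncate" "on1 forgetful = forget1" "on2 forgetful = forget2"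
  by (simp_all add: forgetful_def)

lemma forget1_simps [simp]:
  "Fo (forget1 F) = Fo F" "Fa (forget1 F) = Fa F" "dsrc (forget1 F) = underlying (nsrc F)" "dtgt (forget1 F) = underlying (ntgt F)"
  by (simp_all add: forget1_def fct.defs dfun.defs)

lemma forget2_simps [simp]:
  "dnsrc (forget2 \<alpha>) = forget1 (ncsrc \<alpha>)" "dntgt (forget2 \<alpha>) = forget1 (nctgt \<alpha>)" "dncomp (forget2 \<alpha>) = nccomp \<alpha>"
  by (simp_all add: forget2_def)

text \<open>Moves these predicates between \<open>dfun\<close>, \<open>nmor\<close> and plain
  \<open>fct\<close> records, which share the two maps but differ in their further fields.\<close>

lemma fct_fields_cong:
  assumes "Fo F = Fo F'" "Fa F = Fa F'"
  shows "display_functor C D F = display_functor C D F'" "preserves_finite_limits C D F = preserves_finite_limits C D F'"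
  unfolding display_functor_def is_functor_def preserves_finite_limits_def cmp_fct_def assms by (rule refl)+

lemma is_nat_forget1 [simp]: "is_nat C D (forget1 F) (forget1 G) a = is_nat C D F G a"
  unfolding is_nat_def forget1_simps by (rule refl)

lemma truncate_is_nat [simp]: "is_nat (underlying C) (underlying D) F G a = is_nat C D F G a"
  unfolding is_nat_def truncate_simps truncate_hom by (rule refl)

lemma forget1_mor:
  assumes F: "cnm_mor small F"
  shows "cdc_mor small (forget1 F)"
proof -
  note f = cnm_morD[OF F]
  have "display_functor (nsrc F) (ntgt F) F" by (rule nat_mor.display_functor[OF f(3)])
  then show ?thesis
    using f fct_fields_cong[of "forget1 F" F "nsrc F" "ntgt F"] cnm_objectD(5)[OF f(1)] cnm_objectD(5)[OF f(2)]
    by (simp add: cdc_mor_def nmor_extensional_def fct_extensional_def)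
qed

lemma forget2_cell:
  assumes a: "cnm_cell small \<alpha>"
  shows "cdc_cell small (forget2 \<alpha>)"
proof (rule cdc_cellI[of small "forget1 (ncsrc \<alpha>)" "forget1 (nctgt \<alpha>)"])
  note ca = cnm_cellD[OF a refl refl]
  show "cdc_mor small (forget1 (ncsrc \<alpha>))" "cdc_mor small (forget1 (nctgt \<alpha>))" using ca(1,2) forget1_mor by auto
  show "is_nat (dsrc (forget1 (ncsrc \<alpha>))) (dtgt (forget1 (ncsrc \<alpha>))) (forget1 (ncsrc \<alpha>)) (forget1 (nctgt \<alpha>)) (nccomp \<alpha>)"
    using ca(7) by simp
qed (use cnm_cellD[OF a refl refl] in auto)

lemma forget1_cmp1: "forget1 (cnm_cmp1 G F) = cdc_cmp1 (forget1 G) (forget1 F)"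
  by (rule dfun.equality) auto

lemma forget1_id1: "forget1 (cnm_id1 N) = cdc_id1 (underlying N)"
  by (rule dfun.equality) (auto simp: id_fct_def)

text \<open>On contexts the composites of 2-cells are given by the same formulas in both
  2-categories, so \<open>forget2\<close> preserves them on the nose; injectivity is
  \<open>ncell_eqI\<close>.\<close>

lemma forgetful_reflecting: "reflecting_2_functor (CNM small) (CDC small) forgetful"
proof (unfold_locales, unfold CNM_simps CDC_simps forgetful_simps mem_Collect_eq)
  show "strict_2_category (CDC small)" by (rule CDC_2_category)
  show "category (cat1 (CNM small))" by (rule CNM_cat1)
  show "is_functor (cat1 (CNM small)) (cat1 (CDC small)) \<lparr>Fo = dcat.truncate, Fa = forget1\<rparr>"
    by (rule is_functorI) (auto simp: cnm_objectD forget1_mor forget1_id1 forget1_cmp1)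
next
  fix \<alpha> assume a: "cnm_cell small \<alpha>"
  note ca = cnm_cellD[OF a refl refl]
  show "cnm_mor small (ncsrc \<alpha>) \<and> cnm_mor small (nctgt \<alpha>) \<and> nsrc (ncsrc \<alpha>) = nsrc (nctgt \<alpha>) \<and> ntgt (ncsrc \<alpha>) = ntgt (nctgt \<alpha>)"
    using ca(1-4) by auto
  show "cdc_cell small (forget2 \<alpha>) \<and> dnsrc (forget2 \<alpha>) = forget1 (ncsrc \<alpha>) \<and> dntgt (forget2 \<alpha>) = forget1 (nctgt \<alpha>)"
    using forget2_cell[OF a] by simp
next
  fix \<alpha> \<beta> assume "cnm_cell small \<alpha>" "cnm_cell small \<beta>" "ncsrc \<alpha> = ncsrc \<beta>" "nctgt \<alpha> = nctgt \<beta>" "forget2 \<alpha> = forget2 \<beta>"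
  moreover have "nccomp \<alpha> = nccomp \<beta>" using \<open>forget2 \<alpha> = forget2 \<beta>\<close> by (simp add: forget2_def)
  ultimately show "\<alpha> = \<beta>" using ncell_eqI by blast
next
  fix F assume F: "cnm_mor small F"
  have "forget2 (cnm_id2 F) = cdc_id2 (forget1 F)" by (rule dnat.equality) (auto simp: cnm_id2_def cdc_id2_def Let_def)
  then show "cnm_cell small (cnm_id2 F) \<and> ncsrc (cnm_id2 F) = F \<and> nctgt (cnm_id2 F) = F \<and> forget2 (cnm_id2 F) = cdc_id2 (forget1 F)"
    using cnm_cell_id2[OF F] by (simp add: cnm_id2_def Let_def)
next
  fix \<alpha> \<beta> assume c: "cnm_cell small \<alpha>" "cnm_cell small \<beta>" "nctgt \<alpha> = ncsrc \<beta>"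
  have "forget2 (cnm_vcmp \<beta> \<alpha>) = cdc_vcmp (forget2 \<beta>) (forget2 \<alpha>)"
    by (rule dnat.equality) (auto simp: cnm_vcmp_def cdc_vcmp_def Let_def)
  then show "cnm_cell small (cnm_vcmp \<beta> \<alpha>) \<and> ncsrc (cnm_vcmp \<beta> \<alpha>) = ncsrc \<alpha> \<and> nctgt (cnm_vcmp \<beta> \<alpha>) = nctgt \<beta> \<and>
      forget2 (cnm_vcmp \<beta> \<alpha>) = cdc_vcmp (forget2 \<beta>) (forget2 \<alpha>)"
    using cnm_cell_vcmp[OF c] by (simp add: cnm_vcmp_def Let_def)
next
  fix \<alpha> \<beta> assume c: "cnm_cell small \<alpha>" "cnm_cell small \<beta>" "ntgt (ncsrc \<alpha>) = nsrc (ncsrc \<beta>)"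
  have "forget2 (cnm_hcmp \<beta> \<alpha>) = cdc_hcmp (forget2 \<beta>) (forget2 \<alpha>)"
    by (rule dnat.equality) (auto simp: cnm_hcmp_def cdc_hcmp_def Let_def forget1_cmp1)
  then show "cnm_cell small (cnm_hcmp \<beta> \<alpha>) \<and> ncsrc (cnm_hcmp \<beta> \<alpha>) = cnm_cmp1 (ncsrc \<beta>) (ncsrc \<alpha>) \<and>
      nctgt (cnm_hcmp \<beta> \<alpha>) = cnm_cmp1 (nctgt \<beta>) (nctgt \<alpha>) \<and> forget2 (cnm_hcmp \<beta> \<alpha>) = cdc_hcmp (forget2 \<beta>) (forget2 \<alpha>)"
    using cnm_cell_hcmp[OF c] by (simp add: cnm_hcmp_def Let_def)
qed

text \<open>The model of generalised elements of a universe truncates to the very display category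
  it was built from, so no equivalence has to be constructed.\<close>

lemma forgetful_surj0:
  assumes small: "\<And>A B. small A \<Longrightarrow> B \<subseteq> A \<Longrightarrow> small B" and C: "cdc_object small C"
  shows "\<exists>N. cnm_object small N \<and> underlying N = C"
proof -
  obtain T E p0 p1 where u: "is_universe C T E p0 p1" using C by (auto simp: cdc_object_def admits_universe_def)
  have "cnm_object small (univ_model C T E p0 p1)"
    by (rule universe_natural_model) (use C u small in \<open>auto simp: cdc_object_def\<close>)
  then show ?thesis using truncate_univ_model[of C T E p0 p1] by blast
qed

text \<open>The generic display of \<open>M\<close> is sent to a display of \<open>N\<close>, and a
  type with isomorphic comprehension is the remaining datum that the lifting construction asks
  for.\<close>

lemma forgetful_surj1:
  assumes M: "cnm_object small M" and N: "cnm_object small N"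
    and g: "cdc_mor small g" "dsrc g = underlying M" "dtgt g = underlying N"
  shows "\<exists>f. cnm_mor small f \<and> nsrc f = M \<and> ntgt f = N \<and> forget1 f = g"
proof -
  note m = cnm_objectD[OF M] and n = cnm_objectD[OF N] and gD = cdc_morD[OF g(1)]
  define H :: "('a, 'a, 'a, 'a) fct" where "H = \<lparr>Fo = Fo g, Fa = Fa g\<rparr>"
  have H: "Fo H = Fo g" "Fa H = Fa g" by (simp_all add: H_def)
  have dH: "display_functor M N H" and pH: "preserves_finite_limits M N g"
    using gD(8,9) fct_fields_cong(1)[of H g M N] H g by auto
  obtain E \<Phi> \<Psi> where "classified_model M E \<Phi> \<Psi>" by (rule type_classifier_cases[OF m(2,4)])
  then interpret M: classified_model M E \<Phi> \<Psi> .
  have fH: "is_functor M N H" using dH by (simp add: display_functor_def)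
  have "Fa H M.p0 \<in> Disp N" using dH by (simp add: display_functor_def)
  then obtain B i where B: "B \<in> Ob (ty N (Cod N (Fa H M.p0)))" "is_iso N i" "Dom N i = Dom N (Fa H M.p0)"
    "Cod N i = ext N (Cod N (Fa H M.p0)) B" "Cmp N (Prj N (Cod N (Fa H M.p0)) B) i = Fa H M.p0"
    using comp_ess_surj[OF n(1)] by metis
  have c: "Cod N (Fa H M.p0) = Fo H (I0 E)" "Dom N (Fa H M.p0) = Fo H (Dom M M.p0)"
    using functor_Cod[OF fH, of M.p0] functor_Dom[OF fH, of M.p0] by auto
  interpret L: functor_lift M N H "I0 E" M.A0 B i
  proof unfold_locales
    show "Dom N i = Fo H (ext M (I0 E) M.A0)" using B(3) c by (simp add: M.p0_def del: M.p0_simps)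
    show "Cmp N (Prj N (Fo H (I0 E)) B) i = Fa H (Prj M (I0 E) M.A0)" using B(5) c by (simp add: M.p0_def del: M.p0_simps)
  qed (use m n dH B c M.classify in auto)
  have "cnm_mor small L.lmor"
    unfolding cnm_mor_def
  proof (intro conjI)
    show "preserves_finite_limits (nsrc L.lmor) (ntgt L.lmor) L.lmor"
      using pH fct_fields_cong(2)[of L.lmor g M N] H by simp
    show "nmor_extensional L.lmor"
      by (rule L.lmor_extensional) (use gD(10,11) g H in \<open>auto simp: fct_extensional_def\<close>)
  qed (use M N L.lmor_morphism in auto)
  moreover have "forget1 L.lmor = g" by (rule dfun.equality) (use g H in auto)
  ultimately show ?thesis by (intro exI[of _ L.lmor]) simp
qed

lemma forgetful_bij2:
  assumes f: "cnm_mor small f" and g: "cnm_mor small g" and fg: "nsrc g = nsrc f" "ntgt g = ntgt f"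
  shows "bij_betw forget2 (hom (vcat (CNM small)) f g) (hom (vcat (CDC small)) (forget1 f) (forget1 g))"
  unfolding bij_betw_def
proof
  show "inj_on forget2 (hom (vcat (CNM small)) f g)"
  proof (rule inj_onI)
    fix \<alpha> \<beta> assume "\<alpha> \<in> hom (vcat (CNM small)) f g" "\<beta> \<in> hom (vcat (CNM small)) f g" and e: "forget2 \<alpha> = forget2 \<beta>"
    moreover have "nccomp \<alpha> = nccomp \<beta>" using e by (simp add: forget2_def)
    ultimately show "\<alpha> = \<beta>" using ncell_eqI[of small \<alpha> \<beta>] by simp
  qed
  show "forget2 ` hom (vcat (CNM small)) f g = hom (vcat (CDC small)) (forget1 f) (forget1 g)"
  proof
    show "forget2 ` hom (vcat (CNM small)) f g \<subseteq> hom (vcat (CDC small)) (forget1 f) (forget1 g)"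
      using forget2_cell by auto
    show "hom (vcat (CDC small)) (forget1 f) (forget1 g) \<subseteq> forget2 ` hom (vcat (CNM small)) f g"
    proof
      fix \<beta> assume "\<beta> \<in> hom (vcat (CDC small)) (forget1 f) (forget1 g)"
      then have b: "cdc_cell small \<beta>" "dnsrc \<beta> = forget1 f" "dntgt \<beta> = forget1 g" by auto
      have "is_nat (dsrc (dnsrc \<beta>)) (dtgt (dnsrc \<beta>)) (dnsrc \<beta>) (dntgt \<beta>) (dncomp \<beta>)"
        "dncomp \<beta> \<in> extensional (Ob (dsrc (dnsrc \<beta>)))"
        using b(1) unfolding cdc_cell_def by blast+
      then have "is_nat (nsrc f) (ntgt f) f g (dncomp \<beta>)" "dncomp \<beta> \<in> extensional (Ob (nsrc f))"
        unfolding b(2,3) by simp_all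
      then obtain \<alpha> where a: "cnm_cell small \<alpha>" "ncsrc \<alpha> = f" "nctgt \<alpha> = g" "nccomp \<alpha> = dncomp \<beta>"
        using cnm_cell_exists[OF f g fg] by blast
      have "forget2 \<alpha> = \<beta>" by (rule dnat.equality) (use a b in auto)
      then show "\<beta> \<in> forget2 ` hom (vcat (CNM small)) f g" using a by (intro image_eqI[of _ _ \<alpha>]) auto
    qed
  qed
qed

text \<open>The hypothesis on \<open>small\<close> enters through surjectivity on objects, to make
  the fibres of an externalization small. It holds for the elements of a Grothendieck universe and
  for all subsets of the type.\<close>

theorem corollary3p2p14:
  fixes small :: "'u set \<Rightarrow> bool"
  assumes "\<And>A B. small A \<Longrightarrow> B \<subseteq> A \<Longrightarrow> small B"
  shows "is_2_equivalence (CNM small) (CDC small) forgetful \<and>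
         is_2_equivalence (NTyp small) (Typ small) forgetful \<and>
         is_2_equivalence (NDTop small) (DTop small) forgetful"
proof -
  interpret reflecting_2_functor "CNM small" "CDC small" forgetful by (rule forgetful_reflecting)
  have s0: "\<exists>a\<in>Obj (CNM small). on0 forgetful a = b" if "b \<in> Obj (CDC small)" for b
    using forgetful_surj0[OF assms, where C = b] that by auto
  have s1: "\<exists>f\<in>hom (cat1 (CNM small)) a b. on1 forgetful f = g"
    if "a \<in> Obj (CNM small)" "b \<in> Obj (CNM small)" "g \<in> hom (cat1 (CDC small)) (on0 forgetful a) (on0 forgetful b)" for a b g
    using forgetful_surj1[of small a b g] that by auto
  have s2: "bij_betw (on2 forgetful) (hom (vcat (CNM small)) f g) (hom (vcat (CDC small)) (on1 forgetful f) (on1 forgetful g))"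
    if "a \<in> Obj (CNM small)" "b \<in> Obj (CNM small)" "f \<in> hom (cat1 (CNM small)) a b" "g \<in> hom (cat1 (CNM small)) a b" for a b f g
    using forgetful_bij2[of small f g] that by auto
  \<comment> \<open>One argument for every condition \<open>S\<close> on the underlying display
    category; it is instantiated with small typoses and with small display toposes.\<close>
  have sub: "is_2_equivalence (full_sub2 (CNM small) {a. on0 forgetful a \<in> S}) (full_sub2 (CDC small) S) forgetful" for S
    by (rule strictly_surjective_full_sub2[OF strict_2_category L strict_2_functor s0 s1 s2])
  have "is_2_equivalence (CNM small) (CDC small) forgetful"
    by (rule strictly_surjective_2_equivalence[OF strict_2_category L strict_2_functor s0 s1 s2])
  moreover have "is_2_equivalence (NTyp small) (Typ small) forgetful"
    using sub[of "{C. small_typos small C}"] by (simp add: NTyp_def Typ_def)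
  moreover have "is_2_equivalence (NDTop small) (DTop small) forgetful"
    using sub[of "{C. small_display_topos small C}"] by (simp add: NDTop_def DTop_def)
  ultimately show ?thesis by blast
qed

end
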